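(* Let $X$ be a simplicial complex in $\mathbb R^n$ and let $\mathrm{Co}_k^{S}$, $k\ge0$, be a singular cone operator on $X$ with contraction point $a\in|X|$. Let $V_h^k$ be the space of Whitney $k$-forms over $X$, and for $k\ge1$ let $\mathcal P^k : V_h^k\to V_h^{k-1}$ be the operator determined by $$\int_\sigma \mathcal P^k u = \int_{\mathrm{Co}^{S}_{k-1}(\sigma)} u \qquad \text{for all } \sigma\in X^{k-1},\ u\in V_h^k.$$ Then $$(d^{k-1}\mathcal P^k + \mathcal P^{k+1}d^k)u = u \quad\text{for all } u\in V_h^k,\ k\ge 1,$$ $$\mathcal P^{1}d^0u = u - u(a)\quad\text{for all } u\in V_h^0 .$$
   Context: Chains. Fix a total order on the vertices of the geometric simplicial complex $X\subset\mathbb R^n$; each $k$-simplex $\sigma\in X^k$ is written $[v_0,\dots,v_k]$ with $v_0<\dots<v_k$. $C_k(X)$ is the real vector space with basis $X^k$, with boundary $\partial_k[v_0,\dots,v_k]=\sum_i(-1)^i[v_0,\dots,\widehat{v_i},\dots,v_k]$. Singular chains. $Q_k$ is the standard simplex with vertices $q_0=0$, $q_i=e_i$ ($1\le i\le k$). A Lipschitz singular $k$-simplex of $M$ is a Lipschitz map $T:Q_k\to M$; $S_k^{\mathrm{Lip}}(M)$ is the real vector space of finite formal linear combinations of these. For points $a_0,\dots,a_k$, $L[a_0,\dots,a_k](x)=a_0+\sum_{i=1}^k x_i(a_i-a_0)$ on $Q_k$; for $\sigma=[v_0,\dots,v_k]$, $L\sigma=L[v_0,\dots,v_k]$. The boundary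 is $\partial_k^S T=\sum_{i=0}^k(-1)^i\,T\circ L[q_0,\dots,\widehat{q_i},\dots,q_k]$. A singular cone operator with contraction point $a\in|X|$ is a family of linear maps $\mathrm{Co}_k^S:C_k(X)\to S_{k+1}^{\mathrm{Lip}}(|X|)$ with $\mathrm{Co}^S_{k-1}(\partial_k\sigma)+\partial^S_{k+1}\mathrm{Co}^S_k(\sigma)=L\sigma$ for all $\sigma\in X^k$, $k\ge1$, and $\partial_1^S\mathrm{Co}_0^S(v)=L[v]-L[a]$ for all $v\in X^0$. Whitney forms. $V_h^k$ is the span of the forms $w_\sigma=k!\sum_{i=0}^k(-1)^i\lambda_{v_i}\,d\lambda_{v_0}\wedge\dots\wedge\widehat{d\lambda_{v_i}}\wedge\dots\wedge d\lambda_{v_k}$, $\sigma=[v_0,\dots,v_k]\in X^k$, where $\lambda_v$ is the continuous piecewise linear hat function of the vertex $v$. A Whitney $k$-form is smooth on each simplex and its traces on common faces agree; it is uniquely determined by its integrals over all $\sigma\in X^k$, which may be prescribed arbitrarily. $d^k:V_h^k\to V_h^{k+1}$ is the exterior derivative. Integration. $\int_T u=\int_{Q_k}T^*u$ for a Lipschitz singular $k$-simplex $T$ of $|X|$, extended linearly to chains; here, for a.e. $q\in Q_k$, $(T^*u)(q)$ is the pullback under $DT(q)$ of the trace of $u$ on the simplex of $X$ whose relative interior contains $T(q)$ (for a.e. $q$ the image of $DT(q)$ is tangent to that simplex). For $k=0$ the integral is evaluation at a point. *)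

theory Defs
  imports "HOL-Analysis.Analysis" "HOL-Library.Poly_Mapping" "HOL-Library.Function_Algebras"
begin

section \<open>Formal real linear combinations\<close>

instantiation poly_mapping :: (type, real_vector) real_vector
begin

definition scaleR_poly_mapping :: "real \<Rightarrow> ('a \<Rightarrow>\<^sub>0 'b) \<Rightarrow> ('a \<Rightarrow>\<^sub>0 'b)" where
  "scaleR_poly_mapping c = Poly_Mapping.map (scaleR c)"

lemma lookup_scaleR: "Poly_Mapping.lookup (c *\<^sub>R p) x = c *\<^sub>R Poly_Mapping.lookup p x" for p :: "'a \<Rightarrow>\<^sub>0 'b"
  by (cases "Poly_Mapping.lookup p x = 0") (simp_all add: scaleR_poly_mapping_def Poly_Mapping.map.rep_eq)

instance
  by standard (auto intro!: poly_mapping_eqI simp: lookup_scaleR lookup_add scaleR_add_right scaleR_add_left)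

end

definition linear_extension :: "('b \<Rightarrow> 'c) \<Rightarrow> ('b \<Rightarrow>\<^sub>0 real) \<Rightarrow> 'c::real_vector" where
  "linear_extension f c = (\<Sum>x\<in>Poly_Mapping.keys c. Poly_Mapping.lookup c x *\<^sub>R f x)"

definition linear_between :: "'b::real_vector set \<Rightarrow> 'c::real_vector set \<Rightarrow> ('b \<Rightarrow> 'c) \<Rightarrow> bool" where
  "linear_between V W f \<longleftrightarrow>
     (\<forall>x\<in>V. f x \<in> W) \<and>
     (\<forall>x\<in>V. \<forall>y\<in>V. f (x + y) = f x + f y) \<and>
     (\<forall>c. \<forall>x\<in>V. f (c *\<^sub>R x) = c *\<^sub>R f x)"

definition omit :: "nat \<Rightarrow> 'b list \<Rightarrow> 'b list" where
  "omit i xs = take i xs @ drop (Suc i) xs"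


section \<open>Simplicial chains\<close>

definition vertices :: "'a::euclidean_space set set \<Rightarrow> 'a set" where
  "vertices X = {v. {v} \<in> X}"

text \<open>A \<open>k\<close>-simplex is the increasing list of its vertices with respect to the order \<open>r\<close>.\<close>

definition simplices :: "'a::euclidean_space set set \<Rightarrow> 'a rel \<Rightarrow> nat \<Rightarrow> 'a list set" where
  "simplices X r k =
     {\<sigma>. length \<sigma> = Suc k \<and> sorted_wrt (\<lambda>v w. (v, w) \<in> r \<and> v \<noteq> w) \<sigma> \<and>
         set \<sigma> \<subseteq> vertices X \<and> \<not> affine_dependent (set \<sigma>) \<and> convex hull (set \<sigma>) \<in> X}"

definition chains :: "'a::euclidean_space set set \<Rightarrow> 'a rel \<Rightarrow> nat \<Rightarrow> ('a list \<Rightarrow>\<^sub>0 real) set" where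
  "chains X r k = {c. Poly_Mapping.keys c \<subseteq> simplices X r k}"

definition boundary :: "nat \<Rightarrow> ('a list \<Rightarrow>\<^sub>0 real) \<Rightarrow> ('a list \<Rightarrow>\<^sub>0 real)" where
  "boundary k = linear_extension (\<lambda>\<sigma>. \<Sum>i\<le>k. (-1) ^ i *\<^sub>R Poly_Mapping.single (omit i \<sigma>) 1)"


section \<open>Lipschitz singular chains\<close>

text \<open>
  The points of \<open>\<real>\<^sup>k\<close> are the functions on \<open>{1..k}\<close>, extensional outside, so that Lebesgue measure on
  \<open>\<real>\<^sup>k\<close> is the completion of the product measure \<open>\<Pi>\<^sub>M i\<in>{1..k}. lborel\<close>.
\<close>

definition edist :: "nat \<Rightarrow> (nat \<Rightarrow> real) \<Rightarrow> (nat \<Rightarrow> real) \<Rightarrow> real" where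
  "edist k x y = L2_set (\<lambda>i. x i - y i) {1..k}"

definition std_Q :: "nat \<Rightarrow> (nat \<Rightarrow> real) set" where
  "std_Q k = {x \<in> extensional {1..k}. (\<forall>i\<in>{1..k}. 0 \<le> x i) \<and> (\<Sum>i=1..k. x i) \<le> 1}"

definition Q_vertex :: "nat \<Rightarrow> nat \<Rightarrow> nat \<Rightarrow> real" where
  "Q_vertex k i = (\<lambda>j\<in>{1..k}. if j = i then 1 else 0)"

text \<open>Singular simplices are extensional, so that equality of formal sums is equality on \<open>std_Q k\<close>.\<close>

definition lipschitz_simplex :: "nat \<Rightarrow> 'a::euclidean_space set \<Rightarrow> ((nat \<Rightarrow> real) \<Rightarrow> 'a) \<Rightarrow> bool" where
  "lipschitz_simplex k M T \<longleftrightarrow>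
     T \<in> extensional (std_Q k) \<and> T ` std_Q k \<subseteq> M \<and>
     (\<exists>C. \<forall>x\<in>std_Q k. \<forall>y\<in>std_Q k. dist (T x) (T y) \<le> C * edist k x y)"

type_synonym 'a singular_chain = "((nat \<Rightarrow> real) \<Rightarrow> 'a) \<Rightarrow>\<^sub>0 real"

definition lipschitz_chains :: "nat \<Rightarrow> 'a::euclidean_space set \<Rightarrow> 'a singular_chain set" where
  "lipschitz_chains k M = {c. \<forall>T\<in>Poly_Mapping.keys c. lipschitz_simplex k M T}"

text \<open>\<open>affine_simplex [a\<^sub>0, \<dots>, a\<^sub>k]\<close> is the map \<open>L[a\<^sub>0, \<dots>, a\<^sub>k]\<close>.
  \<open>affine_simplex_R m\<close> is the same map for points of \<open>\<real>\<^sup>m\<close>, written coordinatewise.\<close>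

definition affine_simplex :: "'a::euclidean_space list \<Rightarrow> (nat \<Rightarrow> real) \<Rightarrow> 'a" where
  "affine_simplex as =
     (\<lambda>x\<in>std_Q (length as - 1). as ! 0 + (\<Sum>i=1..length as - 1. x i *\<^sub>R (as ! i - as ! 0)))"

definition affine_simplex_R :: "nat \<Rightarrow> (nat \<Rightarrow> real) list \<Rightarrow> (nat \<Rightarrow> real) \<Rightarrow> (nat \<Rightarrow> real)" where
  "affine_simplex_R m as =
     (\<lambda>x\<in>std_Q (length as - 1). \<lambda>j\<in>{1..m}.
        (as ! 0) j + (\<Sum>i=1..length as - 1. x i * ((as ! i) j - (as ! 0) j)))"

definition face_map :: "nat \<Rightarrow> nat \<Rightarrow> (nat \<Rightarrow> real) \<Rightarrow> (nat \<Rightarrow> real)" where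
  "face_map k i = affine_simplex_R k (omit i (map (Q_vertex k) [0..<Suc k]))"

definition singular_boundary :: "nat \<Rightarrow> 'a singular_chain \<Rightarrow> 'a singular_chain" where
  "singular_boundary k = linear_extension (\<lambda>T.
     \<Sum>i\<le>k. (-1) ^ i *\<^sub>R Poly_Mapping.single (\<lambda>x\<in>std_Q (k - 1). T (face_map k i x)) 1)"

definition singular_cone_operator ::
  "'a::euclidean_space set set \<Rightarrow> 'a rel \<Rightarrow> 'a \<Rightarrow> (nat \<Rightarrow> ('a list \<Rightarrow>\<^sub>0 real) \<Rightarrow> 'a singular_chain) \<Rightarrow> bool"
  where
  "singular_cone_operator X r a Co \<longleftrightarrow>
     (\<forall>k. linear_between (chains X r k) (lipschitz_chains (Suc k) (\<Union>X)) (Co k)) \<and>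
     (\<forall>k\<ge>1. \<forall>\<sigma>\<in>simplices X r k.
        Co (k - 1) (boundary k (Poly_Mapping.single \<sigma> 1)) +
        singular_boundary (k + 1) (Co k (Poly_Mapping.single \<sigma> 1))
          = Poly_Mapping.single (affine_simplex \<sigma>) 1) \<and>
     (\<forall>v\<in>vertices X.
        singular_boundary 1 (Co 0 (Poly_Mapping.single [v] 1))
          = Poly_Mapping.single (affine_simplex [v]) 1 - Poly_Mapping.single (affine_simplex [a]) 1)"


section \<open>Piecewise smooth forms and Whitney forms\<close>

text \<open>
  A \<open>k\<close>-form \<open>u\<close> on the complex \<open>X\<close> is given by its traces: \<open>u S x [w\<^sub>1, \<dots>, w\<^sub>k]\<close> is the value at
  \<open>x \<in> S\<close> of the trace of \<open>u\<close> on the closed simplex \<open>S \<in> X\<close>, for \<open>w\<^sub>i\<close> tangent to \<open>S\<close>.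
  For all other arguments \<open>u\<close> is set to 0, so that equal forms are equal functions.
\<close>

type_synonym 'a form = "'a set \<Rightarrow> 'a \<Rightarrow> 'a list \<Rightarrow> real"

definition tangent :: "'a::euclidean_space set \<Rightarrow> 'a set" where
  "tangent S = span {y - x |x y. x \<in> S \<and> y \<in> S}"

definition normalize_form :: "'a::euclidean_space set set \<Rightarrow> nat \<Rightarrow> 'a form \<Rightarrow> 'a form" where
  "normalize_form X k u =
     (\<lambda>S x ws. if S \<in> X \<and> x \<in> S \<and> length ws = k \<and> set ws \<subseteq> tangent S then u S x ws else 0)"

text \<open>
  In both definitions below, the derivative within \<open>S\<close> is applied to vectors tangent to \<open>S\<close> only,
  and on these it is unique. The second one is
  \<open>du(w\<^sub>0, \<dots>, w\<^sub>k) = \<Sum>\<^sub>i (-1)\<^sup>i D\<^sub>w\<^sub>i (u(w\<^sub>0, \<dots>, w\<^sub>k without w\<^sub>i))\<close> for constant \<open>w\<^sub>i\<close>.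
\<close>

definition differential :: "('a::euclidean_space \<Rightarrow> real) \<Rightarrow> 'a set \<Rightarrow> 'a \<Rightarrow> 'a \<Rightarrow> real" where
  "differential f S x = frechet_derivative f (at x within S)"

definition ext_deriv :: "'a::euclidean_space set set \<Rightarrow> nat \<Rightarrow> 'a form \<Rightarrow> 'a form" where
  "ext_deriv X k u = normalize_form X (Suc k) (\<lambda>S x ws.
     \<Sum>i\<le>k. (-1) ^ i * differential (\<lambda>y. u S y (omit i ws)) S x (ws ! i))"

definition wedge :: "('a \<Rightarrow> real) list \<Rightarrow> 'a list \<Rightarrow> real" where
  "wedge \<alpha>s ws =
     (\<Sum>p | p permutes {..<length \<alpha>s}. of_int (sign p) * (\<Prod>i<length \<alpha>s. (\<alpha>s ! i) (ws ! p i)))"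

definition is_hat :: "'a::euclidean_space set set \<Rightarrow> 'a \<Rightarrow> ('a \<Rightarrow> real) \<Rightarrow> bool" where
  "is_hat X v f \<longleftrightarrow>
     continuous_on (\<Union>X) f \<and>
     (\<forall>S\<in>X. \<forall>x\<in>S. \<forall>y\<in>S. \<forall>t\<in>{0..1}. f ((1 - t) *\<^sub>R x + t *\<^sub>R y) = (1 - t) * f x + t * f y) \<and>
     (\<forall>w\<in>vertices X. f w = (if w = v then 1 else 0)) \<and>
     (\<forall>x. x \<notin> \<Union>X \<longrightarrow> f x = 0)"

definition hat :: "'a::euclidean_space set set \<Rightarrow> 'a \<Rightarrow> 'a \<Rightarrow> real" where
  "hat X v = (THE f. is_hat X v f)"

definition whitney_form :: "'a::euclidean_space set set \<Rightarrow> nat \<Rightarrow> 'a list \<Rightarrow> 'a form" where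
  "whitney_form X k \<sigma> = normalize_form X k (\<lambda>S x ws.
     fact k * (\<Sum>i\<le>k. (-1) ^ i * hat X (\<sigma> ! i) x *
       wedge (map (\<lambda>v. differential (hat X v) S x) (omit i \<sigma>)) ws))"

definition whitney_space :: "'a::euclidean_space set set \<Rightarrow> 'a rel \<Rightarrow> nat \<Rightarrow> 'a form set" where
  "whitney_space X r k =
     {u. \<exists>c. u = (\<lambda>S x ws. \<Sum>\<sigma>\<in>simplices X r k. c \<sigma> * whitney_form X k \<sigma> S x ws)}"

definition carrier_simplex :: "'a::euclidean_space set set \<Rightarrow> 'a \<Rightarrow> 'a set" where
  "carrier_simplex X x = (THE S. S \<in> X \<and> x \<in> rel_interior S)"

definition point_value :: "'a::euclidean_space set set \<Rightarrow> 'a form \<Rightarrow> 'a \<Rightarrow> real" where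
  "point_value X u x = u (carrier_simplex X x) x []"

definition constant_form :: "'a::euclidean_space set set \<Rightarrow> real \<Rightarrow> 'a form" where
  "constant_form X c = normalize_form X 0 (\<lambda>S x ws. c)"


section \<open>Integration over singular chains\<close>

text \<open>The linear map \<open>DT(q)\<close> on \<open>\<real>\<^sup>k\<close> is represented by the images \<open>D 1, \<dots>, D k\<close> of the unit vectors.\<close>

definition has_total_derivative ::
  "nat \<Rightarrow> ((nat \<Rightarrow> real) \<Rightarrow> 'a::euclidean_space) \<Rightarrow> (nat \<Rightarrow> 'a) \<Rightarrow> (nat \<Rightarrow> real) \<Rightarrow> bool" where
  "has_total_derivative k T D q \<longleftrightarrow>
     (\<forall>e>0. \<exists>d>0. \<forall>y\<in>std_Q k. edist k y q < d \<longrightarrow>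
        norm (T y - T q - (\<Sum>i=1..k. (y i - q i) *\<^sub>R D i)) \<le> e * edist k y q)"

definition total_derivative ::
  "nat \<Rightarrow> ((nat \<Rightarrow> real) \<Rightarrow> 'a::euclidean_space) \<Rightarrow> (nat \<Rightarrow> real) \<Rightarrow> nat \<Rightarrow> 'a" where
  "total_derivative k T q = (SOME D. has_total_derivative k T D q)"

text \<open>The coefficient of \<open>dx\<^sub>1 \<and> \<dots> \<and> dx\<^sub>k\<close> in \<open>T\<^sup>*u\<close>.\<close>

definition pullback ::
  "'a::euclidean_space set set \<Rightarrow> nat \<Rightarrow> ((nat \<Rightarrow> real) \<Rightarrow> 'a) \<Rightarrow> 'a form \<Rightarrow> (nat \<Rightarrow> real) \<Rightarrow> real" where
  "pullback X k T u q =
     u (carrier_simplex X (T q)) (T q) (map (total_derivative k T q) [1..<Suc k])"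

definition simplex_integral ::
  "'a::euclidean_space set set \<Rightarrow> nat \<Rightarrow> ((nat \<Rightarrow> real) \<Rightarrow> 'a) \<Rightarrow> 'a form \<Rightarrow> real" where
  "simplex_integral X k T u =
     (if k = 0 then point_value X u (T (Q_vertex 0 0))
      else set_lebesgue_integral (completion (\<Pi>\<^sub>M i\<in>{1..k}. lborel)) (std_Q k) (pullback X k T u))"

definition chain_integral ::
  "'a::euclidean_space set set \<Rightarrow> nat \<Rightarrow> 'a singular_chain \<Rightarrow> 'a form \<Rightarrow> real" where
  "chain_integral X k c u = linear_extension (\<lambda>T. simplex_integral X k T u) c"

definition cone_potential ::
  "'a::euclidean_space set set \<Rightarrow> 'a rel \<Rightarrow> (nat \<Rightarrow> ('a list \<Rightarrow>\<^sub>0 real) \<Rightarrow> 'a singular_chain) \<Rightarrow>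
   nat \<Rightarrow> 'a form \<Rightarrow> 'a form" where
  "cone_potential X r Co k u =
     (THE w. w \<in> whitney_space X r (k - 1) \<and>
        (\<forall>\<sigma>\<in>simplices X r (k - 1).
           simplex_integral X (k - 1) (affine_simplex \<sigma>) w
             = chain_integral X k (Co (k - 1) (Poly_Mapping.single \<sigma> 1)) u))"

end

theory Submission
  imports Defs "Jordan_Normal_Form.Determinant"
begin

text \<open>
  The integrals of a Whitney form over the simplices of \<open>X\<close> are its coefficients, so two
  Whitney forms are equal once these integrals agree. Since \<open>d\<close> maps Whitney forms to Whitney
  forms, the identity reduces, over a fixed \<open>\<sigma>\<close>, to Stokes' theorem on \<open>\<sigma>\<close> and on the Lipschitz
  singular simplices of \<open>Co \<sigma>\<close>, combined with the cone identity
  \<open>Co (\<partial>\<sigma>) + \<partial> (Co \<sigma>) = L \<sigma>\<close>.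

  For a Lipschitz singular simplex \<open>T\<close> the pullback of a Whitney form only involves the functions
  \<open>\<lambda>\<^sub>v \<circ> T\<close>, which are Lipschitz on \<open>std_Q k\<close>. So Stokes' theorem is needed for
  \<open>f dg\<^sub>1 \<and> \<dots> \<and> dg\<^sub>k\<close> with Lipschitz \<open>f, g\<^sub>i\<close>. For coordinate functions \<open>g\<^sub>i\<close> it is Fubini's theorem.
  The class of admissible \<open>g\<^sub>i\<close> is closed under linear combinations, under composition with smooth
  functions, and under limits of uniformly Lipschitz sequences, because their partial derivatives
  converge weakly. Hence it contains the minima of finitely many cones, and by a further limit
  all Lipschitz functions.
\<close>

section \<open>Lipschitz functions of several real variables\<close>

text \<open>The obstacle is that \<open>T\<close> is only Lipschitz. Limits of its approximants
  control derivatives only weakly, and a product of weakly convergent factors need not converge to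
  the product of the limits, so the entries \<open>g\<^sub>i\<close> of a wedge product cannot be
  approximated simultaneously. Therefore a single slot varies at a time, while the other entries are
  arbitrary fixed Lipschitz functions whose minors form an integrable weight. The leading function
  \<open>f\<close> stays universally quantified throughout, because composing the varying entry with
  a smooth \<open>F\<close> is paid for by multiplying \<open>f\<close> by
  \<open>F' \<circ> g\<close>.

  The route to minima is sqrt (t^2 + e), which tends to the absolute value. The cones are those of
  the l1 distance, because these are sums of absolute values of coordinate functions.

  Total derivatives enter since the pullback is defined by \<open>DT\<close>. Rademacher's theorem
  for the finitely many functions \<lambda>_v \<circ> T, together with T = \<Sum> (\<lambda>_v
  \<circ> T) v, expresses \<open>DT\<close> almost everywhere by their partial derivatives.
  Rademacher's theorem rests in turn on differentiability almost everywhere on the line, obtained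
  from Vitali coverings.\<close>

lemma countable_disjoint_emeasure_mono:
  assumes C: "countable C" "disjoint_family_on X C"
    and s: "\<And>i. i \<in> C \<Longrightarrow> X i \<in> sets M" "\<And>i. i \<in> C \<Longrightarrow> X i \<in> sets N"
    and le: "\<And>i. i \<in> C \<Longrightarrow> a * emeasure M (X i) \<le> b * emeasure N (X i)"
  shows "a * emeasure M (\<Union>(X ` C)) \<le> b * emeasure N (\<Union>(X ` C))"
proof -
  have "a * emeasure M (\<Union>(X ` C)) = (\<integral>\<^sup>+i. a * emeasure M (X i) \<partial>count_space C)"
    using emeasure_UN_countable[OF s(1) C] by (simp add: nn_integral_cmult)
  also have "\<dots> \<le> (\<integral>\<^sup>+i. b * emeasure N (X i) \<partial>count_space C)"
    by (intro nn_integral_mono) (auto intro: le)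
  also have "\<dots> = b * emeasure N (\<Union>(X ` C))"
    using emeasure_UN_countable[OF s(2) C] by (simp add: nn_integral_cmult)
  finally show ?thesis .
qed

text \<open>An interval {u..v} is the ball with centre (u + v)/2 and radius (v - u)/2, so Vitali's
  covering theorem for balls applies. The predicate \<open>P\<close> will carry a growth condition
  that selects the intervals.\<close>

lemma Vitali_covering_intervals:
  fixes S :: "real set"
  assumes "\<And>x d. x \<in> S \<Longrightarrow> 0 < d \<Longrightarrow> \<exists>u v. P u v \<and> u < v \<and> x \<in> {u..v} \<and> v - u < d"
  obtains C where "countable C" "\<And>u v. (u, v) \<in> C \<Longrightarrow> P u v \<and> u < v"
    "disjoint_family_on (\<lambda>(u, v). {u..v}) C" "negligible (S - (\<Union>(u, v)\<in>C. {u..v}))"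
proof -
  define K where "K = {(u, v). P u v \<and> (u::real) < v}"
  have cb: "cball ((fst i + snd i) / 2) ((snd i - fst i) / 2) = {fst i..snd i}" for i :: "real \<times> real"
    by (auto simp: cball_eq_atLeastAtMost field_simps)
  have r: "0 < (snd i - fst i) / 2" if "i \<in> K" for i using that by (auto simp: K_def)
  have S: "\<exists>i. i \<in> K \<and> x \<in> cball ((fst i + snd i) / 2) ((snd i - fst i) / 2) \<and> (snd i - fst i) / 2 < d"
    if xd: "x \<in> S" "0 < d" for x d
  proof -
    obtain u v where "P u v \<and> u < v \<and> x \<in> {u..v} \<and> v - u < d" using assms[OF xd] by blast
    then show ?thesis using cb[of "(u, v)"] by (intro exI[of _ "(u, v)"]) (auto simp: K_def simp del: mem_cball)
  qed
  obtain C where C: "countable C" "C \<subseteq> K"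
    "pairwise (\<lambda>i j. disjnt (cball ((fst i + snd i) / 2) ((snd i - fst i) / 2)) (cball ((fst j + snd j) / 2) ((snd j - fst j) / 2))) C"
    "negligible (S - (\<Union>i\<in>C. cball ((fst i + snd i) / 2) ((snd i - fst i) / 2)))"
    using Vitali_covering_theorem_cballs[of K "\<lambda>i. (snd i - fst i) / 2" S "\<lambda>i. (fst i + snd i) / 2"] r S
    by auto
  show ?thesis
  proof
    show "countable C" by fact
    show "P u v \<and> u < v" if "(u, v) \<in> C" for u v using that C(2) by (auto simp: K_def)
    show "disjoint_family_on (\<lambda>(u, v). {u..v}) C"
      using C(3) unfolding cb by (auto simp: disjoint_family_on_def pairwise_def disjnt_def split_beta)
    show "negligible (S - (\<Union>(u, v)\<in>C. {u..v}))"
      using C(4) unfolding cb by (simp add: split_beta)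
  qed
qed

text \<open>The Stieltjes measure \<nu> of \<open>g\<close> is squeezed from two sides. A Vitali
  family of intervals with slope at most \<open>p\<close> inside \<open>U\<close> has a union
  \<open>W\<close> with \<nu>(W) \<le> p |U|; a second family with slope at least \<open>q\<close>,
  taken inside the first, has a union \<open>V\<close> with q |V| \<le> \<nu>(W). Since
  \<open>V\<close> covers \<open>S\<close> up to a null set, an outer cover of \<open>S\<close>
  shrinks by the factor p/q.\<close>

lemma shrink_outer_cover:
  fixes g :: "real \<Rightarrow> real"
  assumes mono: "\<And>x y. x \<le> y \<Longrightarrow> g x \<le> g y" and cont: "continuous_on UNIV g"
    and pq: "0 \<le> p" "p < q"
    and low: "\<And>x d. x \<in> S \<Longrightarrow> 0 < d \<Longrightarrow> \<exists>u v. u < v \<and> x \<in> {u..v} \<and> v - u < d \<and> g v - g u \<le> p * (v - u)"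
    and up: "\<And>x d. x \<in> S \<Longrightarrow> 0 < d \<Longrightarrow> \<exists>u v. u < v \<and> x \<in> {u..v} \<and> v - u < d \<and> q * (v - u) \<le> g v - g u"
    and U: "open U" "U \<in> lmeasurable" "S \<subseteq> U" and e: "0 < e"
  obtains U' where "open U'" "U' \<in> lmeasurable" "S \<subseteq> U'" "measure lebesgue U' \<le> p / q * measure lebesgue U + e"
proof -
  let ?\<nu> = "interval_measure g"
  have \<nu>: "emeasure ?\<nu> {u..v} = ennreal (g v - g u)" if "u < v" for u v
    using that mono cont by (intro emeasure_interval_measure_Icc) auto
  obtain C where C: "countable C" "\<And>u v. (u, v) \<in> C \<Longrightarrow> ({u..v} \<subseteq> U \<and> g v - g u \<le> p * (v - u)) \<and> u < v"
    "disjoint_family_on (\<lambda>(u, v). {u..v}) C" "negligible (S - (\<Union>(u, v)\<in>C. {u..v}))"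
  proof (rule Vitali_covering_intervals[of S "\<lambda>u v. {u..v} \<subseteq> U \<and> g v - g u \<le> p * (v - u)"])
    fix x d :: real assume x: "x \<in> S" "0 < d"
    obtain r where r: "0 < r" "ball x r \<subseteq> U" using U x by (meson openE subsetD)
    obtain u v where uv: "u < v" "x \<in> {u..v}" "v - u < min d r" "g v - g u \<le> p * (v - u)"
      using low[of x "min d r"] x r by auto
    then have "{u..v} \<subseteq> ball x r" by (auto simp: dist_real_def)
    then show "\<exists>u v. ({u..v} \<subseteq> U \<and> g v - g u \<le> p * (v - u)) \<and> u < v \<and> x \<in> {u..v} \<and> v - u < d"
      using uv r by (intro exI[of _ u] exI[of _ v]) auto
  qed blast
  define W where "W = (\<Union>(u, v)\<in>C. {u..v})"
  \<comment> \<open>Only points in the open intervals of the first family are kept, so that small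
    intervals around them remain inside \<open>W\<close>. The endpoints lost are countably many,
    hence negligible.\<close>
  define S' where "S' = S \<inter> (\<Union>(u, v)\<in>C. {u<..<v})"
  have Wb: "W \<in> sets borel" unfolding W_def using C(1) by (auto intro!: sets.countable_UN'')
  have WU: "W \<subseteq> U" unfolding W_def using C(2) by fastforce
  have \<nu>W: "1 * emeasure ?\<nu> W \<le> ennreal p * emeasure lborel W" unfolding W_def
  proof (rule countable_disjoint_emeasure_mono[OF C(1) C(3)])
    fix i assume "i \<in> C"
    then obtain u v where i: "i = (u, v)" "u < v" "g v - g u \<le> p * (v - u)" using C(2) by (cases i) auto
    then show "1 * emeasure ?\<nu> (case i of (u, v) \<Rightarrow> {u..v}) \<le> ennreal p * emeasure lborel (case i of (u, v) \<Rightarrow> {u..v})"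
      using pq by (auto simp: \<nu> ennreal_mult[symmetric] intro!: ennreal_leI)
  qed auto
  obtain D where D: "countable D" "\<And>u v. (u, v) \<in> D \<Longrightarrow> ({u..v} \<subseteq> W \<and> q * (v - u) \<le> g v - g u) \<and> u < v"
    "disjoint_family_on (\<lambda>(u, v). {u..v}) D" "negligible (S' - (\<Union>(u, v)\<in>D. {u..v}))"
  proof (rule Vitali_covering_intervals[of S' "\<lambda>u v. {u..v} \<subseteq> W \<and> q * (v - u) \<le> g v - g u"])
    fix x d :: real assume x: "x \<in> S'" "0 < d"
    then obtain a b where ab: "(a, b) \<in> C" "a < x" "x < b" "x \<in> S" by (auto simp: S'_def)
    define r where "r = min (x - a) (b - x)"
    obtain u v where uv: "u < v" "x \<in> {u..v}" "v - u < min d r" "q * (v - u) \<le> g v - g u"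
      using up[of x "min d r"] x ab by (auto simp: r_def)
    then have "{u..v} \<subseteq> {a..b}" by (auto simp: r_def)
    also have "\<dots> \<subseteq> W" using ab by (auto simp: W_def)
    finally show "\<exists>u v. ({u..v} \<subseteq> W \<and> q * (v - u) \<le> g v - g u) \<and> u < v \<and> x \<in> {u..v} \<and> v - u < d"
      using uv by (intro exI[of _ u] exI[of _ v]) auto
  qed blast
  define V where "V = (\<Union>(u, v)\<in>D. {u..v})"
  have Vb: "V \<in> sets borel" unfolding V_def using D(1) by (auto intro!: sets.countable_UN'')
  have VW: "V \<subseteq> W" unfolding V_def using D(2) by fastforce
  have "ennreal q * emeasure lborel V \<le> 1 * emeasure ?\<nu> V" unfolding V_def
  proof (rule countable_disjoint_emeasure_mono[OF D(1) D(3)])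
    fix i assume "i \<in> D"
    then obtain u v where i: "i = (u, v)" "u < v" "q * (v - u) \<le> g v - g u" using D(2) by (cases i) auto
    then show "ennreal q * emeasure lborel (case i of (u, v) \<Rightarrow> {u..v}) \<le> 1 * emeasure ?\<nu> (case i of (u, v) \<Rightarrow> {u..v})"
      using pq by (auto simp: \<nu> ennreal_mult[symmetric] intro!: ennreal_leI)
  qed auto
  also have "\<dots> \<le> 1 * emeasure ?\<nu> W" using VW Wb by (simp add: emeasure_mono)
  also note \<nu>W
  also have "ennreal p * emeasure lborel W = ennreal p * emeasure lebesgue W" using Wb by simp
  also have "\<dots> \<le> ennreal p * emeasure lebesgue U" using WU U by (intro mult_left_mono emeasure_mono) auto
  also have "\<dots> = ennreal (p * measure lebesgue U)" using pq U(2) by (simp add: fmeasurableD2 ennreal_mult emeasure_eq_ennreal_measure del: emeasure_completion)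
  finally have "ennreal q * emeasure lborel V \<le> ennreal (p * measure lebesgue U)" .
  moreover have "emeasure lebesgue V = emeasure lborel V" using Vb by simp
  ultimately have *: "ennreal q * emeasure lebesgue V \<le> ennreal (p * measure lebesgue U)" by (simp only:)
  have Vm: "V \<in> lmeasurable"
    by (rule fmeasurableI2[OF U(2) order_trans[OF VW WU]]) (use Vb in \<open>simp add: sets_completionI_sets\<close>)
  have "ennreal (q * measure lebesgue V) \<le> ennreal (p * measure lebesgue U)" using * pq Vm by (simp add: fmeasurableD2 ennreal_mult emeasure_eq_ennreal_measure del: emeasure_completion)
  then have "q * measure lebesgue V \<le> p * measure lebesgue U" using pq by simp
  then have mV: "measure lebesgue V \<le> p / q * measure lebesgue U" using pq by (simp add: field_simps)
  have "countable (fst ` C \<union> snd ` C)" using C(1) by auto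
  then have negE: "negligible (fst ` C \<union> snd ` C)"
    by (simp add: negligible_iff_null_sets countable_imp_null_set_lborel null_sets_completionI)
  have "S - V \<subseteq> (S - W) \<union> (fst ` C \<union> snd ` C) \<union> (S' - V)"
  proof
    fix x assume x: "x \<in> S - V"
    show "x \<in> (S - W) \<union> (fst ` C \<union> snd ` C) \<union> (S' - V)"
    proof (cases "x \<in> W \<and> x \<notin> S'")
      case True
      then obtain u v where "(u, v) \<in> C" "u \<le> x" "x \<le> v" by (auto simp: W_def)
      moreover from this have "x = u \<or> x = v" using True x by (force simp: S'_def)
      ultimately show ?thesis by force
    qed (use x in auto)
  qed
  then have nSV: "negligible (S - V)" using C(4) D(4) negE
    unfolding W_def[symmetric] V_def[symmetric] by (meson negligible_Un negligible_subset)
  have VS_eq: "V \<union> S = V \<union> (S - V)" by auto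
  have VS: "V \<union> S \<in> lmeasurable" unfolding VS_eq
    by (intro fmeasurable.Un Vm negligible_imp_measurable nSV)
  have "measure lebesgue (V \<union> S) = measure lebesgue V" unfolding VS_eq
    by (rule measure_Un_null_set) (use Vm nSV in \<open>auto simp: negligible_iff_null_sets fmeasurableD\<close>)
  note VS = VS this
  \<comment> \<open>Outer regularity: \<open>S - V\<close> is null, so an open set exceeding
    \<open>V \<union> S\<close> by less than \<open>e\<close> has the required measure.\<close>
  obtain T where T: "open T" "V \<union> S \<subseteq> T" "T - (V \<union> S) \<in> lmeasurable" "emeasure lebesgue (T - (V \<union> S)) < ennreal e"
    using sets_lebesgue_outer_open[of "V \<union> S" e] VS e by (auto simp: fmeasurableD)
  have T2: "T = (V \<union> S) \<union> (T - (V \<union> S))" using T by auto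
  have Tm: "T \<in> lmeasurable" by (subst T2) (intro fmeasurable.Un VS T)
  have "measure lebesgue T \<le> measure lebesgue (V \<union> S) + measure lebesgue (T - (V \<union> S))"
    by (subst T2) (intro measure_Un_le fmeasurableD VS T)
  also have "measure lebesgue (T - (V \<union> S)) \<le> e" using T(3,4) e
    by (simp add: fmeasurableD2 emeasure_eq_ennreal_measure less_imp_le ennreal_less_iff del: emeasure_completion)
  finally show ?thesis using that[of T] T Tm VS mV by auto
qed

text \<open>The infimum \<open>s\<close> of the measures of open sets containing \<open>S\<close>
  satisfies s \<le> c s + e for every e > 0, so it is 0 because c < 1. Boundedness supplies a first
  open set of finite measure.\<close>

lemma negligible_if_outer_shrinks:
  fixes S :: "real set"
  assumes "bounded S" "0 \<le> c" "c < 1"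
    and step: "\<And>U e. open U \<Longrightarrow> U \<in> lmeasurable \<Longrightarrow> S \<subseteq> U \<Longrightarrow> 0 < e \<Longrightarrow>
      \<exists>U'. open U' \<and> U' \<in> lmeasurable \<and> S \<subseteq> U' \<and> measure lebesgue U' \<le> c * measure lebesgue U + e"
  shows "negligible S"
proof -
  define A where "A = {measure lebesgue U |U. open U \<and> U \<in> lmeasurable \<and> S \<subseteq> U}"
  obtain r where r: "S \<subseteq> ball 0 r" using \<open>bounded S\<close> bounded_subset_ballD by blast
  then have ne: "A \<noteq> {}" by (auto simp: A_def intro!: exI[of _ "ball 0 r"])
  have bdd: "bdd_below A" by (rule bdd_belowI[of _ 0]) (auto simp: A_def)
  define s where "s = Inf A"
  have s0: "0 \<le> s" unfolding s_def using ne by (intro cInf_greatest) (auto simp: A_def)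
  have "s \<le> c * s + e" if e: "0 < e" for e
  proof -
    have "s < s + e / 2" using e by simp
    then obtain U where U: "open U" "U \<in> lmeasurable" "S \<subseteq> U" "measure lebesgue U < s + e / 2"
      using cInf_lessD[OF ne, of "s + e / 2"] unfolding s_def[symmetric] by (auto simp: A_def)
    obtain U' where U': "open U'" "U' \<in> lmeasurable" "S \<subseteq> U'" "measure lebesgue U' \<le> c * measure lebesgue U + e / 2"
      using step[OF U(1-3), of "e/2"] e by auto
    have "s \<le> measure lebesgue U'" unfolding s_def by (rule cInf_lower[OF _ bdd]) (unfold A_def, use U' in blast)
    also have "\<dots> \<le> c * (s + e / 2) + e / 2" using U'(4) U(4) assms(2) mult_left_mono[of "measure lebesgue U" "s + e / 2" c] by linarith
    also have "c * (s + e / 2) + e / 2 \<le> c * s + e"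
    proof -
      have "c * e \<le> 1 * e" by (rule mult_right_mono) (use assms e in auto)
      then show ?thesis by (simp add: algebra_simps)
    qed
    finally show ?thesis .
  qed
  then have "s \<le> c * s" by (rule field_le_epsilon)
  then have "(1 - c) * s \<le> 0" by (simp add: algebra_simps)
  then have s: "s = 0" using assms s0 by (simp add: mult_le_0_iff)
  show ?thesis unfolding negligible_outer
  proof safe
    fix e :: real assume "0 < e"
    then obtain U where "open U" "U \<in> lmeasurable" "S \<subseteq> U" "measure lebesgue U < e"
      using cInf_lessD[OF ne, of e] s unfolding s_def by (auto simp: A_def)
    then show "\<exists>T. S \<subseteq> T \<and> T \<in> lmeasurable \<and> measure lebesgue T < e" by auto
  qed
qed
text \<open>A bounded function without a limit has lower limit strictly below upper limit, and two
  rationals fit between. Their rationality later makes the exceptional set a countable union.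
  \<open>Sup s\<close> is the lower limit.\<close>

lemma liminf_limsup_split:
  fixes h :: "real \<Rightarrow> real"
  assumes bd: "\<And>t. \<bar>h t\<bar> \<le> L"
    and no: "\<not> (\<exists>l. (h \<longlongrightarrow> l) (at 0))"
  obtains p q where "p \<in> \<rat>" "q \<in> \<rat>" "p < q" "\<exists>\<^sub>F t in at 0. h t \<le> p" "\<exists>\<^sub>F t in at 0. q \<le> h t"
proof (rule ccontr)
  assume nt: "\<not> thesis"
  note * = that
  have A: "(\<forall>\<^sub>F t in at 0. p < h t) \<or> (\<forall>\<^sub>F t in at 0. h t < q)" if pq: "p \<in> \<rat>" "q \<in> \<rat>" "p < q" for p q
  proof (rule ccontr)
    assume "\<not> ?thesis"
    then have "\<exists>\<^sub>F t in at 0. h t \<le> p" "\<exists>\<^sub>F t in at 0. q \<le> h t"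
      by (simp_all add: frequently_def not_le)
    from *[OF pq this] nt show False by contradiction
  qed
  define s where "s = {p. \<forall>\<^sub>F t in at 0. p < h t}"
  have "- L - 1 < h t" for t using bd[of t] by linarith
  then have lo: "- L - 1 \<in> s" by (simp add: s_def)
  have up: "p \<le> L" if "p \<in> s" for p
  proof (rule ccontr)
    assume "\<not> p \<le> L"
    then have "\<not> p < h t" for t using bd[of t] by linarith
    then have "\<forall>\<^sub>F t::real in at 0. False" using that unfolding s_def by simp
    then show False by simp
  qed
  define l where "l = Sup s"
  have bdd: "bdd_above s" using up by (auto simp: bdd_above_def)
  have "(h \<longlongrightarrow> l) (at 0)"
  proof (rule order_tendstoI)
    fix y assume "y < l"
    then obtain p where "p \<in> s" "y < p" unfolding l_def using less_cSupD[of s y] lo by blast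
    then show "\<forall>\<^sub>F t in at 0. y < h t" by (auto simp: s_def elim!: eventually_mono)
  next
    fix y assume "l < y"
    obtain q where q: "q \<in> \<rat>" "l < q" "q < y" using Rats_dense_in_real[OF \<open>l < y\<close>] by auto
    obtain p where p: "p \<in> \<rat>" "l < p" "p < q" using Rats_dense_in_real[OF q(2)] by auto
    have "p \<notin> s" using p cSup_upper[OF _ bdd, of p] by (auto simp: l_def)
    then have "\<forall>\<^sub>F t in at 0. h t < q" using A[OF p(1) q(1) p(3)] by (auto simp: s_def)
    then show "\<forall>\<^sub>F t in at 0. h t < y" by eventually_elim (use q in auto)
  qed
  with no show False by blast
qed

text \<open>Lebesgue's theorem. Where no derivative exists, the difference quotients are frequently
  at most \<open>p\<close> and frequently at least \<open>q\<close> for some rationals p < q; outer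
  covers of such a set shrink by p/q again and again.\<close>

lemma monotone_Lipschitz_differentiable_ae:
  fixes g :: "real \<Rightarrow> real"
  assumes mono: "\<And>x y. x \<le> y \<Longrightarrow> g x \<le> g y" and lip: "\<And>x y. \<bar>g x - g y\<bar> \<le> L * \<bar>x - y\<bar>"
  shows "negligible {x. \<not> (\<exists>l. ((\<lambda>t. (g (x + t) - g x) / t) \<longlongrightarrow> l) (at 0))}"
proof -
  define h where "h x t = (g (x + t) - g x) / t" for x t
  have L0: "0 \<le> L" using lip[of 0 1] by simp
  have cont: "continuous_on UNIV g"
    by (rule lipschitz_on_continuous_on[of L]) (use lip L0 in \<open>auto simp: lipschitz_on_def dist_real_def\<close>)
  have bd: "\<bar>h x t\<bar> \<le> L" for x t
    using lip[of "x + t" x] L0 by (cases "t = 0") (auto simp: h_def field_simps)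
  have h0: "0 \<le> h x t" for x t
    using mono[of x "x + t"] mono[of "x + t" x] by (cases "t \<ge> 0") (auto simp: h_def field_simps)
  \<comment> \<open>The restriction to an interval given by \<open>N\<close> makes the set bounded;
    the union over \<open>N\<close> removes it again.\<close>
  define E where "E p q N = {x \<in> {-real N<..<real N}. (\<exists>\<^sub>F t in at 0. h x t \<le> p) \<and> (\<exists>\<^sub>F t in at 0. q \<le> h x t)}" for p q N
  \<comment> \<open>A quotient with increment \<open>t\<close> of either sign is the slope of
    \<open>g\<close> over an interval that has \<open>x\<close> as an endpoint.\<close>
  have fr: "\<exists>u v. u < v \<and> x \<in> {u..v} \<and> v - u < d \<and> P ((g v - g u) / (v - u))"
    if P: "\<exists>\<^sub>F t in at 0. P (h x t)" and d: "0 < d" for x d P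
  proof -
    have "\<exists>t. t \<noteq> 0 \<and> \<bar>t\<bar> < d \<and> P (h x t)"
      using frequently_eventually_conj[OF P, of "\<lambda>t. t \<noteq> 0 \<and> \<bar>t\<bar> < d"] d
      by (fastforce dest: frequently_ex simp: eventually_at dist_real_def)
    then obtain t where t: "t \<noteq> 0" "\<bar>t\<bar> < d" "P (h x t)" by blast
    show ?thesis
    proof (cases "t > 0")
      case True
      then have "x < x + t \<and> x \<in> {x..x + t} \<and> x + t - x < d \<and> P ((g (x + t) - g x) / (x + t - x))"
        using t by (simp add: h_def)
      then show ?thesis by blast
    next
      case False
      have "(g x - g (x + t)) / - t = (g (x + t) - g x) / t" by (metis minus_diff_eq minus_divide_divide)
      then have "x + t < x \<and> x \<in> {x + t..x} \<and> x - (x + t) < d \<and> P ((g x - g (x + t)) / (x - (x + t)))"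
        using t False by (simp add: h_def)
      then show ?thesis by blast
    qed
  qed
  have negE: "negligible (E p q N)" if pq: "p < q" for p q N
  proof (cases "0 \<le> p")
    case False
    have "E p q N = {}"
    proof safe
      fix x assume "x \<in> E p q N"
      then have "\<exists>\<^sub>F t in at 0. h x t \<le> p" by (auto simp: E_def)
      then obtain t where "h x t \<le> p" using frequently_ex by blast
      then show "x \<in> {}" using h0[of x t] False by linarith
    qed
    then show ?thesis by simp
  next
    case p: True
    show ?thesis
    proof (rule negligible_if_outer_shrinks[where c = "p / q"])
      show "bounded (E p q N)" by (rule bounded_subset[of "{-real N<..<real N}"]) (auto simp: E_def)
      fix U :: "real set" and e :: real
      assume U: "open U" "U \<in> lmeasurable" "E p q N \<subseteq> U" and e: "0 < e"
      show "\<exists>U'. open U' \<and> U' \<in> lmeasurable \<and> E p q N \<subseteq> U' \<and> measure lebesgue U' \<le> p / q * measure lebesgue U + e"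
      proof (rule shrink_outer_cover[OF mono cont p pq _ _ U e])
        fix x d :: real assume "x \<in> E p q N" "0 < d"
        then have "\<exists>\<^sub>F t in at 0. h x t \<le> p" "\<exists>\<^sub>F t in at 0. q \<le> h x t" by (auto simp: E_def)
        note ex = fr[where P = "\<lambda>r. r \<le> p", OF this(1) \<open>0 < d\<close>] fr[where P = "\<lambda>r. q \<le> r", OF this(2) \<open>0 < d\<close>]
        obtain u v where uv: "u < v" "x \<in> {u..v}" "v - u < d" "(g v - g u) / (v - u) \<le> p"
          using ex(1) by blast
        obtain u' v' where uv': "u' < v'" "x \<in> {u'..v'}" "v' - u' < d" "q \<le> (g v' - g u') / (v' - u')"
          using ex(2) by blast
        have "g v - g u \<le> p * (v - u)" "q * (v' - u') \<le> g v' - g u'"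
          using uv(1,4) uv'(1,4) by (simp_all add: pos_divide_le_eq pos_le_divide_eq)
        with uv uv' show "\<exists>u v. u < v \<and> x \<in> {u..v} \<and> v - u < d \<and> g v - g u \<le> p * (v - u)"
          "\<exists>u v. u < v \<and> x \<in> {u..v} \<and> v - u < d \<and> q * (v - u) \<le> g v - g u"
          by blast+
      qed auto
    qed (use p pq in auto)
  qed
  have "{x. \<not> (\<exists>l. (h x \<longlongrightarrow> l) (at 0))} \<subseteq> (\<Union>p\<in>\<rat>. \<Union>q\<in>\<rat> \<inter> {p<..}. \<Union>N. E p q N)"
    (is "_ \<subseteq> ?R")
  proof
    fix x assume "x \<in> {x. \<not> (\<exists>l. (h x \<longlongrightarrow> l) (at 0))}"
    then obtain p q where pq: "p \<in> \<rat>" "q \<in> \<rat>" "p < q" "\<exists>\<^sub>F t in at 0. h x t \<le> p" "\<exists>\<^sub>F t in at 0. q \<le> h x t"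
      using liminf_limsup_split[of "h x" L] bd by blast
    obtain N where "\<bar>x\<bar> < real N" using reals_Archimedean2 by blast
    with pq have "x \<in> E p q N" by (auto simp: E_def)
    with pq show "x \<in> ?R" by blast
  qed
  moreover have "negligible ?R"
  proof (rule negligible_countable_Union)
    show "countable ((\<lambda>p. \<Union>q\<in>\<rat> \<inter> {p<..}. \<Union>N. E p q N) ` \<rat>)"
      by (rule countable_image[OF countable_rat])
    fix S assume "S \<in> (\<lambda>p. \<Union>q\<in>\<rat> \<inter> {p<..}. \<Union>N. E p q N) ` \<rat>"
    then obtain p where S: "S = (\<Union>q\<in>\<rat> \<inter> {p<..}. \<Union>N. E p q N)" by blast
    show "negligible S" unfolding S
    proof (rule negligible_countable_Union)
      show "countable ((\<lambda>q. \<Union>N. E p q N) ` (\<rat> \<inter> {p<..}))"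
        by (rule countable_image[OF countable_Int1[OF countable_rat]])
      fix S' assume "S' \<in> (\<lambda>q. \<Union>N. E p q N) ` (\<rat> \<inter> {p<..})"
      then obtain q where "p < q" and S': "S' = (\<Union>N. E p q N)" by blast
      then show "negligible S'" unfolding S' by (intro negligible_Union_nat negE)
    qed
  qed
  ultimately show ?thesis unfolding h_def by (rule negligible_subset[rotated])
qed

text \<open>Adding \<open>L * x\<close> makes the function monotone and does not affect
  differentiability.\<close>

lemma Lipschitz_differentiable_ae:
  fixes f :: "real \<Rightarrow> real"
  assumes lip: "\<And>x y. \<bar>f x - f y\<bar> \<le> L * \<bar>x - y\<bar>"
  shows "negligible {x. \<not> (\<exists>l. ((\<lambda>t. (f (x + t) - f x) / t) \<longlongrightarrow> l) (at 0))}"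
proof -
  define g where "g x = f x + L * x" for x
  have L0: "0 \<le> L" using lip[of 0 1] by simp
  have mono: "g x \<le> g y" if "x \<le> y" for x y using lip[of x y] that by (simp add: g_def algebra_simps)
  have lip': "\<bar>g x - g y\<bar> \<le> (2 * L) * \<bar>x - y\<bar>" for x y
  proof -
    have "\<bar>g x - g y\<bar> \<le> \<bar>f x - f y\<bar> + \<bar>L * (x - y)\<bar>" by (simp add: g_def algebra_simps)
    also have "\<dots> \<le> (2 * L) * \<bar>x - y\<bar>" using lip[of x y] L0 by (simp add: abs_mult)
    finally show ?thesis .
  qed
  show ?thesis
  proof (rule negligible_subset[OF monotone_Lipschitz_differentiable_ae[where g = g and L = "2 * L"]], rule mono, assumption, rule lip', rule Collect_mono, rule impI, erule contrapos_nn, erule exE)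
    fix x l assume l: "((\<lambda>t. (g (x + t) - g x) / t) \<longlongrightarrow> l) (at 0)"
    have "((\<lambda>t. (g (x + t) - g x) / t - L) \<longlongrightarrow> l - L) (at 0)" by (intro tendsto_intros l)
    then have "((\<lambda>t. (f (x + t) - f x) / t) \<longlongrightarrow> l - L) (at 0)"
    proof (rule Lim_transform_eventually)
      have "(g (x + t) - g x) / t - L = (f (x + t) - f x) / t" if "t \<noteq> 0" for t
        using that by (simp add: g_def divide_simps) (simp add: algebra_simps)
      then show "\<forall>\<^sub>F t in at 0. (g (x + t) - g x) / t - L = (f (x + t) - f x) / t"
        by (auto simp: eventually_at intro!: exI[of _ 1])
    qed
    then show "\<exists>l. ((\<lambda>t. (f (x + t) - f x) / t) \<longlongrightarrow> l) (at 0)" by (rule exI)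
  qed
qed

section \<open>Lipschitz functions of finitely many coordinates\<close>

abbreviation leb :: "nat set \<Rightarrow> (nat \<Rightarrow> real) measure" where
  "leb I \<equiv> Pi\<^sub>M I (\<lambda>_. lborel)"

interpretation lborel_prod: product_sigma_finite "\<lambda>_::nat. lborel :: real measure" ..

text \<open>With the l1 distance over \<open>I\<close> on the right, the condition also says that
  \<open>g\<close> depends on the coordinates in \<open>I\<close> only. Arguments can therefore be
  updated or shifted as arbitrary functions, without restoring extensionality.\<close>

definition lip_on :: "nat set \<Rightarrow> real \<Rightarrow> ((nat \<Rightarrow> real) \<Rightarrow> real) \<Rightarrow> bool" where
  "lip_on I L g \<longleftrightarrow> (\<forall>x y. \<bar>g x - g y\<bar> \<le> L * (\<Sum>i\<in>I. \<bar>x i - y i\<bar>))"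

lemma lip_onD: "lip_on I L g \<Longrightarrow> \<bar>g x - g y\<bar> \<le> L * (\<Sum>i\<in>I. \<bar>x i - y i\<bar>)"
  by (simp add: lip_on_def)

lemma lip_on_cong: "lip_on I L g \<Longrightarrow> (\<And>i. i \<in> I \<Longrightarrow> x i = y i) \<Longrightarrow> g x = g y"
  using lip_onD[of I L g x y] by simp

lemma lip_on_mono: "lip_on I L g \<Longrightarrow> L \<le> L' \<Longrightarrow> lip_on I L' g"
  unfolding lip_on_def by (meson abs_ge_zero mult_right_mono order_trans sum_nonneg)

text \<open>A sequence of minima of finitely many cones, decreasing to any given Lipschitz function.\<close>

primrec cone_min :: "nat set \<Rightarrow> real \<Rightarrow> ((nat \<Rightarrow> real) \<Rightarrow> real) \<Rightarrow> (nat \<Rightarrow> nat \<Rightarrow> real) \<Rightarrow> nat \<Rightarrow> (nat \<Rightarrow> real) \<Rightarrow> real" where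
  "cone_min I L g y 0 x = g (y 0) + L * (\<Sum>i\<in>I. \<bar>x i - y 0 i\<bar>)"
| "cone_min I L g y (Suc m) x = min (cone_min I L g y m x) (g (y (Suc m)) + L * (\<Sum>i\<in>I. \<bar>x i - y (Suc m) i\<bar>))"

lemma cone_min_le: "k \<le> m \<Longrightarrow> cone_min I L g y m x \<le> g (y k) + L * (\<Sum>i\<in>I. \<bar>x i - y k i\<bar>)"
  by (induction m) (auto simp: le_Suc_eq min_le_iff_disj)

lemma cone_min_ge: "lip_on I L g \<Longrightarrow> g x \<le> cone_min I L g y m x"
proof (induction m)
  case 0
  then show ?case using lip_onD[of I L g x "y 0"] by auto
next
  case (Suc m)
  then show ?case using lip_onD[of I L g x "y (Suc m)"] by auto
qed

lemma dense_sequence: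
  assumes "finite (I :: nat set)"
  obtains y :: "nat \<Rightarrow> nat \<Rightarrow> real" where "\<And>x e. 0 < e \<Longrightarrow> \<exists>k. (\<Sum>i\<in>I. \<bar>x i - y k i\<bar>) < e"
proof -
  define D where "D = (\<Pi>\<^sub>E i\<in>I. \<rat> :: real set)"
  have D: "countable D" "D \<noteq> {}" using assms countable_PiE[of I "\<lambda>_. \<rat>"] Rats_0 by (auto simp: D_def countable_rat PiE_eq_empty_iff)
  show ?thesis
  proof (rule that[of "from_nat_into D"])
    fix x :: "nat \<Rightarrow> real" and e :: real assume e: "0 < e"
    \<comment> \<open>The added 1 makes the denominator positive for empty \<open>I\<close> and the
      final estimate strict.\<close>
    define d where "d = e / (real (card I) + 1)"
    have d: "0 < d" using e by (simp add: d_def)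
    have "\<exists>q. q \<in> \<rat> \<and> \<bar>x i - q\<bar> < d" for i
      using Rats_dense_in_real[of "x i" "x i + d"] d by (metis abs_minus_commute abs_of_pos add_diff_cancel_left' diff_gt_0_iff_gt diff_less_eq add.commute)
    then obtain q where q: "\<And>i. q i \<in> \<rat> \<and> \<bar>x i - q i\<bar> < d" by metis
    define z where "z = restrict q I"
    have "z \<in> D" using q by (auto simp: z_def D_def)
    then obtain k where k: "from_nat_into D k = z" using D by (metis from_nat_into_surj)
    have "(\<Sum>i\<in>I. \<bar>x i - z i\<bar>) \<le> (\<Sum>i\<in>I. d)" by (intro sum_mono) (use q in \<open>auto simp: z_def less_imp_le\<close>)
    also have "\<dots> = real (card I) * d" by simp
    also have "\<dots> < (real (card I) + 1) * d" using d by (simp add: ring_distribs)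
    also have "\<dots> = e" by (simp add: d_def)
    finally show "\<exists>k. (\<Sum>i\<in>I. \<bar>x i - from_nat_into D k i\<bar>) < e" using k by blast
  qed
qed

text \<open>The minimum never falls below \<open>g\<close>. Once a sample \<open>y k\<close> closer
  than \<open>d\<close> to \<open>x\<close> has entered, its cone exceeds \<open>g x\<close> by at
  most 2 \<bar>L\<bar> d: once for the change of \<open>g\<close>, once for the height of the
  cone.\<close>

lemma cone_min_tendsto:
  assumes g: "lip_on I L g" and y: "\<And>x e. 0 < e \<Longrightarrow> \<exists>k. (\<Sum>i\<in>I. \<bar>x i - y k i\<bar>) < e"
  shows "(\<lambda>m. cone_min I L g y m x) \<longlonglongrightarrow> g x"
proof (rule LIMSEQ_I)
  fix e :: real assume e: "0 < e"
  define d where "d = e / (2 * \<bar>L\<bar> + 1)"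
  have d: "0 < d" "(2 * \<bar>L\<bar>) * d < e" using e by (auto simp: d_def field_simps)
  obtain k where k: "(\<Sum>i\<in>I. \<bar>x i - y k i\<bar>) < d" using y d by blast
  have "norm (cone_min I L g y m x - g x) < e" if "k \<le> m" for m
  proof -
    have "cone_min I L g y m x - g x \<le> \<bar>g x - g (y k)\<bar> + L * (\<Sum>i\<in>I. \<bar>x i - y k i\<bar>)"
      using cone_min_le[OF that, of I L g y x] by linarith
    also have "\<dots> \<le> (2 * L) * (\<Sum>i\<in>I. \<bar>x i - y k i\<bar>)" using lip_onD[OF g, of x "y k"] by linarith
    also have "\<dots> \<le> (2 * \<bar>L\<bar>) * (\<Sum>i\<in>I. \<bar>x i - y k i\<bar>)" by (intro mult_right_mono sum_nonneg) auto
    also have "\<dots> \<le> (2 * \<bar>L\<bar>) * d" by (intro mult_left_mono) (use k in auto)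
    also note d(2)
    finally show ?thesis using cone_min_ge[OF g, of x y m] by simp
  qed
  then show "\<exists>no. \<forall>m\<ge>no. norm (cone_min I L g y m x - g x) < e" by blast
qed

text \<open>Minima of cones are built from the coordinates by sums and minima, and measurability
  passes to their limit. Only the coordinates of \<phi> are assumed measurable, so that arguments
  outside the extensional product space are covered too.\<close>

lemma lip_on_measurable:
  assumes "finite I" and g: "lip_on I L g" and \<phi>: "\<And>i. i \<in> I \<Longrightarrow> (\<lambda>w. \<phi> w i) \<in> borel_measurable M"
  shows "(\<lambda>w. g (\<phi> w)) \<in> borel_measurable M"
proof -
  obtain y :: "nat \<Rightarrow> nat \<Rightarrow> real" where y: "\<And>x e. 0 < e \<Longrightarrow> \<exists>k. (\<Sum>i\<in>I. \<bar>x i - y k i\<bar>) < e"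
    using dense_sequence[OF \<open>finite I\<close>] by blast
  show ?thesis
  proof (rule borel_measurable_LIMSEQ_real)
    show "(\<lambda>m. cone_min I L g y m (\<phi> w)) \<longlonglongrightarrow> g (\<phi> w)" for w by (rule cone_min_tendsto[OF g y])
    show "(\<lambda>w. cone_min I L g y m (\<phi> w)) \<in> borel_measurable M" for m
      using \<phi> by (induction m) (simp_all add: borel_measurable_sum borel_measurable_min)
  qed
qed

section \<open>Directional derivatives and their existence almost everywhere\<close>

text \<open>The limit runs over the increments 1/(m + 1) only and is 0 where it fails. This gives a
  function that is measurable and bounded everywhere, and it equals the two-sided derivative
  wherever that exists (\<open>has_dird_imp_dird\<close>).\<close>

definition dird :: "((nat \<Rightarrow> real) \<Rightarrow> real) \<Rightarrow> (nat \<Rightarrow> real) \<Rightarrow> (nat \<Rightarrow> real) \<Rightarrow> real" where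
  "dird g v x = (let q = (\<lambda>m. (g (\<lambda>i. x i + 1 / real (Suc m) * v i) - g x) / (1 / real (Suc m))) in if convergent q then lim q else 0)"

definition has_dird :: "((nat \<Rightarrow> real) \<Rightarrow> real) \<Rightarrow> (nat \<Rightarrow> real) \<Rightarrow> (nat \<Rightarrow> real) \<Rightarrow> real \<Rightarrow> bool" where
  "has_dird g v x l \<longleftrightarrow> ((\<lambda>t. (g (\<lambda>i. x i + t * v i) - g x) / t) \<longlongrightarrow> l) (at 0)"

lemma quotient_bound:
  assumes "lip_on I L g"
  shows "\<bar>(g (\<lambda>i. x i + t * v i) - g x) / t\<bar> \<le> L * (\<Sum>i\<in>I. \<bar>v i\<bar>)"
proof (cases "t = 0")
  case True
  have "0 \<le> \<bar>g v - g (\<lambda>_. 0)\<bar>" by simp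
  also have "\<dots> \<le> L * (\<Sum>i\<in>I. \<bar>v i\<bar>)" using lip_onD[OF assms, of v "\<lambda>_. 0"] by simp
  finally show ?thesis using True by simp
next
  case False
  have "\<bar>g (\<lambda>i. x i + t * v i) - g x\<bar> \<le> L * (\<Sum>i\<in>I. \<bar>t\<bar> * \<bar>v i\<bar>)"
    using lip_onD[OF assms, of "\<lambda>i. x i + t * v i" x] by (simp add: abs_mult)
  then show ?thesis using False by (simp add: abs_divide divide_le_eq sum_distrib_left[symmetric] mult_ac)
qed

lemma inverse_Suc_at_0: "filterlim (\<lambda>m. 1 / real (Suc m)) (at 0) sequentially"
  unfolding filterlim_at using LIMSEQ_inverse_real_of_nat by (simp add: inverse_eq_divide)

lemma dird_seq:
  assumes "has_dird g v x l"
  shows "(\<lambda>m. (g (\<lambda>i. x i + 1 / real (Suc m) * v i) - g x) / (1 / real (Suc m))) \<longlonglongrightarrow> l"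
  using filterlim_compose[OF assms[unfolded has_dird_def] inverse_Suc_at_0] .

lemma has_dird_imp_dird: "has_dird g v x l \<Longrightarrow> dird g v x = l"
  using dird_seq[of g v x l] unfolding dird_def Let_def by (auto simp: convergent_def limI)

lemma dird_bound:
  assumes "lip_on I L g"
  shows "\<bar>dird g v x\<bar> \<le> L * (\<Sum>i\<in>I. \<bar>v i\<bar>)"
proof -
  let ?q = "\<lambda>m. (g (\<lambda>i. x i + 1 / real (Suc m) * v i) - g x) / (1 / real (Suc m))"
  have b: "\<bar>?q m\<bar> \<le> L * (\<Sum>i\<in>I. \<bar>v i\<bar>)" for m by (rule quotient_bound[OF assms])
  show ?thesis
  proof (cases "convergent ?q")
    case True
    then have "?q \<longlonglongrightarrow> lim ?q" by (simp only: convergent_LIMSEQ_iff)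
    then have "(\<lambda>m. \<bar>?q m\<bar>) \<longlonglongrightarrow> \<bar>lim ?q\<bar>" by (rule tendsto_rabs)
    then have "\<bar>lim ?q\<bar> \<le> L * (\<Sum>i\<in>I. \<bar>v i\<bar>)" by (rule LIMSEQ_le_const2) (use b in blast)
    then show ?thesis using True by (simp only: dird_def Let_def if_True)
  next
    case False
    then show ?thesis using order_trans[OF abs_ge_zero b[of 0]] by (simp only: dird_def Let_def if_False abs_zero)
  qed
qed

lemma dird_measurable:
  assumes "finite I" "lip_on I L g"
  shows "dird g v \<in> borel_measurable (leb I)"
proof -
  have [measurable]: "g \<in> borel_measurable (leb I)" by (rule lip_on_measurable[OF assms]) simp
  have [measurable]: "(\<lambda>x. g (\<lambda>i. x i + c * v i)) \<in> borel_measurable (leb I)" for c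
    by (rule lip_on_measurable[OF assms]) simp
  let ?q = "\<lambda>m x. (g (\<lambda>i. x i + 1 / real (Suc m) * v i) - g x) / (1 / real (Suc m))"
  have q[measurable]: "?q m \<in> borel_measurable (leb I)" for m by measurable
  have "Measurable.pred (leb I) (\<lambda>x. convergent (\<lambda>m. ?q m x))"
    unfolding Cauchy_convergent_iff[symmetric] Cauchy_iff2 by measurable
  moreover have "(\<lambda>x. lim (\<lambda>m. ?q m x)) \<in> borel_measurable (leb I)" by (rule borel_measurable_lim_metric[OF q])
  ultimately show ?thesis unfolding dird_def Let_def by (intro measurable_If) (simp_all add: pred_def)
qed

lemma translation_leb:
  assumes "finite I"
  shows "distr (leb I) (leb I) (\<lambda>x. \<lambda>i\<in>I. x i + c i) = leb I"
proof (rule lborel_prod.PiM_eqI)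
  have meas: "(\<lambda>x. \<lambda>i\<in>I. x i + c i) \<in> measurable (leb I) (leb I)" by measurable
  fix A :: "nat \<Rightarrow> real set" assume A: "\<And>i. i \<in> I \<Longrightarrow> A i \<in> sets lborel"
  have t: "(\<lambda>t. t + c i) -` A i \<in> sets lborel" if "i \<in> I" for i
    using measurable_sets[of "\<lambda>t. t + c i" lborel lborel "A i"] A that by simp
  have "emeasure (distr (leb I) (leb I) (\<lambda>x. \<lambda>i\<in>I. x i + c i)) (Pi\<^sub>E I A) =
    emeasure (leb I) ((\<lambda>x. \<lambda>i\<in>I. x i + c i) -` Pi\<^sub>E I A \<inter> space (leb I))"
    using A assms by (intro emeasure_distr meas sets_PiM_I_finite) auto
  also have "(\<lambda>x. \<lambda>i\<in>I. x i + c i) -` Pi\<^sub>E I A \<inter> space (leb I) = (\<Pi>\<^sub>E i\<in>I. (\<lambda>t. t + c i) -` A i)"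
    by (auto simp: space_PiM PiE_def Pi_def extensional_def)
  also have "emeasure (leb I) \<dots> = (\<Prod>i\<in>I. emeasure lborel ((\<lambda>t. t + c i) -` A i))"
    using assms t by (rule lborel_prod.emeasure_PiM)
  also have "\<dots> = (\<Prod>i\<in>I. emeasure lborel (A i))"
  proof (rule prod.cong[OF refl])
    fix i assume i: "i \<in> I"
    have "emeasure lborel (A i) = emeasure (distr lborel borel ((+) (c i))) (A i)" by (simp add: lborel_distr_plus)
    also have "\<dots> = emeasure lborel ((+) (c i) -` A i \<inter> space lborel)" using A[OF i] by (intro emeasure_distr) auto
    finally show "emeasure lborel ((\<lambda>t. t + c i) -` A i) = emeasure lborel (A i)" by (simp add: add.commute vimage_def)
  qed
  finally show "emeasure (distr (leb I) (leb I) (\<lambda>x. \<lambda>i\<in>I. x i + c i)) (Pi\<^sub>E I A) = (\<Prod>i\<in>I. emeasure lborel (A i))" .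
qed (use assms in auto)


lemma lip_line:
  assumes "lip_on I L g"
  shows "\<bar>g (\<lambda>i. x i + s * v i) - g (\<lambda>i. x i + t * v i)\<bar> \<le> L * (\<Sum>i\<in>I. \<bar>v i\<bar>) * \<bar>s - t\<bar>"
proof -
  have "\<bar>g (\<lambda>i. x i + s * v i) - g (\<lambda>i. x i + t * v i)\<bar> \<le> L * (\<Sum>i\<in>I. \<bar>s - t\<bar> * \<bar>v i\<bar>)"
    using lip_onD[OF assms, of "\<lambda>i. x i + s * v i" "\<lambda>i. x i + t * v i"]
    by (simp add: abs_mult[symmetric] algebra_simps)
  then show ?thesis unfolding sum_distrib_left[symmetric] by (simp only: mult_ac)
qed

text \<open>On each line in direction \<open>v\<close> the function is Lipschitz in one variable, so
  the exceptional set meets the line in a null set. Averaging the translates of this set along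
  \<open>v\<close> over parameters in [0,1] and exchanging the integrals shows that the set is null,
  without coordinates adapted to \<open>v\<close>.\<close>

lemma dird_exists_ae:
  assumes "finite I" and g: "lip_on I L g"
  shows "AE x in leb I. \<exists>l. has_dird g v x l"
proof -
  define q where "q x t = (g (\<lambda>i. x i + t * v i) - g x) / t" for x t
  define osc where "osc x S d e \<longleftrightarrow> (\<forall>s\<in>S. \<forall>t\<in>S. s \<noteq> 0 \<and> t \<noteq> 0 \<and> \<bar>s\<bar> < d \<and> \<bar>t\<bar> < d \<longrightarrow> \<bar>q x s - q x t\<bar> \<le> e)"
    for x S and d e :: real
  \<comment> \<open>Cauchy's criterion for the quotients as the increment tends to 0, tested on
    rational increments. That makes the good set measurable; continuity of the quotients away from 0
    extends it to all increments.\<close>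
  define good where "good x \<longleftrightarrow> (\<forall>k::nat. \<exists>d::nat. osc x \<rat> (1 / Suc d) (1 / Suc k))" for x
  have [measurable]: "g \<in> borel_measurable (leb I)" by (rule lip_on_measurable[OF assms]) simp
  have [measurable]: "(\<lambda>x. g (\<lambda>i. x i + c * v i)) \<in> borel_measurable (leb I)" for c
    by (rule lip_on_measurable[OF assms]) simp
  have [measurable]: "(\<lambda>x. q x t) \<in> borel_measurable (leb I)" for t unfolding q_def by measurable
  have [measurable]: "Measurable.pred (leb I) (\<lambda>x. osc x \<rat> d e)" for d e
  proof -
    have "osc x \<rat> d e \<longleftrightarrow> (\<forall>s t :: rat. of_rat s \<noteq> (0::real) \<and> of_rat t \<noteq> (0::real) \<and> \<bar>of_rat s\<bar> < d \<and> \<bar>of_rat t\<bar> < d \<longrightarrow>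
        \<bar>q x (of_rat s) - q x (of_rat t)\<bar> \<le> e)" for x
      unfolding osc_def Rats_def by simp
    then show ?thesis by simp
  qed
  have gm[measurable]: "Measurable.pred (leb I) good" unfolding good_def by measurable
  have qc: "isCont (q x) t" if "t \<noteq> 0" for x t
  proof -
    have "continuous_on UNIV (\<lambda>t. g (\<lambda>i. x i + t * v i))"
    proof (rule lipschitz_on_continuous_on)
      have "0 \<le> L * (\<Sum>i\<in>I. \<bar>v i\<bar>)" using quotient_bound[OF g, of undefined 0] by (meson abs_ge_zero order_trans)
      then show "(L * (\<Sum>i\<in>I. \<bar>v i\<bar>))-lipschitz_on UNIV (\<lambda>t. g (\<lambda>i. x i + t * v i))"
        using lip_line[OF g] by (auto simp: lipschitz_on_def dist_real_def)
    qed
    then have "isCont (\<lambda>t. g (\<lambda>i. x i + t * v i)) t" by (simp add: continuous_on_eq_continuous_at)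
    then show ?thesis unfolding q_def using that by (intro continuous_intros) auto
  qed
  have osc_all: "osc x UNIV d e" if o: "osc x \<rat> d e" for x d e
    unfolding osc_def
  proof (intro ballI impI)
    fix s t :: real assume st: "s \<noteq> 0 \<and> t \<noteq> 0 \<and> \<bar>s\<bar> < d \<and> \<bar>t\<bar> < d"
    have near: "\<exists>r\<in>\<rat>. r \<noteq> 0 \<and> \<bar>r\<bar> < d \<and> \<bar>q x r - q x s\<bar> < \<eta>" if s: "s \<noteq> 0" "\<bar>s\<bar> < d" and \<eta>: "0 < \<eta>" for s \<eta>
    proof -
      obtain \<delta> where \<delta>: "0 < \<delta>" "\<And>r. \<bar>r - s\<bar> < \<delta> \<Longrightarrow> \<bar>q x r - q x s\<bar> < \<eta>"
        using qc[OF s(1), of x] \<eta> unfolding continuous_at_eps_delta dist_real_def by blast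
      \<comment> \<open>The three terms keep the quotients close, the rational increment away from
        0, and its absolute value below \<open>d\<close>.\<close>
      define \<rho> where "\<rho> = Min {\<delta>, \<bar>s\<bar>, d - \<bar>s\<bar>}"
      have \<rho>: "0 < \<rho>" "\<rho> \<le> \<delta>" "\<rho> \<le> \<bar>s\<bar>" "\<rho> \<le> d - \<bar>s\<bar>" using s \<delta> by (auto simp: \<rho>_def)
      obtain r where r: "r \<in> \<rat>" "s < r" "r < s + \<rho>" using Rats_dense_in_real[of s "s + \<rho>"] \<rho> by auto
      then have "r \<noteq> 0" "\<bar>r\<bar> < d" "\<bar>r - s\<bar> < \<delta>" using \<rho> s by linarith+
      then show ?thesis using r \<delta>(2) by blast
    qed
    show "\<bar>q x s - q x t\<bar> \<le> e"
    proof (rule field_le_epsilon)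
      fix \<eta> :: real assume "0 < \<eta>"
      then have "0 < \<eta> / 2" by simp
      obtain s' where s': "s' \<in> \<rat>" "s' \<noteq> 0" "\<bar>s'\<bar> < d" "\<bar>q x s' - q x s\<bar> < \<eta> / 2" using near[OF _ _ \<open>0 < \<eta> / 2\<close>] st by blast
      obtain t' where t': "t' \<in> \<rat>" "t' \<noteq> 0" "\<bar>t'\<bar> < d" "\<bar>q x t' - q x t\<bar> < \<eta> / 2" using near[OF _ _ \<open>0 < \<eta> / 2\<close>] st by blast
      have "\<bar>q x s' - q x t'\<bar> \<le> e" using o s' t' unfolding osc_def by blast
      then show "\<bar>q x s - q x t\<bar> \<le> e + \<eta>" using s'(4) t'(4) by linarith
    qed
  qed
  have good_ex: "\<exists>l. has_dird g v x l" if "good x" for x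
  proof -
    have G: "\<exists>d::nat. osc x UNIV (1 / Suc d) (1 / Suc k)" for k :: nat
      using that osc_all unfolding good_def by blast
    have fin: "\<exists>N. \<forall>m\<ge>N. 1 / real (Suc m) < 1 / real (Suc d)" for d
      by (intro exI[of _ "Suc d"]) (auto simp: field_simps)
    have "Cauchy (\<lambda>m. q x (1 / real (Suc m)))"
      unfolding Cauchy_iff2
    proof
      fix k
      obtain d :: nat where d: "osc x UNIV (1 / Suc d) (1 / Suc (Suc k))" using G by blast
      have lt: "1 / real (Suc (Suc k)) < inverse (real (Suc k))" by (simp add: field_simps)
      have "\<bar>q x (1 / real (Suc m)) - q x (1 / real (Suc n))\<bar> < inverse (real (Suc k))" if "Suc d \<le> m" "Suc d \<le> n" for m n
      proof -
        have "\<bar>1 / real (Suc m)\<bar> < 1 / real (Suc d)" "\<bar>1 / real (Suc n)\<bar> < 1 / real (Suc d)" using that by (auto simp: field_simps)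
        moreover have "1 / real (Suc m) \<noteq> 0" "1 / real (Suc n) \<noteq> 0" by auto
        ultimately have "\<bar>q x (1 / real (Suc m)) - q x (1 / real (Suc n))\<bar> \<le> 1 / Suc (Suc k)"
          using d[unfolded osc_def, rule_format, OF UNIV_I UNIV_I] by blast
        then show ?thesis using lt by simp
      qed
      then show "\<exists>M. \<forall>m\<ge>M. \<forall>n\<ge>M. \<bar>q x (1 / real (Suc m)) - q x (1 / real (Suc n))\<bar> < inverse (real (Suc k))" by blast
    qed
    then obtain l where l: "(\<lambda>m. q x (1 / real (Suc m))) \<longlonglongrightarrow> l" using Cauchy_convergent convergent_def by blast
    have "(q x \<longlongrightarrow> l) (at 0)"
    proof (rule LIM_I)
      fix r :: real assume "0 < r"
      then obtain k where k: "1 / real (Suc k) < r" using reals_Archimedean by (auto simp: inverse_eq_divide)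
      obtain d :: nat where d: "osc x UNIV (1 / Suc d) (1 / Suc k)" using G by blast
      have "norm (q x t - l) < r" if t: "t \<noteq> 0" "\<bar>t\<bar> < 1 / Suc d" for t
      proof -
        have "(\<lambda>m. \<bar>q x t - q x (1 / real (Suc m))\<bar>) \<longlonglongrightarrow> \<bar>q x t - l\<bar>" by (intro tendsto_intros l)
        moreover have "\<forall>m\<ge>Suc d. \<bar>q x t - q x (1 / real (Suc m))\<bar> \<le> 1 / Suc k"
        proof (intro allI impI)
          fix m assume "Suc d \<le> m"
          then have "\<bar>1 / real (Suc m)\<bar> < 1 / real (Suc d)" by (auto simp: field_simps)
          moreover have "1 / real (Suc m) \<noteq> 0" by auto
          ultimately show "\<bar>q x t - q x (1 / real (Suc m))\<bar> \<le> 1 / Suc k" using d t unfolding osc_def by blast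
        qed
        ultimately have "\<bar>q x t - l\<bar> \<le> 1 / Suc k" by (intro LIMSEQ_le_const2) auto
        then show ?thesis using k by simp
      qed
      then show "\<exists>s>0. \<forall>t. t \<noteq> 0 \<and> norm (t - 0) < s \<longrightarrow> norm (q x t - l) < r"
        by (intro exI[of _ "1 / Suc d"]) auto
    qed
    then show ?thesis unfolding has_dird_def q_def by blast
  qed
  have ex_good: "good x" if "(q x \<longlongrightarrow> l) (at 0)" for x l
    unfolding good_def
  proof
    fix k :: nat
    have "0 < 1 / real (Suc k) / 2" by simp
    from LIM_D[OF that this] obtain r where r: "0 < r" "\<And>t. t \<noteq> 0 \<Longrightarrow> \<bar>t\<bar> < r \<Longrightarrow> \<bar>q x t - l\<bar> < 1 / Suc k / 2"
      by auto
    obtain d where d: "1 / real (Suc d) < r" using reals_Archimedean[OF r(1)] by (auto simp: inverse_eq_divide)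
    have "osc x \<rat> (1 / Suc d) (1 / Suc k)" unfolding osc_def
    proof (intro ballI impI)
      fix s t assume "s \<noteq> 0 \<and> t \<noteq> 0 \<and> \<bar>s\<bar> < 1 / real (Suc d) \<and> \<bar>t\<bar> < 1 / real (Suc d)"
      then have "\<bar>q x s - l\<bar> < 1 / Suc k / 2" "\<bar>q x t - l\<bar> < 1 / Suc k / 2" using d r(2) by auto
      from add_strict_mono[OF this] have "\<bar>q x s - l\<bar> + \<bar>q x t - l\<bar> < 1 / real (Suc k)"
        unfolding field_sum_of_halves .
      moreover have "\<bar>q x s - q x t\<bar> \<le> \<bar>q x s - l\<bar> + \<bar>q x t - l\<bar>" by linarith
      ultimately show "\<bar>q x s - q x t\<bar> \<le> 1 / real (Suc k)" by simp
    qed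
    then show "\<exists>d. osc x \<rat> (1 / real (Suc d)) (1 / real (Suc k))" ..
  qed
  define N where "N = {x \<in> space (leb I). \<not> good x}"
  have N[measurable]: "N \<in> sets (leb I)" unfolding N_def by measurable
  define tr where "tr \<tau> x = (\<lambda>i\<in>I. x i + \<tau> * v i)" for \<tau> x
  have line: "AE \<tau> in lborel. tr \<tau> x \<notin> N" for x
  proof -
    have "negligible {\<tau>. \<not> (\<exists>l. ((\<lambda>t. (g (\<lambda>i. x i + (\<tau> + t) * v i) - g (\<lambda>i. x i + \<tau> * v i)) / t) \<longlongrightarrow> l) (at 0))}"
      by (rule Lipschitz_differentiable_ae[where f = "\<lambda>\<tau>. g (\<lambda>i. x i + \<tau> * v i)", OF lip_line[OF g]])
    then have "AE \<tau> in lebesgue. \<exists>l. ((\<lambda>t. (g (\<lambda>i. x i + (\<tau> + t) * v i) - g (\<lambda>i. x i + \<tau> * v i)) / t) \<longlongrightarrow> l) (at 0)"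
      by (simp add: negligible_iff_null_sets AE_iff_null_sets[symmetric] eventually_ae_filter) (rule bexI, rule order_refl, simp)
    then have "AE \<tau> in lborel. \<exists>l. ((\<lambda>t. (g (\<lambda>i. x i + (\<tau> + t) * v i) - g (\<lambda>i. x i + \<tau> * v i)) / t) \<longlongrightarrow> l) (at 0)"
      by (simp add: AE_completion_iff)
    then show ?thesis
    proof (rule AE_mp, intro AE_I2 impI)
      fix \<tau> assume "\<exists>l. ((\<lambda>t. (g (\<lambda>i. x i + (\<tau> + t) * v i) - g (\<lambda>i. x i + \<tau> * v i)) / t) \<longlongrightarrow> l) (at 0)"
      moreover have "q (tr \<tau> x) t = (g (\<lambda>i. x i + (\<tau> + t) * v i) - g (\<lambda>i. x i + \<tau> * v i)) / t" for t
      proof -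
        have "g (\<lambda>i. tr \<tau> x i + t * v i) = g (\<lambda>i. x i + (\<tau> + t) * v i)"
          by (rule lip_on_cong[OF g]) (simp add: tr_def algebra_simps)
        moreover have "g (tr \<tau> x) = g (\<lambda>i. x i + \<tau> * v i)"
          by (rule lip_on_cong[OF g]) (simp add: tr_def)
        ultimately show ?thesis by (simp add: q_def)
      qed
      then have "q (tr \<tau> x) = (\<lambda>t. (g (\<lambda>i. x i + (\<tau> + t) * v i) - g (\<lambda>i. x i + \<tau> * v i)) / t)" ..
      ultimately have "good (tr \<tau> x)" using ex_good[of "tr \<tau> x"] by (simp only:) blast
      then show "tr \<tau> x \<notin> N" by (simp add: N_def)
    qed
  qed
  have trm[measurable]: "(\<lambda>(x, \<tau>). tr \<tau> x) \<in> measurable (leb I \<Otimes>\<^sub>M lborel) (leb I)"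
    unfolding tr_def by measurable
  interpret P: pair_sigma_finite "leb I" lborel
    by (intro pair_sigma_finite.intro lborel_prod.sigma_finite lborel.sigma_finite_measure_axioms assms)
  have inv: "emeasure (leb I) N = (\<integral>\<^sup>+x. indicator N (tr \<tau> x) \<partial>leb I)" for \<tau>
  proof -
    have "emeasure (leb I) N = (\<integral>\<^sup>+x. indicator N x \<partial>distr (leb I) (leb I) (tr \<tau>))"
      unfolding tr_def translation_leb[OF \<open>finite I\<close>] by simp
    also have "\<dots> = (\<integral>\<^sup>+x. indicator N (tr \<tau> x) \<partial>leb I)"
      by (rule nn_integral_distr) (simp_all add: tr_def)
    finally show ?thesis .
  qed
  \<comment> \<open>The indicator of {0..1} has integral 1. It brings in the translation parameter
    without changing the value, and translation invariance holds for each parameter.\<close>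
  have "emeasure (leb I) N = (\<integral>\<^sup>+\<tau>. emeasure (leb I) N * indicator {0..1::real} \<tau> \<partial>lborel)"
    by (simp add: nn_integral_cmult)
  also have "\<dots> = (\<integral>\<^sup>+\<tau>. (\<integral>\<^sup>+x. indicator N (tr \<tau> x) * indicator {0..1::real} \<tau> \<partial>leb I) \<partial>lborel)"
    by (intro nn_integral_cong) (subst inv, simp add: nn_integral_multc tr_def)
  also have "\<dots> = (\<integral>\<^sup>+x. (\<integral>\<^sup>+\<tau>. indicator N (tr \<tau> x) * indicator {0..1::real} \<tau> \<partial>lborel) \<partial>leb I)"
    by (rule P.Fubini') measurable
  also have "\<dots> = (\<integral>\<^sup>+x. 0 \<partial>leb I)"
  proof (rule nn_integral_cong)
    fix x
    have "AE \<tau> in lborel. indicator N (tr \<tau> x) * indicator {0..1::real} \<tau> = (0::ennreal)"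
      using line[of x] by eventually_elim simp
    then show "(\<integral>\<^sup>+\<tau>. indicator N (tr \<tau> x) * indicator {0..1::real} \<tau> \<partial>lborel) = 0"
      using nn_integral_cong_AE[of "\<lambda>\<tau>. indicator N (tr \<tau> x) * indicator {0..1::real} \<tau>" "\<lambda>_. 0" lborel] by simp
  qed
  finally have "N \<in> null_sets (leb I)" using N by auto
  then have "AE x in leb I. x \<notin> N" by (rule AE_not_in)
  then show ?thesis
  proof (rule AE_mp, intro AE_I2 impI)
    fix x assume "x \<in> space (leb I)" "x \<notin> N"
    then show "\<exists>l. has_dird g v x l" using good_ex by (simp add: N_def)
  qed
qed

section \<open>Weak convergence tested on boxes\<close>

abbreviation Ioc_box :: "nat set \<Rightarrow> (nat \<Rightarrow> real) \<Rightarrow> (nat \<Rightarrow> real) \<Rightarrow> (nat \<Rightarrow> real) set" where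
  "Ioc_box I a b \<equiv> Pi\<^sub>E I (\<lambda>i. {a i<..b i})"

text \<open>Half-open boxes are stable under intersection and generate the product algebra, the two
  facts on which Dynkin's argument in \<open>weak_null_sequence\<close> rests.\<close>

lemma sets_leb_Ioc:
  assumes "finite I"
  shows "sets (leb I) = sigma_sets (space (leb I)) (range (\<lambda>(a, b). Ioc_box I a b))"
proof -
  let ?E = "range (\<lambda>(a, b). {a<..b::real})"
  have cover: "\<exists>S\<subseteq>?E. countable S \<and> UNIV = \<Union>S"
  proof (intro exI conjI)
    show "range (\<lambda>n. {- real n<..real n}) \<subseteq> ?E" by auto
    show "UNIV = \<Union> (range (\<lambda>n. {- real n<..real n}))"
    proof -
      have "\<exists>n. - real n < x \<and> x \<le> real n" for x :: real
        using reals_Archimedean2[of "\<bar>x\<bar>"] by (metis abs_less_iff less_imp_le minus_less_iff)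
      then show ?thesis by auto
    qed
  qed auto
  have "sets (leb I) = sets (\<Pi>\<^sub>M i\<in>I. sigma UNIV ?E)"
    by (rule sets_PiM_cong) (simp_all add: borel_sigma_sets_Ioc[symmetric])
  also have "\<dots> = sets (sigma (\<Pi>\<^sub>E i\<in>I. UNIV) {{f \<in> \<Pi>\<^sub>E i\<in>I. UNIV. \<forall>i\<in>j. f i \<in> A i} |A j. j \<in> {I} \<and> A \<in> Pi j (\<lambda>_. ?E)})"
    by (rule sets_PiM_sigma) (use cover assms in auto)
  also have "{{f \<in> \<Pi>\<^sub>E i\<in>I. UNIV. \<forall>i\<in>j. f i \<in> A i} |A j. j \<in> {I} \<and> A \<in> Pi j (\<lambda>_. ?E)} = range (\<lambda>(a, b). Ioc_box I a b)"
    (is "?L = ?R")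
  proof (intro equalityI subsetI)
    fix B assume "B \<in> ?L"
    then obtain A where B: "B = {f \<in> \<Pi>\<^sub>E i\<in>I. UNIV. \<forall>i\<in>I. f i \<in> A i}" and A: "A \<in> Pi I (\<lambda>_. ?E)" by auto
    have "\<forall>i\<in>I. \<exists>p. A i = {fst p<..snd p}" using A by (force simp: Pi_def)
    then obtain p where p: "\<And>i. i \<in> I \<Longrightarrow> A i = {fst (p i)<..snd (p i)}" by metis
    have "B = Ioc_box I (\<lambda>i. fst (p i)) (\<lambda>i. snd (p i))" unfolding B using p by (auto simp: PiE_def Pi_def)
    then show "B \<in> ?R" by (intro image_eqI[of _ _ "(\<lambda>i. fst (p i), \<lambda>i. snd (p i))"]) auto
  next
    fix B assume "B \<in> ?R"
    then obtain a b where B: "B = Ioc_box I a b" by auto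
    show "B \<in> ?L" unfolding B
      by (intro CollectI exI[of _ "\<lambda>i. {a i<..b i}"] exI[of _ I]) (auto simp: PiE_def Pi_def)
  qed
  also have "sets (sigma (\<Pi>\<^sub>E i\<in>I. UNIV) ?R) = sigma_sets (space (leb I)) ?R"
    by (subst sets_measure_of) (auto simp: space_PiM PiE_def)
  finally show ?thesis .
qed

lemma emeasure_Ioc_box_finite: "finite I \<Longrightarrow> emeasure (leb I) (Ioc_box I a b) < \<infinity>"
proof -
  assume "finite I"
  have "emeasure lborel {u<..v} \<noteq> \<infinity>" for u v :: real by (cases "u \<le> v") auto
  then show ?thesis using \<open>finite I\<close>
    by (subst lborel_prod.emeasure_PiM) (auto simp: ennreal_prod_eq_top less_top[symmetric])
qed

context
  fixes I :: "nat set" and h :: "nat \<Rightarrow> (nat \<Rightarrow> real) \<Rightarrow> real" and c :: real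
  assumes fin: "finite I" and hm: "\<And>m. h m \<in> borel_measurable (leb I)" and hb: "\<And>m x. \<bar>h m x\<bar> \<le> c"
begin

text \<open>The test functions for which convergence holds. They form a vector space closed under
  dominated limits, so it is enough to place the boxes in it.\<close>

private definition W :: "((nat \<Rightarrow> real) \<Rightarrow> real) \<Rightarrow> bool" where
  "W \<phi> \<longleftrightarrow> integrable (leb I) \<phi> \<and> (\<lambda>m. \<integral>x. \<phi> x * h m x \<partial>leb I) \<longlonglongrightarrow> 0"

private lemma W_int: "integrable (leb I) \<phi> \<Longrightarrow> integrable (leb I) (\<lambda>x. \<phi> x * h m x)"
proof (rule Bochner_Integration.integrable_bound[of _ "\<lambda>x. c * \<phi> x"])
  assume "integrable (leb I) \<phi>"
  then show "(\<lambda>x. \<phi> x * h m x) \<in> borel_measurable (leb I)" "integrable (leb I) (\<lambda>x. c * \<phi> x)"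
    using hm by (auto intro: borel_measurable_times)
  have "\<bar>\<phi> x\<bar> * \<bar>h m x\<bar> \<le> \<bar>\<phi> x\<bar> * \<bar>c\<bar>" for x by (intro mult_left_mono order_trans[OF hb]) auto
  then show "AE x in leb I. norm (\<phi> x * h m x) \<le> norm (c * \<phi> x)" by (auto simp: abs_mult mult.commute)
qed

private lemma W_add: "W f \<Longrightarrow> W g \<Longrightarrow> W (\<lambda>x. f x + g x)"
  using tendsto_add[of "\<lambda>m. \<integral>x. f x * h m x \<partial>leb I" 0 _ "\<lambda>m. \<integral>x. g x * h m x \<partial>leb I" 0]
  by (simp add: W_def W_int ring_distribs)

private lemma W_scale: "W f \<Longrightarrow> W (\<lambda>x. k * f x)"
  using tendsto_mult_left[of "\<lambda>m. \<integral>x. f x * h m x \<partial>leb I" 0 _ k]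
  by (simp add: W_def mult.assoc)

private lemma W_diff: "W f \<Longrightarrow> W g \<Longrightarrow> W (\<lambda>x. f x - g x)"
  using W_add[of f "\<lambda>x. (-1) * g x"] W_scale[of g "-1"] by simp

private lemma W_sum: "(\<And>i. i \<in> A \<Longrightarrow> W (f i)) \<Longrightarrow> W (\<lambda>x. \<Sum>i\<in>A. f i x)"
proof (induction A rule: infinite_finite_induct)
  case (insert i A)
  then show ?case using W_add[of "f i"] by simp
qed (simp_all add: W_def)

text \<open>Since all \<open>h m\<close> are bounded by \<open>c\<close>, replacing \<open>f\<close>
  by \<open>\<phi> k\<close> costs at most \<bar>c\<bar> times their L1 distance, uniformly in
  \<open>m\<close>. This uniformity allows the two limits to be exchanged.\<close>

private lemma W_dominated:
  assumes W: "\<And>k. W (\<phi> k)" and lim: "\<And>x. x \<in> space (leb I) \<Longrightarrow> (\<lambda>k. \<phi> k x) \<longlonglongrightarrow> f x"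
    and w: "integrable (leb I) w" and dom: "\<And>k x. x \<in> space (leb I) \<Longrightarrow> \<bar>\<phi> k x\<bar> \<le> w x"
  shows "W f"
proof -
  have i: "integrable (leb I) (\<phi> k)" for k using W by (simp add: W_def)
  have m: "f \<in> borel_measurable (leb I)" by (rule borel_measurable_LIMSEQ_real[OF lim]) (use i in auto)
  have fi: "integrable (leb I) f"
    by (rule integrable_dominated_convergence[where s = \<phi>, OF m _ w]) (use i lim dom in auto)
  have L1: "(\<lambda>k. \<integral>x. \<bar>\<phi> k x - f x\<bar> \<partial>leb I) \<longlonglongrightarrow> (\<integral>x. 0 \<partial>leb I)"
  proof (rule integral_dominated_convergence)
    show "integrable (leb I) (\<lambda>x. w x + \<bar>f x\<bar>)" using w fi by auto
    show "AE x in leb I. (\<lambda>k. \<bar>\<phi> k x - f x\<bar>) \<longlonglongrightarrow> 0"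
    proof (rule AE_I2)
      fix x assume "x \<in> space (leb I)"
      from tendsto_diff[OF lim[OF this] tendsto_const[of "f x"]] show "(\<lambda>k. \<bar>\<phi> k x - f x\<bar>) \<longlonglongrightarrow> 0"
        by (simp add: tendsto_rabs_zero)
    qed
    show "AE x in leb I. norm \<bar>\<phi> k x - f x\<bar> \<le> w x + \<bar>f x\<bar>" for k
    proof (rule AE_I2)
      fix x assume "x \<in> space (leb I)"
      then show "norm \<bar>\<phi> k x - f x\<bar> \<le> w x + \<bar>f x\<bar>" using dom[of x k] by (auto simp: abs_le_iff)
    qed
  qed (use i m in auto)
  have "(\<lambda>m. \<integral>x. f x * h m x \<partial>leb I) \<longlonglongrightarrow> 0"
  proof (rule LIMSEQ_I)
    fix e :: real assume e: "0 < e"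
    define d where "d = e / (2 * (\<bar>c\<bar> + 1))"
    have d: "0 < d" "\<bar>c\<bar> * d \<le> e / 2" using e by (auto simp: d_def field_simps)
    obtain k where k: "(\<integral>x. \<bar>\<phi> k x - f x\<bar> \<partial>leb I) < d"
      using LIMSEQ_D[OF L1 d(1)] by auto
    obtain m0 where m0: "\<And>m. m0 \<le> m \<Longrightarrow> \<bar>\<integral>x. \<phi> k x * h m x \<partial>leb I\<bar> < e / 2"
      using LIMSEQ_D[of "\<lambda>m. \<integral>x. \<phi> k x * h m x \<partial>leb I" 0 "e / 2"] W[of k] e by (auto simp: W_def)
    have "norm ((\<integral>x. f x * h m x \<partial>leb I) - 0) < e" if "m0 \<le> m" for m
    proof -
      have "(\<integral>x. f x * h m x \<partial>leb I) = (\<integral>x. \<phi> k x * h m x \<partial>leb I) - (\<integral>x. (\<phi> k x - f x) * h m x \<partial>leb I)"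
        using W_int[OF fi] W_int[OF i] by (simp add: left_diff_distrib)
      moreover have "\<bar>\<integral>x. (\<phi> k x - f x) * h m x \<partial>leb I\<bar> \<le> (\<integral>x. \<bar>c\<bar> * \<bar>\<phi> k x - f x\<bar> \<partial>leb I)"
      proof (rule order_trans[OF integral_abs_bound integral_mono])
        show "integrable (leb I) (\<lambda>x. \<bar>(\<phi> k x - f x) * h m x\<bar>)" using W_int[of "\<lambda>x. \<phi> k x - f x" m] i fi by auto
        show "integrable (leb I) (\<lambda>x. \<bar>c\<bar> * \<bar>\<phi> k x - f x\<bar>)" using i fi by auto
        show "\<bar>(\<phi> k x - f x) * h m x\<bar> \<le> \<bar>c\<bar> * \<bar>\<phi> k x - f x\<bar>" for x
          using mult_left_mono[OF order_trans[OF hb abs_ge_self[of c]], of "\<bar>\<phi> k x - f x\<bar>" m x] by (simp add: abs_mult mult.commute)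
      qed
      moreover have "(\<integral>x. \<bar>c\<bar> * \<bar>\<phi> k x - f x\<bar> \<partial>leb I) \<le> e / 2"
        using k d mult_left_mono[of "\<integral>x. \<bar>\<phi> k x - f x\<bar> \<partial>leb I" d "\<bar>c\<bar>"] by simp
      ultimately show ?thesis using m0[OF that] by simp
    qed
    then show "\<exists>no. \<forall>m\<ge>no. norm ((\<integral>x. f x * h m x \<partial>leb I) - 0) < e" by blast
  qed
  then show ?thesis using fi by (simp add: W_def)
qed

text \<open>From boxes to measurable subsets of a box by Dynkin's argument, to sets of finite
  measure by exhaustion with growing boxes, and to integrable functions by the standard
  induction.\<close>

lemma weak_null_sequence:
  assumes box: "\<And>a b. (\<lambda>m. \<integral>x. indicator (Ioc_box I a b) x * h m x \<partial>leb I) \<longlonglongrightarrow> 0"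
    and \<phi>: "integrable (leb I) \<phi>"
  shows "(\<lambda>m. \<integral>x. \<phi> x * h m x \<partial>leb I) \<longlonglongrightarrow> 0"
proof -
  have bs[simp]: "Ioc_box I a b \<in> sets (leb I)" for a b using fin by (intro sets_PiM_I_finite) auto
  have bW: "W (indicator (Ioc_box I a b))" for a b
    using box emeasure_Ioc_box_finite[OF fin] bs by (auto simp: W_def intro!: integrable_real_indicator)
  define G where "G = range (\<lambda>(a, b). Ioc_box I a b)"
  have G: "Int_stable G" "G \<subseteq> Pow (space (leb I))"
  proof -
    have "Ioc_box I a b \<inter> Ioc_box I a' b' = Ioc_box I (\<lambda>i. max (a i) (a' i)) (\<lambda>i. min (b i) (b' i))" for a b a' b'
      by (auto simp: PiE_def Pi_def)
    then show "Int_stable G" unfolding Int_stable_def G_def by force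
    show "G \<subseteq> Pow (space (leb I))" by (auto simp: G_def space_PiM PiE_def)
  qed
  \<comment> \<open>The fixed box keeps every indicator integrable, which complements within the
    whole space would violate.\<close>
  have AW: "W (indicator (A \<inter> Ioc_box I a b))" if "A \<in> sets (leb I)" for A a b
    using G that[unfolded sets_leb_Ioc[OF fin] G_def[symmetric]]
  proof (induction rule: sigma_sets_induct_disjoint)
    case (basic A)
    then obtain a' b' where "A = Ioc_box I a' b'" by (auto simp: G_def)
    then have "A \<inter> Ioc_box I a b = Ioc_box I (\<lambda>i. max (a' i) (a i)) (\<lambda>i. min (b' i) (b i))"
      by (auto simp: PiE_def Pi_def)
    then show ?case using bW by simp
  next
    case empty
    then show ?case by (simp add: W_def)
  next
    case (compl A)
    have "(indicator ((space (leb I) - A) \<inter> Ioc_box I a b) :: _ \<Rightarrow> real) =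
      (\<lambda>x. indicator (Ioc_box I a b) x - indicator (A \<inter> Ioc_box I a b) x)"
      by (auto simp: indicator_def fun_eq_iff space_PiM PiE_def)
    then show ?case using W_diff[OF bW compl(2)] by simp
  next
    case (union A)
    show ?case
    proof (rule W_dominated)
      show "W (\<lambda>x. \<Sum>i<k. indicator (A i \<inter> Ioc_box I a b) x)" for k by (rule W_sum) (rule union)
      have *: "(\<Sum>i<k. indicator (A i \<inter> Ioc_box I a b) x) = (indicator ((\<Union>i<k. A i) \<inter> Ioc_box I a b) x :: real)" for k x
      proof -
        have "disjoint_family_on (\<lambda>i. A i \<inter> Ioc_box I a b) {..<k}"
          using union(1) by (auto simp: disjoint_family_on_def)
        from indicator_UN_disjoint[OF _ this, of x]
        have "(indicator (\<Union>i<k. A i \<inter> Ioc_box I a b) x :: real) = (\<Sum>i<k. indicator (A i \<inter> Ioc_box I a b) x)" by simp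
        moreover have "(\<Union>i<k. A i) \<inter> Ioc_box I a b = (\<Union>i<k. A i \<inter> Ioc_box I a b)" by blast
        ultimately show ?thesis by (simp only:)
      qed
      show "(\<lambda>k. \<Sum>i<k. indicator (A i \<inter> Ioc_box I a b) x :: real) \<longlonglongrightarrow> indicator (\<Union> (range A) \<inter> Ioc_box I a b) x" for x
      proof (cases "x \<in> \<Union> (range A)")
        case True
        then obtain n where n: "x \<in> A n" by auto
        then have "(indicator ((\<Union>i<k. A i) \<inter> Ioc_box I a b) x :: real) = indicator (\<Union> (range A) \<inter> Ioc_box I a b) x" if "Suc n \<le> k" for k
          using that by (auto simp: indicator_def)
        then show ?thesis unfolding * by (intro tendsto_eventually eventually_sequentiallyI)
      next
        case False
        then show ?thesis unfolding * by (auto simp: indicator_def)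
      qed
      show "\<bar>\<Sum>i<k. indicator (A i \<inter> Ioc_box I a b) x\<bar> \<le> (indicator (Ioc_box I a b) x :: real)" for k x
        unfolding * by (auto simp: indicator_def)
      show "integrable (leb I) (indicator (Ioc_box I a b) :: _ \<Rightarrow> real)" using bW by (simp add: W_def)
    qed
  qed
  have "W \<phi>" using \<phi>
  proof (induction rule: integrable_induct)
    case (base A c)
    have "W (indicator A)"
    proof (rule W_dominated)
      show "W (indicator (A \<inter> Ioc_box I (\<lambda>_. - real k) (\<lambda>_. real k)))" for k using base by (intro AW)
      show "integrable (leb I) (indicator A :: _ \<Rightarrow> real)" using base by (intro integrable_real_indicator)
      show "\<bar>indicator (A \<inter> Ioc_box I (\<lambda>_. - real k) (\<lambda>_. real k)) x\<bar> \<le> (indicator A x :: real)" for k x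
        by (auto simp: indicator_def)
      fix x assume x: "x \<in> space (leb I)"
      obtain n :: nat where n: "\<And>i. i \<in> I \<Longrightarrow> \<bar>x i\<bar> < real n"
      proof -
        obtain n where "(\<Sum>i\<in>I. \<bar>x i\<bar>) < real n" using reals_Archimedean2 by blast
        moreover have "\<bar>x i\<bar> \<le> (\<Sum>i\<in>I. \<bar>x i\<bar>)" if "i \<in> I" for i by (rule member_le_sum) (use that fin in auto)
        ultimately show ?thesis by (intro that[of n]) (meson le_less_trans)
      qed
      have "x \<in> Ioc_box I (\<lambda>_. - real k) (\<lambda>_. real k)" if k: "n \<le> k" for k
      proof -
        have "real n \<le> real k" using k by simp
        then have "- real k < x i \<and> x i \<le> real k" if "i \<in> I" for i using n[OF that] by linarith
        then show ?thesis using x by (simp add: space_PiM PiE_iff)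
      qed
      then have "(indicator (A \<inter> Ioc_box I (\<lambda>_. - real k) (\<lambda>_. real k)) x :: real) = indicator A x" if "n \<le> k" for k
        using that by (auto simp: indicator_def)
      then show "(\<lambda>k. indicator (A \<inter> Ioc_box I (\<lambda>_. - real k) (\<lambda>_. real k)) x :: real) \<longlonglongrightarrow> indicator A x"
        by (intro tendsto_eventually eventually_sequentiallyI)
    qed
    from W_scale[OF this, of c] show ?case by (simp add: mult.commute)
  next
    case (add f g)
    then show ?case by (intro W_add)
  next
    case (lim f s)
    show ?case
    proof (rule W_dominated)
      show "W (s k)" for k by (rule lim)
      show "(\<lambda>k. s k x) \<longlonglongrightarrow> f x" if "x \<in> space (leb I)" for x by (rule lim) fact
      show "\<bar>s k x\<bar> \<le> 2 * \<bar>f x\<bar>" if "x \<in> space (leb I)" for k x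
        unfolding real_norm_def[symmetric] by (rule lim) fact
      show "integrable (leb I) (\<lambda>x. 2 * \<bar>f x\<bar>)"
        by (intro integrable_mult_right integrable_abs lim)
    qed
  qed
  then show ?thesis by (simp add: W_def)
qed

end

section \<open>Partial derivatives of Lipschitz functions and Rademacher's theorem\<close>

lemma hyperplane_ae:
  assumes "finite I" "i \<in> I"
  shows "AE x in leb I. x i \<noteq> c"
proof -
  have "emeasure (leb I) (\<Pi>\<^sub>E j\<in>I. if j = i then {c} else UNIV) = (\<Prod>j\<in>I. emeasure lborel (if j = i then {c} else UNIV))"
    by (rule lborel_prod.emeasure_PiM) (use assms in auto)
  also have "\<dots> = 0" by (rule prod_zero) (use assms in auto)
  finally have "(\<Pi>\<^sub>E j\<in>I. if j = i then {c} else UNIV) \<in> null_sets (leb I)"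
    using assms by (auto intro!: null_setsI sets_PiM_I_finite)
  from AE_not_in[OF this] show ?thesis
  proof (rule AE_mp, intro AE_I2 impI)
    fix x assume "x \<in> space (leb I)" and n: "x \<notin> (\<Pi>\<^sub>E j\<in>I. if j = i then {c} else UNIV)"
    then have "x \<in> extensional I" by (simp add: space_PiM PiE_def)
    show "x i \<noteq> c"
    proof
      assume "x i = c"
      then have "x \<in> (\<Pi>\<^sub>E j\<in>I. if j = i then {c} else UNIV)" using \<open>x \<in> extensional I\<close> by (simp add: PiE_iff)
      with n show False by contradiction
    qed
  qed
qed

lemma integral_translate:
  fixes f :: "(nat \<Rightarrow> real) \<Rightarrow> real"
  assumes "finite I" "f \<in> borel_measurable (leb I)"
  shows "(\<integral>x. f (\<lambda>i\<in>I. x i + c i) \<partial>leb I) = (\<integral>x. f x \<partial>leb I)"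
proof -
  have "(\<integral>x. f x \<partial>leb I) = (\<integral>x. f x \<partial>distr (leb I) (leb I) (\<lambda>x. \<lambda>i\<in>I. x i + c i))"
    by (simp only: translation_leb[OF assms(1)])
  also have "\<dots> = (\<integral>x. f (\<lambda>i\<in>I. x i + c i) \<partial>leb I)"
    by (rule integral_distr) (use assms in simp_all)
  finally show ?thesis by simp
qed

lemma Ioc_box_sets[measurable]: "finite I \<Longrightarrow> Ioc_box I a b \<in> sets (leb I)"
  by (intro sets_PiM_I_finite) auto

lemma integrable_Ioc_box[simp]: "finite I \<Longrightarrow> integrable (leb I) (indicator (Ioc_box I a b) :: _ \<Rightarrow> real)"
  using emeasure_Ioc_box_finite[of I a b] Ioc_box_sets[of I a b] by (intro integrable_real_indicator) auto

lemma integrable_bounded_mult: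
  fixes \<phi> h :: "'b \<Rightarrow> real"
  assumes "integrable M \<phi>" "h \<in> borel_measurable M" "\<And>x. \<bar>h x\<bar> \<le> c"
  shows "integrable M (\<lambda>x. \<phi> x * h x)"
proof (rule Bochner_Integration.integrable_bound[of _ "\<lambda>x. c * \<phi> x"])
  show "(\<lambda>x. \<phi> x * h x) \<in> borel_measurable M" "integrable M (\<lambda>x. c * \<phi> x)"
    using assms by auto
  have "\<bar>\<phi> x\<bar> * \<bar>h x\<bar> \<le> \<bar>\<phi> x\<bar> * \<bar>c\<bar>" for x by (intro mult_left_mono order_trans[OF assms(3)]) auto
  then show "AE x in M. norm (\<phi> x * h x) \<le> norm (c * \<phi> x)" by (auto simp: abs_mult mult.commute)
qed

text \<open>The constant sequence \<open>h\<close> is weakly null, so on each box the sign of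
  \<open>h\<close> may serve as test function, which makes the integral of \<bar>h\<bar>
  vanish.\<close>

lemma ae_zero_if_box_integrals_zero:
  fixes h :: "(nat \<Rightarrow> real) \<Rightarrow> real"
  assumes fin: "finite I" and hm: "h \<in> borel_measurable (leb I)" and hb: "\<And>x. \<bar>h x\<bar> \<le> c"
    and box: "\<And>a b. (\<integral>x. indicator (Ioc_box I a b) x * h x \<partial>leb I) = 0"
  shows "AE x in leb I. h x = 0"
proof -
  have "AE x in leb I. x \<in> Ioc_box I (\<lambda>_. - real n) (\<lambda>_. real n) \<longrightarrow> h x = 0" for n
  proof -
    let ?B = "Ioc_box I (\<lambda>_. - real n) (\<lambda>_. real n)"
    have [measurable]: "h \<in> borel_measurable (leb I)" "?B \<in> sets (leb I)" using hm Ioc_box_sets[OF fin] by auto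
    have sm: "(\<lambda>x. sgn (h x)) \<in> borel_measurable (leb I)" by measurable
    have i: "integrable (leb I) (\<lambda>x. indicator ?B x * sgn (h x))"
      by (rule integrable_bounded_mult[where c = 1]) (use fin sm in \<open>auto simp: sgn_real_def\<close>)
    have "(\<lambda>m::nat. \<integral>x. (indicator ?B x * sgn (h x)) * h x \<partial>leb I) \<longlonglongrightarrow> 0"
      by (rule weak_null_sequence[where c = c, OF fin hm hb _ i]) (simp add: box)
    then have "(\<integral>x. (indicator ?B x * sgn (h x)) * h x \<partial>leb I) = 0" by (simp add: LIMSEQ_const_iff)
    then have z: "(\<integral>x. indicator ?B x * \<bar>h x\<bar> \<partial>leb I) = 0" by (simp add: mult.assoc abs_sgn mult.commute)
    have "integrable (leb I) (\<lambda>x. indicator ?B x * \<bar>h x\<bar>)"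
      by (rule integrable_bounded_mult[where c = c]) (use fin hb in auto)
    from integral_nonneg_eq_0_iff_AE[OF this] z have "AE x in leb I. indicator ?B x * \<bar>h x\<bar> = 0" by simp
    then show ?thesis by eventually_elim (auto simp: indicator_def)
  qed
  then have "AE x in leb I. \<forall>n. x \<in> Ioc_box I (\<lambda>_. - real n) (\<lambda>_. real n) \<longrightarrow> h x = 0" by (subst AE_all_countable) blast
  then show ?thesis
  proof (rule AE_mp, intro AE_I2 impI)
    fix x assume x: "x \<in> space (leb I)" and a: "\<forall>n. x \<in> Ioc_box I (\<lambda>_. - real n) (\<lambda>_. real n) \<longrightarrow> h x = 0"
    obtain n where n: "(\<Sum>i\<in>I. \<bar>x i\<bar>) < real n" using reals_Archimedean2 by blast
    have "\<bar>x i\<bar> < real n" if "i \<in> I" for i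
      using member_le_sum[of i I "\<lambda>i. \<bar>x i\<bar>"] that fin n by simp
    then have "x \<in> Ioc_box I (\<lambda>_. - real n) (\<lambda>_. real n)" using x
      by (force simp: space_PiM PiE_iff abs_less_iff)
    then show "h x = 0" using a by blast
  qed
qed

text \<open>Convergence can fail only on the hyperplanes bounding the box, and these are null
  sets.\<close>

lemma translate_box_ae:
  assumes fin: "finite I"
  shows "AE x in leb I. (\<lambda>m. indicator (Ioc_box I a b) (\<lambda>i\<in>I. x i + - (1 / real (Suc m) * v i)) :: real) \<longlonglongrightarrow> indicator (Ioc_box I a b) x"
proof -
  have "AE x in leb I. \<forall>i\<in>I. x i \<noteq> a i \<and> x i \<noteq> b i"
    using hyperplane_ae[OF fin] by (intro AE_finite_allI[OF fin] AE_conjI)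
  then show ?thesis
  proof (rule AE_mp, intro AE_I2 impI)
    fix x assume x: "x \<in> space (leb I)" and n: "\<forall>i\<in>I. x i \<noteq> a i \<and> x i \<noteq> b i"
    have lim: "(\<lambda>m. x i + - (1 / real (Suc m) * v i)) \<longlonglongrightarrow> x i" for i
    proof -
      have "(\<lambda>m. x i + - (inverse (real (Suc m)) * v i)) \<longlonglongrightarrow> x i + - (0 * v i)"
        by (intro tendsto_intros LIMSEQ_inverse_real_of_nat)
      then show ?thesis by (simp add: inverse_eq_divide)
    qed
    have "\<forall>\<^sub>F m in sequentially. \<forall>i\<in>I. (x i + - (1 / real (Suc m) * v i) \<in> {a i<..b i}) = (x i \<in> {a i<..b i})"
      unfolding eventually_ball_finite_distrib[OF fin]
    proof
      fix i assume i: "i \<in> I"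
      consider "x i < a i" | "a i < x i" "x i < b i" | "b i < x i" using n i by force
      then show "\<forall>\<^sub>F m in sequentially. (x i + - (1 / real (Suc m) * v i) \<in> {a i<..b i}) = (x i \<in> {a i<..b i})"
      proof cases
        case 1
        from order_tendstoD(2)[OF lim 1] show ?thesis by eventually_elim (use 1 in simp)
      next
        case 2
        from order_tendstoD(1)[OF lim 2(1)] order_tendstoD(2)[OF lim 2(2)] show ?thesis by eventually_elim (use 2 in simp)
      next
        case 3
        from order_tendstoD(1)[OF lim 3] show ?thesis by eventually_elim (use 3 in simp)
      qed
    qed
    then show "(\<lambda>m. indicator (Ioc_box I a b) (\<lambda>i\<in>I. x i + - (1 / real (Suc m) * v i)) :: real) \<longlonglongrightarrow> indicator (Ioc_box I a b) x"
    proof (intro tendsto_eventually, elim eventually_mono)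
      fix m assume *: "\<forall>i\<in>I. (x i + - (1 / real (Suc m) * v i) \<in> {a i<..b i}) = (x i \<in> {a i<..b i})"
      have "(\<lambda>i\<in>I. x i + - (1 / real (Suc m) * v i)) \<in> Ioc_box I a b \<longleftrightarrow> x \<in> Ioc_box I a b"
        using x * by (simp add: PiE_iff space_PiM del: greaterThanAtMost_iff)
      then show "indicator (Ioc_box I a b) (\<lambda>i\<in>I. x i + - (1 / real (Suc m) * v i)) = (indicator (Ioc_box I a b) x :: real)"
        by (simp add: indicator_def)
    qed
  qed
qed

lemma integral_quotient_tendsto:
  assumes fin: "finite I" and g: "lip_on I L g" and \<phi>: "integrable (leb I) \<phi>"
  shows "(\<lambda>m. \<integral>x. \<phi> x * ((g (\<lambda>i. x i + 1 / real (Suc m) * v i) - g x) / (1 / real (Suc m))) \<partial>leb I)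
    \<longlonglongrightarrow> (\<integral>x. \<phi> x * dird g v x \<partial>leb I)"
proof (rule integral_dominated_convergence)
  let ?c = "L * (\<Sum>i\<in>I. \<bar>v i\<bar>)"
  have [measurable]: "g \<in> borel_measurable (leb I)" by (rule lip_on_measurable[OF fin g]) simp
  have [measurable]: "(\<lambda>x. g (\<lambda>i. x i + c * v i)) \<in> borel_measurable (leb I)" for c
    by (rule lip_on_measurable[OF fin g]) simp
  have [measurable]: "\<phi> \<in> borel_measurable (leb I)" "dird g v \<in> borel_measurable (leb I)" using \<phi> dird_measurable[OF fin g] by auto
  show "(\<lambda>x. \<phi> x * dird g v x) \<in> borel_measurable (leb I)" by measurable
  show "(\<lambda>x. \<phi> x * ((g (\<lambda>i. x i + 1 / real (Suc m) * v i) - g x) / (1 / real (Suc m)))) \<in> borel_measurable (leb I)" for m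
    by measurable
  show "integrable (leb I) (\<lambda>x. \<bar>\<phi> x\<bar> * \<bar>?c\<bar>)" using \<phi> by auto
  show "AE x in leb I. (\<lambda>m. \<phi> x * ((g (\<lambda>i. x i + 1 / real (Suc m) * v i) - g x) / (1 / real (Suc m)))) \<longlonglongrightarrow> \<phi> x * dird g v x"
    using dird_exists_ae[OF fin g, of v]
  proof eventually_elim
    case (elim x)
    then have "has_dird g v x (dird g v x)" using has_dird_imp_dird by metis
    from tendsto_mult_left[OF dird_seq[OF this], of "\<phi> x"] show ?case .
  qed
  show "AE x in leb I. norm (\<phi> x * ((g (\<lambda>i. x i + 1 / real (Suc m) * v i) - g x) / (1 / real (Suc m)))) \<le> \<bar>\<phi> x\<bar> * \<bar>?c\<bar>" for m
    unfolding real_norm_def abs_mult[of "\<phi> _"]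
    by (intro AE_I2 mult_left_mono order_trans[OF quotient_bound[OF g] abs_ge_self]) simp
qed

text \<open>The quotient in direction v + w is the quotient in direction \<open>v\<close> plus a
  quotient in direction \<open>w\<close> taken at the point translated by v/(m + 1). Tested against
  a box, the translation moves to the indicator, where it disappears in the limit. This weak
  argument comes before total differentiability, which is derived from it.\<close>

lemma dird_add_ae:
  assumes fin: "finite I" and g: "lip_on I L g"
  shows "AE x in leb I. dird g (\<lambda>i. v i + w i) x = dird g v x + dird g w x"
proof -
  let ?vw = "\<lambda>i. v i + w i"
  define c where "c u = L * (\<Sum>i\<in>I. \<bar>u i\<bar>)" for u :: "nat \<Rightarrow> real"
  have dm[measurable]: "dird g u \<in> borel_measurable (leb I)" for u by (rule dird_measurable[OF fin g])
  have [measurable]: "g \<in> borel_measurable (leb I)" by (rule lip_on_measurable[OF fin g]) simp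
  have gt[measurable]: "(\<lambda>x. g (\<lambda>i. x i + c * v i)) \<in> borel_measurable (leb I)" for c v
    by (rule lip_on_measurable[OF fin g]) simp
  define Q where "Q u m x = (g (\<lambda>i. x i + 1 / real (Suc m) * u i) - g x) / (1 / real (Suc m))" for u m x
  have Qm[measurable]: "Q u m \<in> borel_measurable (leb I)" for u m unfolding Q_def by measurable
  have Qb: "\<bar>Q u m x\<bar> \<le> c u" for u m x unfolding Q_def c_def by (rule quotient_bound[OF g])
  have Qcong: "Q u m x = Q u m y" if "\<And>i. i \<in> I \<Longrightarrow> x i = y i" for u m x y
    unfolding Q_def using lip_on_cong[OF g, of x y] lip_on_cong[OF g, of "\<lambda>i. x i + 1 / real (Suc m) * u i" "\<lambda>i. y i + 1 / real (Suc m) * u i"] that by simp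
  have "AE x in leb I. dird g ?vw x - dird g v x - dird g w x = 0"
  proof (rule ae_zero_if_box_integrals_zero[OF fin, where c = "c ?vw + c v + c w"])
    show "(\<lambda>x. dird g ?vw x - dird g v x - dird g w x) \<in> borel_measurable (leb I)" by measurable
    show "\<bar>dird g ?vw x - dird g v x - dird g w x\<bar> \<le> c ?vw + c v + c w" for x
      using dird_bound[OF g, of ?vw x] dird_bound[OF g, of v x] dird_bound[OF g, of w x] unfolding c_def by linarith
    fix a b :: "nat \<Rightarrow> real"
    let ?B = "Ioc_box I a b"
    have iB: "integrable (leb I) (indicator ?B :: _ \<Rightarrow> real)" using fin by simp
    have [measurable]: "?B \<in> sets (leb I)" using fin by (rule Ioc_box_sets)
    have Ib: "integrable (leb I) (\<lambda>x. indicator ?B x * f x)" if "f \<in> borel_measurable (leb I)" "\<And>x. \<bar>f x\<bar> \<le> C" for f :: "(nat \<Rightarrow> real) \<Rightarrow> real" and C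
      by (rule integrable_bounded_mult[OF iB that])
    define tr where "tr m x = (\<lambda>i\<in>I. x i + - (1 / real (Suc m) * v i))" for m x
    define J where "J u m = (\<integral>x. indicator ?B x * Q u m x \<partial>leb I)" for u m
    have J: "J u \<longlonglongrightarrow> (\<integral>x. indicator ?B x * dird g u x \<partial>leb I)" for u
      unfolding J_def Q_def by (rule integral_quotient_tendsto[OF fin g iB])
    have trm[measurable]: "tr m \<in> measurable (leb I) (leb I)" for m unfolding tr_def by measurable
    have split: "J ?vw m - J v m - J w m = (\<integral>x. (indicator ?B (tr m x) - indicator ?B x) * Q w m x \<partial>leb I)" for m
    proof -
      let ?t = "1 / real (Suc m)"
      let ?T = "\<lambda>x. \<lambda>i\<in>I. x i + ?t * v i"
      have q: "Q ?vw m x = Q v m x + Q w m (?T x)" for x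
      proof -
        have "g (\<lambda>i. x i + ?t * ?vw i) = g (\<lambda>i. ?T x i + ?t * w i)"
          by (rule lip_on_cong[OF g]) (simp add: add_divide_distrib)
        moreover have "g (?T x) = g (\<lambda>i. x i + ?t * v i)" by (rule lip_on_cong[OF g]) simp
        ultimately show ?thesis unfolding Q_def by (simp only: diff_divide_distrib)
      qed
      have Tm[measurable]: "?T \<in> measurable (leb I) (leb I)" by measurable
      have QTm: "(\<lambda>x. Q w m (?T x)) \<in> borel_measurable (leb I)" by measurable
      have "(\<integral>x. indicator ?B x * Q w m (?T x) \<partial>leb I) = (\<integral>x. indicator ?B (tr m (?T x)) * Q w m (?T x) \<partial>leb I)"
      proof (rule Bochner_Integration.integral_cong[OF refl])
        fix x assume "x \<in> space (leb I)"
        then have "tr m (?T x) = x" by (auto simp: tr_def space_PiM PiE_def extensional_def)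
        then show "indicator ?B x * Q w m (?T x) = indicator ?B (tr m (?T x)) * Q w m (?T x)" by simp
      qed
      also have "\<dots> = (\<integral>x. indicator ?B (tr m x) * Q w m x \<partial>leb I)"
        by (rule integral_translate[OF fin, where f = "\<lambda>x. indicator ?B (tr m x) * Q w m x"]) measurable
      finally have e: "(\<integral>x. indicator ?B x * Q w m (?T x) \<partial>leb I) = (\<integral>x. indicator ?B (tr m x) * Q w m x \<partial>leb I)" .
      have itr: "integrable (leb I) (\<lambda>x. indicator ?B (tr m x) * Q w m x)"
      proof (rule integrable_bounded_mult[OF _ Qm Qb])
        show "integrable (leb I) (\<lambda>x. indicator ?B (tr m x) :: real)"
        proof (rule integrable_distr_eq[THEN iffD1, of "tr m" "leb I" "leb I" "indicator ?B"])
          show "integrable (distr (leb I) (leb I) (tr m)) (indicator ?B :: _ \<Rightarrow> real)"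
            unfolding tr_def translation_leb[OF fin] by (rule iB)
        qed measurable
      qed
      have "J ?vw m = J v m + (\<integral>x. indicator ?B x * Q w m (?T x) \<partial>leb I)"
        unfolding J_def q ring_distribs by (rule Bochner_Integration.integral_add[OF Ib[OF Qm Qb] Ib[OF QTm Qb]])
      then have "J ?vw m = J v m + (\<integral>x. indicator ?B (tr m x) * Q w m x \<partial>leb I)" unfolding e .
      then have "J ?vw m - J v m - J w m = (\<integral>x. indicator ?B (tr m x) * Q w m x \<partial>leb I) - J w m" by linarith
      also have "\<dots> = (\<integral>x. indicator ?B (tr m x) * Q w m x - indicator ?B x * Q w m x \<partial>leb I)"
        unfolding J_def by (rule Bochner_Integration.integral_diff[OF itr Ib[OF Qm Qb], symmetric])
      finally show ?thesis by (simp add: left_diff_distrib)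
    qed
    have "(\<lambda>m. \<integral>x. (indicator ?B (tr m x) - indicator ?B x) * Q w m x \<partial>leb I) \<longlonglongrightarrow> (\<integral>x. 0 \<partial>leb I)"
    proof (rule integral_dominated_convergence)
      \<comment> \<open>All translated boxes lie in this larger box because 1/(m + 1) \<le> 1, so
        its indicator dominates.\<close>
      let ?B' = "Ioc_box I (\<lambda>i. a i - \<bar>v i\<bar>) (\<lambda>i. b i + \<bar>v i\<bar>)"
      show "integrable (leb I) (\<lambda>x. indicator ?B' x * c w)" using fin by simp
      show "AE x in leb I. (\<lambda>m. (indicator ?B (tr m x) - indicator ?B x) * Q w m x) \<longlonglongrightarrow> 0"
        using translate_box_ae[OF fin, of a b v]
      proof eventually_elim
        case (elim x)
        have "(\<lambda>m. indicator ?B (tr m x) - indicator ?B x :: real) \<longlonglongrightarrow> 0"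
          using tendsto_diff[OF elim tendsto_const[of "indicator ?B x"]] unfolding tr_def by simp
        then have lim: "(\<lambda>m. \<bar>indicator ?B (tr m x) - indicator ?B x\<bar> * c w) \<longlonglongrightarrow> 0"
          by (intro tendsto_mult_left_zero tendsto_rabs_zero)
        show ?case
          by (rule Lim_null_comparison[OF _ lim], rule always_eventually)
            (use Qb[of w _ x] in \<open>auto simp: abs_mult intro!: mult_left_mono\<close>)
      qed
      show "AE x in leb I. norm ((indicator ?B (tr m x) - indicator ?B x) * Q w m x) \<le> indicator ?B' x * c w" for m
      proof (rule AE_I2)
        fix x assume x: "x \<in> space (leb I)"
        have t: "0 \<le> 1 / real (Suc m)" "1 / real (Suc m) \<le> 1" by auto
        have tv: "\<bar>1 / real (Suc m) * v i\<bar> \<le> \<bar>v i\<bar>" for i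
          unfolding abs_mult using mult_right_mono[OF t(2), of "\<bar>v i\<bar>"] t by simp
        have "tr m x \<in> ?B \<Longrightarrow> x \<in> ?B'"
        proof -
          assume "tr m x \<in> ?B"
          then have "a i < x i + - (1 / real (Suc m) * v i) \<and> x i + - (1 / real (Suc m) * v i) \<le> b i" if "i \<in> I" for i
            using that by (auto simp: tr_def PiE_iff)
          then have "x i \<in> {a i - \<bar>v i\<bar><..b i + \<bar>v i\<bar>}" if "i \<in> I" for i
            using abs_le_D1[OF tv[of i]] abs_le_D2[OF tv[of i]] that by fastforce
          then show ?thesis using x by (simp add: space_PiM PiE_iff del: greaterThanAtMost_iff)
        qed
        moreover have "x \<in> ?B \<Longrightarrow> x \<in> ?B'" by (force simp: PiE_iff)
        ultimately have "\<bar>indicator ?B (tr m x) - indicator ?B x\<bar> \<le> (indicator ?B' x :: real)" by (auto simp: indicator_def)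
        then show "norm ((indicator ?B (tr m x) - indicator ?B x) * Q w m x) \<le> indicator ?B' x * c w"
          unfolding real_norm_def abs_mult by (intro mult_mono Qb) auto
      qed
    qed measurable
    then have "(\<lambda>m. J ?vw m - J v m - J w m) \<longlonglongrightarrow> 0" by (simp add: split)
    moreover have "(\<lambda>m. J ?vw m - J v m - J w m) \<longlonglongrightarrow> (\<integral>x. indicator ?B x * dird g ?vw x \<partial>leb I) - (\<integral>x. indicator ?B x * dird g v x \<partial>leb I) - (\<integral>x. indicator ?B x * dird g w x \<partial>leb I)"
      by (intro tendsto_diff J)
    ultimately have "(\<integral>x. indicator ?B x * dird g ?vw x \<partial>leb I) - (\<integral>x. indicator ?B x * dird g v x \<partial>leb I) - (\<integral>x. indicator ?B x * dird g w x \<partial>leb I) = 0"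
      using LIMSEQ_unique by blast
    then show "(\<integral>x. indicator ?B x * (dird g ?vw x - dird g v x - dird g w x) \<partial>leb I) = 0"
      by (simp add: right_diff_distrib Ib[OF dm dird_bound[OF g]])
  qed
  then show ?thesis by eventually_elim simp
qed

definition pd :: "nat \<Rightarrow> ((nat \<Rightarrow> real) \<Rightarrow> real) \<Rightarrow> (nat \<Rightarrow> real) \<Rightarrow> real" where
  "pd j g = dird g (\<lambda>i. if i = j then 1 else 0)"

lemma pd_measurable: "finite I \<Longrightarrow> lip_on I L g \<Longrightarrow> pd j g \<in> borel_measurable (leb I)"
  unfolding pd_def by (rule dird_measurable)

lemma lip_on_nonneg: "lip_on I L g \<Longrightarrow> I \<noteq> {} \<Longrightarrow> finite I \<Longrightarrow> 0 \<le> L"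
proof -
  assume g: "lip_on I L g" and I: "I \<noteq> {}" "finite I"
  have "0 \<le> L * real (card I)"
    using lip_onD[OF g, of "\<lambda>_. 1" "\<lambda>_. 0"] order_trans[OF abs_ge_zero] by simp
  moreover have "0 < real (card I)" using I by (simp add: card_gt_0_iff)
  ultimately show "0 \<le> L" by (simp add: zero_le_mult_iff)
qed

lemma pd_bound: "finite I \<Longrightarrow> j \<in> I \<Longrightarrow> lip_on I L g \<Longrightarrow> \<bar>pd j g x\<bar> \<le> L"
  using dird_bound[of I L g "\<lambda>i. if i = j then 1 else 0" x] unfolding pd_def
  by (simp add: if_distrib[of abs] cong: if_cong)

lemma has_dird_scale:
  assumes "has_dird g v x l"
  shows "has_dird g (\<lambda>i. c * v i) x (c * l)"
proof (cases "c = 0")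
  case False
  have "filterlim (\<lambda>t. c * t) (at 0) (at 0)"
    unfolding filterlim_at using False by (auto simp: eventually_at intro!: tendsto_eq_intros exI[of _ 1])
  from filterlim_compose[OF assms[unfolded has_dird_def] this]
  have "((\<lambda>t. c * ((g (\<lambda>i. x i + (c * t) * v i) - g x) / (c * t))) \<longlongrightarrow> c * l) (at 0)" by (rule tendsto_mult_left)
  then show ?thesis unfolding has_dird_def using False by (simp add: mult_ac)
qed (simp add: has_dird_def)

text \<open>Coordinate directions are added one at a time, starting from the zero direction. The
  passage from \<open>v\<close> cut off outside \<open>I\<close> to \<open>v\<close> itself uses
  that \<open>g\<close> depends on the coordinates in \<open>I\<close> only.\<close>

lemma dird_linear_ae:
  assumes fin: "finite I" and g: "lip_on I L g"
  shows "AE x in leb I. has_dird g v x (\<Sum>i\<in>I. v i * pd i g x)"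
proof -
  have "AE x in leb I. dird g (\<lambda>i. if i \<in> S then v i else 0) x = (\<Sum>i\<in>S. v i * pd i g x)" if "finite S" for S
    using that
  proof (induction S)
    case empty
    have "has_dird g (\<lambda>_. 0) x 0" for x by (simp add: has_dird_def)
    then show ?case by (simp add: has_dird_imp_dird)
  next
    case (insert j S)
    have eq: "(\<lambda>i. (if i \<in> S then v i else 0) + v j * (if i = j then 1 else 0)) = (\<lambda>i. if i \<in> insert j S then v i else 0)"
      using insert by (auto simp: fun_eq_iff)
    show ?case
      using insert.IH dird_add_ae[OF fin g, of "\<lambda>i. if i \<in> S then v i else 0" "\<lambda>i. v j * (if i = j then 1 else 0)", unfolded eq]
        dird_exists_ae[OF fin g, of "\<lambda>i. if i = j then 1 else 0"]
    proof eventually_elim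
      case (elim x)
      then obtain l where l: "has_dird g (\<lambda>i. if i = j then 1 else 0) x l" by blast
      have "dird g (\<lambda>i. v j * (if i = j then 1 else 0)) x = v j * pd j g x"
        unfolding pd_def has_dird_imp_dird[OF l] by (rule has_dird_imp_dird[OF has_dird_scale[OF l]])
      then show ?case using elim insert by simp
    qed
  qed
  from this[OF fin] dird_exists_ae[OF fin g, of v] show ?thesis
  proof eventually_elim
    case (elim x)
    have "g (\<lambda>i. x i + t * (if i \<in> I then v i else 0)) = g (\<lambda>i. x i + t * v i)" for t
      by (rule lip_on_cong[OF g]) simp
    then have hc: "has_dird g (\<lambda>i. if i \<in> I then v i else 0) x l \<longleftrightarrow> has_dird g v x l" for l by (simp add: has_dird_def)
    obtain l where l: "has_dird g v x l" using elim by blast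
    then have "dird g (\<lambda>i. if i \<in> I then v i else 0) x = l" using hc has_dird_imp_dird by blast
    then show ?case using elim(1) l by simp
  qed
qed

definition has_grad :: "nat set \<Rightarrow> ((nat \<Rightarrow> real) \<Rightarrow> real) \<Rightarrow> (nat \<Rightarrow> real) \<Rightarrow> bool" where
  "has_grad I g x \<longleftrightarrow> (\<forall>e>0. \<exists>d>0. \<forall>y. (\<Sum>i\<in>I. \<bar>y i - x i\<bar>) < d \<longrightarrow>
     \<bar>g y - g x - (\<Sum>i\<in>I. (y i - x i) * pd i g x)\<bar> \<le> e * (\<Sum>i\<in>I. \<bar>y i - x i\<bar>))"

text \<open>Rademacher's theorem: directional derivatives along a grid of directions control all increments.\<close>

theorem has_grad_ae:
  assumes fin: "finite I" and g: "lip_on I L g"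
  shows "AE x in leb I. has_grad I g x"
proof -
  \<comment> \<open>A grid of mesh 1/N in the cube [-1,1]^I. The union over all \<open>N\<close> is
    countable, so one null set serves all these directions.\<close>
  define V where "V N = (\<Pi>\<^sub>E i\<in>I. (\<lambda>k::int. of_int k / real N) ` {- int N..int N})" for N :: nat
  have finV: "finite (V N)" for N unfolding V_def using fin by (intro finite_PiE) auto
  have "AE x in leb I. \<forall>v\<in>\<Union>(range V). has_dird g v x (\<Sum>i\<in>I. v i * pd i g x)"
    by (subst AE_ball_countable) (auto intro: countable_finite[OF finV] dird_linear_ae[OF fin g])
  then show ?thesis
  proof eventually_elim
    case (elim x)
    show ?case unfolding has_grad_def
    proof (intro allI impI)
      fix e :: real assume e: "0 < e"
      define c where "c = real (card I) + 1"
      have c: "0 < c" by (simp add: c_def)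
      \<comment> \<open>Moving to the nearest lower grid direction costs at most \<bar>L\<bar> c/N
        per unit length, once in \<open>g\<close> and once in the linear part. This \<open>N\<close>
        makes the sum at most e/2; the other half is spent on the finitely many grid
        directions.\<close>
      obtain N :: nat where N: "4 * (\<bar>L\<bar> + 1) * c / e < real N" using reals_Archimedean2 by blast
      have N0: "0 < real N" using N e c by (smt (verit) divide_pos_pos mult_pos_pos zero_less_mult_iff)
      have LN: "2 * (\<bar>L\<bar> * (c / real N)) \<le> e / 2"
      proof -
        have "4 * (\<bar>L\<bar> + 1) * c \<le> e * real N" using N e by (simp add: pos_divide_less_eq mult.commute)
        moreover have "4 * \<bar>L\<bar> * c \<le> 4 * (\<bar>L\<bar> + 1) * c" using c by (intro mult_right_mono) auto
        ultimately have "4 * \<bar>L\<bar> * c \<le> e * real N" by linarith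
        then show ?thesis using N0 by (simp add: field_simps)
      qed
      have "\<forall>\<^sub>F t in at 0. \<forall>v\<in>V N. \<bar>(g (\<lambda>i. x i + t * v i) - g x) / t - (\<Sum>i\<in>I. v i * pd i g x)\<bar> < e / 2"
        unfolding eventually_ball_finite_distrib[OF finV]
      proof
        fix v assume "v \<in> V N"
        then have "has_dird g v x (\<Sum>i\<in>I. v i * pd i g x)" using elim by blast
        from tendstoD[OF this[unfolded has_dird_def], of "e / 2"] e
        show "\<forall>\<^sub>F t in at 0. \<bar>(g (\<lambda>i. x i + t * v i) - g x) / t - (\<Sum>i\<in>I. v i * pd i g x)\<bar> < e / 2"
          by (simp add: dist_real_def)
      qed
      then obtain d where d: "0 < d" "\<And>t v. t \<noteq> 0 \<Longrightarrow> \<bar>t\<bar> < d \<Longrightarrow> v \<in> V N \<Longrightarrow>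
          \<bar>(g (\<lambda>i. x i + t * v i) - g x) / t - (\<Sum>i\<in>I. v i * pd i g x)\<bar> < e / 2"
        unfolding eventually_at dist_real_def by auto
      have "\<bar>g y - g x - (\<Sum>i\<in>I. (y i - x i) * pd i g x)\<bar> \<le> e * (\<Sum>i\<in>I. \<bar>y i - x i\<bar>)"
        if y: "(\<Sum>i\<in>I. \<bar>y i - x i\<bar>) < d" for y
      proof (cases "(\<Sum>i\<in>I. \<bar>y i - x i\<bar>) = 0")
        case True
        then have "\<And>i. i \<in> I \<Longrightarrow> y i = x i" using fin by (simp add: sum_nonneg_eq_0_iff)
        then have "g y = g x" "(\<Sum>i\<in>I. (y i - x i) * pd i g x) = 0" using lip_on_cong[OF g, of y x] by auto
        then show ?thesis using True by simp
      next
        case False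
        define r where "r = (\<Sum>i\<in>I. \<bar>y i - x i\<bar>)"
        have r: "0 < r" "r < d" using False y sum_nonneg[of I "\<lambda>i. \<bar>y i - x i\<bar>"] by (auto simp: r_def less_le)
        \<comment> \<open>The direction (y - x)/r has l1 norm 1, so its coordinates lie in [-1,1];
          they are rounded down to multiples of 1/N.\<close>
        define k where "k i = \<lfloor>real N * ((y i - x i) / r)\<rfloor>" for i
        define v where "v = (\<lambda>i\<in>I. of_int (k i) / real N)"
        have yr: "\<bar>(y i - x i) / r\<bar> \<le> 1" if "i \<in> I" for i
          using member_le_sum[of i I "\<lambda>i. \<bar>y i - x i\<bar>"] that fin r by (simp add: r_def[symmetric])
        have v: "v \<in> V N"
        proof -
          have "k i \<in> {- int N..int N}" if "i \<in> I" for i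
          proof -
            have "\<bar>real N * ((y i - x i) / r)\<bar> \<le> real N"
              using mult_left_mono[OF yr[OF that], of "real N"] by (simp add: abs_mult)
            then have "- real N \<le> real N * ((y i - x i) / r)" "real N * ((y i - x i) / r) \<le> real N"
              by (rule abs_le_D2[THEN minus_le_iff[THEN iffD1]], rule abs_le_D1)
            then have "\<lfloor>- real N\<rfloor> \<le> k i" "k i \<le> \<lfloor>real N\<rfloor>" unfolding k_def by (intro floor_mono; simp)+
            moreover have "\<lfloor>- real N\<rfloor> = - int N" by (metis floor_of_int of_int_minus of_int_of_nat_eq)
            ultimately show ?thesis by simp
          qed
          then show ?thesis unfolding V_def v_def by (intro restrict_PiE_iff[THEN iffD2] ballI imageI)
        qed
        have vd: "\<bar>y i - (x i + r * v i)\<bar> \<le> r / real N" if "i \<in> I" for i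
        proof -
          have "\<bar>real N * ((y i - x i) / r) - of_int (k i)\<bar> \<le> 1" unfolding k_def by linarith
          then have "r / real N * \<bar>real N * ((y i - x i) / r) - of_int (k i)\<bar> \<le> r / real N * 1"
            using r N0 by (intro mult_left_mono) auto
          also have "r / real N * \<bar>real N * ((y i - x i) / r) - of_int (k i)\<bar> = \<bar>r / real N * (real N * ((y i - x i) / r) - of_int (k i))\<bar>"
            using r N0 by (simp add: abs_mult)
          also have "r / real N * (real N * ((y i - x i) / r) - of_int (k i)) = y i - (x i + r * v i)"
            using r N0 that by (simp add: v_def field_simps)
          finally show ?thesis by simp
        qed
        have sum_vd: "(\<Sum>i\<in>I. \<bar>y i - (x i + r * v i)\<bar>) \<le> r * (c / real N)"
        proof -
          have "(\<Sum>i\<in>I. \<bar>y i - (x i + r * v i)\<bar>) \<le> real (card I) * (r / real N)"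
            by (rule sum_bounded_above) (rule vd)
          also have "\<dots> \<le> c * (r / real N)" using r N0 by (intro mult_right_mono) (auto simp: c_def)
          finally show ?thesis by (simp add: mult_ac)
        qed
        have "\<bar>g y - g (\<lambda>i. x i + r * v i)\<bar> \<le> \<bar>L\<bar> * (r * (c / real N))"
        proof -
          have "\<bar>g y - g (\<lambda>i. x i + r * v i)\<bar> \<le> L * (\<Sum>i\<in>I. \<bar>y i - (x i + r * v i)\<bar>)" by (rule lip_onD[OF g])
          also have "\<dots> \<le> \<bar>L\<bar> * (\<Sum>i\<in>I. \<bar>y i - (x i + r * v i)\<bar>)" by (intro mult_right_mono sum_nonneg) auto
          also have "\<dots> \<le> \<bar>L\<bar> * (r * (c / real N))" by (intro mult_left_mono sum_vd) auto
          finally show ?thesis .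
        qed
        moreover have "\<bar>(\<Sum>i\<in>I. (y i - x i) * pd i g x) - r * (\<Sum>i\<in>I. v i * pd i g x)\<bar> \<le> \<bar>L\<bar> * (r * (c / real N))"
        proof -
          have "(\<Sum>i\<in>I. (y i - x i) * pd i g x) - r * (\<Sum>i\<in>I. v i * pd i g x) = (\<Sum>i\<in>I. (y i - (x i + r * v i)) * pd i g x)"
            by (simp add: sum_distrib_left sum_subtractf[symmetric] algebra_simps)
          also have "\<bar>\<dots>\<bar> \<le> (\<Sum>i\<in>I. \<bar>y i - (x i + r * v i)\<bar> * \<bar>L\<bar>)"
            unfolding abs_mult[symmetric]
            by (rule order_trans[OF sum_abs], rule sum_mono, unfold abs_mult abs_idempotent, rule mult_left_mono)
              (use pd_bound[OF fin _ g] order_trans abs_ge_self in blast, simp)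
          also have "\<dots> = \<bar>L\<bar> * (\<Sum>i\<in>I. \<bar>y i - (x i + r * v i)\<bar>)" by (simp add: sum_distrib_left mult.commute)
          also have "\<dots> \<le> \<bar>L\<bar> * (r * (c / real N))" by (intro mult_left_mono sum_vd) auto
          finally show ?thesis .
        qed
        moreover have "\<bar>g (\<lambda>i. x i + r * v i) - g x - r * (\<Sum>i\<in>I. v i * pd i g x)\<bar> \<le> r * (e / 2)"
        proof -
          have "\<bar>(g (\<lambda>i. x i + r * v i) - g x) / r - (\<Sum>i\<in>I. v i * pd i g x)\<bar> < e / 2"
            using d(2)[OF _ _ v, of r] r by simp
          then have "r * \<bar>(g (\<lambda>i. x i + r * v i) - g x) / r - (\<Sum>i\<in>I. v i * pd i g x)\<bar> \<le> r * (e / 2)"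
            using r by (intro mult_left_mono) auto
          also have "r * \<bar>(g (\<lambda>i. x i + r * v i) - g x) / r - (\<Sum>i\<in>I. v i * pd i g x)\<bar> =
              \<bar>r * ((g (\<lambda>i. x i + r * v i) - g x) / r - (\<Sum>i\<in>I. v i * pd i g x))\<bar>" using r by (simp add: abs_mult)
          also have "r * ((g (\<lambda>i. x i + r * v i) - g x) / r - (\<Sum>i\<in>I. v i * pd i g x)) = g (\<lambda>i. x i + r * v i) - g x - r * (\<Sum>i\<in>I. v i * pd i g x)"
            using r by (subst right_diff_distrib) simp
          finally show ?thesis .
        qed
        ultimately have "\<bar>g y - g x - (\<Sum>i\<in>I. (y i - x i) * pd i g x)\<bar> \<le> 2 * (\<bar>L\<bar> * (r * (c / real N))) + r * (e / 2)"
          by linarith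
        also have "2 * (\<bar>L\<bar> * (r * (c / real N))) = r * (2 * (\<bar>L\<bar> * (c / real N)))" by (simp only: mult_ac)
        also have "\<dots> \<le> r * (e / 2)" using r LN by (intro mult_left_mono) auto
        finally show ?thesis by (simp add: r_def[symmetric] mult.commute)
      qed
      then show "\<exists>d>0. \<forall>y. (\<Sum>i\<in>I. \<bar>y i - x i\<bar>) < d \<longrightarrow>
          \<bar>g y - g x - (\<Sum>i\<in>I. (y i - x i) * pd i g x)\<bar> \<le> e * (\<Sum>i\<in>I. \<bar>y i - x i\<bar>)"
        using d(1) by blast
    qed
  qed
qed

section \<open>The fundamental theorem along coordinate lines and weak convergence of partial
  derivatives\<close>

text \<open>The integral of the difference quotient of \<open>f\<close> with step s is the
  difference of the corresponding quotients of an antiderivative at \<open>b\<close> and at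
  \<open>a\<close>, which tends to f b - f a. The quotients are bounded by \<open>L\<close>, so
  dominated convergence identifies the other side.\<close>

lemma integral_Lipschitz_derivative:
  fixes f D :: "real \<Rightarrow> real"
  assumes ab: "a \<le> b" and lip: "\<And>x y. \<bar>f x - f y\<bar> \<le> L * \<bar>x - y\<bar>"
    and Dm: "D \<in> borel_measurable borel"
    and D: "AE t in lborel. ((\<lambda>s. (f (t + s) - f t) / s) \<longlongrightarrow> D t) (at 0)"
  shows "(\<integral>t. D t * indicator {a..b} t \<partial>lborel) = f b - f a"
proof -
  have L0: "0 \<le> L" using lip[of 0 1] by simp
  have cont: "continuous_on UNIV f"
    by (rule lipschitz_on_continuous_on[of L]) (use lip L0 in \<open>auto simp: lipschitz_on_def dist_real_def\<close>)
  then have ic: "isCont f t" for t by (simp add: continuous_on_eq_continuous_at)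
  have fm[measurable]: "f \<in> borel_measurable borel" using cont by (rule borel_measurable_continuous_onI)
  \<comment> \<open>An antiderivative on the whole line, since the steps reach beyond
    \<open>b\<close>.\<close>
  obtain F where F: "\<And>t. (F has_real_derivative f t) (at t)"
    using einterval_antiderivative[of "-\<infinity>" \<infinity> f] ic by (auto simp: has_real_derivative_iff_has_vector_derivative)
  define s where "s m = 1 / real (Suc m)" for m
  have s: "s m \<noteq> 0" for m by (simp add: s_def)
  have Flim: "(\<lambda>m. (F (t + s m) - F t) / s m) \<longlonglongrightarrow> f t" for t
    using filterlim_compose[OF F[of t, unfolded DERIV_def] inverse_Suc_at_0]
    by (simp add: s_def)
  have "(\<lambda>m. \<integral>t. ((f (t + s m) - f t) / s m) * indicator {a..b} t \<partial>lborel) \<longlonglongrightarrow> (\<integral>t. D t * indicator {a..b} t \<partial>lborel)"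
  proof (rule integral_dominated_convergence)
    show "integrable lborel (\<lambda>t. L * indicator {a..b} t :: real)"
      by (intro integrable_mult_right integrable_real_indicator) (auto simp: emeasure_lborel_Icc_eq)
    show "AE t in lborel. (\<lambda>m. ((f (t + s m) - f t) / s m) * indicator {a..b} t) \<longlonglongrightarrow> D t * indicator {a..b} t"
      using D
    proof eventually_elim
      case (elim t)
      from filterlim_compose[OF this inverse_Suc_at_0]
      show ?case unfolding s_def by (intro tendsto_mult_right)
    qed
    show "AE t in lborel. norm ((f (t + s m) - f t) / s m * indicator {a..b} t) \<le> L * indicator {a..b} t" for m
    proof (rule AE_I2)
      fix t
      have "\<bar>(f (t + s m) - f t) / s m\<bar> \<le> L"
        using lip[of "t + s m" t] s[of m] by (simp add: abs_divide divide_le_eq)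
      then show "norm ((f (t + s m) - f t) / s m * indicator {a..b} t) \<le> L * indicator {a..b} t"
        by (auto simp: indicator_def)
    qed
  qed (use Dm in measurable)
  moreover have "(\<integral>t. ((f (t + s m) - f t) / s m) * indicator {a..b} t \<partial>lborel) = (F (b + s m) - F b) / s m - (F (a + s m) - F a) / s m" for m
  proof -
    have "(\<integral>t. ((f (t + s m) - f t) / s m) * indicator {a..b} t \<partial>lborel) = (F (b + s m) - F b) / s m - (F (a + s m) - F a) / s m"
    proof (rule integral_FTC_Icc_real[OF ab])
      fix t
      have "((\<lambda>t. F (t + s m)) has_real_derivative f (t + s m)) (at t)"
        using DERIV_shift[THEN iffD1, OF F[of "t + s m"]] .
      from DERIV_cdivide[OF DERIV_diff[OF this F], of "s m"]
      show "((\<lambda>t. (F (t + s m) - F t) / s m) has_real_derivative (f (t + s m) - f t) / s m) (at t)" .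
      have "isCont (\<lambda>t. f (t + s m)) t" by (rule isCont_o2[OF _ ic]) (intro continuous_intros)
      then show "isCont (\<lambda>t. (f (t + s m) - f t) / s m) t" by (intro continuous_intros ic s)
    qed
    then show ?thesis .
  qed
  moreover have "(\<lambda>m. (F (b + s m) - F b) / s m - (F (a + s m) - F a) / s m) \<longlonglongrightarrow> f b - f a"
    by (intro tendsto_diff Flim)
  ultimately show ?thesis using LIMSEQ_unique by (simp only:) 
qed

text \<open>Fubini followed by the fundamental theorem on each section in direction
  \<open>j\<close>. Boxes and the standard simplex both have sections of this form; agreement for
  almost every \<open>t\<close> admits half-open sections.\<close>

lemma integral_pd_slices:
  assumes fin: "finite I" and j: "j \<notin> I" and g: "lip_on (insert j I) L g"
    and A: "A \<in> sets (leb (insert j I))" "emeasure (leb (insert j I)) A < \<infinity>"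
    and sl: "\<And>x. x \<in> space (leb I) \<Longrightarrow> AE t in lborel. indicator A (x(j := t)) = (indicator A' x * indicator {\<alpha> x..\<beta> x} t :: real)"
    and le: "\<And>x. x \<in> A' \<Longrightarrow> \<alpha> x \<le> \<beta> x"
  shows "(\<integral>x. indicator A x * pd j g x \<partial>leb (insert j I)) = (\<integral>x. indicator A' x * (g (x(j := \<beta> x)) - g (x(j := \<alpha> x))) \<partial>leb I)"
proof -
  let ?J = "insert j I"
  have fJ: "finite ?J" using fin by simp
  have pm[measurable]: "pd j g \<in> borel_measurable (leb ?J)" by (rule pd_measurable[OF fJ g])
  have int: "integrable (leb ?J) (\<lambda>x. indicator A x * pd j g x)"
    by (rule integrable_bounded_mult[where c = L]) (use A pd_bound[OF fJ insertI1 g] in \<open>auto intro!: integrable_real_indicator\<close>)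
  have "(\<integral>x. indicator A x * pd j g x \<partial>leb ?J) = (\<integral>x. \<integral>t. indicator A (x(j := t)) * pd j g (x(j := t)) \<partial>lborel \<partial>leb I)"
    by (rule lborel_prod.product_integral_insert[OF fin j int])
  also have "\<dots> = (\<integral>x. indicator A' x * (g (x(j := \<beta> x)) - g (x(j := \<alpha> x))) \<partial>leb I)"
  proof (rule Bochner_Integration.integral_cong[OF refl])
    fix x assume x: "x \<in> space (leb I)"
    have xt[measurable]: "(\<lambda>t. x(j := t)) \<in> measurable borel (leb ?J)"
      using measurable_compose[OF measurable_Pair1'[OF x] measurable_add_dim[of j I "\<lambda>_. lborel"]] by simp
    have Dm: "(\<lambda>t. pd j g (x(j := t))) \<in> borel_measurable borel" by measurable
    have lip: "\<bar>g (x(j := s)) - g (x(j := t))\<bar> \<le> L * \<bar>s - t\<bar>" for s t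
    proof -
      have "(\<Sum>i\<in>?J. \<bar>(x(j := s)) i - (x(j := t)) i\<bar>) = \<bar>s - t\<bar>"
        using fin j by (simp add: sum.insert) (intro sum.neutral; auto)
      then show ?thesis using lip_onD[OF g, of "x(j := s)" "x(j := t)"] by simp
    qed
    have "negligible {t. \<not> (\<exists>l. ((\<lambda>s. (g (x(j := t + s)) - g (x(j := t))) / s) \<longlongrightarrow> l) (at 0))}"
      by (rule Lipschitz_differentiable_ae[where f = "\<lambda>t. g (x(j := t))", OF lip])
    then have "AE t in lebesgue. \<exists>l. ((\<lambda>s. (g (x(j := t + s)) - g (x(j := t))) / s) \<longlongrightarrow> l) (at 0)"
      by (simp add: negligible_iff_null_sets AE_iff_null_sets[symmetric] eventually_ae_filter) (rule bexI, rule order_refl, simp)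
    then have "AE t in lborel. \<exists>l. ((\<lambda>s. (g (x(j := t + s)) - g (x(j := t))) / s) \<longlongrightarrow> l) (at 0)"
      by (simp add: AE_completion_iff)
    then have D: "AE t in lborel. ((\<lambda>s. (g (x(j := t + s)) - g (x(j := t))) / s) \<longlongrightarrow> pd j g (x(j := t))) (at 0)"
    proof eventually_elim
      case (elim t)
      have "(\<lambda>i. (x(j := t)) i + s * (if i = j then 1 else 0)) = x(j := t + s)" for s by auto
      then have iff: "has_dird g (\<lambda>i. if i = j then 1 else 0) (x(j := t)) l \<longleftrightarrow> ((\<lambda>s. (g (x(j := t + s)) - g (x(j := t))) / s) \<longlongrightarrow> l) (at 0)" for l
        unfolding has_dird_def by simp
      obtain l where l: "((\<lambda>s. (g (x(j := t + s)) - g (x(j := t))) / s) \<longlongrightarrow> l) (at 0)" using elim by (elim exE)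
      have "pd j g (x(j := t)) = l" unfolding pd_def by (rule has_dird_imp_dird[OF iff[THEN iffD2, OF l]])
      with l show ?case by (simp only:)
    qed
    have "(\<integral>t. indicator A (x(j := t)) * pd j g (x(j := t)) \<partial>lborel) = (\<integral>t. indicator A' x * (pd j g (x(j := t)) * indicator {\<alpha> x..\<beta> x} t) \<partial>lborel)"
      by (rule integral_cong_AE) (use sl[OF x] A(1) in \<open>auto elim: eventually_mono\<close>)
    also have "\<dots> = indicator A' x * (\<integral>t. pd j g (x(j := t)) * indicator {\<alpha> x..\<beta> x} t \<partial>lborel)" by simp
    also have "\<dots> = indicator A' x * (g (x(j := \<beta> x)) - g (x(j := \<alpha> x)))"
    proof (cases "x \<in> A'")
      case True
      show ?thesis
        unfolding integral_Lipschitz_derivative[where f = "\<lambda>t. g (x(j := t))", OF le[OF True] lip Dm D] ..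
    qed simp
    finally show "(\<integral>t. indicator A (x(j := t)) * pd j g (x(j := t)) \<partial>lborel) = indicator A' x * (g (x(j := \<beta> x)) - g (x(j := \<alpha> x)))" .
  qed
  finally show ?thesis .
qed

text \<open>The upper limit is \<open>max (a j) (b j)\<close> so that the endpoints are ordered even
  for an empty interval, where both sides are 0.\<close>

lemma integral_pd_box:
  assumes fin: "finite I" and j: "j \<notin> I" and g: "lip_on (insert j I) L g"
  shows "(\<integral>x. indicator (Ioc_box (insert j I) a b) x * pd j g x \<partial>leb (insert j I)) =
    (\<integral>x. indicator (Ioc_box I a b) x * (g (x(j := max (a j) (b j))) - g (x(j := a j))) \<partial>leb I)"
proof (rule integral_pd_slices[OF fin j g])
  show "Ioc_box (insert j I) a b \<in> sets (leb (insert j I))" "emeasure (leb (insert j I)) (Ioc_box (insert j I) a b) < \<infinity>"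
    using fin by (intro Ioc_box_sets emeasure_Ioc_box_finite; simp)+
  fix x assume x: "x \<in> space (leb I)"
  have "AE t in lborel. t \<noteq> a j" by (rule AE_lborel_singleton)
  then show "AE t in lborel. indicator (Ioc_box (insert j I) a b) (x(j := t)) = (indicator (Ioc_box I a b) x * indicator {a j..max (a j) (b j)} t :: real)"
  proof eventually_elim
    case (elim t)
    have "x(j := t) \<in> Ioc_box (insert j I) a b \<longleftrightarrow> x \<in> Ioc_box I a b \<and> t \<in> {a j<..b j}"
      using x j by (auto simp: PiE_iff space_PiM extensional_def)
    then show ?case using elim by (auto simp: indicator_def)
  qed
qed auto

text \<open>Over a box, the integral of a partial derivative depends only on values of the function
  on two opposite sides, and these converge with a common bound. \<open>weak_null_sequence\<close>,
  applied to the differences of the derivatives with bound 2 L, passes to all integrable test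
  functions.\<close>

lemma weak_pd:
  assumes fin: "finite I" and j: "j \<in> I" and G: "\<And>m. lip_on I L (G m)" and g: "lip_on I L g"
    and lim: "\<And>x. (\<lambda>m. G m x) \<longlonglongrightarrow> g x" and \<phi>: "integrable (leb I) \<phi>"
  shows "(\<lambda>m. \<integral>x. \<phi> x * pd j (G m) x \<partial>leb I) \<longlonglongrightarrow> (\<integral>x. \<phi> x * pd j g x \<partial>leb I)"
proof -
  define I' where "I' = I - {j}"
  have I: "I = insert j I'" "finite I'" "j \<notin> I'" using fin j by (auto simp: I'_def)
  have mG: "pd j (G m) \<in> borel_measurable (leb I)" for m by (rule pd_measurable[OF fin G])
  have mg: "pd j g \<in> borel_measurable (leb I)" by (rule pd_measurable[OF fin g])
  note iG = integrable_bounded_mult[OF _ mG pd_bound[OF fin j G]]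
  note ig = integrable_bounded_mult[OF _ mg pd_bound[OF fin j g]]
  have "(\<lambda>m. \<integral>x. \<phi> x * (pd j (G m) x - pd j g x) \<partial>leb I) \<longlonglongrightarrow> 0"
  proof (rule weak_null_sequence[OF fin _ _ _ \<phi>, where c = "2 * L"])
    show "(\<lambda>x. pd j (G m) x - pd j g x) \<in> borel_measurable (leb I)" for m by (intro borel_measurable_diff mG mg)
    show "\<bar>pd j (G m) x - pd j g x\<bar> \<le> 2 * L" for m x using pd_bound[OF fin j G, of m x] pd_bound[OF fin j g, of x] by linarith
    fix a b :: "nat \<Rightarrow> real"
    let ?B = "Ioc_box I a b" and ?B' = "Ioc_box I' a b" and ?\<beta> = "max (a j) (b j)"
    have box: "(\<integral>x. indicator ?B x * pd j f x \<partial>leb I) = (\<integral>x. indicator ?B' x * (f (x(j := ?\<beta>)) - f (x(j := a j))) \<partial>leb I')"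
      if "lip_on I L f" for f using integral_pd_box[OF I(2,3), of L f a b] that I(1) by simp
    have m: "(\<lambda>x. f (x(j := c))) \<in> borel_measurable (leb I')" if "lip_on I L f" for f c
      by (rule lip_on_measurable[OF fin that]) (use I in auto)
    have "(\<lambda>m. \<integral>x. indicator ?B' x * (G m (x(j := ?\<beta>)) - G m (x(j := a j))) \<partial>leb I') \<longlonglongrightarrow>
        (\<integral>x. indicator ?B' x * (g (x(j := ?\<beta>)) - g (x(j := a j))) \<partial>leb I')"
    proof (rule integral_dominated_convergence)
      have [measurable]: "?B' \<in> sets (leb I')" using I by (intro Ioc_box_sets)
      have "(\<lambda>x. indicator ?B' x * (f (x(j := ?\<beta>)) - f (x(j := a j)))) \<in> borel_measurable (leb I')" if "lip_on I L f" for f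
        by (intro borel_measurable_times borel_measurable_diff m[OF that]) measurable
      from this[OF g] this[OF G] show "(\<lambda>x. indicator ?B' x * (g (x(j := ?\<beta>)) - g (x(j := a j)))) \<in> borel_measurable (leb I')"
        "\<And>m. (\<lambda>x. indicator ?B' x * (G m (x(j := ?\<beta>)) - G m (x(j := a j)))) \<in> borel_measurable (leb I')" by blast+
      show "integrable (leb I') (\<lambda>x. indicator ?B' x * (L * (?\<beta> - a j)))" using I(2) by simp
      show "AE x in leb I'. (\<lambda>m. indicator ?B' x * (G m (x(j := ?\<beta>)) - G m (x(j := a j)))) \<longlonglongrightarrow> indicator ?B' x * (g (x(j := ?\<beta>)) - g (x(j := a j)))"
        by (intro AE_I2 tendsto_intros lim)
      show "AE x in leb I'. norm (indicator ?B' x * (G m (x(j := ?\<beta>)) - G m (x(j := a j)))) \<le> indicator ?B' x * (L * (?\<beta> - a j))" for m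
      proof (rule AE_I2)
        fix x
        have "(\<Sum>i\<in>I. \<bar>(x(j := ?\<beta>)) i - (x(j := a j)) i\<bar>) = ?\<beta> - a j"
          unfolding I(1) using I(2,3) by (simp add: sum.insert) (intro sum.neutral; auto)
        then show "norm (indicator ?B' x * (G m (x(j := ?\<beta>)) - G m (x(j := a j)))) \<le> indicator ?B' x * (L * (?\<beta> - a j))"
          using lip_onD[OF G[of m], of "x(j := ?\<beta>)" "x(j := a j)"] by (simp add: indicator_def)
      qed
    qed
    then have "(\<lambda>m. (\<integral>x. indicator ?B x * pd j (G m) x \<partial>leb I) - (\<integral>x. indicator ?B x * pd j g x \<partial>leb I)) \<longlonglongrightarrow> 0"
      unfolding box[OF g] box[OF G] by (rule LIM_zero)
    then show "(\<lambda>m. \<integral>x. indicator ?B x * (pd j (G m) x - pd j g x) \<partial>leb I) \<longlonglongrightarrow> 0"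
      by (simp add: right_diff_distrib iG ig fin)
  qed
  then have "(\<lambda>m. (\<integral>x. \<phi> x * pd j (G m) x \<partial>leb I) - (\<integral>x. \<phi> x * pd j g x \<partial>leb I)) \<longlonglongrightarrow> 0"
    by (simp add: right_diff_distrib iG ig \<phi>)
  then show ?thesis by (rule LIM_zero_cancel)
qed

section \<open>Wedge products as determinants\<close>

lemma permutes_lessD: "p permutes {0..<n} \<Longrightarrow> i < n \<Longrightarrow> p i < (n :: nat)"
  using permutes_in_image[of p "{0..<n}" i] by simp

text \<open>Expansion, repeated rows and permuted rows of wedge products are all read off from
  determinants through this identity.\<close>

lemma wedge_det:
  "wedge \<alpha>s ws = det (mat (length \<alpha>s) (length \<alpha>s) (\<lambda>(i, j). (\<alpha>s ! i) (ws ! j)))"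
proof -
  let ?n = "length \<alpha>s"
  have "det (mat ?n ?n (\<lambda>(i, j). (\<alpha>s ! i) (ws ! j))) =
    (\<Sum>p | p permutes {0..<?n}. of_int (sign p) * (\<Prod>i = 0..<?n. mat ?n ?n (\<lambda>(i, j). (\<alpha>s ! i) (ws ! j)) $$ (i, p i)))"
    by (subst det_def'[of _ ?n]) auto
  also have "\<dots> = (\<Sum>p | p permutes {0..<?n}. of_int (sign p) * (\<Prod>i = 0..<?n. (\<alpha>s ! i) (ws ! p i)))"
    by (intro sum.cong refl arg_cong2[of _ _ _ _ "(*)"] prod.cong) (auto simp: permutes_lessD)
  finally show ?thesis by (simp add: wedge_def atLeast0LessThan)
qed

lemma wedge_cong:
  assumes "length \<alpha>s = length \<beta>s"
    and "\<And>i j. i < length \<alpha>s \<Longrightarrow> j < length \<alpha>s \<Longrightarrow> (\<alpha>s ! i) (ws ! j) = (\<beta>s ! i) (vs ! j)"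
  shows "wedge \<alpha>s ws = wedge \<beta>s vs"
  unfolding wedge_det using assms by (intro arg_cong[of _ _ det] eq_matI) auto

lemma wedge_repeated:
  assumes "i < length \<alpha>s" "j < length \<alpha>s" "i \<noteq> j" "\<alpha>s ! i = \<alpha>s ! j"
  shows "wedge \<alpha>s ws = 0"
  unfolding wedge_det by (rule det_identical_rows[of _ _ i j]) (use assms in \<open>auto intro!: eq_vecI\<close>)

lemma wedge_permute:
  assumes p: "p permutes {0..<length \<alpha>s}"
  shows "wedge (map (\<lambda>i. \<alpha>s ! p i) [0..<length \<alpha>s]) ws = of_int (sign p) * wedge \<alpha>s ws"
proof -
  let ?n = "length \<alpha>s"
  have "wedge (map (\<lambda>i. \<alpha>s ! p i) [0..<?n]) ws = det (mat ?n ?n (\<lambda>(i, j). mat ?n ?n (\<lambda>(i, j). (\<alpha>s ! i) (ws ! j)) $$ (p i, j)))"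
    unfolding wedge_det using permutes_lessD[OF p] by (intro arg_cong[of _ _ det] eq_matI) auto
  also have "\<dots> = of_int (sign p) * det (mat ?n ?n (\<lambda>(i, j). (\<alpha>s ! i) (ws ! j)))"
    by (rule det_permute_rows) (use p in auto)
  finally show ?thesis by (simp add: wedge_det)
qed

text \<open>The cofactor of the entry (i, j), kept as a sum over permutations so that boundedness
  and measurability in a parameter can be seen termwise (\<open>am_wcof\<close>).\<close>

definition wcof :: "('a \<Rightarrow> real) list \<Rightarrow> 'a list \<Rightarrow> nat \<Rightarrow> nat \<Rightarrow> real" where
  "wcof \<alpha>s ws i j = (\<Sum>p | p permutes {..<length \<alpha>s} \<and> p i = j.
     of_int (sign p) * (\<Prod>k\<in>{..<length \<alpha>s} - {i}. (\<alpha>s ! k) (ws ! p k)))"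

text \<open>Row \<open>i\<close> is separated from coefficients that do not depend on it. Weak
  convergence can then be applied to this row alone.\<close>

lemma wedge_slot:
  assumes i: "i < length \<alpha>s"
  shows "wedge (\<alpha>s[i := f]) ws = (\<Sum>j<length \<alpha>s. wcof \<alpha>s ws i j * f (ws ! j))"
proof -
  let ?n = "length \<alpha>s"
  have fin: "finite {p. p permutes {..<?n}}" by (rule finite_permutations) simp
  have "wedge (\<alpha>s[i := f]) ws = (\<Sum>p | p permutes {..<?n}. of_int (sign p) * (\<Prod>k\<in>{..<?n} - {i}. (\<alpha>s ! k) (ws ! p k)) * f (ws ! p i))"
    unfolding wedge_def length_list_update
  proof (intro sum.cong refl)
    fix p
    have "(\<Prod>k<?n. (\<alpha>s[i := f] ! k) (ws ! p k)) = f (ws ! p i) * (\<Prod>k\<in>{..<?n} - {i}. (\<alpha>s[i := f] ! k) (ws ! p k))"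
      using i by (subst prod.remove[of _ i]) auto
    also have "(\<Prod>k\<in>{..<?n} - {i}. (\<alpha>s[i := f] ! k) (ws ! p k)) = (\<Prod>k\<in>{..<?n} - {i}. (\<alpha>s ! k) (ws ! p k))"
      by (intro prod.cong) auto
    finally show "of_int (sign p) * (\<Prod>k<?n. (\<alpha>s[i := f] ! k) (ws ! p k)) =
        of_int (sign p) * (\<Prod>k\<in>{..<?n} - {i}. (\<alpha>s ! k) (ws ! p k)) * f (ws ! p i)" by simp
  qed
  also have "\<dots> = (\<Sum>j<?n. \<Sum>p | p \<in> {p. p permutes {..<?n}} \<and> p i = j. of_int (sign p) * (\<Prod>k\<in>{..<?n} - {i}. (\<alpha>s ! k) (ws ! p k)) * f (ws ! p i))"
    by (rule sum.group[symmetric]) (use fin i permutes_in_image in fastforce)+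
  also have "\<dots> = (\<Sum>j<?n. wcof \<alpha>s ws i j * f (ws ! j))"
    by (intro sum.cong refl) (auto simp: wcof_def sum_distrib_right intro!: sum.cong)
  finally show ?thesis .
qed

lemma wedge_slot_linear:
  assumes "i < length \<alpha>s"
  shows "wedge (\<alpha>s[i := \<lambda>w. a * f w + b * g w]) ws = a * wedge (\<alpha>s[i := f]) ws + b * wedge (\<alpha>s[i := g]) ws"
  unfolding wedge_slot[OF assms] by (simp add: sum_distrib_left sum.distrib[symmetric] algebra_simps)

lemma length_omit [simp]: "i < length xs \<Longrightarrow> length (omit i xs) = length xs - 1"
  by (simp add: omit_def min_def)

lemma nth_omit: "i < length xs \<Longrightarrow> j < length xs - 1 \<Longrightarrow> omit i xs ! j = xs ! (if j < i then j else Suc j)"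
  by (auto simp: omit_def nth_append min_def)

lemma map_omit: "map f (omit i xs) = omit i (map f xs)"
  by (simp add: omit_def take_map drop_map)

lemma wedge_laplace_col:
  assumes len: "length \<alpha>s = Suc (length ws)"
  shows "wedge \<alpha>s (w # ws) = (\<Sum>i\<le>length ws. (-1) ^ i * (\<alpha>s ! i) w * wedge (omit i \<alpha>s) ws)"
proof -
  let ?n = "length \<alpha>s"
  let ?A = "mat ?n ?n (\<lambda>(i, j). (\<alpha>s ! i) ((w # ws) ! j))"
  have "wedge \<alpha>s (w # ws) = (\<Sum>i<?n. ?A $$ (i, 0) * cofactor ?A i 0)"
    unfolding wedge_det by (rule laplace_expansion_column) (use len in auto)
  also have "\<dots> = (\<Sum>i\<le>length ws. (-1) ^ i * (\<alpha>s ! i) w * wedge (omit i \<alpha>s) ws)"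
  proof (intro sum.cong)
    fix i assume "i \<in> {..length ws}"
    then have i: "i < ?n" using len by simp
    have "mat_delete ?A i 0 = mat (length (omit i \<alpha>s)) (length (omit i \<alpha>s)) (\<lambda>(k, j). (omit i \<alpha>s ! k) (ws ! j))"
      by (rule eq_matI) (use i len in \<open>auto simp: mat_delete_def nth_omit\<close>)
    moreover have "?A $$ (i, 0) = (\<alpha>s ! i) w" using i len by (subst index_mat(1)) auto
    ultimately show "?A $$ (i, 0) * cofactor ?A i 0 = (-1) ^ i * (\<alpha>s ! i) w * wedge (omit i \<alpha>s) ws"
      by (simp only: cofactor_def wedge_det) simp
  qed (use len in auto)
  finally show ?thesis .
qed

lemma wedge_laplace_row:
  assumes len: "length ws = Suc (length \<alpha>s)"
  shows "wedge (\<alpha> # \<alpha>s) ws = (\<Sum>j\<le>length \<alpha>s. (-1) ^ j * \<alpha> (ws ! j) * wedge \<alpha>s (omit j ws))"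
proof -
  let ?n = "Suc (length \<alpha>s)"
  let ?A = "mat ?n ?n (\<lambda>(i, j). ((\<alpha> # \<alpha>s) ! i) (ws ! j))"
  have "wedge (\<alpha> # \<alpha>s) ws = (\<Sum>j<?n. ?A $$ (0, j) * cofactor ?A 0 j)"
    unfolding wedge_det by (subst laplace_expansion_row[of _ ?n 0]) auto
  also have "\<dots> = (\<Sum>j\<le>length \<alpha>s. (-1) ^ j * \<alpha> (ws ! j) * wedge \<alpha>s (omit j ws))"
  proof (intro sum.cong)
    fix j assume "j \<in> {..length \<alpha>s}"
    then have j: "j < ?n" by simp
    have "mat_delete ?A 0 j = mat (length \<alpha>s) (length \<alpha>s) (\<lambda>(k, l). (\<alpha>s ! k) (omit j ws ! l))"
      by (rule eq_matI) (use j len in \<open>auto simp: mat_delete_def nth_omit\<close>)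
    then show "?A $$ (0, j) * cofactor ?A 0 j = (-1) ^ j * \<alpha> (ws ! j) * wedge \<alpha>s (omit j ws)"
      using j by (simp add: cofactor_def wedge_det)
  qed auto
  finally show ?thesis .
qed

text \<open>Subtracting the first column from the others clears the row of ones behind its first
  entry, and expansion along that row leaves one minor. The case arises on the slanted face of the
  simplex.\<close>

lemma wedge_ones_row:
  assumes len: "length ws = length \<alpha>s"
  shows "wedge ((\<lambda>_. 1) # \<alpha>s) (w # ws) = wedge (map (\<lambda>\<alpha> v. \<alpha> v - \<alpha> w) \<alpha>s) ws"
proof -
  let ?n = "Suc (length \<alpha>s)"
  let ?vs = "w # ws"
  let ?A = "mat ?n ?n (\<lambda>(i, j). (((\<lambda>_. 1) # \<alpha>s) ! i) (?vs ! j))"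
  \<comment> \<open>Multiplication by this matrix on the right is the column operation; it is upper
    triangular with ones on the diagonal.\<close>
  let ?B = "mat ?n ?n (\<lambda>(i, j). if i = j then 1 else if i = 0 then -1 else 0 :: real)"
  let ?C = "mat ?n ?n (\<lambda>(i, j). if j = 0 then ((((\<lambda>_. 1) # \<alpha>s) ! i) w) else ((((\<lambda>_. 1) # \<alpha>s) ! i) (?vs ! j)) - ((((\<lambda>_. 1) # \<alpha>s) ! i) w))"
  have AB: "?A * ?B = ?C"
  proof (rule eq_matI)
    fix i j assume ij: "i < dim_row ?C" "j < dim_col ?C"
    then have "(?A * ?B) $$ (i, j) = (\<Sum>k = 0..<?n. ?A $$ (i, k) * ?B $$ (k, j))"
      by (simp add: scalar_prod_def)
    also have "\<dots> = ?A $$ (i, 0) * ?B $$ (0, j) + (\<Sum>k = Suc 0..<?n. ?A $$ (i, k) * ?B $$ (k, j))"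
      by (subst sum.atLeast_Suc_lessThan) auto
    also have "(\<Sum>k = Suc 0..<?n. ?A $$ (i, k) * ?B $$ (k, j)) = (\<Sum>k = Suc 0..<?n. if k = j then ?A $$ (i, j) else 0)"
      by (intro sum.cong refl) (use ij in auto)
    also have "\<dots> = (if j = 0 then 0 else ?A $$ (i, j))" using ij by (auto simp: sum.delta)
    finally show "(?A * ?B) $$ (i, j) = ?C $$ (i, j)" using ij by (auto split: if_splits)
  qed auto
  have "diag_mat ?B = map (\<lambda>_. 1) [0..<?n]" unfolding diag_mat_def by (rule map_cong) auto
  then have "det ?B = 1"
    by (subst det_upper_triangular[of _ ?n]) (auto simp: map_replicate_const)
  then have "det ?A = det ?C" unfolding AB[symmetric] by (subst det_mult[of _ ?n]) auto
  also have "det ?C = (\<Sum>j<?n. ?C $$ (0, j) * cofactor ?C 0 j)"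
    by (subst laplace_expansion_row[of _ ?n 0]) auto
  also have "\<dots> = cofactor ?C 0 0" by (subst lessThan_Suc_eq_insert_0) (simp add: sum.reindex)
  also have "mat_delete ?C 0 0 = mat (length \<alpha>s) (length \<alpha>s) (\<lambda>(i, j). (map (\<lambda>\<alpha> v. \<alpha> v - \<alpha> w) \<alpha>s ! i) (ws ! j))"
    by (rule eq_matI) (auto simp: mat_delete_def)
  then have "cofactor ?C 0 0 = wedge (map (\<lambda>\<alpha> v. \<alpha> v - \<alpha> w) \<alpha>s) ws" by (simp add: cofactor_def wedge_det)
  finally show ?thesis by (simp add: wedge_det)
qed

section \<open>Stokes' theorem for Lipschitz functions on the standard simplex\<close>

declare One_nat_def [simp del] upt_Suc [simp del]

section \<open>The standard simplex and its interior\<close>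

abbreviation lebn :: "nat \<Rightarrow> (nat \<Rightarrow> real) measure" where
  "lebn n \<equiv> leb {1..n}"

lemma std_Q_eq: "std_Q n = {x \<in> space (lebn n). (\<forall>i\<in>{1..n}. 0 \<le> x i) \<and> (\<Sum>i\<in>{1..n}. x i) \<le> 1}"
  by (auto simp: std_Q_def space_PiM PiE_def)

lemma std_Q_sets[measurable]: "std_Q n \<in> sets (lebn n)"
  unfolding std_Q_eq by measurable

lemma emeasure_std_Q: "emeasure (lebn n) (std_Q n) = ennreal (1 / fact n)"
proof -
  have "std_Q n = {x. (\<forall>i\<in>{1..n}. 0 \<le> x i) \<and> sum x {1..n} \<le> 1} \<inter> space (lebn n)"
    unfolding std_Q_eq by auto
  then show ?thesis using emeasure_std_simplex_aux[of "{1..n}" 1] by simp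
qed

lemma integrable_std_Q[simp]: "integrable (lebn n) (indicator (std_Q n) :: _ \<Rightarrow> real)"
  by (intro integrable_real_indicator) (simp_all add: emeasure_std_Q)

text \<open>The open simplex. At its points, short segments in coordinate directions stay inside, so
  partial derivatives depend only on values in the simplex (\<open>has_dird_cong_qint\<close>). It
  fills \<open>std_Q n\<close> up to a null set.\<close>

definition qint :: "nat \<Rightarrow> (nat \<Rightarrow> real) set" where
  "qint n = {x \<in> extensional {1..n}. (\<forall>i\<in>{1..n}. 0 < x i) \<and> (\<Sum>i\<in>{1..n}. x i) < 1}"

lemma qint_subset: "qint n \<subseteq> std_Q n"
  by (auto simp: qint_def std_Q_def less_imp_le)

lemma sum_ne_ae:
  assumes fin: "finite I" and j: "j \<notin> I"
  shows "AE x in leb (insert j I). (\<Sum>i\<in>insert j I. x i) \<noteq> c"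
proof -
  let ?J = "insert j I"
  define N where "N = {x \<in> space (leb ?J). (\<Sum>i\<in>?J. x i) = c}"
  have N[measurable]: "N \<in> sets (leb ?J)" unfolding N_def by measurable
  have "emeasure (leb ?J) N = (\<integral>\<^sup>+x. indicator N x \<partial>leb ?J)" using N by simp
  also have "\<dots> = (\<integral>\<^sup>+x. \<integral>\<^sup>+t. indicator N (x(j := t)) \<partial>lborel \<partial>leb I)"
    by (rule lborel_prod.product_nn_integral_insert[OF fin j]) simp
  also have "\<dots> = (\<integral>\<^sup>+x. 0 \<partial>leb I)"
  proof (rule nn_integral_cong)
    fix x
    have "indicator N (x(j := t)) \<le> (indicator {c - (\<Sum>i\<in>I. x i)} t :: ennreal)" for t
    proof -
      have "(\<Sum>i\<in>?J. (x(j := t)) i) = t + (\<Sum>i\<in>I. x i)"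
        using fin j by (simp add: sum.insert) (intro sum.cong; auto)
      then show ?thesis by (auto simp: N_def indicator_def)
    qed
    then have "(\<integral>\<^sup>+t. indicator N (x(j := t)) \<partial>lborel) \<le> (\<integral>\<^sup>+t. indicator {c - (\<Sum>i\<in>I. x i)} t \<partial>lborel)"
      by (rule nn_integral_mono)
    also have "\<dots> = 0" by simp
    finally show "(\<integral>\<^sup>+t. indicator N (x(j := t)) \<partial>lborel) = 0" by simp
  qed
  finally have "N \<in> null_sets (leb ?J)" using N by (simp add: null_sets_def)
  from AE_not_in[OF this] AE_space show ?thesis by eventually_elim (simp add: N_def)
qed

lemma qint_ae: "AE x in lebn n. x \<in> std_Q n \<longrightarrow> x \<in> qint n"
proof -
  have "AE x in lebn n. (\<Sum>i\<in>{1..n}. x i) \<noteq> 1"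
  proof (cases n)
    case (Suc m)
    have "{1..n} = insert n {1..m}" unfolding Suc by auto
    have "AE x in lebn n. (\<Sum>i\<in>insert n {1..m}. x i) \<noteq> 1"
      unfolding \<open>{1..n} = insert n {1..m}\<close> by (rule sum_ne_ae) (use Suc in auto)
    then show ?thesis unfolding \<open>{1..n} = insert n {1..m}\<close> .
  qed simp
  moreover have "AE x in lebn n. \<forall>i\<in>{1..n}. x i \<noteq> 0"
    by (intro AE_finite_allI hyperplane_ae) auto
  ultimately show ?thesis
  proof eventually_elim
    case (elim x)
    show ?case
    proof
      assume "x \<in> std_Q n"
      then show "x \<in> qint n" using elim by (auto simp: qint_def std_Q_def less_le)
    qed
  qed
qed

abbreviation pdir :: "nat \<Rightarrow> nat \<Rightarrow> real" where
  "pdir j \<equiv> (\<lambda>i. if i = j then 1 else 0)"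

lemma has_dird_iff_DERIV:
  "has_dird g v x l \<longleftrightarrow> ((\<lambda>t. g (\<lambda>i. x i + t * v i)) has_real_derivative l) (at 0)"
  by (simp add: has_dird_def DERIV_def)

lemma pd_exists_ae:
  assumes "finite I" "lip_on I L g"
  shows "AE x in leb I. \<forall>j. has_dird g (pdir j) x (pd j g x)"
  unfolding AE_all_countable
proof
  fix j
  show "AE x in leb I. has_dird g (pdir j) x (pd j g x)"
    using dird_exists_ae[OF assms, of "pdir j"]
  proof eventually_elim
    case (elim x)
    then obtain l where l: "has_dird g (pdir j) x l" by (elim exE)
    from has_dird_imp_dird[OF this] have "pd j g x = l" by (simp add: pd_def)
    with l show ?case by simp
  qed
qed

lemma pd_eqI: "has_dird g (pdir j) x l \<Longrightarrow> pd j g x = l"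
  unfolding pd_def by (rule has_dird_imp_dird)

lemma has_dird_const: "has_dird (\<lambda>_. c) v x 0"
  by (simp add: has_dird_def)

lemma has_dird_lincomb:
  "has_dird f v x l \<Longrightarrow> has_dird g v x m \<Longrightarrow> has_dird (\<lambda>x. a * f x + b * g x) v x (a * l + b * m)"
  unfolding has_dird_iff_DERIV by (intro DERIV_add DERIV_cmult)

lemma has_dird_mult:
  "has_dird f v x l \<Longrightarrow> has_dird g v x m \<Longrightarrow> has_dird (\<lambda>x. f x * g x) v x (l * g x + f x * m)"
  unfolding has_dird_iff_DERIV
  using DERIV_mult[of "\<lambda>t. f (\<lambda>i. x i + t * v i)" l 0 UNIV "\<lambda>t. g (\<lambda>i. x i + t * v i)" m] by (simp add: mult.commute add.commute)

lemma has_dird_comp: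
  assumes "has_dird g v x m" "(F has_real_derivative D) (at (g x))"
  shows "has_dird (\<lambda>x. F (g x)) v x (D * m)"
  using DERIV_chain2[of F D "\<lambda>t. g (\<lambda>i. x i + t * v i)" 0 m UNIV] assms unfolding has_dird_iff_DERIV by simp

lemma has_dird_local:
  assumes "has_dird g v x l" "\<forall>\<^sub>F t in at 0. g (\<lambda>i. x i + t * v i) = g' (\<lambda>i. x i + t * v i)" "g x = g' x"
  shows "has_dird g' v x l"
  using assms unfolding has_dird_def
  by (auto elim!: Lim_transform_eventually eventually_mono)

lemma has_dird_linear_local:
  assumes "\<forall>\<^sub>F t in at 0. g (\<lambda>i. x i + t * v i) = g x + t * c"
  shows "has_dird g v x c"
  unfolding has_dird_def
proof (rule tendsto_eventually)
  from assms eventually_at_ball'[of 1 0 UNIV] show "\<forall>\<^sub>F t in at 0. (g (\<lambda>i. x i + t * v i) - g x) / t = c"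
    by (auto elim!: eventually_elim2)
qed

lemma qint_line:
  assumes x: "x \<in> qint n" and j: "j \<in> {1..n}"
  shows "\<forall>\<^sub>F t in at 0. (\<lambda>i. x i + t * pdir j i) \<in> qint n"
proof -
  have "\<forall>\<^sub>F t in at (0::real). 0 < x j + t" using x j
    by (intro order_tendstoD[of _ "x j"]) (auto simp: qint_def intro!: tendsto_eq_intros)
  moreover have "\<forall>\<^sub>F t in at (0::real). (\<Sum>i\<in>{1..n}. x i) + t < 1" using x
    by (intro order_tendstoD[of _ "\<Sum>i\<in>{1..n}. x i"]) (auto simp: qint_def intro!: tendsto_eq_intros)
  ultimately show ?thesis
  proof eventually_elim
    case (elim t)
    have "(\<Sum>i\<in>{1..n}. x i + t * pdir j i) = (\<Sum>i\<in>{1..n}. x i) + t"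
      using j by (simp add: sum.distrib if_distrib[of "(*) t"] cong: if_cong)
    then show ?case using elim x j by (auto simp: qint_def extensional_def)
  qed
qed

lemma has_dird_cong_qint:
  assumes "x \<in> qint n" "j \<in> {1..n}" "\<And>y. y \<in> qint n \<Longrightarrow> g y = g' y" "has_dird g (pdir j) x l"
  shows "has_dird g' (pdir j) x l"
  by (rule has_dird_local[OF assms(4)])
    (use qint_line[OF assms(1,2)] assms in \<open>auto elim!: eventually_mono\<close>)

section \<open>Bounded Lipschitz functions and integrals of wedge products\<close>

text \<open>Boundedness is imposed besides the Lipschitz condition so that products stay in the
  class.\<close>

definition bl :: "nat \<Rightarrow> ((nat \<Rightarrow> real) \<Rightarrow> real) \<Rightarrow> bool" where
  "bl n g \<longleftrightarrow> (\<exists>L. lip_on {1..n} L g) \<and> (\<exists>B. \<forall>x. \<bar>g x\<bar> \<le> B)"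

lemma blI: "lip_on {1..n} L g \<Longrightarrow> (\<And>x. \<bar>g x\<bar> \<le> B) \<Longrightarrow> bl n g"
  by (auto simp: bl_def)

lemma blE:
  assumes "bl n g"
  obtains L B where "0 \<le> L" "0 \<le> B" "lip_on {1..n} L g" "\<And>x. \<bar>g x\<bar> \<le> B"
proof -
  obtain L B where L: "lip_on {1..n} L g" "\<And>x. \<bar>g x\<bar> \<le> B" using assms by (auto simp: bl_def)
  have "lip_on {1..n} (max 0 L) g" by (rule lip_on_mono[OF L(1)]) simp
  moreover have "0 \<le> B" using L(2)[of undefined] by simp
  ultimately show ?thesis using that[of "max 0 L" B] L by simp
qed

lemma bl_const: "bl n (\<lambda>_. c)"
  by (rule blI[of n 0 _ "\<bar>c\<bar>"]) (auto simp: lip_on_def)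

lemma bl_lincomb:
  assumes "bl n f" "bl n g"
  shows "bl n (\<lambda>x. a * f x + b * g x)"
proof -
  obtain L B where f: "0 \<le> L" "0 \<le> B" "lip_on {1..n} L f" "\<And>x. \<bar>f x\<bar> \<le> B" using assms blE by blast
  obtain L' B' where g: "0 \<le> L'" "0 \<le> B'" "lip_on {1..n} L' g" "\<And>x. \<bar>g x\<bar> \<le> B'" using assms blE by blast
  show ?thesis
  proof (rule blI)
    show "lip_on {1..n} (\<bar>a\<bar> * L + \<bar>b\<bar> * L') (\<lambda>x. a * f x + b * g x)" unfolding lip_on_def
    proof (intro allI)
      fix x y
      have "\<bar>a * f x + b * g x - (a * f y + b * g y)\<bar> \<le> \<bar>a\<bar> * \<bar>f x - f y\<bar> + \<bar>b\<bar> * \<bar>g x - g y\<bar>"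
        unfolding abs_mult[symmetric] right_diff_distrib by linarith
      also have "\<dots> \<le> \<bar>a\<bar> * (L * (\<Sum>i\<in>{1..n}. \<bar>x i - y i\<bar>)) + \<bar>b\<bar> * (L' * (\<Sum>i\<in>{1..n}. \<bar>x i - y i\<bar>))"
        by (intro add_mono mult_left_mono lip_onD f g) auto
      finally show "\<bar>a * f x + b * g x - (a * f y + b * g y)\<bar> \<le> (\<bar>a\<bar> * L + \<bar>b\<bar> * L') * (\<Sum>i\<in>{1..n}. \<bar>x i - y i\<bar>)"
        by (simp add: ring_distribs mult.assoc)
    qed
    show "\<bar>a * f x + b * g x\<bar> \<le> \<bar>a\<bar> * B + \<bar>b\<bar> * B'" for x
      by (rule order_trans[OF abs_triangle_ineq]) (auto simp: abs_mult intro!: add_mono mult_left_mono f g)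
  qed
qed

lemma bl_mult:
  assumes "bl n f" "bl n g"
  shows "bl n (\<lambda>x. f x * g x)"
proof -
  obtain L B where f: "0 \<le> L" "0 \<le> B" "lip_on {1..n} L f" "\<And>x. \<bar>f x\<bar> \<le> B" using assms blE by blast
  obtain L' B' where g: "0 \<le> L'" "0 \<le> B'" "lip_on {1..n} L' g" "\<And>x. \<bar>g x\<bar> \<le> B'" using assms blE by blast
  show ?thesis
  proof (rule blI)
    show "lip_on {1..n} (B * L' + B' * L) (\<lambda>x. f x * g x)" unfolding lip_on_def
    proof (intro allI)
      fix x y
      have "f x * g x - f y * g y = f x * (g x - g y) + g y * (f x - f y)" by (simp add: algebra_simps)
      then have "\<bar>f x * g x - f y * g y\<bar> \<le> \<bar>f x\<bar> * \<bar>g x - g y\<bar> + \<bar>g y\<bar> * \<bar>f x - f y\<bar>"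
        unfolding abs_mult[symmetric] by linarith
      also have "\<dots> \<le> B * (L' * (\<Sum>i\<in>{1..n}. \<bar>x i - y i\<bar>)) + B' * (L * (\<Sum>i\<in>{1..n}. \<bar>x i - y i\<bar>))"
        by (intro add_mono mult_mono lip_onD f g) auto
      finally show "\<bar>f x * g x - f y * g y\<bar> \<le> (B * L' + B' * L) * (\<Sum>i\<in>{1..n}. \<bar>x i - y i\<bar>)"
        by (simp add: ring_distribs mult.assoc)
    qed
    show "\<bar>f x * g x\<bar> \<le> B * B'" for x unfolding abs_mult by (intro mult_mono f g) auto
  qed
qed

lemma bl_comp:
  assumes g: "bl n g" and F: "\<And>s t. \<bar>F s - F t\<bar> \<le> K * \<bar>s - t\<bar>"
  shows "bl n (\<lambda>x. F (g x))"
proof -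
  obtain L B where g: "0 \<le> L" "0 \<le> B" "lip_on {1..n} L g" "\<And>x. \<bar>g x\<bar> \<le> B" using g blE by blast
  have K: "0 \<le> K" using F[of 0 1] by simp
  show ?thesis
  proof (rule blI)
    show "lip_on {1..n} (K * L) (\<lambda>x. F (g x))" unfolding lip_on_def
    proof (intro allI)
      fix x y
      have "\<bar>F (g x) - F (g y)\<bar> \<le> K * (L * (\<Sum>i\<in>{1..n}. \<bar>x i - y i\<bar>))"
        by (rule order_trans[OF F mult_left_mono[OF lip_onD[OF g(3)] K]])
      then show "\<bar>F (g x) - F (g y)\<bar> \<le> K * L * (\<Sum>i\<in>{1..n}. \<bar>x i - y i\<bar>)" by (simp add: mult.assoc)
    qed
    show "\<bar>F (g x)\<bar> \<le> \<bar>F 0\<bar> + K * B" for x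
    proof -
      have "\<bar>F (g x) - F 0\<bar> \<le> K * B" by (rule order_trans[OF F]) (use K g in \<open>auto intro: mult_left_mono\<close>)
      then show ?thesis by linarith
    qed
  qed
qed

definition jac :: "nat \<Rightarrow> ((nat \<Rightarrow> real) \<Rightarrow> real) list \<Rightarrow> (nat \<Rightarrow> real) \<Rightarrow> real" where
  "jac n hs x = wedge (map (\<lambda>h j. pd j h x) hs) [1..<Suc n]"

text \<open>The weights allowed in front of a wedge product. Partial derivatives of
  \<open>bl\<close> functions and their minors belong to this class, and all its members are
  integrable over the simplex.\<close>

definition am :: "nat \<Rightarrow> ((nat \<Rightarrow> real) \<Rightarrow> real) \<Rightarrow> bool" where
  "am n \<alpha> \<longleftrightarrow> \<alpha> \<in> borel_measurable (lebn n) \<and> (\<exists>B. \<forall>x. \<bar>\<alpha> x\<bar> \<le> B)"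

text \<open>The integral of \<open>\<alpha> dh\<^sub>1 \<and> \<dots> \<and> dh\<^sub>n\<close> over
  the standard simplex, for functions differentiable almost everywhere.\<close>

definition wint :: "nat \<Rightarrow> ((nat \<Rightarrow> real) \<Rightarrow> real) \<Rightarrow> ((nat \<Rightarrow> real) \<Rightarrow> real) list \<Rightarrow> real" where
  "wint n \<alpha> hs = (\<integral>x. indicator (std_Q n) x * (\<alpha> x * jac n hs x) \<partial>lebn n)"

lemma bl_measurable: "bl n g \<Longrightarrow> g \<in> borel_measurable (lebn n)"
  by (erule blE) (rule lip_on_measurable[of "{1..n}"], auto)

lemma bl_am: "bl n g \<Longrightarrow> am n g"
  using bl_measurable by (auto simp: am_def bl_def)

lemma am_mult:
  assumes "am n \<alpha>" "am n \<beta>"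
  shows "am n (\<lambda>x. \<alpha> x * \<beta> x)"
proof -
  obtain A B where "\<And>x. \<bar>\<alpha> x\<bar> \<le> A" "\<And>x. \<bar>\<beta> x\<bar> \<le> B" using assms by (auto simp: am_def)
  then have "\<bar>\<alpha> x * \<beta> x\<bar> \<le> A * B" for x unfolding abs_mult by (intro mult_mono) (auto intro: order_trans[OF abs_ge_zero])
  then show ?thesis using assms by (auto simp: am_def)
qed

lemma am_sum:
  assumes "finite A" "\<And>i. i \<in> A \<Longrightarrow> am n (f i)"
  shows "am n (\<lambda>x. \<Sum>i\<in>A. f i x)"
  using assms
proof (induction A)
  case empty
  then show ?case by (auto simp: am_def)
next
  case (insert i A)
  then have fi: "am n (f i)" and fA: "am n (\<lambda>x. \<Sum>i\<in>A. f i x)" by auto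
  obtain B where "\<And>x. \<bar>f i x\<bar> \<le> B" using fi by (auto simp: am_def)
  moreover obtain B' where "\<And>x. \<bar>\<Sum>i\<in>A. f i x\<bar> \<le> B'" using fA by (auto simp: am_def)
  ultimately have "\<bar>f i x + (\<Sum>i\<in>A. f i x)\<bar> \<le> B + B'" for x by (meson abs_triangle_ineq add_mono order_trans)
  moreover have "(\<lambda>x. f i x + (\<Sum>i\<in>A. f i x)) \<in> borel_measurable (lebn n)"
    using fi fA by (auto simp: am_def)
  ultimately show ?case using insert(1,2) by (auto simp: am_def)
qed

lemma am_prod:
  assumes "finite A" "\<And>i. i \<in> A \<Longrightarrow> am n (f i)"
  shows "am n (\<lambda>x. \<Prod>i\<in>A. f i x)"
  using assms
proof (induction A)
  case empty
  then show ?case by (auto simp: am_def intro: exI[of _ 1])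
next
  case (insert i A)
  then show ?case using am_mult[of n "f i"] by simp
qed

lemma am_const: "am n (\<lambda>_. c)"
  by (auto simp: am_def)

lemma am_pd: "bl n g \<Longrightarrow> j \<in> {1..n} \<Longrightarrow> am n (pd j g)"
  by (erule blE) (auto simp: am_def intro!: pd_measurable[of "{1..n}"] exI pd_bound[of "{1..n}"])

lemma am_jac:
  assumes "length hs = n" "\<And>h. h \<in> set hs \<Longrightarrow> bl n h"
  shows "am n (jac n hs)"
proof -
  have "am n (\<lambda>x. pd ([1..<Suc n] ! p i) (hs ! i) x)" if "p permutes {..<n}" "i < n" for p i
  proof -
    have "p i < n" using permutes_in_image[OF that(1), of i] that(2) by simp
    then have "[1..<Suc n] ! p i \<in> {1..n}" by simp
    then show ?thesis by (intro am_pd) (use assms that in auto)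
  qed
  then have "am n (\<lambda>x. \<Sum>p | p permutes {..<n}. of_int (sign p) * (\<Prod>i<n. pd ([1..<Suc n] ! p i) (hs ! i) x))"
    by (intro am_sum am_mult am_const am_prod) (auto simp: finite_permutations)
  moreover have "jac n hs = (\<lambda>x. \<Sum>p | p permutes {..<n}. of_int (sign p) * (\<Prod>i<n. pd ([1..<Suc n] ! p i) (hs ! i) x))"
    unfolding fun_eq_iff jac_def wedge_def using assms(1) by simp
  ultimately show ?thesis by (simp only:)
qed

lemma am_wcof:
  assumes "length hs = n" "\<And>h. h \<in> set hs \<Longrightarrow> bl n h"
  shows "am n (\<lambda>x. wcof (map (\<lambda>h j. pd j h x) hs) [1..<Suc n] s j)"
proof -
  have "am n (\<lambda>x. pd ([1..<Suc n] ! p i) (hs ! i) x)" if "p permutes {..<n}" "i < n" for p i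
  proof -
    have "p i < n" using permutes_in_image[OF that(1), of i] that(2) by simp
    then have "[1..<Suc n] ! p i \<in> {1..n}" by simp
    then show ?thesis by (intro am_pd) (use assms that in auto)
  qed
  then have "am n (\<lambda>x. \<Sum>p | p permutes {..<n} \<and> p s = j. of_int (sign p) * (\<Prod>i\<in>{..<n} - {s}. pd ([1..<Suc n] ! p i) (hs ! i) x))"
    by (intro am_sum am_mult am_const am_prod) (auto simp: finite_permutations)
  moreover have "wcof (map (\<lambda>h j. pd j h x) hs) [1..<Suc n] s j = (\<Sum>p | p permutes {..<n} \<and> p s = j. of_int (sign p) * (\<Prod>i\<in>{..<n} - {s}. pd ([1..<Suc n] ! p i) (hs ! i) x))" for x
    unfolding wcof_def using assms(1) by simp
  ultimately show ?thesis by (simp only:)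
qed

lemma integrable_am: "am n \<alpha> \<Longrightarrow> integrable (lebn n) (\<lambda>x. indicator (std_Q n) x * \<alpha> x)"
  unfolding am_def by (elim conjE exE) (rule integrable_bounded_mult, auto)

lemma wint_cong_ae:
  assumes "am n \<alpha>" "am n \<alpha>'" "length hs = n" "\<And>h. h \<in> set hs \<Longrightarrow> bl n h" "length hs' = n" "\<And>h. h \<in> set hs' \<Longrightarrow> bl n h"
    and eq: "AE x in lebn n. x \<in> qint n \<longrightarrow> \<alpha> x * jac n hs x = \<alpha>' x * jac n hs' x"
  shows "wint n \<alpha> hs = wint n \<alpha>' hs'"
  unfolding wint_def
proof (rule integral_cong_AE)
  show "(\<lambda>x. indicator (std_Q n) x * (\<alpha> x * jac n hs x)) \<in> borel_measurable (lebn n)"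
    "(\<lambda>x. indicator (std_Q n) x * (\<alpha>' x * jac n hs' x)) \<in> borel_measurable (lebn n)"
    using integrable_am[OF am_mult[OF assms(1) am_jac[OF assms(3,4)]]] integrable_am[OF am_mult[OF assms(2) am_jac[OF assms(5,6)]]]
    by (simp_all add: borel_measurable_integrable)
  show "AE x in lebn n. indicator (std_Q n) x * (\<alpha> x * jac n hs x) = indicator (std_Q n) x * (\<alpha>' x * jac n hs' x)"
    using eq qint_ae by eventually_elim (auto simp: indicator_def)
qed

lemma bl_list_update: "(\<And>h. h \<in> set hs \<Longrightarrow> bl n h) \<Longrightarrow> bl n g \<Longrightarrow> h \<in> set (hs[s := g]) \<Longrightarrow> bl n h"
  using set_update_subset_insert[of hs s g] by auto

text \<open>The integrals become those of partial derivatives of \<open>g\<close> against integrable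
  weights free of \<open>g\<close>, the form required by \<open>weak_pd\<close>. Directions are
  numbered from 1, hence \<open>Suc j\<close>.\<close>

lemma wint_slot:
  assumes \<alpha>: "am n \<alpha>" and hs: "length hs = n" "\<And>h. h \<in> set hs \<Longrightarrow> bl n h" and g: "bl n g" and s: "s < n"
  shows "wint n \<alpha> (hs[s := g]) = (\<Sum>j<n. \<integral>x. (indicator (std_Q n) x * (\<alpha> x * wcof (map (\<lambda>h j. pd j h x) hs) [1..<Suc n] s j)) * pd (Suc j) g x \<partial>lebn n)"
proof -
  have "jac n (hs[s := g]) x = (\<Sum>j<n. wcof (map (\<lambda>h j. pd j h x) hs) [1..<Suc n] s j * pd (Suc j) g x)" for x
    unfolding jac_def map_update using wedge_slot[of s "map (\<lambda>h j. pd j h x) hs" "\<lambda>j. pd j g x" "[1..<Suc n]"] hs s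
    by (simp add: plus_1_eq_Suc)
  then have "wint n \<alpha> (hs[s := g]) = (\<integral>x. (\<Sum>j<n. indicator (std_Q n) x * ((\<alpha> x * wcof (map (\<lambda>h j. pd j h x) hs) [1..<Suc n] s j) * pd (Suc j) g x)) \<partial>lebn n)"
    unfolding wint_def by (simp add: sum_distrib_left mult.assoc)
  also have "\<dots> = (\<Sum>j<n. \<integral>x. indicator (std_Q n) x * ((\<alpha> x * wcof (map (\<lambda>h j. pd j h x) hs) [1..<Suc n] s j) * pd (Suc j) g x) \<partial>lebn n)"
    by (rule Bochner_Integration.integral_sum) (intro integrable_am am_mult \<alpha> am_wcof hs am_pd[OF g], auto)
  finally show ?thesis by (simp only: mult.assoc)
qed

text \<open>The common Lipschitz constant \<open>L\<close> bounds the partial derivatives of all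
  \<open>G m\<close> and passes to the limit \<open>g\<close>; everything outside slot
  \<open>s\<close> is a fixed weight.\<close>

lemma wint_limit:
  assumes \<alpha>: "am n \<alpha>" and hs: "length hs = n" "\<And>h. h \<in> set hs \<Longrightarrow> bl n h" and s: "s < n"
    and G: "\<And>m. lip_on {1..n} L (G m)" "\<And>m. bl n (G m)" and g: "bl n g" and lim: "\<And>x. (\<lambda>m. G m x) \<longlonglongrightarrow> g x"
  shows "(\<lambda>m. wint n \<alpha> (hs[s := G m])) \<longlonglongrightarrow> wint n \<alpha> (hs[s := g])"
proof -
  have gL: "lip_on {1..n} L g" unfolding lip_on_def
  proof (intro allI)
    fix x y
    have "(\<lambda>m. \<bar>G m x - G m y\<bar>) \<longlonglongrightarrow> \<bar>g x - g y\<bar>" by (intro tendsto_intros lim)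
    then show "\<bar>g x - g y\<bar> \<le> L * (\<Sum>i\<in>{1..n}. \<bar>x i - y i\<bar>)" by (rule LIMSEQ_le_const2) (use lip_onD[OF G(1)] in blast)
  qed
  define \<phi> where "\<phi> j x = indicator (std_Q n) x * (\<alpha> x * wcof (map (\<lambda>h j. pd j h x) hs) [1..<Suc n] s j)" for j x
  have slot: "wint n \<alpha> (hs[s := k]) = (\<Sum>j<n. \<integral>x. \<phi> j x * pd (Suc j) k x \<partial>lebn n)" if "bl n k" for k
    unfolding \<phi>_def by (rule wint_slot[OF \<alpha> hs that s])
  have "(\<lambda>m. \<Sum>j<n. \<integral>x. \<phi> j x * pd (Suc j) (G m) x \<partial>lebn n) \<longlonglongrightarrow> (\<Sum>j<n. \<integral>x. \<phi> j x * pd (Suc j) g x \<partial>lebn n)"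
  proof (rule tendsto_sum)
    fix j assume "j \<in> {..<n}"
    moreover have "integrable (lebn n) (\<phi> j)" unfolding \<phi>_def by (intro integrable_am am_mult \<alpha> am_wcof hs)
    ultimately show "(\<lambda>m. \<integral>x. \<phi> j x * pd (Suc j) (G m) x \<partial>lebn n) \<longlonglongrightarrow> (\<integral>x. \<phi> j x * pd (Suc j) g x \<partial>lebn n)"
      by (intro weak_pd[where L = L] G gL lim) simp_all
  qed
  then show ?thesis unfolding slot[OF G(2)] slot[OF g] .
qed

lemma wint_lincomb:
  assumes \<alpha>: "am n \<alpha>" and hs: "length hs = n" "\<And>h. h \<in> set hs \<Longrightarrow> bl n h" and s: "s < n" and f: "bl n f" and g: "bl n g"
  shows "wint n \<alpha> (hs[s := \<lambda>x. a * f x + b * g x]) = a * wint n \<alpha> (hs[s := f]) + b * wint n \<alpha> (hs[s := g])"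
proof -
  obtain L L' where L: "lip_on {1..n} L f" "lip_on {1..n} L' g" using f g by (auto simp: bl_def)
  have u: "\<And>h k. bl n k \<Longrightarrow> h \<in> set (hs[s := k]) \<Longrightarrow> bl n h" using bl_list_update hs(2) by blast
  have i: "integrable (lebn n) (\<lambda>x. indicator (std_Q n) x * (\<alpha> x * jac n (hs[s := k]) x))" if "bl n k" for k
    by (intro integrable_am am_mult \<alpha> am_jac) (use hs u[OF that] in auto)
  have "AE x in lebn n. jac n (hs[s := \<lambda>x. a * f x + b * g x]) x = a * jac n (hs[s := f]) x + b * jac n (hs[s := g]) x"
    using pd_exists_ae[OF finite_atLeastAtMost L(1)] pd_exists_ae[OF finite_atLeastAtMost L(2)]
  proof eventually_elim
    case (elim x)
    have "pd j (\<lambda>x. a * f x + b * g x) x = a * pd j f x + b * pd j g x" for j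
      by (intro pd_eqI has_dird_lincomb) (use elim in auto)
    then show ?case unfolding jac_def map_update
      using wedge_slot_linear[of s "map (\<lambda>h j. pd j h x) hs" a "\<lambda>j. pd j f x" b "\<lambda>j. pd j g x" "[1..<Suc n]"] hs s by simp
  qed
  then have "wint n \<alpha> (hs[s := \<lambda>x. a * f x + b * g x]) =
     (\<integral>x. a * (indicator (std_Q n) x * (\<alpha> x * jac n (hs[s := f]) x)) + b * (indicator (std_Q n) x * (\<alpha> x * jac n (hs[s := g]) x)) \<partial>lebn n)"
    unfolding wint_def
    by (intro integral_cong_AE borel_measurable_integrable i bl_lincomb f g Bochner_Integration.integrable_add integrable_mult_right)
      (auto elim!: eventually_mono simp: algebra_simps)
  also have "\<dots> = a * wint n \<alpha> (hs[s := f]) + b * wint n \<alpha> (hs[s := g])"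
    unfolding wint_def
    by (subst Bochner_Integration.integral_add[OF integrable_mult_right[OF i[OF f]] integrable_mult_right[OF i[OF g]]]) simp
  finally show ?thesis .
qed

lemma wint_const:
  assumes "length hs = n" "s < n"
  shows "wint n \<alpha> (hs[s := \<lambda>_. c]) = 0"
proof -
  have "pd j (\<lambda>_. c) x = 0" for j x by (rule pd_eqI[OF has_dird_const])
  then have "jac n (hs[s := \<lambda>_. c]) x = 0" for x
    unfolding jac_def map_update using assms by (subst wedge_slot) auto
  then show ?thesis by (simp add: wint_def)
qed

text \<open>By the chain rule d(F \<circ> g) = (F' \<circ> g) dg, and the scalar factor moves from
  the row into the weight.\<close>

lemma wint_comp:
  assumes \<alpha>: "am n \<alpha>" and hs: "length hs = n" "\<And>h. h \<in> set hs \<Longrightarrow> bl n h" and s: "s < n" and g: "bl n g"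
    and F: "\<And>t. (F has_real_derivative F' t) (at t)" "bl n (\<lambda>x. F (g x))" "bl n (\<lambda>x. F' (g x))"
  shows "wint n \<alpha> (hs[s := \<lambda>x. F (g x)]) = wint n (\<lambda>x. \<alpha> x * F' (g x)) (hs[s := g])"
proof (rule wint_cong_ae)
  obtain L where L: "lip_on {1..n} L g" using g by (auto simp: bl_def)
  show "AE x in lebn n. x \<in> qint n \<longrightarrow> \<alpha> x * jac n (hs[s := \<lambda>x. F (g x)]) x = \<alpha> x * F' (g x) * jac n (hs[s := g]) x"
    using pd_exists_ae[OF finite_atLeastAtMost L]
  proof eventually_elim
    case (elim x)
    have "pd j (\<lambda>x. F (g x)) x = F' (g x) * pd j g x" for j
      by (intro pd_eqI has_dird_comp F) (use elim in auto)
    then show ?case unfolding jac_def map_update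
      using wedge_slot_linear[of s "map (\<lambda>h j. pd j h x) hs" "F' (g x)" "\<lambda>j. pd j g x" 0 "\<lambda>j. 0" "[1..<Suc n]"] hs s by simp
  qed
qed (use hs bl_list_update[OF hs(2)] F g \<alpha> in \<open>simp_all add: am_mult[OF \<alpha> bl_am[OF F(3)]]\<close>)

declare sum.cl_ivl_Suc [simp del]

lemma coord_measurable: "j \<in> {1..k} \<Longrightarrow> (\<lambda>x. x j) \<in> borel_measurable (lebn k)"
  using measurable_component_singleton[of j "{1..k}" "\<lambda>_. lborel"] by simp

section \<open>Faces of the standard simplex and integration over sections\<close>

definition ins :: "nat \<Rightarrow> real \<Rightarrow> (nat \<Rightarrow> real) \<Rightarrow> nat \<Rightarrow> real" where
  "ins m c y = (\<lambda>j. if j < m then y j else if j = m then c else y (j - 1))"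

definition shift :: "nat \<Rightarrow> nat \<Rightarrow> nat" where
  "shift m l = (if l < m then l else Suc l)"

text \<open>The face maps given by formulas that make sense for every function, so that composition
  preserves the global Lipschitz property; on \<open>std_Q k\<close> they agree with
  \<open>face_map (Suc k) i\<close> (\<open>face_map_eq\<close>). Face 0 is the slanted one,
  opposite the origin, where the coordinates sum to 1.\<close>

definition face :: "nat \<Rightarrow> nat \<Rightarrow> (nat \<Rightarrow> real) \<Rightarrow> nat \<Rightarrow> real" where
  "face k i y = (if i = 0 then ins 1 (1 - (\<Sum>l\<in>{1..k}. y l)) y else ins i 0 y)"

lemma ins_shift [simp]: "ins m c y (shift m l) = y l" "ins m c y m = c"
  by (auto simp: ins_def shift_def)

lemma shift_bij: "m \<in> {1..Suc k} \<Longrightarrow> bij_betw (shift m) {1..k} ({1..Suc k} - {m})"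
  by (rule bij_betwI[where g = "\<lambda>j. if j < m then j else j - 1"]) (auto simp: shift_def split: if_splits)

lemma sum_shift: "m \<in> {1..Suc k} \<Longrightarrow> (\<Sum>j\<in>{1..Suc k}. h j) = h m + (\<Sum>l\<in>{1..k}. h (shift m l))"
  by (simp add: sum.remove[of "{1..Suc k}" m] sum.reindex_bij_betw[OF shift_bij, symmetric])

lemma ball_shift: "m \<in> {1..Suc k} \<Longrightarrow> (\<forall>j\<in>{1..Suc k}. P j) \<longleftrightarrow> P m \<and> (\<forall>l\<in>{1..k}. P (shift m l))"
proof -
  assume m: "m \<in> {1..Suc k}"
  have "{1..Suc k} = insert m (shift m ` {1..k})" using bij_betw_imp_surj_on[OF shift_bij[OF m]] m by auto
  then show ?thesis by auto
qed

lemma ins_extensional: "m \<in> {1..Suc k} \<Longrightarrow> y \<in> extensional {1..k} \<Longrightarrow> ins m c y \<in> extensional {1..Suc k}"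
proof -
  assume m: "m \<in> {1..Suc k}" and y: "y \<in> extensional {1..k}"
  have "ins m c y j = undefined" if "j \<notin> {1..Suc k}" for j
  proof -
    show ?thesis
    proof (cases j)
      case 0
      have "y 0 = undefined" by (rule extensional_arb[OF y]) simp
      then show ?thesis using 0 m by (simp add: ins_def)
    next
      case (Suc i)
      then have "Suc k < j" using that by (simp add: not_le Suc_le_eq)
      moreover have "y i = undefined" by (rule extensional_arb[OF y]) (use Suc \<open>Suc k < j\<close> in simp)
      ultimately show ?thesis using Suc m by (simp add: ins_def)
    qed
  qed
  then show ?thesis by (simp add: extensional_def)
qed

lemma face_in_std_Q:
  assumes i: "i \<le> Suc k" and y: "y \<in> std_Q k"
  shows "face k i y \<in> std_Q (Suc k)"
proof -
  have *: "ins m c y \<in> std_Q (Suc k)" if m: "m \<in> {1..Suc k}" and c: "0 \<le> c" "c + (\<Sum>l\<in>{1..k}. y l) \<le> 1" for m c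
    using y ins_extensional[OF m, of y c] c unfolding std_Q_def
    by (simp add: ball_shift[OF m] sum_shift[OF m])
  have s: "(\<Sum>l\<in>{1..k}. y l) \<le> 1" using y by (simp add: std_Q_def)
  show ?thesis
  proof (cases "i = 0")
    case True
    have "ins 1 (1 - (\<Sum>l\<in>{1..k}. y l)) y \<in> std_Q (Suc k)" by (rule *) (use s in auto)
    then show ?thesis using True by (simp add: face_def)
  next
    case False
    have "ins i 0 y \<in> std_Q (Suc k)" by (rule *) (use s i False in auto)
    then show ?thesis using False by (simp add: face_def)
  qed
qed

lemma face_diff:
  assumes i: "i \<le> Suc k"
  shows "(\<Sum>j\<in>{1..Suc k}. \<bar>face k i x j - face k i y j\<bar>) \<le> 2 * (\<Sum>l\<in>{1..k}. \<bar>x l - y l\<bar>)"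
proof -
  have *: "(\<Sum>j\<in>{1..Suc k}. \<bar>ins m c x j - ins m d y j\<bar>) = \<bar>c - d\<bar> + (\<Sum>l\<in>{1..k}. \<bar>x l - y l\<bar>)"
    if "m \<in> {1..Suc k}" for m c d by (simp add: sum_shift[OF that])
  have "\<bar>(\<Sum>l\<in>{1..k}. y l) - (\<Sum>l\<in>{1..k}. x l)\<bar> \<le> (\<Sum>l\<in>{1..k}. \<bar>x l - y l\<bar>)"
    unfolding sum_subtractf[symmetric] by (rule order_trans[OF sum_abs]) (simp add: abs_minus_commute)
  moreover have "0 \<le> (\<Sum>l\<in>{1..k}. \<bar>x l - y l\<bar>)" by (rule sum_nonneg) simp
  ultimately show ?thesis using i unfolding face_def by (cases "i = 0") (simp_all add: *)
qed

lemma lip_face: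
  assumes g: "lip_on {1..Suc k} L g" and i: "i \<le> Suc k"
  shows "lip_on {1..k} (2 * L) (\<lambda>y. g (face k i y))"
  unfolding lip_on_def
proof (intro allI)
  fix x y
  have L: "0 \<le> L" by (rule lip_on_nonneg[OF g]) auto
  have "\<bar>g (face k i x) - g (face k i y)\<bar> \<le> L * (2 * (\<Sum>l\<in>{1..k}. \<bar>x l - y l\<bar>))"
    by (rule order_trans[OF lip_onD[OF g] mult_left_mono[OF face_diff[OF i] L]])
  then show "\<bar>g (face k i x) - g (face k i y)\<bar> \<le> 2 * L * (\<Sum>l\<in>{1..k}. \<bar>x l - y l\<bar>)" by simp
qed

lemma bl_face: "bl (Suc k) g \<Longrightarrow> i \<le> Suc k \<Longrightarrow> bl k (\<lambda>y. g (face k i y))"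
  unfolding bl_def using lip_face by blast

lemma leb_reindex:
  assumes t: "bij_betw t B A" and fin: "finite A"
  shows "distr (leb A) (leb B) (\<lambda>y. \<lambda>j\<in>B. y (t j)) = leb B"
proof (rule lborel_prod.PiM_eqI)
  have finB: "finite B" using bij_betw_finite[OF t] fin by simp
  then show "finite B" .
  have tA: "t j \<in> A" if "j \<in> B" for j using t that by (auto simp: bij_betw_def)
  have meas: "(\<lambda>y. \<lambda>j\<in>B. y (t j)) \<in> measurable (leb A) (leb B)"
    by (rule measurable_restrict) (use tA in simp)
  fix E :: "nat \<Rightarrow> real set" assume E: "\<And>i. i \<in> B \<Longrightarrow> E i \<in> sets lborel"
  define u where "u = the_inv_into B t"
  have u: "u (t j) = j" if "j \<in> B" for j unfolding u_def using t that by (auto simp: bij_betw_def the_inv_into_f_f)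
  have u': "t (u i) = i" "u i \<in> B" if "i \<in> A" for i
    using that t unfolding u_def by (auto simp: bij_betw_def f_the_inv_into_f the_inv_into_into)
  have "emeasure (distr (leb A) (leb B) (\<lambda>y. \<lambda>j\<in>B. y (t j))) (Pi\<^sub>E B E) =
    emeasure (leb A) ((\<lambda>y. \<lambda>j\<in>B. y (t j)) -` Pi\<^sub>E B E \<inter> space (leb A))"
    using E finB by (intro emeasure_distr meas sets_PiM_I_finite) auto
  also have "(\<lambda>y. \<lambda>j\<in>B. y (t j)) -` Pi\<^sub>E B E \<inter> space (leb A) = Pi\<^sub>E A (\<lambda>i. E (u i))"
  proof (intro equalityI subsetI)
    fix y assume "y \<in> (\<lambda>y. \<lambda>j\<in>B. y (t j)) -` Pi\<^sub>E B E \<inter> space (leb A)"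
    then have "y \<in> extensional A" "\<And>j. j \<in> B \<Longrightarrow> y (t j) \<in> E j" by (auto simp: space_PiM PiE_iff)
    then show "y \<in> Pi\<^sub>E A (\<lambda>i. E (u i))" using u' by (metis PiE_iff)
  next
    fix y assume y: "y \<in> Pi\<^sub>E A (\<lambda>i. E (u i))"
    show "y \<in> (\<lambda>y. \<lambda>j\<in>B. y (t j)) -` Pi\<^sub>E B E \<inter> space (leb A)"
    proof -
      have "y (t j) \<in> E j" if "j \<in> B" for j
        using PiE_mem[OF y tA[OF that]] u[OF that] by simp
      then show ?thesis using y by (simp add: space_PiM PiE_iff)
    qed
  qed
  also have "emeasure (leb A) \<dots> = (\<Prod>i\<in>A. emeasure lborel (E (u i)))"
    using fin E u' by (intro lborel_prod.emeasure_PiM) auto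
  also have "\<dots> = (\<Prod>j\<in>B. emeasure lborel (E (u (t j))))"
    by (rule prod.reindex_bij_betw[OF t, symmetric])
  also have "\<dots> = (\<Prod>j\<in>B. emeasure lborel (E j))" by (intro prod.cong refl) (simp add: u)
  finally show "emeasure (distr (leb A) (leb B) (\<lambda>y. \<lambda>j\<in>B. y (t j))) (Pi\<^sub>E B E) = (\<Prod>i\<in>B. emeasure lborel (E i))" .
qed simp

text \<open>A section in direction \<open>m\<close> is the interval from 0 to 1 minus the sum of the
  other coordinates; its ends lie on the face where coordinate \<open>m\<close> is 0 and on the
  slanted face. The base is a simplex in the coordinates other than \<open>m\<close>, which are then
  renumbered by {1..k}.\<close>

lemma integral_pd_std_Q:
  assumes m: "m \<in> {1..Suc k}" and f: "lip_on {1..Suc k} L f"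
  shows "(\<integral>x. indicator (std_Q (Suc k)) x * pd m f x \<partial>lebn (Suc k)) =
    (\<integral>y. indicator (std_Q k) y * (f (ins m (1 - (\<Sum>l\<in>{1..k}. y l)) y) - f (ins m 0 y)) \<partial>lebn k)"
proof -
  define B where "B = {1..Suc k} - {m}"
  have B: "finite B" "m \<notin> B" "{1..Suc k} = insert m B" using m by (auto simp: B_def)
  define A' where "A' = {x \<in> space (leb B). (\<forall>i\<in>B. 0 \<le> x i) \<and> (\<Sum>i\<in>B. x i) \<le> 1}"
  have A'[measurable]: "A' \<in> sets (leb B)" unfolding A'_def using B(1) by measurable
  define \<Psi> where "\<Psi> x = indicator A' x * (f (x(m := 1 - (\<Sum>i\<in>B. x i))) - f (x(m := 0)))" for x
  have "(\<integral>x. indicator (std_Q (Suc k)) x * pd m f x \<partial>lebn (Suc k)) = (\<integral>x. \<Psi> x \<partial>leb B)"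
    unfolding \<Psi>_def B(3)
  proof (rule integral_pd_slices[OF B(1,2)])
    show "lip_on (insert m B) L f" using f B(3) by simp
    show "std_Q (Suc k) \<in> sets (leb (insert m B))" "emeasure (leb (insert m B)) (std_Q (Suc k)) < \<infinity>"
      using std_Q_sets[of "Suc k"] emeasure_std_Q[of "Suc k"] by (simp_all add: B(3)[symmetric])
    show "0 \<le> 1 - (\<Sum>i\<in>B. x i)" if "x \<in> A'" for x using that by (simp add: A'_def)
    fix x assume x: "x \<in> space (leb B)"
    have "indicator (std_Q (Suc k)) (x(m := t)) = (indicator A' x * indicator {0..1 - (\<Sum>i\<in>B. x i)} t :: real)" for t
    proof -
      have "(\<Sum>i\<in>insert m B. (x(m := t)) i) = t + (\<Sum>i\<in>B. x i)"
        using B(1,2) by (simp add: sum.insert) (intro sum.cong; auto)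
      moreover have "x(m := t) \<in> extensional (insert m B)" using x by (auto simp: space_PiM PiE_def extensional_def)
      moreover have "(\<forall>i\<in>insert m B. 0 \<le> (x(m := t)) i) \<longleftrightarrow> 0 \<le> t \<and> (\<forall>i\<in>B. 0 \<le> x i)" using B(2) by auto
      ultimately have "x(m := t) \<in> std_Q (Suc k) \<longleftrightarrow> x \<in> A' \<and> t \<in> {0..1 - (\<Sum>i\<in>B. x i)}"
        unfolding std_Q_def A'_def B(3) mem_Collect_eq using x by auto
      then show ?thesis by (simp add: indicator_def)
    qed
    then show "AE t in lborel. indicator (std_Q (Suc k)) (x(m := t)) = (indicator A' x * indicator {0..1 - (\<Sum>i\<in>B. x i)} t :: real)"
      by (intro AE_I2)
  qed
  also have "\<dots> = (\<integral>x. \<Psi> x \<partial>distr (lebn k) (leb B) (\<lambda>y. \<lambda>j\<in>B. y (if j < m then j else j - 1)))"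
  proof -
    have "bij_betw (\<lambda>j. if j < m then j else j - 1) B {1..k}"
      by (rule bij_betwI[where g = "shift m"]) (use m in \<open>auto simp: shift_def B_def split: if_splits\<close>)
    from leb_reindex[OF this] show ?thesis by simp
  qed
  also have "\<dots> = (\<integral>y. \<Psi> (\<lambda>j\<in>B. y (if j < m then j else j - 1)) \<partial>lebn k)"
  proof (rule integral_distr)
    show "(\<lambda>y. \<lambda>j\<in>B. y (if j < m then j else j - 1)) \<in> measurable (lebn k) (leb B)"
      by (rule measurable_restrict) (use m in \<open>auto simp: B_def intro!: coord_measurable\<close>)
    have "(\<lambda>x. f (x(m := 1 - (\<Sum>i\<in>B. x i)))) \<in> borel_measurable (leb B)" "(\<lambda>x. f (x(m := 0))) \<in> borel_measurable (leb B)"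
      by (rule lip_on_measurable[OF _ f], use B in auto)+
    then show "\<Psi> \<in> borel_measurable (leb B)" unfolding \<Psi>_def by measurable
  qed
  also have "\<dots> = (\<integral>y. indicator (std_Q k) y * (f (ins m (1 - (\<Sum>l\<in>{1..k}. y l)) y) - f (ins m 0 y)) \<partial>lebn k)"
  proof (rule Bochner_Integration.integral_cong[OF refl])
    fix y assume y: "y \<in> space (lebn k)"
    let ?z = "\<lambda>j\<in>B. y (if j < m then j else j - 1)"
    have zs: "?z (shift m l) = y l" if "l \<in> {1..k}" for l
      using bij_betwE[OF shift_bij[OF m]] that by (auto simp: B_def shift_def)
    have bs: "bij_betw (shift m) {1..k} B" unfolding B_def by (rule shift_bij[OF m])
    have sum: "(\<Sum>i\<in>B. ?z i) = (\<Sum>l\<in>{1..k}. y l)"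
      unfolding sum.reindex_bij_betw[OF bs, symmetric] by (intro sum.cong refl zs)
    have "(\<forall>i\<in>B. 0 \<le> ?z i) \<longleftrightarrow> (\<forall>l\<in>{1..k}. 0 \<le> ?z (shift m l))"
      using bij_betw_imp_surj_on[OF bs] by blast
    then have "(\<forall>i\<in>B. 0 \<le> ?z i) \<longleftrightarrow> (\<forall>l\<in>{1..k}. 0 \<le> y l)" using zs by simp
    then have "?z \<in> A' \<longleftrightarrow> y \<in> std_Q k" using y by (simp add: A'_def std_Q_eq sum[simplified] space_PiM)
    moreover have "f (?z(m := c)) = f (ins m c y)" for c
      by (rule lip_on_cong[OF f]) (auto simp: ins_def B_def)
    ultimately show "\<Psi> ?z = indicator (std_Q k) y * (f (ins m (1 - (\<Sum>l\<in>{1..k}. y l)) y) - f (ins m 0 y))"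
      unfolding \<Psi>_def sum by (simp add: indicator_def)
  qed
  finally show ?thesis .
qed

text \<open>On each line in direction \<open>j\<close> the map is t \<mapsto> s - t, with s equal to
  1 minus the sum of the other coordinates. It reverses the section of the simplex and preserves
  Lebesgue measure.\<close>

lemma integral_reflect:
  assumes j: "j \<in> {1..k}" and \<Phi>: "am k \<Phi>"
  shows "(\<integral>y. indicator (std_Q k) y * \<Phi> (y(j := 1 - (\<Sum>l\<in>{1..k}. y l))) \<partial>lebn k) = (\<integral>y. indicator (std_Q k) y * \<Phi> y \<partial>lebn k)"
proof -
  define I where "I = {1..k} - {j}"
  have I: "finite I" "j \<notin> I" "{1..k} = insert j I" using j by (auto simp: I_def)
  have sumI: "(\<Sum>l\<in>insert j I. (x(j := t)) l) = t + (\<Sum>l\<in>I. x l)" for x :: "nat \<Rightarrow> real" and t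
    using I(1,2) by (simp add: sum.insert) (intro sum.cong; auto)
  have Qiff: "x(j := t) \<in> std_Q k \<longleftrightarrow> x(j := 1 - (\<Sum>l\<in>I. x l) - t) \<in> std_Q k" for x t
  proof -
    have ext: "x(j := t) \<in> extensional (insert j I) \<longleftrightarrow> x \<in> extensional (insert j I)" for t by (auto simp: extensional_def)
    have ball: "(\<forall>i\<in>insert j I. 0 \<le> (x(j := t)) i) \<longleftrightarrow> 0 \<le> t \<and> (\<forall>i\<in>I. 0 \<le> x i)" for t using I(2) by auto
    show ?thesis unfolding std_Q_def I(3) mem_Collect_eq sumI ball ext by auto
  qed
  have "(\<lambda>y. y(j := 1 - (\<Sum>l\<in>{1..k}. y l))) \<in> measurable (lebn k) (lebn k)"
  proof (rule measurable_fun_upd[where J = "{1..k}"])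
    show "{1..k} = {1..k} \<union> {j}" using j by auto
  qed auto
  then have \<Phi>': "am k (\<lambda>y. \<Phi> (y(j := 1 - (\<Sum>l\<in>{1..k}. y l))))"
    using \<Phi> unfolding am_def by (auto intro: measurable_compose[where N = "lebn k"])
  have "(\<integral>y. indicator (std_Q k) y * \<Phi> (y(j := 1 - (\<Sum>l\<in>{1..k}. y l))) \<partial>lebn k) =
    (\<integral>x. \<integral>t. indicator (std_Q k) (x(j := t)) * \<Phi> ((x(j := t))(j := 1 - (\<Sum>l\<in>{1..k}. (x(j := t)) l))) \<partial>lborel \<partial>leb I)"
    using lborel_prod.product_integral_insert[OF I(1,2), folded I(3), OF integrable_am[OF \<Phi>']] .
  also have "\<dots> = (\<integral>x. \<integral>t. indicator (std_Q k) (x(j := t)) * \<Phi> (x(j := t)) \<partial>lborel \<partial>leb I)"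
  proof (rule Bochner_Integration.integral_cong[OF refl])
    fix x assume "x \<in> space (leb I)"
    define s where "s = 1 - (\<Sum>l\<in>I. x l)"
    define K where "K t = indicator (std_Q k) (x(j := t)) * \<Phi> (x(j := t))" for t
    have K: "indicator (std_Q k) (x(j := t)) * \<Phi> ((x(j := t))(j := 1 - (\<Sum>l\<in>{1..k}. (x(j := t)) l))) = K (s + (-1) * t)" for t
    proof -
      have "1 - (\<Sum>l\<in>{1..k}. (x(j := t)) l) = s + (-1) * t" unfolding I(3) sumI s_def by simp
      moreover have "x(j := t) \<in> std_Q k \<longleftrightarrow> x(j := s + (-1) * t) \<in> std_Q k" using Qiff[of x t] by (simp add: s_def)
      ultimately show ?thesis by (simp add: K_def indicator_def)
    qed
    show "(\<integral>t. indicator (std_Q k) (x(j := t)) * \<Phi> ((x(j := t))(j := 1 - (\<Sum>l\<in>{1..k}. (x(j := t)) l))) \<partial>lborel) = (\<integral>t. indicator (std_Q k) (x(j := t)) * \<Phi> (x(j := t)) \<partial>lborel)"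
      unfolding K unfolding K_def[symmetric] using lborel_integral_real_affine[of "-1" K s] by simp
  qed
  also have "\<dots> = (\<integral>y. indicator (std_Q k) y * \<Phi> y \<partial>lebn k)"
    using lborel_prod.product_integral_insert[OF I(1,2), folded I(3), OF integrable_am[OF \<Phi>]] by simp
  finally show ?thesis .
qed

lemma ins_measurable:
  assumes "bl (Suc k) f" and c: "c \<in> borel_measurable (lebn k)" and m: "m \<in> {1..Suc k}"
  shows "am k (\<lambda>y. f (ins m (c y) y))"
proof -
  obtain L B where L: "lip_on {1..Suc k} L f" "\<And>x. \<bar>f x\<bar> \<le> B" using assms(1) by (auto simp: bl_def)
  have "(\<lambda>y. f (ins m (c y) y)) \<in> borel_measurable (lebn k)"
  proof (rule lip_on_measurable[OF _ L(1)])
    show "(\<lambda>y. ins m (c y) y i) \<in> borel_measurable (lebn k)" if "i \<in> {1..Suc k}" for i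
      using that c m unfolding ins_def by (cases "i < m"; cases "i = m") (auto intro!: coord_measurable)
  qed simp
  then show ?thesis using L(2) by (auto simp: am_def)
qed

text \<open>The slanted face is a graph over each coordinate hyperplane. Passing from chart
  \<open>m\<close> to chart m + 1 exchanges the free coordinate \<open>m\<close> with the dependent
  one, which is the substitution of \<open>integral_reflect\<close>; so every chart yields the
  integral of the chart used in \<open>face\<close>.\<close>

lemma slanted_face_chart:
  assumes f: "bl (Suc k) f" and m: "m \<in> {1..Suc k}"
  shows "(\<integral>y. indicator (std_Q k) y * f (ins m (1 - (\<Sum>l\<in>{1..k}. y l)) y) \<partial>lebn k) =
    (\<integral>y. indicator (std_Q k) y * f (ins 1 (1 - (\<Sum>l\<in>{1..k}. y l)) y) \<partial>lebn k)"
proof -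
  have "1 \<le> m \<Longrightarrow> m \<le> Suc k \<Longrightarrow> ?thesis"
  proof (induction m rule: dec_induct)
    case (step m)
    then have m: "m \<in> {1..k}" by auto
    define \<Phi> where "\<Phi> y = f (ins m (1 - (\<Sum>l\<in>{1..k}. y l)) y)" for y
    have \<Phi>: "am k \<Phi>" unfolding \<Phi>_def by (rule ins_measurable[OF f]) (use m in auto)
    have "\<Phi> (y(m := 1 - (\<Sum>l\<in>{1..k}. y l))) = f (ins (Suc m) (1 - (\<Sum>l\<in>{1..k}. y l)) y)" for y
    proof -
      have "(\<Sum>l\<in>{1..k}. (y(m := 1 - (\<Sum>l\<in>{1..k}. y l))) l) = 1 - y m"
      proof -
        have "(\<Sum>l\<in>{1..k}. (y(m := c)) l) = c - y m + (\<Sum>l\<in>{1..k}. y l)" for c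
          using m by (simp add: sum.remove[of "{1..k}" m])
        then show ?thesis by simp
      qed
      then show ?thesis unfolding \<Phi>_def by (intro arg_cong[of _ _ f]) (auto simp: ins_def fun_eq_iff less_Suc_eq)
    qed
    then have "(\<integral>y. indicator (std_Q k) y * f (ins (Suc m) (1 - (\<Sum>l\<in>{1..k}. y l)) y) \<partial>lebn k) = (\<integral>y. indicator (std_Q k) y * \<Phi> y \<partial>lebn k)"
      using integral_reflect[OF m \<Phi>] by simp
    also have "\<dots> = (\<integral>y. indicator (std_Q k) y * f (ins 1 (1 - (\<Sum>l\<in>{1..k}. y l)) y) \<partial>lebn k)"
      unfolding \<Phi>_def using step by simp
    finally show ?case .
  qed simp
  then show ?thesis using m by simp
qed

text \<open>Coordinate functions clamped to [0,1]: this makes them bounded, as \<open>bl\<close>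
  demands, and leaves them unchanged on the simplex.\<close>

definition xc :: "nat \<Rightarrow> (nat \<Rightarrow> real) \<Rightarrow> real" where
  "xc j x = max 0 (min 1 (x j))"

lemma bl_xc: "j \<in> {1..n} \<Longrightarrow> bl n (xc j)"
proof (rule blI[of _ 1 _ 1])
  assume j: "j \<in> {1..n}"
  show "lip_on {1..n} 1 (xc j)" unfolding lip_on_def
  proof (intro allI)
    fix x y :: "nat \<Rightarrow> real"
    have "\<bar>xc j x - xc j y\<bar> \<le> \<bar>x j - y j\<bar>" by (auto simp: xc_def)
    also have "\<dots> \<le> (\<Sum>i\<in>{1..n}. \<bar>x i - y i\<bar>)" using j by (intro member_le_sum[of j _ "\<lambda>i. \<bar>x i - y i\<bar>"]) auto
    finally show "\<bar>xc j x - xc j y\<bar> \<le> 1 * (\<Sum>i\<in>{1..n}. \<bar>x i - y i\<bar>)" by simp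
  qed
  show "\<bar>xc j x\<bar> \<le> 1" for x by (auto simp: xc_def)
qed

lemma std_Q_le_1: "x \<in> std_Q n \<Longrightarrow> j \<in> {1..n} \<Longrightarrow> 0 \<le> x j \<and> x j \<le> 1"
proof -
  assume x: "x \<in> std_Q n" and j: "j \<in> {1..n}"
  then have "x j \<le> (\<Sum>i\<in>{1..n}. x i)" by (intro member_le_sum) (auto simp: std_Q_def)
  then show ?thesis using x j by (auto simp: std_Q_def)
qed

lemma xc_std_Q: "x \<in> std_Q n \<Longrightarrow> j \<in> {1..n} \<Longrightarrow> xc j x = x j"
  using std_Q_le_1 by (fastforce simp: xc_def)

lemma pd_xc: "x \<in> qint n \<Longrightarrow> j \<in> {1..n} \<Longrightarrow> m \<in> {1..n} \<Longrightarrow> pd m (xc j) x = (if m = j then 1 else 0)"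
proof (rule pd_eqI, rule has_dird_cong_qint[where g = "\<lambda>x. x j"])
  show "has_dird (\<lambda>x. x j) (pdir m) x (if m = j then 1 else 0)"
    by (rule has_dird_linear_local) auto
  show "y \<in> qint n \<Longrightarrow> y j = xc j y" if "j \<in> {1..n}" for y
    using that xc_std_Q qint_subset by (metis subsetD)
qed

text \<open>The derivative in direction \<open>l\<close> of the j-th coordinate of the i-th face
  map, constant because the face maps are affine.\<close>

definition dface :: "nat \<Rightarrow> nat \<Rightarrow> nat \<Rightarrow> real" where
  "dface i j l = (if i = 0 then (if shift 1 l = j then 1 else 0) - (if j = 1 then 1 else 0) else (if shift i l = j then 1 else 0))"

lemma face_affine:
  assumes i: "i \<le> Suc k" and j: "j \<in> {1..Suc k}" and l: "l \<in> {1..k}"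
  shows "face k i (\<lambda>a. y a + t * pdir l a) j = face k i y j + t * dface i j l"
proof (cases "i = 0")
  case True
  have "(\<Sum>a\<in>{1..k}. y a + t * pdir l a) = (\<Sum>a\<in>{1..k}. y a) + t"
    using l by (simp add: sum.distrib if_distrib[of "(*) t"] cong: if_cong)
  then show ?thesis using True j l by (auto simp: face_def ins_def dface_def shift_def)
next
  case False
  then show ?thesis using i j l by (auto simp: face_def ins_def dface_def shift_def)
qed

lemma pd_xc_face:
  assumes y: "y \<in> qint k" and i: "i \<le> Suc k" and j: "j \<in> {1..Suc k}" and l: "l \<in> {1..k}"
  shows "pd l (\<lambda>y. xc j (face k i y)) y = dface i j l"
proof (rule pd_eqI, rule has_dird_cong_qint[where g = "\<lambda>y. face k i y j"])
  show "has_dird (\<lambda>y. face k i y j) (pdir l) y (dface i j l)"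
    by (rule has_dird_linear_local) (simp add: face_affine[OF i j l])
  show "face k i z j = xc j (face k i z)" if "z \<in> qint k" for z
    using xc_std_Q[OF face_in_std_Q[OF i, of z] j] that qint_subset by (metis subsetD)
qed (use y l in auto)

section \<open>Stokes' theorem with coordinate functions\<close>

definition stokes :: "nat \<Rightarrow> ((nat \<Rightarrow> real) \<Rightarrow> real) \<Rightarrow> ((nat \<Rightarrow> real) \<Rightarrow> real) list \<Rightarrow> bool" where
  "stokes k f gs \<longleftrightarrow> wint (Suc k) (\<lambda>_. 1) (f # gs) =
     (\<Sum>i\<le>Suc k. (-1) ^ i * wint k (\<lambda>y. f (face k i y)) (map (\<lambda>g y. g (face k i y)) gs))"

text \<open>Only the row of \<open>f\<close> is not constant. Expansion along it leaves partial
  derivatives of \<open>f\<close> with constant minors \<open>w m\<close>, and each integrates to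
  \<open>P 1 - Z (Suc m)\<close>. On the right the same minors return: the face on which coordinate
  m + 1 vanishes has Jacobian \<open>w m\<close>, the slanted face their alternating sum.\<close>

lemma stokes_coordinates:
  assumes f: "bl (Suc k) f" and js: "length js = k" "set js \<subseteq> {1..Suc k}"
  shows "stokes k f (map xc js)"
proof -
  obtain L where L: "lip_on {1..Suc k} L f" using f by (auto simp: bl_def)
  let ?ws = "[1..<Suc (Suc k)]"
  let ?\<delta>s = "map (\<lambda>j v. if v = j then 1 else 0 :: real) js"
  define w where "w m = wedge ?\<delta>s (omit m ?ws)" for m
  define S where "S y = 1 - (\<Sum>l\<in>{1..k}. y l)" for y :: "nat \<Rightarrow> real"
  define P where "P m = (\<integral>y. indicator (std_Q k) y * f (ins m (S y) y) \<partial>lebn k)" for m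
  define Z where "Z m = (\<integral>y. indicator (std_Q k) y * f (ins m 0 y) \<partial>lebn k)" for m
  have [measurable]: "S \<in> borel_measurable (lebn k)" unfolding S_def by measurable
  have iS: "integrable (lebn k) (\<lambda>y. indicator (std_Q k) y * f (ins m (c y) y))"
    if "c \<in> borel_measurable (lebn k)" "m \<in> {1..Suc k}" for m c
    by (rule integrable_am[OF ins_measurable[OF f that]])
  have pdI: "(\<integral>x. indicator (std_Q (Suc k)) x * pd (Suc m) f x \<partial>lebn (Suc k)) = P 1 - Z (Suc m)" if "m \<le> k" for m
  proof -
    have m: "Suc m \<in> {1..Suc k}" using that by simp
    have "(\<integral>x. indicator (std_Q (Suc k)) x * pd (Suc m) f x \<partial>lebn (Suc k)) = P (Suc m) - Z (Suc m)"
      unfolding integral_pd_std_Q[OF m L] P_def Z_def S_def[symmetric] right_diff_distrib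
      by (rule Bochner_Integration.integral_diff) (auto intro!: iS m)
    moreover have "P (Suc m) = P 1" unfolding P_def S_def by (rule slanted_face_chart[OF f m])
    ultimately show ?thesis by simp
  qed
  have jacL: "jac (Suc k) (f # map xc js) x = (\<Sum>m\<le>k. (-1) ^ m * pd (Suc m) f x * w m)" if x: "x \<in> qint (Suc k)" for x
  proof -
    have "jac (Suc k) (f # map xc js) x = wedge ((\<lambda>j. pd j f x) # ?\<delta>s) ?ws"
      unfolding jac_def
    proof (rule wedge_cong)
      fix i m assume i: "i < length (map (\<lambda>h j. pd j h x) (f # map xc js))" and m: "m < length (map (\<lambda>h j. pd j h x) (f # map xc js))"
      then have m': "?ws ! m \<in> {1..Suc k}" using js by (auto simp: nth_upt)
      show "(map (\<lambda>h j. pd j h x) (f # map xc js) ! i) (?ws ! m) = (((\<lambda>j. pd j f x) # ?\<delta>s) ! i) (?ws ! m)"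
      proof (cases i)
        case (Suc i')
        then have "js ! i' \<in> set js" using i by simp
        then have "js ! i' \<in> {1..Suc k}" using js(2) by blast
        then show ?thesis using Suc i pd_xc[OF x _ m'] by simp
      qed simp
    qed simp
    also have "\<dots> = (\<Sum>m\<le>k. (-1) ^ m * pd (Suc m) f x * w m)"
      by (subst wedge_laplace_row) (simp_all add: js w_def nth_upt plus_1_eq_Suc)
    finally show ?thesis .
  qed
  have "wint (Suc k) (\<lambda>_. 1) (f # map xc js) = (\<integral>x. (\<Sum>m\<le>k. (-1) ^ m * w m * (indicator (std_Q (Suc k)) x * pd (Suc m) f x)) \<partial>lebn (Suc k))"
    unfolding wint_def
  proof (rule integral_cong_AE)
    have "am (Suc k) (jac (Suc k) (f # map xc js))" by (rule am_jac) (use js f in \<open>auto intro!: bl_xc\<close>)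
    from integrable_am[OF am_mult[OF am_const this]]
    show "(\<lambda>x. indicator (std_Q (Suc k)) x * (1 * jac (Suc k) (f # map xc js) x)) \<in> borel_measurable (lebn (Suc k))"
      by (rule borel_measurable_integrable)
    show "(\<lambda>x. \<Sum>m\<le>k. (-1) ^ m * w m * (indicator (std_Q (Suc k)) x * pd (Suc m) f x)) \<in> borel_measurable (lebn (Suc k))"
      by (intro borel_measurable_sum borel_measurable_times borel_measurable_const borel_measurable_integrable[OF integrable_am[OF am_pd[OF f]]]
        borel_measurable_indicator std_Q_sets pd_measurable[OF _ L]) auto
    show "AE x in lebn (Suc k). indicator (std_Q (Suc k)) x * (1 * jac (Suc k) (f # map xc js) x) =
        (\<Sum>m\<le>k. (-1) ^ m * w m * (indicator (std_Q (Suc k)) x * pd (Suc m) f x))"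
      using qint_ae by eventually_elim (auto simp: indicator_def jacL mult_ac)
  qed
  also have "\<dots> = (\<Sum>m\<le>k. (-1) ^ m * w m * (P 1 - Z (Suc m)))"
    using integrable_am[OF am_pd[OF f]] by (subst Bochner_Integration.integral_sum) (auto simp: pdI)
  finally have lhs: "wint (Suc k) (\<lambda>_. 1) (f # map xc js) = (\<Sum>m\<le>k. (-1) ^ m * w m * (P 1 - Z (Suc m)))" .
  have jacR: "jac k (map (\<lambda>g y. g (face k i y)) (map xc js)) y = wedge (map (dface i) js) [1..<Suc k]"
    if "i \<le> Suc k" "y \<in> qint k" for i y
    unfolding jac_def
  proof (rule wedge_cong)
    fix a b assume a: "a < length (map (\<lambda>h j. pd j h y) (map (\<lambda>g y. g (face k i y)) (map xc js)))"
      and b: "b < length (map (\<lambda>h j. pd j h y) (map (\<lambda>g y. g (face k i y)) (map xc js)))"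
    then have "js ! a \<in> set js" "[1..<Suc k] ! b \<in> {1..k}" using js(1) by (auto simp: nth_upt)
    moreover from this have "js ! a \<in> {1..Suc k}" using js(2) by blast
    ultimately show "(map (\<lambda>h j. pd j h y) (map (\<lambda>g y. g (face k i y)) (map xc js)) ! a) ([1..<Suc k] ! b) = (map (dface i) js ! a) ([1..<Suc k] ! b)"
      using a pd_xc_face[OF that(2,1)] by simp
  qed simp
  have wR: "wint k (\<lambda>y. f (face k i y)) (map (\<lambda>g y. g (face k i y)) (map xc js)) = wedge (map (dface i) js) [1..<Suc k] * (if i = 0 then P 1 else Z i)"
    if i: "i \<le> Suc k" for i
  proof -
    have "wint k (\<lambda>y. f (face k i y)) (map (\<lambda>g y. g (face k i y)) (map xc js)) =
      (\<integral>y. wedge (map (dface i) js) [1..<Suc k] * (indicator (std_Q k) y * f (face k i y)) \<partial>lebn k)"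
      unfolding wint_def
    proof (rule integral_cong_AE)
      have "am k (jac k (map (\<lambda>g y. g (face k i y)) (map xc js)))"
        by (rule am_jac) (use js i in \<open>auto intro!: bl_face bl_xc\<close>)
      from integrable_am[OF am_mult[OF bl_am[OF bl_face[OF f i]] this]]
      show "(\<lambda>y. indicator (std_Q k) y * (f (face k i y) * jac k (map (\<lambda>g y. g (face k i y)) (map xc js)) y)) \<in> borel_measurable (lebn k)"
        by (rule borel_measurable_integrable)
      show "(\<lambda>y. wedge (map (dface i) js) [1..<Suc k] * (indicator (std_Q k) y * f (face k i y))) \<in> borel_measurable (lebn k)"
        by (intro borel_measurable_times borel_measurable_const borel_measurable_integrable[OF integrable_am[OF bl_am[OF bl_face[OF f i]]]]
          borel_measurable_indicator std_Q_sets bl_measurable bl_face f i)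
      show "AE y in lebn k. indicator (std_Q k) y * (f (face k i y) * jac k (map (\<lambda>g y. g (face k i y)) (map xc js)) y) =
         wedge (map (dface i) js) [1..<Suc k] * (indicator (std_Q k) y * f (face k i y))"
        using qint_ae by eventually_elim (auto simp: indicator_def jacR[OF i] simp del: map_map)
    qed
    also have "\<dots> = wedge (map (dface i) js) [1..<Suc k] * (if i = 0 then P 1 else Z i)"
      by (simp add: P_def Z_def S_def face_def)
    finally show ?thesis .
  qed
  \<comment> \<open>Restriction to the slanted face subtracts the column of direction 1 from the
    later columns. Completing the matrix by a row of ones undoes this, and expansion along that row
    gives the alternating sum.\<close>
  have w0: "wedge (map (dface 0) js) [1..<Suc k] = (\<Sum>m\<le>k. (-1) ^ m * w m)"
  proof -
    have "wedge (map (dface 0) js) [1..<Suc k] = wedge (map (\<lambda>\<alpha> v. \<alpha> v - \<alpha> 1) ?\<delta>s) [Suc 1..<Suc (Suc k)]"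
    proof (rule wedge_cong)
      fix a b assume "a < length (map (dface 0) js)" "b < length (map (dface 0) js)"
      then show "(map (dface 0) js ! a) ([1..<Suc k] ! b) = (map (\<lambda>\<alpha> v. \<alpha> v - \<alpha> 1) ?\<delta>s ! a) ([Suc 1..<Suc (Suc k)] ! b)"
        using js by (auto simp: nth_upt dface_def shift_def)
    qed simp
    also have "\<dots> = wedge ((\<lambda>_. 1) # ?\<delta>s) (1 # [Suc 1..<Suc (Suc k)])"
      by (rule wedge_ones_row[symmetric]) (simp add: js)
    also have "1 # [Suc 1..<Suc (Suc k)] = ?ws" by (simp add: upt_conv_Cons)
    also have "wedge ((\<lambda>_. 1) # ?\<delta>s) ?ws = (\<Sum>m\<le>k. (-1) ^ m * w m)"
      by (subst wedge_laplace_row) (simp_all add: js w_def)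
    finally show ?thesis .
  qed
  have wi: "wedge (map (dface (Suc m)) js) [1..<Suc k] = w m" if "m \<le> k" for m
    unfolding w_def
  proof (rule wedge_cong)
    fix a b assume "a < length (map (dface (Suc m)) js)" "b < length (map (dface (Suc m)) js)"
    then show "(map (dface (Suc m)) js ! a) ([1..<Suc k] ! b) = (?\<delta>s ! a) (omit m ?ws ! b)"
      using js that by (auto simp: nth_upt dface_def shift_def nth_omit)
  qed simp
  have "(\<Sum>i\<le>Suc k. (-1) ^ i * wint k (\<lambda>y. f (face k i y)) (map (\<lambda>g y. g (face k i y)) (map xc js))) =
    (\<Sum>i\<le>Suc k. (-1) ^ i * (wedge (map (dface i) js) [1..<Suc k] * (if i = 0 then P 1 else Z i)))"
    by (intro sum.cong refl) (simp only: wR atMost_iff)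
  also have "\<dots> = (\<Sum>m\<le>k. (-1) ^ m * w m) * P 1 + (\<Sum>m\<le>k. (-1) ^ Suc m * (w m * Z (Suc m)))"
    by (subst sum.atMost_Suc_shift) (simp add: w0 wi)
  also have "\<dots> = (\<Sum>m\<le>k. (-1) ^ m * w m * (P 1 - Z (Suc m)))"
    by (simp add: sum_distrib_left sum_distrib_right sum.distrib[symmetric] algebra_simps sum_subtractf sum_negf)
  finally show ?thesis unfolding stokes_def lhs by simp
qed

lemma lip_on_bl_set: "(\<And>h. h \<in> set hs \<Longrightarrow> bl n h) \<Longrightarrow> AE x in lebn n. \<forall>h\<in>set hs. \<forall>j. has_dird h (pdir j) x (pd j h x)"
proof (subst AE_ball_countable)
  assume bl: "\<And>h. h \<in> set hs \<Longrightarrow> bl n h"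
  show "\<forall>h\<in>set hs. AE x in lebn n. \<forall>j. has_dird h (pdir j) x (pd j h x)"
  proof
    fix h assume "h \<in> set hs"
    then obtain L where "lip_on {1..n} L h" using bl by (auto simp: bl_def)
    then show "AE x in lebn n. \<forall>j. has_dird h (pdir j) x (pd j h x)" by (intro pd_exists_ae) auto
  qed
qed (simp add: countable_finite)

text \<open>Values on the open simplex determine the partial derivatives there, so entries may be
  exchanged for clamped or extended versions.\<close>

lemma wint_agree:
  assumes \<alpha>: "am n \<alpha>" "am n \<alpha>'" and hs: "length hs = n" "\<And>h. h \<in> set hs \<Longrightarrow> bl n h"
    and hs': "length hs' = n" "\<And>h. h \<in> set hs' \<Longrightarrow> bl n h"
    and eq: "\<And>x. x \<in> qint n \<Longrightarrow> \<alpha> x = \<alpha>' x" "\<And>i x. i < n \<Longrightarrow> x \<in> qint n \<Longrightarrow> (hs ! i) x = (hs' ! i) x"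
  shows "wint n \<alpha> hs = wint n \<alpha>' hs'"
proof (rule wint_cong_ae[OF \<alpha> hs hs'])
  have ae: "AE x in lebn n. \<forall>h\<in>set hs. \<forall>j. has_dird h (pdir j) x (pd j h x)"
    by (rule lip_on_bl_set) (rule hs(2))
  show "AE x in lebn n. x \<in> qint n \<longrightarrow> \<alpha> x * jac n hs x = \<alpha>' x * jac n hs' x"
    using ae
  proof eventually_elim
    case (elim x)
    show ?case
    proof
      assume x: "x \<in> qint n"
      have "jac n hs x = jac n hs' x" unfolding jac_def
      proof (rule wedge_cong)
        fix i j assume "i < length (map (\<lambda>h j. pd j h x) hs)" "j < length (map (\<lambda>h j. pd j h x) hs)"
        then have i: "i < n" and j: "[1..<Suc n] ! j \<in> {1..n}" using hs by (auto simp: nth_upt)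
        have "pd ([1..<Suc n] ! j) (hs' ! i) x = pd ([1..<Suc n] ! j) (hs ! i) x"
        proof (rule pd_eqI, rule has_dird_cong_qint[OF x j])
          show "has_dird (hs ! i) (pdir ([1..<Suc n] ! j)) x (pd ([1..<Suc n] ! j) (hs ! i) x)" using elim i hs by simp
          show "(hs ! i) y = (hs' ! i) y" if "y \<in> qint n" for y by (rule eq(2)[OF i that])
        qed
        then show "(map (\<lambda>h j. pd j h x) hs ! i) ([1..<Suc n] ! j) = (map (\<lambda>h j. pd j h x) hs' ! i) ([1..<Suc n] ! j)"
          using i hs hs' by simp
      qed (simp add: hs hs')
      then show "\<alpha> x * jac n hs x = \<alpha>' x * jac n hs' x" using eq(1)[OF x] by simp
    qed
  qed
qed

text \<open>By the product rule d(f F'(g)) = F'(g) df + f F''(g) dg, and the last term vanishes in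
  the wedge product because dg already occupies a later slot.\<close>

lemma wint_product_row:
  assumes f: "bl n f" and g: "bl n g" and gs: "length gs = n - 1" "\<And>h. h \<in> set gs \<Longrightarrow> bl n h" and s: "Suc s < n"
    and F': "\<And>t. (F' has_real_derivative F'' t) (at t)" "bl n (\<lambda>x. F' (g x))"
  shows "wint n (\<lambda>_. 1) ((\<lambda>x. f x * F' (g x)) # gs[s := g]) = wint n (\<lambda>x. F' (g x)) (f # gs[s := g])"
proof (rule wint_cong_ae)
  have ae: "AE x in lebn n. \<forall>h\<in>set [f, g]. \<forall>j. has_dird h (pdir j) x (pd j h x)"
    by (rule lip_on_bl_set) (use f g in auto)
  show "AE x in lebn n. x \<in> qint n \<longrightarrow> 1 * jac n ((\<lambda>x. f x * F' (g x)) # gs[s := g]) x = F' (g x) * jac n (f # gs[s := g]) x"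
    using ae
  proof eventually_elim
    case (elim x)
    have "pd j (\<lambda>x. f x * F' (g x)) x = F' (g x) * pd j f x + (f x * F'' (g x)) * pd j g x" for j
    proof -
      have "has_dird (\<lambda>x. f x * F' (g x)) (pdir j) x (pd j f x * F' (g x) + f x * (F'' (g x) * pd j g x))"
        by (intro has_dird_mult has_dird_comp F') (use elim in auto)
      from pd_eqI[OF this] show ?thesis by simp
    qed
    moreover
    let ?R = "\<lambda>h. (\<lambda>j. pd j h x)"
    have "wedge ((map ?R (f # gs[s := g]))[0 := \<lambda>j. F' (g x) * ?R f j + (f x * F'' (g x)) * ?R g j]) [1..<Suc n]
      = F' (g x) * wedge ((map ?R (f # gs[s := g]))[0 := ?R f]) [1..<Suc n] + (f x * F'' (g x)) * wedge ((map ?R (f # gs[s := g]))[0 := ?R g]) [1..<Suc n]"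
      by (rule wedge_slot_linear) simp
    moreover have "wedge ((map ?R (f # gs[s := g]))[0 := ?R g]) [1..<Suc n] = 0"
      by (rule wedge_repeated[of 0 _ "Suc s"]) (use s gs in auto)
    ultimately show ?case by (simp add: jac_def)
  qed
qed (use assms bl_list_update[of gs n g _ s] in \<open>auto intro!: am_const bl_am bl_mult\<close>)

section \<open>Stokes' theorem with Lipschitz entries, one slot at a time\<close>

text \<open>The quantifier over \<open>f\<close> is part of the property: composing the entry with a
  smooth function replaces \<open>f\<close> by another function, so a version for a single
  \<open>f\<close> would not be closed under composition.\<close>

definition stokes_slot :: "nat \<Rightarrow> ((nat \<Rightarrow> real) \<Rightarrow> real) list \<Rightarrow> nat \<Rightarrow> ((nat \<Rightarrow> real) \<Rightarrow> real) \<Rightarrow> bool" where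
  "stokes_slot k gs s g \<longleftrightarrow> bl (Suc k) g \<and> (\<forall>f. bl (Suc k) f \<longrightarrow> stokes k f (gs[s := g]))"

context
  fixes k :: nat and gs :: "((nat \<Rightarrow> real) \<Rightarrow> real) list" and s :: nat
  assumes gs: "length gs = k" "\<And>h. h \<in> set gs \<Longrightarrow> bl (Suc k) h" and s: "s < k"
begin

private abbreviation "gf i \<equiv> map (\<lambda>g y. g (face k i y)) gs"

private lemma gf: "i \<le> Suc k \<Longrightarrow> length (gf i) = k" "i \<le> Suc k \<Longrightarrow> h \<in> set (gf i) \<Longrightarrow> bl k h"
  using gs by (auto intro: bl_face)

private lemma stokes_slot_iff:
  "stokes k f (gs[s := g]) \<longleftrightarrow> wint (Suc k) (\<lambda>_. 1) ((f # gs)[Suc s := g]) =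
     (\<Sum>i\<le>Suc k. (-1) ^ i * wint k (\<lambda>y. f (face k i y)) ((gf i)[s := \<lambda>y. g (face k i y)]))"
  by (simp add: stokes_def map_update)

private lemma fgs: "bl (Suc k) f \<Longrightarrow> length (f # gs) = Suc k" "bl (Suc k) f \<Longrightarrow> h \<in> set (f # gs) \<Longrightarrow> bl (Suc k) h"
  using gs by auto

lemma stokes_slot_lincomb:
  assumes "stokes_slot k gs s g" "stokes_slot k gs s h"
  shows "stokes_slot k gs s (\<lambda>x. a * g x + b * h x)"
  unfolding stokes_slot_def
proof (intro conjI allI impI)
  have bl: "bl (Suc k) g" "bl (Suc k) h" using assms by (auto simp: stokes_slot_def)
  then show "bl (Suc k) (\<lambda>x. a * g x + b * h x)" by (rule bl_lincomb)
  fix f assume f: "bl (Suc k) f"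
  have "wint k (\<lambda>y. f (face k i y)) ((gf i)[s := \<lambda>y. a * g (face k i y) + b * h (face k i y)]) =
     a * wint k (\<lambda>y. f (face k i y)) ((gf i)[s := \<lambda>y. g (face k i y)]) + b * wint k (\<lambda>y. f (face k i y)) ((gf i)[s := \<lambda>y. h (face k i y)])"
    if "i \<le> Suc k" for i
    by (rule wint_lincomb[OF bl_am[OF bl_face[OF f that]] gf(1)[OF that] gf(2)[OF that] s bl_face[OF bl(1) that] bl_face[OF bl(2) that]])
  moreover have "wint (Suc k) (\<lambda>_. 1) ((f # gs)[Suc s := \<lambda>x. a * g x + b * h x]) =
      a * wint (Suc k) (\<lambda>_. 1) ((f # gs)[Suc s := g]) + b * wint (Suc k) (\<lambda>_. 1) ((f # gs)[Suc s := h])"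
    by (rule wint_lincomb[OF am_const fgs[OF f] _ bl]) (simp_all add: s)
  moreover have "stokes k f (gs[s := g])" "stokes k f (gs[s := h])" using assms f by (auto simp: stokes_slot_def)
  ultimately show "stokes k f (gs[s := \<lambda>x. a * g x + b * h x])"
    unfolding stokes_slot_iff by (simp add: sum_distrib_left sum.distrib[symmetric] algebra_simps del: sum.atMost_Suc list_update.simps)
qed

lemma stokes_slot_const: "stokes_slot k gs s (\<lambda>_. c)"
  unfolding stokes_slot_def
proof (intro conjI allI impI bl_const)
  fix f assume f: "bl (Suc k) f"
  have "wint k (\<lambda>y. f (face k i y)) ((gf i)[s := \<lambda>y. c]) = 0" if "i \<le> Suc k" for i
    by (rule wint_const[OF gf(1)[OF that] s])
  moreover have "wint (Suc k) (\<lambda>_. 1) ((f # gs)[Suc s := \<lambda>_. c]) = 0"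
    by (rule wint_const[OF fgs(1)[OF f]]) (simp_all add: s)
  ultimately show "stokes k f (gs[s := \<lambda>_. c])" unfolding stokes_slot_iff by simp
qed

lemma stokes_slot_sum:
  assumes "finite A" "\<And>i. i \<in> A \<Longrightarrow> stokes_slot k gs s (g i)"
  shows "stokes_slot k gs s (\<lambda>x. \<Sum>i\<in>A. g i x)"
  using assms
proof (induction A)
  case empty
  then show ?case using stokes_slot_const by simp
next
  case (insert i A)
  then show ?case using stokes_slot_lincomb[of "g i" "\<lambda>x. \<Sum>i\<in>A. g i x" 1 1] by simp
qed

text \<open>\<open>wint_limit\<close> passes to the limit on both sides; on the faces it applies
  because \<open>lip_face\<close> turns the common constant \<open>L\<close> into the common
  constant 2 L.\<close>

lemma stokes_slot_limit:
  assumes G: "\<And>m. stokes_slot k gs s (G m)" "\<And>m. lip_on {1..Suc k} L (G m)" and g: "bl (Suc k) g"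
    and lim: "\<And>x. (\<lambda>m. G m x) \<longlonglongrightarrow> g x"
  shows "stokes_slot k gs s g"
  unfolding stokes_slot_def
proof (intro conjI allI impI g)
  have bl: "bl (Suc k) (G m)" for m using G by (auto simp: stokes_slot_def)
  fix f assume f: "bl (Suc k) f"
  have 1: "(\<lambda>m. wint k (\<lambda>y. f (face k i y)) ((gf i)[s := \<lambda>y. G m (face k i y)])) \<longlonglongrightarrow> wint k (\<lambda>y. f (face k i y)) ((gf i)[s := \<lambda>y. g (face k i y)])"
    if "i \<le> Suc k" for i
    by (rule wint_limit[OF bl_am[OF bl_face[OF f that]] gf(1)[OF that] gf(2)[OF that] s lip_face[OF G(2) that] bl_face[OF bl that] bl_face[OF g that] lim])
  have "(\<lambda>m. wint (Suc k) (\<lambda>_. 1) ((f # gs)[Suc s := G m])) \<longlonglongrightarrow> wint (Suc k) (\<lambda>_. 1) ((f # gs)[Suc s := g])"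
    by (rule wint_limit[OF am_const fgs[OF f] _ G(2) bl g lim]) (simp_all add: s)
  moreover have "wint (Suc k) (\<lambda>_. 1) ((f # gs)[Suc s := G m]) =
      (\<Sum>i\<le>Suc k. (-1) ^ i * wint k (\<lambda>y. f (face k i y)) ((gf i)[s := \<lambda>y. G m (face k i y)]))" for m
    using G(1)[of m] f unfolding stokes_slot_def stokes_slot_iff by blast
  moreover have "(\<lambda>m. \<Sum>i\<le>Suc k. (-1) ^ i * wint k (\<lambda>y. f (face k i y)) ((gf i)[s := \<lambda>y. G m (face k i y)]))
      \<longlonglongrightarrow> (\<Sum>i\<le>Suc k. (-1) ^ i * wint k (\<lambda>y. f (face k i y)) ((gf i)[s := \<lambda>y. g (face k i y)]))"
    by (intro tendsto_sum tendsto_mult_left 1) simp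
  ultimately show "stokes k f (gs[s := g])" unfolding stokes_slot_iff using LIMSEQ_unique by (simp only:)
qed

text \<open>Replacing \<open>g\<close> by \<open>F \<circ> g\<close> in the slot amounts to multiplying the leading function by \<open>F' \<circ> g\<close>,
  since \<open>d(F' \<circ> g) \<and> dg = 0\<close>.\<close>

lemma stokes_slot_comp:
  assumes g: "stokes_slot k gs s g"
    and F: "\<And>t. (F has_real_derivative F' t) (at t)" "\<And>t. (F' has_real_derivative F'' t) (at t)"
    and lip: "\<And>u v. \<bar>F u - F v\<bar> \<le> K * \<bar>u - v\<bar>" "\<And>u v. \<bar>F' u - F' v\<bar> \<le> K' * \<bar>u - v\<bar>"
  shows "stokes_slot k gs s (\<lambda>x. F (g x))"
  unfolding stokes_slot_def
proof (intro conjI allI impI)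
  have bg: "bl (Suc k) g" using g by (auto simp: stokes_slot_def)
  have bF: "bl (Suc k) (\<lambda>x. F (g x))" "bl (Suc k) (\<lambda>x. F' (g x))"
    by (rule bl_comp[OF bg lip(1)], rule bl_comp[OF bg lip(2)])
  show "bl (Suc k) (\<lambda>x. F (g x))" by fact
  fix f assume f: "bl (Suc k) f"
  have "wint (Suc k) (\<lambda>_. 1) ((f # gs)[Suc s := \<lambda>x. F (g x)]) = wint (Suc k) (\<lambda>x. 1 * F' (g x)) ((f # gs)[Suc s := g])"
    by (rule wint_comp[OF am_const fgs[OF f] _ bg F(1) bF]) (simp_all add: s)
  also have "\<dots> = wint (Suc k) (\<lambda>x. F' (g x)) (f # gs[s := g])" by simp
  also have "\<dots> = wint (Suc k) (\<lambda>_. 1) ((\<lambda>x. f x * F' (g x)) # gs[s := g])"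
    by (rule wint_product_row[OF f bg _ gs(2) _ F(2) bF(2), symmetric]) (use s gs in auto)
  also have "\<dots> = (\<Sum>i\<le>Suc k. (-1) ^ i * wint k (\<lambda>y. f (face k i y) * F' (g (face k i y))) ((gf i)[s := \<lambda>y. g (face k i y)]))"
  proof -
    have "stokes k (\<lambda>x. f x * F' (g x)) (gs[s := g])" using g bl_mult[OF f bF(2)] by (auto simp: stokes_slot_def)
    then show ?thesis unfolding stokes_slot_iff by simp
  qed
  also have "\<dots> = (\<Sum>i\<le>Suc k. (-1) ^ i * wint k (\<lambda>y. f (face k i y)) ((gf i)[s := \<lambda>y. F (g (face k i y))]))"
  proof (intro sum.cong refl arg_cong2[of _ _ _ _ "(*)"])
    fix i assume "i \<in> {..Suc k}"
    then have i: "i \<le> Suc k" by simp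
    show "wint k (\<lambda>y. f (face k i y) * F' (g (face k i y))) ((gf i)[s := \<lambda>y. g (face k i y)]) =
        wint k (\<lambda>y. f (face k i y)) ((gf i)[s := \<lambda>y. F (g (face k i y))])"
      by (rule wint_comp[OF bl_am[OF bl_face[OF f i]] gf(1)[OF i] gf(2)[OF i] s bl_face[OF bg i] F(1) bl_face[OF bF(1) i] bl_face[OF bF(2) i], symmetric])
  qed
  finally show "stokes k f (gs[s := \<lambda>x. F (g x)])" unfolding stokes_slot_iff .
qed

text \<open>The functions sqrt (t^2 + e) are smooth and tend to \<bar>t\<bar> as e tends to 0. Their
  slope is at most 1, so the approximants share the Lipschitz constant \<open>L\<close> of
  \<open>g\<close>.\<close>

lemma stokes_slot_abs:
  assumes g: "stokes_slot k gs s g"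
  shows "stokes_slot k gs s (\<lambda>x. \<bar>g x\<bar>)"
proof -
  have bg: "bl (Suc k) g" using g by (auto simp: stokes_slot_def)
  obtain L B where L: "0 \<le> L" "0 \<le> B" "lip_on {1..Suc k} L g" "\<And>x. \<bar>g x\<bar> \<le> B" using blE[OF bg] by blast
  define F where "F e t = sqrt (t\<^sup>2 + e)" for e t :: real
  have pos: "0 < t\<^sup>2 + e" if "0 < e" for e t :: real using that by (simp add: add_nonneg_pos)
  have F1: "(F e has_real_derivative t / F e t) (at t)" if "0 < e" for e t
  proof -
    have "((\<lambda>t. t\<^sup>2 + e) has_real_derivative 2 * t) (at t)" by (auto intro!: derivative_eq_intros)
    from DERIV_chain2[OF DERIV_real_sqrt[OF pos[OF that]] this]
    show ?thesis unfolding F_def by (simp add: field_simps)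
  qed
  have F0: "0 < F e t" "\<bar>t\<bar> \<le> F e t" if "0 < e" for e t
    using pos[OF that, of t] that real_sqrt_le_mono[of "t\<^sup>2" "t\<^sup>2 + e"] by (auto simp: F_def)
  have F2: "((\<lambda>t. t / F e t) has_real_derivative e / (F e t) ^ 3) (at t)" if "0 < e" for e t
  proof -
    have sq: "F e t * F e t = t\<^sup>2 + e" using pos[OF that, of t] by (simp add: F_def)
    have "((\<lambda>t. t / F e t) has_real_derivative (1 * F e t - t * (t / F e t)) / (F e t * F e t)) (at t)"
      by (rule DERIV_divide[OF DERIV_ident F1[OF that]]) (use F0[OF that, of t] in simp)
    moreover have "(1 * F e t - t * (t / F e t)) / (F e t * F e t) = e / (F e t) ^ 3"
    proof -
      have "1 * F e t - t * (t / F e t) = (F e t * F e t - t\<^sup>2) / F e t"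
        using F0[OF that, of t] by (simp add: field_simps power2_eq_square)
      also have "\<dots> = e / F e t" by (simp add: sq)
      finally show ?thesis by (simp add: power3_eq_cube mult.assoc)
    qed
    ultimately show ?thesis by simp
  qed
  have lip1: "\<bar>F e u - F e v\<bar> \<le> 1 * \<bar>u - v\<bar>" if "0 < e" for e u v
    unfolding real_norm_def[symmetric]
  proof (rule field_differentiable_bound[OF convex_UNIV])
    show "(F e has_field_derivative t / F e t) (at t within UNIV)" for t using F1[OF that] by simp
    show "norm (t / F e t) \<le> 1" for t using F0[OF that, of t] by (simp add: divide_le_eq)
  qed auto
  \<comment> \<open>The second derivative e / F^3 is largest at t = 0, where F = sqrt e. The
    constant grows as \<open>e\<close> decreases, but it is used for one \<open>e\<close> at a time,
    in the composition with \<open>F e\<close>.\<close>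
  have lip2: "\<bar>u / F e u - v / F e v\<bar> \<le> (e / sqrt e ^ 3) * \<bar>u - v\<bar>" if "0 < e" for e u v
    unfolding real_norm_def[symmetric]
  proof (rule field_differentiable_bound[OF convex_UNIV])
    show "((\<lambda>t. t / F e t) has_field_derivative e / (F e t) ^ 3) (at t within UNIV)" for t using F2[OF that] by simp
    show "norm (e / (F e t) ^ 3) \<le> e / sqrt e ^ 3" for t
    proof -
      have "sqrt e \<le> F e t" unfolding F_def by (rule real_sqrt_le_mono) simp
      then have "sqrt e ^ 3 \<le> F e t ^ 3" using that by (intro power_mono) auto
      moreover have "0 < sqrt e ^ 3" "0 < F e t ^ 3" using that F0[OF that, of t] by (auto intro: zero_less_power)
      ultimately show ?thesis using that by (simp add: divide_left_mono abs_of_pos)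
    qed
  qed auto
  show ?thesis
  proof (rule stokes_slot_limit[where G = "\<lambda>m x. F (inverse (real (Suc m))) (g x)" and L = L])
    fix m
    have e: "0 < inverse (real (Suc m))" by simp
    show "stokes_slot k gs s (\<lambda>x. F (inverse (real (Suc m))) (g x))"
      by (rule stokes_slot_comp[OF g F1[OF e] F2[OF e] lip1[OF e] lip2[OF e]])
    show "lip_on {1..Suc k} L (\<lambda>x. F (inverse (real (Suc m))) (g x))"
      unfolding lip_on_def using order_trans[OF lip1[OF e]] lip_onD[OF L(3)] by simp
  next
    show "bl (Suc k) (\<lambda>x. \<bar>g x\<bar>)" by (rule bl_comp[OF bg, of _ 1]) simp
    fix x
    have "(\<lambda>m. sqrt ((g x)\<^sup>2 + inverse (real (Suc m)))) \<longlonglongrightarrow> sqrt ((g x)\<^sup>2 + 0)"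
      by (intro tendsto_intros LIMSEQ_inverse_real_of_nat)
    then show "(\<lambda>m. F (inverse (real (Suc m))) (g x)) \<longlonglongrightarrow> \<bar>g x\<bar>" by (simp add: F_def)
  qed
qed

lemma stokes_slot_min:
  assumes "stokes_slot k gs s g" "stokes_slot k gs s h"
  shows "stokes_slot k gs s (\<lambda>x. min (g x) (h x))"
proof -
  have "stokes_slot k gs s (\<lambda>x. (1/2) * (1 * g x + 1 * h x) + (-1/2) * \<bar>1 * g x + (-1) * h x\<bar>)"
    by (intro stokes_slot_lincomb stokes_slot_abs assms)
  moreover have "(1/2) * (1 * g x + 1 * h x) + (-1/2) * \<bar>1 * g x + (-1) * h x\<bar> = min (g x) (h x)" for x
    by (auto simp: min_def abs_if field_simps)
  ultimately show ?thesis by (simp only:)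
qed

text \<open>Cones are formed from the clamped coordinates, so their minima converge to g \<circ>
  \<pi>, where \<pi> clamps every coordinate to [0,1]. On the simplex \<pi> changes no relevant
  coordinate, and \<open>wint_agree\<close> replaces g \<circ> \<pi> by \<open>g\<close> inside and
  on the faces.\<close>

lemma stokes_slot_all:
  assumes xc: "\<And>j. j \<in> {1..Suc k} \<Longrightarrow> stokes_slot k gs s (xc j)" and g: "bl (Suc k) g"
  shows "stokes_slot k gs s g"
proof -
  let ?I = "{1..Suc k}"
  obtain L B where L: "0 \<le> L" "0 \<le> B" "lip_on ?I L g" "\<And>x. \<bar>g x\<bar> \<le> B" using blE[OF g] by blast
  obtain y :: "nat \<Rightarrow> nat \<Rightarrow> real" where y: "\<And>x e. 0 < e \<Longrightarrow> \<exists>k. (\<Sum>i\<in>?I. \<bar>x i - y k i\<bar>) < e"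
    using dense_sequence[of ?I] by blast
  define \<pi> where "\<pi> x = (\<lambda>i. xc i x)" for x
  have \<pi>: "(\<Sum>i\<in>?I. \<bar>\<pi> x i - \<pi> z i\<bar>) \<le> (\<Sum>i\<in>?I. \<bar>x i - z i\<bar>)" for x z
    by (rule sum_mono) (auto simp: \<pi>_def xc_def)
  have cone: "stokes_slot k gs s (\<lambda>x. g (y m) + L * (\<Sum>i\<in>?I. \<bar>\<pi> x i - y m i\<bar>))" for m
  proof -
    have "stokes_slot k gs s (\<lambda>x. 1 * g (y m) + L * (\<Sum>i\<in>?I. \<bar>1 * xc i x + (-1) * y m i\<bar>))"
      by (intro stokes_slot_lincomb stokes_slot_const stokes_slot_sum stokes_slot_abs xc) auto
    then show ?thesis by (simp add: \<pi>_def)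
  qed
  have conem: "stokes_slot k gs s (\<lambda>x. cone_min ?I L g y m (\<pi> x))" for m
    by (induction m) (simp_all add: cone stokes_slot_min)
  have cone_lip: "\<bar>cone_min ?I L g y m x - cone_min ?I L g y m z\<bar> \<le> L * (\<Sum>i\<in>?I. \<bar>x i - z i\<bar>)" for m x z
  proof -
    have *: "\<bar>(a + L * (\<Sum>i\<in>?I. \<bar>x i - u i\<bar>)) - (a + L * (\<Sum>i\<in>?I. \<bar>z i - u i\<bar>))\<bar> \<le> L * (\<Sum>i\<in>?I. \<bar>x i - z i\<bar>)" for a u
    proof -
      have "\<bar>(\<Sum>i\<in>?I. \<bar>x i - u i\<bar>) - (\<Sum>i\<in>?I. \<bar>z i - u i\<bar>)\<bar> \<le> (\<Sum>i\<in>?I. \<bar>x i - z i\<bar>)"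
        unfolding sum_subtractf[symmetric] by (rule order_trans[OF sum_abs], rule sum_mono) auto
      from mult_left_mono[OF this L(1)] show ?thesis
        by (simp add: right_diff_distrib[symmetric] abs_mult L(1))
    qed
    have mm: "\<bar>min a b - min c d\<bar> \<le> K" if "\<bar>a - c\<bar> \<le> K" "\<bar>b - d\<bar> \<le> K" for a b c d K :: real
      using that by (simp add: min_def abs_if split: if_splits)
    show ?thesis
    proof (induction m)
      case 0
      show ?case unfolding cone_min.simps by (rule *)
    next
      case (Suc m)
      show ?case unfolding cone_min.simps by (rule mm[OF Suc.IH *])
    qed
  qed
  have gpi: "lip_on ?I L (\<lambda>x. g (\<pi> x))" "bl (Suc k) (\<lambda>x. g (\<pi> x))"
  proof -
    show *: "lip_on ?I L (\<lambda>x. g (\<pi> x))" unfolding lip_on_def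
      using order_trans[OF lip_onD[OF L(3)] mult_left_mono[OF \<pi> L(1)]] by blast
    show "bl (Suc k) (\<lambda>x. g (\<pi> x))" by (rule blI[OF * L(4)])
  qed
  have "stokes_slot k gs s (\<lambda>x. g (\<pi> x))"
  proof (rule stokes_slot_limit[OF conem _ gpi(2)])
    show "lip_on ?I L (\<lambda>x. cone_min ?I L g y m (\<pi> x))" for m unfolding lip_on_def
      using order_trans[OF cone_lip mult_left_mono[OF \<pi> L(1)]] by blast
    show "(\<lambda>m. cone_min ?I L g y m (\<pi> x)) \<longlonglongrightarrow> g (\<pi> x)" for x by (rule cone_min_tendsto[OF L(3) y])
  qed
  moreover have agree: "g (\<pi> x) = g x" if "x \<in> std_Q (Suc k)" for x
    by (rule lip_on_cong[OF L(3)]) (simp add: \<pi>_def xc_std_Q[OF that])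
  ultimately have "stokes k f (gs[s := g])" if f: "bl (Suc k) f" for f
  proof -
    have "stokes k f (gs[s := \<lambda>x. g (\<pi> x)])" using \<open>stokes_slot k gs s (\<lambda>x. g (\<pi> x))\<close> f by (auto simp: stokes_slot_def)
    moreover have "wint (Suc k) (\<lambda>_. 1) ((f # gs)[Suc s := \<lambda>x. g (\<pi> x)]) = wint (Suc k) (\<lambda>_. 1) ((f # gs)[Suc s := g])"
    proof (rule wint_agree)
      show "((f # gs)[Suc s := \<lambda>x. g (\<pi> x)] ! i) x = ((f # gs)[Suc s := g] ! i) x" if "i < Suc k" "x \<in> qint (Suc k)" for i x
        using that agree qint_subset s gs(1) by (cases i; cases "i = Suc s") auto
    qed (use f gs g gpi(2) bl_list_update[of "f # gs" "Suc k" _ _ "Suc s"] in \<open>auto intro!: am_const simp del: list_update.simps\<close>)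
    moreover have "wint k (\<lambda>y. f (face k i y)) ((gf i)[s := \<lambda>y. g (\<pi> (face k i y))]) = wint k (\<lambda>y. f (face k i y)) ((gf i)[s := \<lambda>y. g (face k i y)])"
      if i: "i \<le> Suc k" for i
    proof (rule wint_agree)
      show "((gf i)[s := \<lambda>y. g (\<pi> (face k i y))] ! j) y = ((gf i)[s := \<lambda>y. g (face k i y)] ! j) y" if "j < k" "y \<in> qint k" for j y
        using that agree face_in_std_Q[OF i] qint_subset s gs(1) by (cases "j = s") auto
      show "bl k h" if "h \<in> set ((gf i)[s := \<lambda>y. g (\<pi> (face k i y))])" for h
        by (rule bl_list_update[OF gf(2)[OF i] bl_face[OF gpi(2) i] that])
      show "bl k h" if "h \<in> set ((gf i)[s := \<lambda>y. g (face k i y)])" for h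
        by (rule bl_list_update[OF gf(2)[OF i] bl_face[OF g i] that])
    qed (use gs bl_am[OF bl_face[OF f i]] in simp_all)
    ultimately show ?thesis unfolding stokes_slot_iff by simp
  qed
  then show ?thesis using g by (simp add: stokes_slot_def)
qed

end

text \<open>Induction on the number \<open>s\<close> of leading slots that may hold arbitrary
  entries, the later ones holding coordinates. The induction hypothesis with a coordinate in slot
  \<open>s\<close> is what \<open>stokes_slot_all\<close> asks for in order to free that
  slot.\<close>

theorem stokes_bl:
  assumes f: "bl (Suc k) f" and gs: "length gs = k" "\<And>h. h \<in> set gs \<Longrightarrow> bl (Suc k) h"
  shows "stokes k f gs"
proof -
  have "stokes k f gs" if "bl (Suc k) f" "length gs = k" "\<And>h. h \<in> set gs \<Longrightarrow> bl (Suc k) h"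
    "\<And>i. i < k \<Longrightarrow> s \<le> i \<Longrightarrow> gs ! i \<in> xc ` {1..Suc k}" for s f gs
    using that
  proof (induction s arbitrary: f gs)
    case 0
    then have "\<forall>i<k. \<exists>j\<in>{1..Suc k}. gs ! i = xc j" by blast
    then obtain j where j: "\<And>i. i < k \<Longrightarrow> j i \<in> {1..Suc k} \<and> gs ! i = xc (j i)" by metis
    have "gs = map xc (map j [0..<k])" using 0 j by (intro nth_equalityI) auto
    moreover have "stokes k f (map xc (map j [0..<k]))"
      by (rule stokes_coordinates) (use 0 j in auto)
    ultimately show ?case by simp
  next
    case (Suc s)
    show ?case
    proof (cases "s < k")
      case True
      have "stokes_slot k gs s (gs ! s)"
      proof (rule stokes_slot_all[OF Suc.prems(2,3) True])
        show "bl (Suc k) (gs ! s)" using Suc.prems(2,3) True by simp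
        fix j assume j: "j \<in> {1..Suc k}"
        show "stokes_slot k gs s (xc j)" unfolding stokes_slot_def
        proof (intro conjI allI impI bl_xc[OF j])
          fix f assume f: "bl (Suc k) f"
          show "stokes k f (gs[s := xc j])"
          proof (rule Suc.IH[OF f])
            show "bl (Suc k) h" if "h \<in> set (gs[s := xc j])" for h
              by (rule bl_list_update[OF Suc.prems(3) bl_xc[OF j] that])
            show "gs[s := xc j] ! i \<in> xc ` {1..Suc k}" if "i < k" "s \<le> i" for i
              using Suc.prems(4)[of i] Suc.prems(2) that j by (cases "i = s") auto
          qed (use Suc.prems in simp)
        qed
      qed
      then show ?thesis using Suc.prems(1) by (simp add: stokes_slot_def)
    next
      case False
      then show ?thesis using Suc.IH[OF Suc.prems(1-3)] by auto
    qed
  qed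
  from this[of f gs k] show ?thesis using assms by auto
qed

section \<open>Barycentric coordinates on a simplicial complex\<close>

text \<open>Differences to a second point \<open>w0\<close> of \<open>C\<close> are linearly
  independent, so a linear functional can be prescribed on them; the constant makes the affine
  function vanish at \<open>w0\<close>.\<close>

lemma affine_coordinate_exists:
  fixes C :: "'a::euclidean_space set"
  assumes C: "\<not> affine_dependent C" "v \<in> C"
  shows "\<exists>l c. linear l \<and> (\<forall>w\<in>C. c + l w = (if w = v then 1 else 0 :: real))"
proof (cases "C = {v}")
  case True
  show ?thesis by (rule exI[of _ "\<lambda>_. 0"], rule exI[of _ 1]) (use True in \<open>auto simp: linear_iff\<close>)
next
  case False
  then obtain w0 where w0: "w0 \<in> C" "w0 \<noteq> v" using C(2) by blast
  have "independent ((\<lambda>x. - w0 + x) ` (C - {w0}))"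
    using affine_dependent_iff_dependent2[OF w0(1)] C(1) by simp
  from linear_independent_extend[OF this, of "\<lambda>z. if z = - w0 + v then 1 else 0 :: real"]
  obtain g where g: "linear g" "\<And>z. z \<in> (\<lambda>x. - w0 + x) ` (C - {w0}) \<Longrightarrow> g z = (if z = - w0 + v then 1 else 0 :: real)"
    by blast
  have "- g w0 + g w = (if w = v then 1 else 0)" if "w \<in> C" for w
  proof (cases "w = w0")
    case True
    then show ?thesis using w0 by simp
  next
    case False
    have "g (- w0 + w) = (if - w0 + w = - w0 + v then 1 else 0)" by (rule g(2)) (use that False in auto)
    then show ?thesis using linear_add[OF g(1), of "- w0" w] linear_neg[OF g(1), of w0] by simp
  qed
  then show ?thesis using g(1) by (intro exI[of _ g] exI[of _ "- g w0"]) auto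
qed

text \<open>Within a set of lower dimension derivatives are not unique as linear maps. Along the
  segment from \<open>x\<close> to \<open>y\<close> they reduce to a one-sided derivative in one
  variable, which is.\<close>

lemma has_derivative_within_segment_unique:
  fixes S :: "'a::euclidean_space set" and D1 D2 :: "'a \<Rightarrow> real"
  assumes S: "convex S" "x \<in> S" "y \<in> S"
    and D: "(f has_derivative D1) (at x within S)" "(f has_derivative D2) (at x within S)"
  shows "D1 (y - x) = D2 (y - x)"
proof -
  define \<gamma> where "\<gamma> t = x + t *\<^sub>R (y - x)" for t :: real
  have \<gamma>S: "\<gamma> ` {0..1} \<subseteq> S"
  proof
    fix z assume "z \<in> \<gamma> ` {0..1}"
    then obtain t where t: "0 \<le> t" "t \<le> 1" "z = (1 - t) *\<^sub>R x + t *\<^sub>R y" by (auto simp: \<gamma>_def algebra_simps)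
    then show "z \<in> S" using convexD_alt[OF S(1,2,3)] by simp
  qed
  have \<gamma>d: "(\<gamma> has_derivative (\<lambda>t. t *\<^sub>R (y - x))) (at 0 within {0..1})"
    unfolding \<gamma>_def by (auto intro!: derivative_eq_intros)
  have d: "(f \<circ> \<gamma> has_derivative E \<circ> (\<lambda>t. t *\<^sub>R (y - x))) (at 0 within {0..1})"
    if "(f has_derivative E) (at x within S)" for E
    by (rule diff_chain_within[OF \<gamma>d]) (use has_derivative_subset[OF that \<gamma>S] in \<open>simp add: \<gamma>_def\<close>)
  have "D1 \<circ> (\<lambda>t. t *\<^sub>R (y - x)) = D2 \<circ> (\<lambda>t. t *\<^sub>R (y - x))"
  proof (rule frechet_derivative_unique_within[OF d[OF D(1)] d[OF D(2)]])
    fix i e :: real assume "i \<in> Basis" "0 < e"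
    then show "\<exists>d. 0 < \<bar>d\<bar> \<and> \<bar>d\<bar> < e \<and> 0 + d *\<^sub>R i \<in> {0..1}" by (intro exI[of _ "min (e / 2) 1"]) auto
  qed
  from fun_cong[OF this, of 1] show ?thesis by simp
qed

text \<open>\<open>frechet_derivative\<close> picks some derivative within \<open>S\<close>. Every
  choice agrees with \<open>l\<close> on differences of points of \<open>S\<close>, hence on their
  span, the tangent space.\<close>

lemma differential_affine:
  fixes S :: "'a::euclidean_space set"
  assumes S: "convex S" "x \<in> S" and l: "linear l" and f: "\<And>y. y \<in> S \<Longrightarrow> f y = c + l y" and w: "w \<in> tangent S"
  shows "differential f S x w = l w"
proof -
  have bl: "bounded_linear l" using l by (simp add: linear_conv_bounded_linear)
  have "((\<lambda>y. c + l y) has_derivative l) (at x within S)"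
    by (auto intro!: derivative_eq_intros bounded_linear.has_derivative[OF bl])
  then have fl: "(f has_derivative l) (at x within S)"
    by (rule has_derivative_transform_within[of _ _ _ _ 1]) (use f S in auto)
  then have fd: "(f has_derivative frechet_derivative f (at x within S)) (at x within S)"
    unfolding frechet_derivative_works[symmetric] by (auto simp: differentiable_def)
  let ?D = "frechet_derivative f (at x within S)"
  have lD: "linear ?D" using fd by (simp add: has_derivative_linear)
  have "?D (y - z) = l (y - z)" if "y \<in> S" "z \<in> S" for y z
  proof -
    have "?D (y - x) = l (y - x)" "?D (z - x) = l (z - x)"
      using has_derivative_within_segment_unique[OF S _ fd fl] that by auto
    then have "?D ((y - x) - (z - x)) = l ((y - x) - (z - x))" by (simp only: linear_diff[OF lD] linear_diff[OF l])
    then show ?thesis by simp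
  qed
  then have "?D z = l z" if "z \<in> {y - x |x y. x \<in> S \<and> y \<in> S}" for z using that by blast
  from linear_eq_on_span[OF lD l this w[unfolded tangent_def]] have "?D w = l w" .
  then show ?thesis by (simp add: differential_def)
qed

section \<open>Vertices, barycentric coordinates and hat functions of a complex\<close>

context
  fixes X :: "'a::euclidean_space set set"
  assumes K: "simplicial_complex X"
begin

definition vx :: "'a set \<Rightarrow> 'a set" where
  "vx S = vertices X \<inter> S"

lemma finite_complex: "finite X"
  using K by (simp add: simplicial_complex_def)

lemma face_in_complex: "S \<in> X \<Longrightarrow> F face_of S \<Longrightarrow> F \<in> X"
  using K by (auto simp: simplicial_complex_def)

lemma Int_face_of: "S \<in> X \<Longrightarrow> S' \<in> X \<Longrightarrow> (S \<inter> S') face_of S"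
  using K by (auto simp: simplicial_complex_def)

lemma finite_vertices: "finite (vertices X)"
proof -
  have "vertices X = (\<lambda>v. {v}) -` X" by (auto simp: vertices_def)
  then show ?thesis using finite_vimageI[OF finite_complex, of "\<lambda>v. {v}"] by (simp add: inj_def)
qed

text \<open>A vertex of \<open>X\<close> lying in \<open>S\<close> is a face of \<open>S\<close>,
  since it meets \<open>S\<close> in a common face; conversely the points spanning \<open>S\<close>
  are faces of \<open>S\<close> and so belong to \<open>X\<close>. One-point faces of a simplex are
  its extreme points, that is, its spanning points.\<close>

lemma vx:
  assumes "S \<in> X"
  shows "\<not> affine_dependent (vx S)" "finite (vx S)" "S = convex hull (vx S)"
proof -
  obtain n C where C: "\<not> affine_dependent C" "S = convex hull C"
    using K assms unfolding simplicial_complex_def simplex_def by metis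
  have "vx S = C"
  proof (intro equalityI subsetI)
    fix v assume "v \<in> vx S"
    then have "{v} \<in> X" "v \<in> S" by (auto simp: vx_def vertices_def)
    then have "{v} face_of S" using Int_face_of[OF assms, of "{v}"] by (simp add: Int_absorb1)
    then show "v \<in> C" using extreme_point_of_convex_hull_affine_independent[OF C(1)] C(2) by (simp add: face_of_singleton)
  next
    fix v assume v: "v \<in> C"
    then have "{v} face_of S" using extreme_point_of_convex_hull_affine_independent[OF C(1)] C(2) by (simp add: face_of_singleton)
    then show "v \<in> vx S" using face_in_complex[OF assms] v C(2) by (auto simp: vx_def vertices_def hull_inc)
  qed
  then show "\<not> affine_dependent (vx S)" "S = convex hull (vx S)" using C by auto
  then show "finite (vx S)" using aff_independent_finite by blast
qed

lemma complex_convex: "S \<in> X \<Longrightarrow> convex S"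
  using vx(3) by (metis convex_convex_hull)

lemma complex_closed: "S \<in> X \<Longrightarrow> closed S"
  using vx(2,3) by (metis compact_convex_hull compact_imp_closed finite_imp_compact)

lemma simplex_points:
  assumes "S \<in> X" "x \<in> S"
  obtains u where "\<And>w. w \<in> vx S \<Longrightarrow> 0 \<le> u w" "(\<Sum>w\<in>vx S. u w) = 1" "(\<Sum>w\<in>vx S. u w *\<^sub>R w) = x"
proof -
  have "x \<in> convex hull (vx S)" using assms vx(3) by simp
  then show ?thesis using that by (auto simp: convex_hull_finite[OF vx(2)[OF assms(1)]])
qed

text \<open>An affine function on the whole space restricting to the barycentric coordinate of
  \<open>v\<close> on \<open>S\<close>, split into linear part and constant because the linear part
  is the differential of \<lambda>_v on \<open>S\<close>. The value 0 for other points matches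
  \<lambda>_v = 0 on simplices without the vertex \<open>v\<close>.\<close>

definition affine_coord :: "'a set \<Rightarrow> 'a \<Rightarrow> ('a \<Rightarrow> real) \<times> real" where
  "affine_coord S v = (if v \<in> vx S
     then SOME p. linear (fst p) \<and> (\<forall>w\<in>vx S. snd p + fst p w = (if w = v then 1 else 0)) else (\<lambda>_. 0, 0))"

definition lin :: "'a set \<Rightarrow> 'a \<Rightarrow> 'a \<Rightarrow> real" where
  "lin S v = fst (affine_coord S v)"

definition cst :: "'a set \<Rightarrow> 'a \<Rightarrow> real" where
  "cst S v = snd (affine_coord S v)"

lemma lin_cst:
  assumes S: "S \<in> X"
  shows "linear (lin S v)" "w \<in> vx S \<Longrightarrow> cst S v + lin S v w = (if w = v then 1 else 0)"
    "v \<notin> vx S \<Longrightarrow> lin S v = (\<lambda>_. 0)" "v \<notin> vx S \<Longrightarrow> cst S v = 0"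
proof -
  have "linear (lin S v) \<and> (\<forall>w\<in>vx S. cst S v + lin S v w = (if w = v then 1 else 0))"
  proof (cases "v \<in> vx S")
    case True
    obtain l c where "linear l \<and> (\<forall>w\<in>vx S. c + l w = (if w = v then 1 else 0 :: real))"
      using affine_coordinate_exists[OF vx(1)[OF S] True] by (elim exE)
    then have "linear (fst (l, c)) \<and> (\<forall>w\<in>vx S. snd (l, c) + fst (l, c) w = (if w = v then 1 else 0))"
      by simp
    from someI[where P = "\<lambda>p. linear (fst p) \<and> (\<forall>w\<in>vx S. snd p + fst p w = (if w = v then 1 else 0 :: real))", OF this]
    show ?thesis unfolding lin_def cst_def affine_coord_def if_P[OF True] .
  next
    case False
    then show ?thesis by (auto simp: lin_def cst_def affine_coord_def linear_iff)
  qed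
  then show "linear (lin S v)" "w \<in> vx S \<Longrightarrow> cst S v + lin S v w = (if w = v then 1 else 0)" by blast+
  show "v \<notin> vx S \<Longrightarrow> lin S v = (\<lambda>_. 0)" "v \<notin> vx S \<Longrightarrow> cst S v = 0"
    by (simp_all add: lin_def cst_def affine_coord_def)
qed

definition bary :: "'a set \<Rightarrow> 'a \<Rightarrow> 'a \<Rightarrow> real" where
  "bary S v x = cst S v + lin S v x"

lemma bary_combination:
  assumes S: "S \<in> X" and A: "A \<subseteq> vx S" and u: "(\<Sum>w\<in>A. u w) = 1"
  shows "bary S v (\<Sum>w\<in>A. u w *\<^sub>R w) = (if v \<in> A then u v else 0)"
proof -
  have fin: "finite A" using A vx(2)[OF S] finite_subset by blast
  have "bary S v (\<Sum>w\<in>A. u w *\<^sub>R w) = (\<Sum>w\<in>A. u w) * cst S v + (\<Sum>w\<in>A. u w * lin S v w)"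
    using u by (simp add: bary_def linear_sum[OF lin_cst(1)[OF S]] linear_cmul[OF lin_cst(1)[OF S]])
  also have "\<dots> = (\<Sum>w\<in>A. u w * (cst S v + lin S v w))"
    by (simp add: sum_distrib_right sum.distrib ring_distribs)
  also have "\<dots> = (\<Sum>w\<in>A. if w = v then u v else 0)"
    by (intro sum.cong refl) (use lin_cst(2)[OF S] A in auto)
  finally show ?thesis using fin by simp
qed

lemma bary_props:
  assumes S: "S \<in> X" and x: "x \<in> S"
  shows "0 \<le> bary S v x" "bary S v x \<le> 1" "(\<Sum>w\<in>vx S. bary S w x) = 1" "(\<Sum>w\<in>vx S. bary S w x *\<^sub>R w) = x"
    "v \<notin> S \<Longrightarrow> bary S v x = 0"
proof -
  obtain u where u: "\<And>w. w \<in> vx S \<Longrightarrow> 0 \<le> u w" "(\<Sum>w\<in>vx S. u w) = 1" "(\<Sum>w\<in>vx S. u w *\<^sub>R w) = x"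
    using simplex_points[OF S x] by blast
  have b: "bary S v x = (if v \<in> vx S then u v else 0)" for v
    using bary_combination[OF S order_refl u(2)] u(3) by simp
  show "0 \<le> bary S v x" using b u(1) by simp
  show "bary S v x \<le> 1" using b u(1,2) member_le_sum[of v "vx S" u] vx(2)[OF S] by auto
  show "(\<Sum>w\<in>vx S. bary S w x) = 1" "(\<Sum>w\<in>vx S. bary S w x *\<^sub>R w) = x" using b u by simp_all
  show "v \<notin> S \<Longrightarrow> bary S v x = 0" using b by (simp add: vx_def)
qed

text \<open>The point lies in the common face, whose vertices are vertices of both simplices, and
  one convex combination of them determines both values.\<close>

lemma bary_agree:
  assumes "S \<in> X" "S' \<in> X" "x \<in> S" "x \<in> S'"
  shows "bary S v x = bary S' v x"
proof -
  have F: "S \<inter> S' \<in> X" using face_in_complex[OF assms(1) Int_face_of[OF assms(1,2)]] .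
  obtain u where u: "(\<Sum>w\<in>vx (S \<inter> S'). u w) = 1" "(\<Sum>w\<in>vx (S \<inter> S'). u w *\<^sub>R w) = x"
    using simplex_points[OF F, of x] assms by auto
  have "vx (S \<inter> S') \<subseteq> vx S" "vx (S \<inter> S') \<subseteq> vx S'" by (auto simp: vx_def)
  from bary_combination[OF assms(1) this(1) u(1)] bary_combination[OF assms(2) this(2) u(1)] show ?thesis
    using u(2) by simp
qed

text \<open>The points of \<open>S\<close> where the two functions agree form a convex set
  containing all vertices of \<open>S\<close>.\<close>

lemma is_hat_bary:
  assumes f: "is_hat X v f" and S: "S \<in> X" and x: "x \<in> S"
  shows "f x = bary S v x"
proof -
  let ?Z = "{x \<in> S. f x = bary S v x}"
  have "convex ?Z"
  proof (rule convexI)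
    fix y z s t assume yz: "y \<in> ?Z" "z \<in> ?Z" and st: "(0::real) \<le> s" "0 \<le> t" "s + t = 1"
    have s: "s = 1 - t" using st by simp
    have "s *\<^sub>R y + t *\<^sub>R z \<in> S" using complex_convex[OF S] yz st by (auto simp: convex_def)
    moreover have "f (s *\<^sub>R y + t *\<^sub>R z) = s * f y + t * f z"
      using f yz st S unfolding is_hat_def s by auto
    moreover have "bary S v (s *\<^sub>R y + t *\<^sub>R z) = s * bary S v y + t * bary S v z"
      unfolding bary_def s linear_add[OF lin_cst(1)[OF S]] linear_cmul[OF lin_cst(1)[OF S]] by (simp add: algebra_simps)
    ultimately show "s *\<^sub>R y + t *\<^sub>R z \<in> ?Z" using yz by simp
  qed
  moreover have "vx S \<subseteq> ?Z"
  proof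
    fix w assume w: "w \<in> vx S"
    then have "f w = (if w = v then 1 else 0)" using f by (auto simp: is_hat_def vx_def)
    then show "w \<in> ?Z" using lin_cst(2)[OF S w] w by (simp add: bary_def vx_def)
  qed
  ultimately have "convex hull (vx S) \<subseteq> ?Z" by (rule hull_minimal[rotated])
  then show ?thesis using vx(3)[OF S] x by blast
qed

text \<open>Barycentric coordinates agree on overlaps and glue to a continuous function, the
  simplices being finitely many closed sets. With uniqueness from \<open>is_hat_bary\<close>, the
  description in \<open>hat\<close> denotes.\<close>

lemma is_hat_hat: "is_hat X v (hat X v)"
proof -
  define h where "h x = (if x \<in> \<Union>X then bary (SOME S. S \<in> X \<and> x \<in> S) v x else 0)" for x
  have h: "h x = bary S v x" if "S \<in> X" "x \<in> S" for S x
  proof -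
    have "(SOME S. S \<in> X \<and> x \<in> S) \<in> X \<and> x \<in> (SOME S. S \<in> X \<and> x \<in> S)"
      by (rule someI_ex) (use that in blast)
    then show ?thesis using bary_agree[of "SOME S. S \<in> X \<and> x \<in> S" S x v] that by (auto simp: h_def)
  qed
  have "is_hat X v h" unfolding is_hat_def
  proof (intro conjI ballI allI impI)
    have "continuous_on (\<Union>S\<in>X. S) h"
    proof (rule continuous_on_closed_Union[OF finite_complex])
      fix S assume S: "S \<in> X"
      have "continuous_on S (\<lambda>x. cst S v + lin S v x)"
        by (intro continuous_intros linear_continuous_on) (use lin_cst(1)[OF S] in \<open>simp add: linear_conv_bounded_linear\<close>)
      then show "continuous_on S h" by (rule continuous_on_eq) (simp add: h[OF S] bary_def)
    qed (rule complex_closed)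
    then show "continuous_on (\<Union>X) h" by simp
  next
    fix S x y and t :: real assume S: "S \<in> X" and xy: "x \<in> S" "y \<in> S" and t: "t \<in> {0..1}"
    have "(1 - t) *\<^sub>R x + t *\<^sub>R y \<in> S" using complex_convex[OF S] xy t by (auto simp: convex_alt)
    then show "h ((1 - t) *\<^sub>R x + t *\<^sub>R y) = (1 - t) * h x + t * h y"
      unfolding h[OF S xy(1)] h[OF S xy(2)] h[OF S \<open>(1 - t) *\<^sub>R x + t *\<^sub>R y \<in> S\<close>]
      unfolding bary_def linear_add[OF lin_cst(1)[OF S]] linear_cmul[OF lin_cst(1)[OF S]] by (simp add: algebra_simps)
  next
    fix w assume "w \<in> vertices X"
    then have w: "{w} \<in> X" "w \<in> vx {w}" by (auto simp: vertices_def vx_def)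
    then show "h w = (if w = v then 1 else 0)" using h[OF w(1), of w] lin_cst(2)[OF w] by (simp add: bary_def)
  next
    fix x assume "x \<notin> \<Union>X"
    then show "h x = 0" by (simp add: h_def)
  qed
  moreover have "f = h" if "is_hat X v f" for f
  proof
    fix x
    show "f x = h x"
    proof (cases "x \<in> \<Union>X")
      case True
      then show ?thesis using is_hat_bary[OF that] h by auto
    next
      case False
      then show ?thesis using that by (simp add: is_hat_def h_def)
    qed
  qed
  ultimately show ?thesis unfolding hat_def by (rule theI)
qed

lemma hat_bary: "S \<in> X \<Longrightarrow> x \<in> S \<Longrightarrow> hat X v x = bary S v x"
  by (rule is_hat_bary[OF is_hat_hat])

lemma differential_hat:
  assumes "S \<in> X" "x \<in> S" "w \<in> tangent S"
  shows "differential (hat X v) S x w = lin S v w"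
  by (rule differential_affine[OF complex_convex[OF assms(1)] assms(2) lin_cst(1)[OF assms(1)] _ assms(3)])
    (simp add: hat_bary[OF assms(1)] bary_def)

lemma hat_sum:
  assumes "x \<in> \<Union>X"
  shows "(\<Sum>v\<in>vertices X. hat X v x) = 1" "(\<Sum>v\<in>vertices X. hat X v x *\<^sub>R v) = x"
proof -
  obtain S where S: "S \<in> X" "x \<in> S" using assms by blast
  have z: "hat X v x = 0" if "v \<in> vertices X - vx S" for v
    using bary_props(5)[OF S, of v] hat_bary[OF S, of v] that by (simp add: vx_def)
  have "(\<Sum>v\<in>vx S. hat X v x) = (\<Sum>v\<in>vertices X. hat X v x)"
    by (rule sum.mono_neutral_left[OF finite_vertices]) (use z in \<open>auto simp: vx_def\<close>)
  moreover have "(\<Sum>v\<in>vx S. hat X v x *\<^sub>R v) = (\<Sum>v\<in>vertices X. hat X v x *\<^sub>R v)"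
    by (rule sum.mono_neutral_left[OF finite_vertices]) (use z in \<open>auto simp: vx_def\<close>)
  ultimately show "(\<Sum>v\<in>vertices X. hat X v x) = 1" "(\<Sum>v\<in>vertices X. hat X v x *\<^sub>R v) = x"
    using bary_props(3,4)[OF S] hat_bary[OF S] by simp_all
qed

lemma hat_range: "x \<in> \<Union>X \<Longrightarrow> 0 \<le> hat X v x \<and> hat X v x \<le> 1"
  using bary_props(1,2) hat_bary by (metis UnionE)

lemma hat_outside: "S \<in> X \<Longrightarrow> x \<in> S \<Longrightarrow> v \<notin> S \<Longrightarrow> hat X v x = 0"
  using bary_props(5) hat_bary by metis

lemma lin_outside: "S \<in> X \<Longrightarrow> v \<notin> S \<Longrightarrow> lin S v w = 0"
  using lin_cst(3)[of S v] by (simp add: vx_def)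

lemma tangent_combination:
  assumes S: "S \<in> X" and c: "(\<Sum>w\<in>vx S. c w) = 0"
  shows "(\<Sum>w\<in>vx S. c w *\<^sub>R w) \<in> tangent S"
proof (cases "vx S = {}")
  case True
  then show ?thesis by (simp add: tangent_def span_zero)
next
  case False
  then obtain w0 where w0: "w0 \<in> vx S" by blast
  have "(\<Sum>w\<in>vx S. c w *\<^sub>R w) = (\<Sum>w\<in>vx S. c w *\<^sub>R (w - w0))"
    using c by (simp add: scaleR_diff_right sum_subtractf scaleR_sum_left[symmetric])
  also have "\<dots> \<in> tangent S" unfolding tangent_def
    by (intro span_sum span_scale span_base) (use w0 in \<open>auto simp: vx_def\<close>)
  finally show ?thesis .
qed

lemma lin_combination:
  assumes S: "S \<in> X" and c: "(\<Sum>w\<in>vx S. c w) = 0" and v: "v \<in> vertices X"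
  shows "lin S v (\<Sum>w\<in>vx S. c w *\<^sub>R w) = (if v \<in> S then c v else 0)"
proof -
  have "lin S v (\<Sum>w\<in>vx S. c w *\<^sub>R w) = (\<Sum>w\<in>vx S. c w) * cst S v + (\<Sum>w\<in>vx S. c w * lin S v w)"
    using c by (simp add: linear_sum[OF lin_cst(1)[OF S]] linear_cmul[OF lin_cst(1)[OF S]])
  also have "\<dots> = (\<Sum>w\<in>vx S. c w * (cst S v + lin S v w))"
    by (simp add: sum_distrib_right sum.distrib ring_distribs)
  also have "\<dots> = (\<Sum>w\<in>vx S. if w = v then c v else 0)"
    by (intro sum.cong refl) (use lin_cst(2)[OF S] in auto)
  finally show ?thesis using vx(2)[OF S] v by (simp add: vx_def)
qed

text \<open>The derivative of the partition of unity \<Sum> \<lambda>_v = 1, valid on tangent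
  vectors only.\<close>

lemma lin_sum_zero:
  assumes S: "S \<in> X" "x \<in> S" and w: "w \<in> tangent S"
  shows "(\<Sum>v\<in>vertices X. lin S v w) = 0"
proof -
  have lin: "linear (\<lambda>w. \<Sum>v\<in>vertices X. lin S v w)" by (intro linear_compose_sum ballI lin_cst(1)[OF S(1)])
  have s: "(\<Sum>v\<in>vertices X. bary S v y) = 1" if "y \<in> S" for y
    using hat_sum(1)[of y] hat_bary[OF S(1) that] S(1) that by auto
  have "(\<Sum>v\<in>vertices X. lin S v (y - z)) = 0" if "y \<in> S" "z \<in> S" for y z
    using s[OF that(1)] s[OF that(2)] by (simp add: bary_def linear_diff[OF lin_cst(1)[OF S(1)]] sum_subtractf sum.distrib)
  then have "(\<Sum>v\<in>vertices X. lin S v z) = 0" if "z \<in> {y - x |x y. x \<in> S \<and> y \<in> S}" for z using that by blast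
  from linear_eq_on_span[OF lin linear_zero this w[unfolded tangent_def]] show ?thesis .
qed

text \<open>The vertices with positive barycentric coordinate span a face that contains
  \<open>x\<close> in its relative interior.\<close>

lemma carrier_simplex:
  assumes "x \<in> \<Union>X"
  shows "carrier_simplex X x \<in> X" "x \<in> carrier_simplex X x"
proof -
  obtain S where S: "S \<in> X" "x \<in> S" using assms by blast
  define C where "C = {w \<in> vx S. 0 < bary S w x}"
  have CS: "C \<subseteq> vx S" by (auto simp: C_def)
  have z: "bary S w x = 0" if "w \<in> vx S - C" for w using that bary_props(1)[OF S, of w] by (auto simp: C_def)
  have C: "\<not> affine_dependent C" using CS vx(1)[OF S(1)] affine_independent_subset by blast
  have "(\<Sum>w\<in>C. bary S w x) = 1" "(\<Sum>w\<in>C. bary S w x *\<^sub>R w) = x"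
    using bary_props(3,4)[OF S] sum.mono_neutral_left[OF vx(2)[OF S(1)] CS, of "\<lambda>w. bary S w x"]
      sum.mono_neutral_left[OF vx(2)[OF S(1)] CS, of "\<lambda>w. bary S w x *\<^sub>R w"] z by auto
  then have r: "x \<in> rel_interior (convex hull C)" unfolding rel_interior_convex_hull_explicit[OF C]
    by (intro CollectI exI[of _ "\<lambda>w. bary S w x"]) (auto simp: C_def)
  have "convex hull C face_of S"
    using face_of_convex_hull_affine_independent[OF vx(1)[OF S(1)], of "convex hull C"] CS vx(3)[OF S(1)] by auto
  then have F: "convex hull C \<in> X" using face_in_complex[OF S(1)] by blast
  \<comment> \<open>A face of S1 that meets the relative interior of S1 is S1 itself; the face in
    question is S1 \<inter> S2. By symmetry the carrier is unique.\<close>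
  have sub: "S1 \<subseteq> S2" if "S1 \<in> X" "S2 \<in> X" "x \<in> rel_interior S1" "x \<in> rel_interior S2" for S1 S2
  proof -
    have "S1 \<subseteq> S1 \<inter> S2"
      by (rule subset_of_face_of[OF Int_face_of[OF that(1,2)]]) (use that rel_interior_subset in blast)+
    then show ?thesis by blast
  qed
  have "\<exists>!S. S \<in> X \<and> x \<in> rel_interior S"
    using F r sub by (intro ex1I[of _ "convex hull C"]) blast+
  from theI'[OF this] show "carrier_simplex X x \<in> X" "x \<in> carrier_simplex X x"
    unfolding carrier_simplex_def using rel_interior_subset by blast+
qed

end

section \<open>Total derivatives and pullbacks of Whitney forms\<close>

text \<open>A path may change between the pieces infinitely often, so subdividing it is impossible.
  Jumping at once to the last parameter \<open>s\<close> in the current piece removes this piece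
  from the cover of the rest, and the induction runs over the number of pieces.\<close>

lemma closed_cover_Lipschitz:
  fixes h :: "real \<Rightarrow> real"
  assumes "finite F" "a \<le> b" "{a..b} \<subseteq> \<Union>F" "\<And>c. c \<in> F \<Longrightarrow> closed c"
    and "\<And>c s t. c \<in> F \<Longrightarrow> s \<in> c \<Longrightarrow> t \<in> c \<Longrightarrow> s \<in> {a..b} \<Longrightarrow> t \<in> {a..b} \<Longrightarrow> \<bar>h s - h t\<bar> \<le> M * \<bar>s - t\<bar>"
  shows "\<bar>h b - h a\<bar> \<le> M * (b - a)"
  using assms
proof (induction F arbitrary: a rule: finite_psubset_induct)
  case (psubset F)
  obtain c where c: "c \<in> F" "a \<in> c" using psubset.prems(1,2) by fastforce
  define s where "s = Sup (c \<inter> {a..b})"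
  have comp: "compact (c \<inter> {a..b})" using psubset.prems(3)[OF c(1)] by (simp add: closed_Int_compact)
  have ne: "c \<inter> {a..b} \<noteq> {}" using c psubset.prems(1) by auto
  have bdd: "bdd_above (c \<inter> {a..b})" by (rule bdd_above_mono[of "{a..b}"]) auto
  have s: "s \<in> c" "a \<le> s" "s \<le> b"
    using closed_contains_Sup[OF ne bdd compact_imp_closed[OF comp]] by (auto simp: s_def)
  have 1: "\<bar>h s - h a\<bar> \<le> M * (s - a)" using psubset.prems(4)[OF c(1) s(1) c(2)] s psubset.prems(1) by simp
  show ?case
  proof (cases "s = b")
    case False
    have gt: "t \<notin> c" if "s < t" "t \<le> b" for t
      using that cSup_upper[OF _ bdd, of t] s by (auto simp: s_def[symmetric])
    have "{s<..b} \<subseteq> \<Union>(F - {c})"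
    proof
      fix t assume t: "t \<in> {s<..b}"
      then have "t \<in> {a..b}" using s by auto
      then obtain c' where "c' \<in> F" "t \<in> c'" using psubset.prems(2) by blast
      moreover have "c' \<noteq> c" using gt[of t] t \<open>t \<in> c'\<close> by auto
      ultimately show "t \<in> \<Union>(F - {c})" by blast
    qed
    moreover have "closed (\<Union>(F - {c}))" using psubset.hyps(1) psubset.prems(3) by (intro closed_Union) auto
    \<comment> \<open>The parameter \<open>s\<close> itself is covered by the remaining pieces
      because their union is closed, so the induction can start from \<open>s\<close>.\<close>
    ultimately have "closure {s<..b} \<subseteq> \<Union>(F - {c})" by (rule closure_minimal)
    moreover have "closure {s<..b} = {s..b}" using False s by (intro closure_greaterThanAtMost) auto
    ultimately have cov: "{s..b} \<subseteq> \<Union>(F - {c})" by (simp only:)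
    have "\<bar>h b - h s\<bar> \<le> M * (b - s)"
    proof (rule psubset.IH[OF _ s(3) cov])
      show "F - {c} \<subset> F" using c by auto
      show "closed d" if "d \<in> F - {c}" for d using psubset.prems(3) that by blast
      show "\<bar>h u - h t\<bar> \<le> M * \<bar>u - t\<bar>" if "d \<in> F - {c}" "u \<in> d" "t \<in> d" "u \<in> {s..b}" "t \<in> {s..b}" for d u t
        by (rule psubset.prems(4)[of d]) (use that s in auto)
    qed
    then show ?thesis using 1 by (simp add: algebra_simps)
  qed (use 1 in simp)
qed

lemma edist_le: "edist k x y \<le> (\<Sum>i\<in>{1..k}. \<bar>x i - y i\<bar>)"
  unfolding edist_def by (rule L2_set_le_sum_abs)

lemma coord_le_edist: "i \<in> {1..k} \<Longrightarrow> \<bar>x i - y i\<bar> \<le> edist k x y"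
proof -
  assume "i \<in> {1..k}"
  then have "\<bar>x i - y i\<bar> \<le> L2_set (\<lambda>i. \<bar>x i - y i\<bar>) {1..k}" by (intro member_le_L2_set) auto
  then show ?thesis by (simp add: edist_def L2_set_def)
qed

lemma sum_le_edist: "(\<Sum>i\<in>{1..k}. \<bar>x i - y i\<bar>) \<le> real k * edist k x y"
  using sum_bounded_above[of "{1..k}" "\<lambda>i. \<bar>x i - y i\<bar>" "edist k x y"] coord_le_edist[of _ k x y] by simp

lemma edist_scale: "edist k (\<lambda>i. x i + s * v i) (\<lambda>i. x i + t * v i) = \<bar>s - t\<bar> * L2_set v {1..k}"
proof -
  have "edist k (\<lambda>i. x i + s * v i) (\<lambda>i. x i + t * v i) = L2_set (\<lambda>i. (s - t) * v i) {1..k}"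
    by (simp add: edist_def algebra_simps)
  also have "\<dots> = sqrt ((s - t)\<^sup>2 * (\<Sum>i\<in>{1..k}. (v i)\<^sup>2))"
    unfolding L2_set_def by (simp add: power_mult_distrib sum_distrib_left)
  also have "\<dots> = \<bar>s - t\<bar> * L2_set v {1..k}" by (simp add: L2_set_def real_sqrt_mult)
  finally show ?thesis .
qed

text \<open>McShane's formula, the infimum of the cones \<open>f y + L * d x y\<close>, clamped to
  [0,1] to become bounded; the clamping keeps the values on \<open>A\<close>.\<close>

lemma Lipschitz_extension:
  assumes f: "\<And>x y. x \<in> A \<Longrightarrow> y \<in> A \<Longrightarrow> \<bar>f x - f y\<bar> \<le> L * (\<Sum>i\<in>{1..k}. \<bar>x i - y i\<bar>)"
    and r: "\<And>x. x \<in> A \<Longrightarrow> 0 \<le> f x \<and> f x \<le> (1::real)" and L: "0 \<le> L"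
  obtains G where "bl k G" "\<And>x. x \<in> A \<Longrightarrow> G x = f x"
proof (cases "A = {}")
  case True
  then show ?thesis using that[OF bl_const[of k 0]] by simp
next
  case False
  define d where "d x y = (\<Sum>i\<in>{1..k}. \<bar>x i - y i\<bar>)" for x y :: "nat \<Rightarrow> real"
  have d0: "0 \<le> d x y" for x y unfolding d_def by (rule sum_nonneg) simp
  have dtri: "d x z \<le> d x y + d y z" for x y z
    unfolding d_def sum.distrib[symmetric] by (rule sum_mono) simp
  define G0 where "G0 x = Inf ((\<lambda>y. f y + L * d x y) ` A)" for x
  have nn: "0 \<le> f y + L * d x y" if "y \<in> A" for x y using r[OF that] L d0 by simp
  have bdd: "bdd_below ((\<lambda>y. f y + L * d x y) ` A)" for x using nn by (intro bdd_belowI[of _ 0]) auto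
  have ne: "(\<lambda>y. f y + L * d x y) ` A \<noteq> {}" for x using False by simp
  have le: "G0 x \<le> G0 z + L * d x z" for x z
  proof -
    have "G0 x - L * d x z \<le> G0 z" unfolding G0_def[of z]
    proof (rule cInf_greatest[OF ne])
      fix u assume "u \<in> (\<lambda>y. f y + L * d z y) ` A"
      then obtain y where y: "y \<in> A" "u = f y + L * d z y" by blast
      have "G0 x \<le> f y + L * d x y" unfolding G0_def by (rule cInf_lower[OF _ bdd]) (use y in blast)
      also have "\<dots> \<le> f y + (L * d x z + L * d z y)"
        using mult_left_mono[OF dtri[of x y z] L] by (simp add: distrib_left)
      finally show "G0 x - L * d x z \<le> u" using y by simp
    qed
    then show ?thesis by simp
  qed
  have sym: "d x z = d z x" for x z by (simp add: d_def abs_minus_commute)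
  have eq: "G0 x = f x" if x: "x \<in> A" for x
  proof (rule antisym)
    have "G0 x \<le> f x + L * d x x" unfolding G0_def by (rule cInf_lower[OF _ bdd]) (use x in blast)
    then show "G0 x \<le> f x" by (simp add: d_def)
    show "f x \<le> G0 x" unfolding G0_def
    proof (rule cInf_greatest[OF ne])
      fix u assume "u \<in> (\<lambda>y. f y + L * d x y) ` A"
      then obtain y where y: "y \<in> A" "u = f y + L * d x y" by blast
      then show "f x \<le> u" using f[OF x y(1)] by (simp add: d_def abs_le_iff)
    qed
  qed
  define G where "G x = max 0 (min 1 (G0 x))" for x
  show ?thesis
  proof (rule that)
    show "bl k G"
    proof (rule blI)
      show "lip_on {1..k} L G" unfolding lip_on_def
      proof (intro allI)
        fix x y
        have "\<bar>G x - G y\<bar> \<le> \<bar>G0 x - G0 y\<bar>" by (auto simp: G_def)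
        also have "\<dots> \<le> L * d x y" using le[of x y] le[of y x] sym[of x y] by (simp add: abs_le_iff)
        finally show "\<bar>G x - G y\<bar> \<le> L * (\<Sum>i\<in>{1..k}. \<bar>x i - y i\<bar>)" by (simp add: d_def)
      qed
      show "\<bar>G x\<bar> \<le> 1" for x by (auto simp: G_def)
    qed
    show "G x = f x" if "x \<in> A" for x using r[OF that] eq[OF that] by (simp add: G_def)
  qed
qed

lemma std_Q_segment:
  assumes "x \<in> std_Q k" "y \<in> std_Q k" "t \<in> {0..1}"
  shows "(\<lambda>i. x i + t * (\<lambda>i. if i \<in> {1..k} then y i - x i else 0) i) \<in> std_Q k"
proof -
  let ?z = "\<lambda>i. x i + t * (\<lambda>i. if i \<in> {1..k} then y i - x i else 0) i"
  have z: "?z i = (1 - t) * x i + t * y i" if "i \<in> {1..k}" for i using that by (simp add: algebra_simps)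
  have "(\<Sum>i\<in>{1..k}. ?z i) = (1 - t) * (\<Sum>i\<in>{1..k}. x i) + t * (\<Sum>i\<in>{1..k}. y i)"
    unfolding sum_distrib_left sum.distrib[symmetric] by (rule sum.cong[OF refl z])
  also have "\<dots> \<le> (1 - t) * 1 + t * 1" using assms by (intro add_mono mult_left_mono) (auto simp: std_Q_def)
  finally have s: "(\<Sum>i\<in>{1..k}. ?z i) \<le> 1" by simp
  have "0 \<le> ?z i" if "i \<in> {1..k}" for i unfolding z[OF that] using assms that by (auto simp: std_Q_def)
  moreover have "?z \<in> extensional {1..k}" using assms(1) by (auto simp: std_Q_def extensional_def)
  ultimately show ?thesis using s by (simp add: std_Q_def)
qed

text \<open>The hat function is Lipschitz on each simplex, but \<open>\<Union>X\<close> may fail to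
  be convex, so \<open>T x\<close> and \<open>T y\<close> cannot be joined by a segment there. The
  image under \<open>T\<close> of the segment from \<open>x\<close> to \<open>y\<close> is a path in
  \<open>\<Union>X\<close>, and its parts in the single simplices are handled by
  \<open>closed_cover_Lipschitz\<close>.\<close>

lemma hat_comp_Lipschitz:
  assumes K: "simplicial_complex X" and T: "lipschitz_simplex k (\<Union>X) T"
  obtains L where "0 \<le> L" "\<And>x y. x \<in> std_Q k \<Longrightarrow> y \<in> std_Q k \<Longrightarrow> \<bar>hat X v (T x) - hat X v (T y)\<bar> \<le> L * (\<Sum>i\<in>{1..k}. \<bar>x i - y i\<bar>)"
proof -
  obtain C0 where C0: "\<And>x y. x \<in> std_Q k \<Longrightarrow> y \<in> std_Q k \<Longrightarrow> dist (T x) (T y) \<le> C0 * edist k x y"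
    using T by (auto simp: lipschitz_simplex_def)
  define C where "C = \<bar>C0\<bar>"
  have e0: "0 \<le> edist k x y" for x y by (simp add: edist_def L2_set_nonneg)
  have C: "0 \<le> C" "\<And>x y. x \<in> std_Q k \<Longrightarrow> y \<in> std_Q k \<Longrightarrow> dist (T x) (T y) \<le> C * edist k x y"
    using order_trans[OF C0 mult_right_mono[OF abs_ge_self e0]] by (auto simp: C_def)
  have TX: "T x \<in> \<Union>X" if "x \<in> std_Q k" for x using T that by (auto simp: lipschitz_simplex_def)
  define B where "B S = onorm (lin X S v)" for S
  \<comment> \<open>A sum of operator norms as a common bound over the finitely many
    simplices.\<close>
  define M where "M = (\<Sum>S\<in>X. B S)"
  have blin: "bounded_linear (lin X S v)" if "S \<in> X" for S
    using lin_cst(1)[OF K that] by (simp add: linear_conv_bounded_linear)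
  have B0: "0 \<le> B S" if "S \<in> X" for S unfolding B_def by (rule onorm_pos_le[OF blin[OF that]])
  have M: "0 \<le> M" "\<And>S. S \<in> X \<Longrightarrow> B S \<le> M"
    unfolding M_def using B0 finite_complex[OF K] by (auto intro: sum_nonneg member_le_sum)
  have hl: "\<bar>hat X v x - hat X v y\<bar> \<le> M * dist x y" if S: "S \<in> X" "x \<in> S" "y \<in> S" for S x y
  proof -
    have "hat X v x - hat X v y = lin X S v (x - y)"
      using hat_bary[OF K S(1,2)] hat_bary[OF K S(1,3)] by (simp add: bary_def[OF K] linear_diff[OF lin_cst(1)[OF K S(1)]])
    also have "\<bar>\<dots>\<bar> \<le> B S * norm (x - y)" unfolding B_def real_norm_def[symmetric] by (rule onorm[OF blin[OF S(1)]])
    also have "\<dots> \<le> M * dist x y" unfolding dist_norm by (intro mult_right_mono M S) simp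
    finally show ?thesis .
  qed
  have main: "\<bar>hat X v (T y) - hat X v (T x)\<bar> \<le> (M * C) * edist k x y" if xy: "x \<in> std_Q k" "y \<in> std_Q k" for x y
  proof -
    define d where "d = (\<lambda>i. if i \<in> {1..k} then y i - x i else 0)"
    define \<gamma> where "\<gamma> t = (\<lambda>i. x i + t * d i)" for t
    have \<gamma>Q: "\<gamma> t \<in> std_Q k" if "t \<in> {0..1}" for t
      unfolding \<gamma>_def d_def by (rule std_Q_segment[OF xy that])
    have ends: "\<gamma> 0 = x" "\<gamma> 1 = y"
      using xy by (auto simp: \<gamma>_def d_def fun_eq_iff std_Q_def extensional_def)
    have ed: "edist k (\<gamma> s) (\<gamma> t) = \<bar>s - t\<bar> * edist k x y" for s t
    proof -
      have "edist k (\<gamma> s) (\<gamma> t) = \<bar>s - t\<bar> * L2_set d {1..k}" for s t unfolding \<gamma>_def by (rule edist_scale)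
      from this[of s t] this[of 0 1] show ?thesis by (simp add: ends)
    qed
    define E where "E = C * edist k x y"
    have TE: "dist (T (\<gamma> s)) (T (\<gamma> t)) \<le> E * \<bar>s - t\<bar>" if "s \<in> {0..1}" "t \<in> {0..1}" for s t
      using C(2)[OF \<gamma>Q[OF that(1)] \<gamma>Q[OF that(2)]] by (simp add: ed E_def mult_ac)
    have E: "0 \<le> E" unfolding E_def using C(1) e0 by simp
    have cont: "continuous_on {0..1} (\<lambda>t. T (\<gamma> t))"
      by (rule lipschitz_on_continuous_on[of E]) (use TE E in \<open>auto simp: lipschitz_on_def dist_real_def\<close>)
    have "\<bar>hat X v (T (\<gamma> 1)) - hat X v (T (\<gamma> 0))\<bar> \<le> (M * E) * (1 - 0)"
    proof (rule closed_cover_Lipschitz[where F = "(\<lambda>S. {t \<in> {0..1}. T (\<gamma> t) \<in> S}) ` X" and h = "\<lambda>t. hat X v (T (\<gamma> t))"])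
      show "finite ((\<lambda>S. {t \<in> {0..1}. T (\<gamma> t) \<in> S}) ` X)" using finite_complex[OF K] by simp
      show "{0..1} \<subseteq> \<Union> ((\<lambda>S. {t \<in> {0..1}. T (\<gamma> t) \<in> S}) ` X)" using TX \<gamma>Q by auto
      show "closed c" if c: "c \<in> (\<lambda>S. {t \<in> {0..1}. T (\<gamma> t) \<in> S}) ` X" for c
      proof -
        obtain S where S: "S \<in> X" and cS: "c = {t \<in> {0..1}. T (\<gamma> t) \<in> S}" using c by blast
        have "c = {0..1} \<inter> (\<lambda>t. T (\<gamma> t)) -` S" using cS by auto
        then show ?thesis using continuous_closed_preimage[OF cont _ complex_closed[OF K S(1)]] by simp
      qed
      fix c s t assume c: "c \<in> (\<lambda>S. {t \<in> {0..1}. T (\<gamma> t) \<in> S}) ` X" and st: "s \<in> c" "t \<in> c" "s \<in> {0..1}" "t \<in> {0..1}"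
      then obtain S where S: "S \<in> X" "T (\<gamma> s) \<in> S" "T (\<gamma> t) \<in> S" by auto
      have "\<bar>hat X v (T (\<gamma> s)) - hat X v (T (\<gamma> t))\<bar> \<le> M * (E * \<bar>s - t\<bar>)"
        by (rule order_trans[OF hl[OF S] mult_left_mono[OF TE[OF st(3,4)] M(1)]])
      then show "\<bar>hat X v (T (\<gamma> s)) - hat X v (T (\<gamma> t))\<bar> \<le> M * E * \<bar>s - t\<bar>" by (simp add: mult.assoc)
    qed simp
    then show ?thesis by (simp add: ends E_def mult.assoc)
  qed
  show ?thesis
  proof (rule that[of "M * C"])
    show MC: "0 \<le> M * C" using M C by simp
    fix x y assume xy: "x \<in> std_Q k" "y \<in> std_Q k"
    show "\<bar>hat X v (T x) - hat X v (T y)\<bar> \<le> M * C * (\<Sum>i\<in>{1..k}. \<bar>x i - y i\<bar>)"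
      using order_trans[OF main[OF xy] mult_left_mono[OF edist_le MC]] by (simp add: abs_minus_commute)
  qed
qed

text \<open>Extensions of \<lambda>_v \<circ> T beyond the simplex, because \<open>bl\<close> and
  partial derivatives are formulated for functions defined everywhere.\<close>

definition hat_functions :: "'a::euclidean_space set set \<Rightarrow> nat \<Rightarrow> ((nat \<Rightarrow> real) \<Rightarrow> 'a) \<Rightarrow> ('a \<Rightarrow> (nat \<Rightarrow> real) \<Rightarrow> real) \<Rightarrow> bool" where
  "hat_functions X k T G \<longleftrightarrow> (\<forall>v. bl k (G v) \<and> (\<forall>q\<in>std_Q k. G v q = hat X v (T q)))"

lemma hat_functions_exist:
  assumes K: "simplicial_complex X" and T: "lipschitz_simplex k (\<Union>X) T"
  shows "\<exists>G. hat_functions X k T G"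
proof -
  have "\<exists>G. bl k G \<and> (\<forall>q\<in>std_Q k. G q = hat X v (T q))" for v
  proof -
    obtain L where L: "0 \<le> L" "\<And>x y. x \<in> std_Q k \<Longrightarrow> y \<in> std_Q k \<Longrightarrow> \<bar>hat X v (T x) - hat X v (T y)\<bar> \<le> L * (\<Sum>i\<in>{1..k}. \<bar>x i - y i\<bar>)"
      using hat_comp_Lipschitz[OF K T] by blast
    have r: "0 \<le> hat X v (T x) \<and> hat X v (T x) \<le> 1" if "x \<in> std_Q k" for x
      by (rule hat_range[OF K]) (use T that in \<open>auto simp: lipschitz_simplex_def\<close>)
    obtain G where "bl k G" "\<And>x. x \<in> std_Q k \<Longrightarrow> G x = hat X v (T x)"
      using Lipschitz_extension[OF L(2) r L(1)] by metis
    then show ?thesis by blast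
  qed
  then show ?thesis unfolding hat_functions_def by (intro choice allI)
qed

lemma has_dird_sum:
  "finite A \<Longrightarrow> (\<And>i. i \<in> A \<Longrightarrow> has_dird (g i) v x (l i)) \<Longrightarrow> has_dird (\<lambda>x. \<Sum>i\<in>A. g i x) v x (\<Sum>i\<in>A. l i)"
  unfolding has_dird_iff_DERIV by (rule DERIV_sum)

text \<open>From an interior point one can move along every coordinate direction inside the simplex,
  so the arbitrary choice in \<open>total_derivative\<close> is determined there.\<close>

lemma total_derivative_unique:
  assumes D: "has_total_derivative k T D q" "has_total_derivative k T D' q" and q: "q \<in> qint k" and j: "j \<in> {1..k}"
  shows "D j = D' j"
proof (rule ccontr)
  assume ne: "D j \<noteq> D' j"
  \<comment> \<open>One third of the gap: two errors of size \<open>e\<close> cannot bridge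
    it.\<close>
  define e where "e = norm (D j - D' j) / 3"
  have e: "0 < e" using ne by (simp add: e_def)
  obtain d where d: "0 < d" "\<And>y. y \<in> std_Q k \<Longrightarrow> edist k y q < d \<Longrightarrow> norm (T y - T q - (\<Sum>i=1..k. (y i - q i) *\<^sub>R D i)) \<le> e * edist k y q"
    using D(1) e unfolding has_total_derivative_def by blast
  obtain d' where d': "0 < d'" "\<And>y. y \<in> std_Q k \<Longrightarrow> edist k y q < d' \<Longrightarrow> norm (T y - T q - (\<Sum>i=1..k. (y i - q i) *\<^sub>R D' i)) \<le> e * edist k y q"
    using D(2) e unfolding has_total_derivative_def by blast
  obtain r where r: "0 < r" "\<And>t. t \<noteq> 0 \<Longrightarrow> \<bar>t\<bar> < r \<Longrightarrow> (\<lambda>i. q i + t * pdir j i) \<in> qint k"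
    using qint_line[OF q j] unfolding eventually_at dist_real_def by auto
  define t where "t = Min {r, d, d'} / 2"
  have t: "0 < t" "t < r" "t < d" "t < d'" using r(1) d(1) d'(1) by (auto simp: t_def)
  define y where "y = (\<lambda>i. q i + t * pdir j i)"
  have y: "y \<in> std_Q k" using r(2)[of t] t qint_subset by (auto simp: y_def)
  have "L2_set (pdir j) {1..k} = 1" unfolding L2_set_def using j by (simp add: if_distrib[of "\<lambda>x. x\<^sup>2"] cong: if_cong)
  then have ed: "edist k y q = t" using edist_scale[of k q t "pdir j" 0] t by (simp add: y_def)
  have S: "(\<Sum>i=1..k. (y i - q i) *\<^sub>R D i) = t *\<^sub>R D j" for D :: "nat \<Rightarrow> 'a"
  proof -
    have "(\<Sum>i=1..k. (y i - q i) *\<^sub>R D i) = (\<Sum>i=1..k. if i = j then t *\<^sub>R D j else 0)"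
      by (intro sum.cong refl) (simp add: y_def)
    then show ?thesis using j by simp
  qed
  have "norm (T y - T q - t *\<^sub>R D j) \<le> e * t" "norm (T y - T q - t *\<^sub>R D' j) \<le> e * t"
    using d(2)[OF y] d'(2)[OF y] t unfolding S ed by auto
  then have "norm ((T y - T q - t *\<^sub>R D' j) - (T y - T q - t *\<^sub>R D j)) \<le> e * t + e * t"
    by (intro order_trans[OF norm_triangle_ineq4]) auto
  moreover have "(T y - T q - t *\<^sub>R D' j) - (T y - T q - t *\<^sub>R D j) = t *\<^sub>R (D j - D' j)" by (simp add: algebra_simps)
  ultimately have "norm (t *\<^sub>R (D j - D' j)) \<le> e * t + e * t" by (simp only:)
  then have "t * norm (D j - D' j) \<le> t * (2 * e)" unfolding norm_scaleR using t by (simp add: algebra_simps)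
  then have "norm (D j - D' j) \<le> 2 * e" using t by simp
  then show False using e by (simp add: e_def)
qed

text \<open>On the simplex T = \<Sum> (\<lambda>_v \<circ> T) v, which reduces the claim to finitely
  many real functions.\<close>

lemma has_total_derivative_hat:
  assumes K: "simplicial_complex X" and T: "lipschitz_simplex k (\<Union>X) T" and G: "hat_functions X k T G"
    and q: "q \<in> std_Q k" and g: "\<And>v. v \<in> vertices X \<Longrightarrow> has_grad {1..k} (G v) q"
  shows "has_total_derivative k T (\<lambda>j. \<Sum>v\<in>vertices X. pd j (G v) q *\<^sub>R v) q"
  unfolding has_total_derivative_def
proof (intro allI impI)
  fix e :: real assume e: "0 < e"
  let ?V = "vertices X"
  have fin: "finite ?V" by (rule finite_vertices[OF K])
  \<comment> \<open>The norms of the vertices come from the expansion of \<open>T\<close>, the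
    factor \<open>k\<close> from comparing the l1 distance with the Euclidean one, and the 1 keeps
    \<open>N\<close> positive.\<close>
  define N where "N = (\<Sum>v\<in>?V. norm v) * real k + 1"
  have N: "0 < N" unfolding N_def by (intro add_nonneg_pos mult_nonneg_nonneg sum_nonneg) auto
  define e' where "e' = e / N"
  have e': "0 < e'" "e' * N = e" using e N by (auto simp: e'_def)
  have "\<forall>v\<in>?V. \<exists>d>0. \<forall>y. (\<Sum>i\<in>{1..k}. \<bar>y i - q i\<bar>) < d \<longrightarrow>
     \<bar>G v y - G v q - (\<Sum>i\<in>{1..k}. (y i - q i) * pd i (G v) q)\<bar> \<le> e' * (\<Sum>i\<in>{1..k}. \<bar>y i - q i\<bar>)"
    using g e'(1) unfolding has_grad_def by blast
  from bchoice[OF this] obtain d where d: "\<And>v. v \<in> ?V \<Longrightarrow> 0 < d v" "\<And>v y. v \<in> ?V \<Longrightarrow> (\<Sum>i\<in>{1..k}. \<bar>y i - q i\<bar>) < d v \<Longrightarrow>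
     \<bar>G v y - G v q - (\<Sum>i\<in>{1..k}. (y i - q i) * pd i (G v) q)\<bar> \<le> e' * (\<Sum>i\<in>{1..k}. \<bar>y i - q i\<bar>)"
    by blast
  define d0 where "d0 = Min (insert 1 (d ` ?V))"
  have d0: "0 < d0" "\<And>v. v \<in> ?V \<Longrightarrow> d0 \<le> d v" using fin d(1) by (auto simp: d0_def)
  define \<delta> where "\<delta> = d0 / (real k + 1)"
  have \<delta>: "0 < \<delta>" using d0 by (simp add: \<delta>_def)
  have Tsum: "T y = (\<Sum>v\<in>?V. G v y *\<^sub>R v)" if "y \<in> std_Q k" for y
  proof -
    have "T y \<in> \<Union>X" using T that by (auto simp: lipschitz_simplex_def)
    from hat_sum(2)[OF K this] show ?thesis using G that by (simp add: hat_functions_def)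
  qed
  have "norm (T y - T q - (\<Sum>i=1..k. (y i - q i) *\<^sub>R (\<Sum>v\<in>?V. pd i (G v) q *\<^sub>R v))) \<le> e * edist k y q"
    if y: "y \<in> std_Q k" and yd: "edist k y q < \<delta>" for y
  proof -
    define s where "s = (\<Sum>i\<in>{1..k}. \<bar>y i - q i\<bar>)"
    have s: "s \<le> real k * edist k y q" "0 \<le> s" unfolding s_def by (rule sum_le_edist, rule sum_nonneg, simp)
    have e0: "0 \<le> edist k y q" by (simp add: edist_def L2_set_nonneg)
    have "s \<le> (real k + 1) * edist k y q" using s e0 by (simp add: ring_distribs)
    also have "\<dots> < (real k + 1) * \<delta>" using yd by (intro mult_strict_left_mono) auto
    also have "\<dots> = d0" by (simp add: \<delta>_def)
    finally have sd: "s < d v" if "v \<in> ?V" for v using d0(2)[OF that] by simp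
    have "T y - T q - (\<Sum>i=1..k. (y i - q i) *\<^sub>R (\<Sum>v\<in>?V. pd i (G v) q *\<^sub>R v))
      = (\<Sum>v\<in>?V. (G v y - G v q - (\<Sum>i\<in>{1..k}. (y i - q i) * pd i (G v) q)) *\<^sub>R v)"
    proof -
      have "(\<Sum>i=1..k. (y i - q i) *\<^sub>R (\<Sum>v\<in>?V. pd i (G v) q *\<^sub>R v)) = (\<Sum>v\<in>?V. \<Sum>i=1..k. ((y i - q i) * pd i (G v) q) *\<^sub>R v)"
        unfolding scaleR_sum_right scaleR_scaleR by (rule sum.swap)
      then show ?thesis unfolding Tsum[OF y] Tsum[OF q]
        by (simp add: scaleR_diff_left sum_subtractf scaleR_sum_left)
    qed
    also have "norm \<dots> \<le> (\<Sum>v\<in>?V. (e' * s) * norm v)"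
    proof (rule order_trans[OF norm_sum], rule sum_mono)
      fix v assume v: "v \<in> ?V"
      show "norm ((G v y - G v q - (\<Sum>i\<in>{1..k}. (y i - q i) * pd i (G v) q)) *\<^sub>R v) \<le> (e' * s) * norm v"
        unfolding norm_scaleR s_def by (intro mult_right_mono d(2)[OF v] sd[OF v, unfolded s_def]) simp
    qed
    also have "\<dots> = e' * s * (\<Sum>v\<in>?V. norm v)" by (simp add: sum_distrib_left)
    also have "\<dots> \<le> e' * (real k * edist k y q) * (\<Sum>v\<in>?V. norm v)"
      by (intro mult_right_mono mult_left_mono s sum_nonneg) (use e' in auto)
    also have "\<dots> = e' * (N - 1) * edist k y q" by (simp add: N_def mult_ac)
    also have "\<dots> \<le> e' * N * edist k y q" using e'(1) e0 by (intro mult_right_mono mult_left_mono) auto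
    finally show ?thesis using e'(2) by simp
  qed
  then show "\<exists>d>0. \<forall>y\<in>std_Q k. edist k y q < d \<longrightarrow>
      norm (T y - T q - (\<Sum>i=1..k. (y i - q i) *\<^sub>R (\<Sum>v\<in>?V. pd i (G v) q *\<^sub>R v))) \<le> e * edist k y q"
    using \<delta> by blast
qed

text \<open>The derivative of \<open>T\<close> is tangent to the carrier of \<open>T q\<close>: the barycentric coordinates that
  vanish at \<open>T q\<close> attain a minimum there.\<close>

lemma total_derivative_ae:
  assumes K: "simplicial_complex X" and T: "lipschitz_simplex k (\<Union>X) T" and G: "hat_functions X k T G"
  shows "AE q in lebn k. q \<in> qint k \<longrightarrow> (\<forall>j\<in>{1..k}.
    total_derivative k T q j \<in> tangent (carrier_simplex X (T q)) \<and>
    (\<forall>v\<in>vertices X. lin X (carrier_simplex X (T q)) v (total_derivative k T q j) = pd j (G v) q))"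
proof -
  let ?V = "vertices X"
  have fin: "finite ?V" by (rule finite_vertices[OF K])
  have bl: "bl k (G v)" for v using G by (simp add: hat_functions_def)
  have "AE q in lebn k. \<forall>v\<in>?V. has_grad {1..k} (G v) q"
    using bl by (intro AE_finite_allI[OF fin]) (auto simp: bl_def intro: has_grad_ae)
  moreover have "AE q in lebn k. \<forall>v\<in>?V. \<forall>j. has_dird (G v) (pdir j) q (pd j (G v) q)"
    using bl by (intro AE_finite_allI[OF fin]) (auto simp: bl_def intro: pd_exists_ae)
  ultimately show ?thesis
  proof eventually_elim
    case (elim q)
    show ?case
    proof (intro impI ballI)
      fix j assume q: "q \<in> qint k" and j: "j \<in> {1..k}"
      have qQ: "q \<in> std_Q k" using q qint_subset by blast
      define S where "S = carrier_simplex X (T q)"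
      have TX: "T y \<in> \<Union>X" if "y \<in> std_Q k" for y using T that by (auto simp: lipschitz_simplex_def)
      have S: "S \<in> X" "T q \<in> S" unfolding S_def using carrier_simplex[OF K TX[OF qQ]] by auto
      have Geq: "G v y = hat X v (T y)" if "y \<in> std_Q k" for v y using G that by (simp add: hat_functions_def)
      have line: "\<forall>\<^sub>F t in at 0. (\<lambda>i. q i + t * pdir j i) \<in> std_Q k"
        using qint_line[OF q j] by eventually_elim (use qint_subset in blast)
      \<comment> \<open>The coordinates sum to 1 on the simplex. A combination of vertices is
        tangent when its coefficients sum to 0.\<close>
      have sum0: "(\<Sum>v\<in>?V. pd j (G v) q) = 0"
      proof -
        have s1: "(\<Sum>v\<in>?V. G v y) = 1" if "y \<in> std_Q k" for y
          using hat_sum(1)[OF K TX[OF that]] Geq[OF that] by simp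
        have "has_dird (\<lambda>x. \<Sum>v\<in>?V. G v x) (pdir j) q 0"
          by (rule has_dird_linear_local) (use line in eventually_elim, simp add: s1 s1[OF qQ])
        moreover have "has_dird (\<lambda>x. \<Sum>v\<in>?V. G v x) (pdir j) q (\<Sum>v\<in>?V. pd j (G v) q)"
          by (rule has_dird_sum[OF fin]) (use elim in blast)
        ultimately show ?thesis using has_dird_imp_dird by metis
      qed
      have out: "pd j (G v) q = 0" if v: "v \<in> ?V" "v \<notin> S" for v
      proof -
        have z: "G v q = 0" using hat_outside[OF K S v(2)] Geq[OF qQ] by simp
        obtain r where r: "0 < r" "\<And>t. t \<noteq> 0 \<Longrightarrow> \<bar>t\<bar> < r \<Longrightarrow> (\<lambda>i. q i + t * pdir j i) \<in> std_Q k"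
          using line unfolding eventually_at dist_real_def by auto
        have "((\<lambda>t. G v (\<lambda>i. q i + t * pdir j i)) has_real_derivative pd j (G v) q) (at 0)"
          using elim v(1) unfolding has_dird_iff_DERIV by blast
        then show ?thesis
        proof (rule DERIV_local_min[OF _ r(1)])
          show "\<forall>y. \<bar>0 - y\<bar> < r \<longrightarrow> G v (\<lambda>i. q i + 0 * pdir j i) \<le> G v (\<lambda>i. q i + y * pdir j i)"
          proof (intro allI impI)
            fix y assume "\<bar>0 - y\<bar> < r"
            then have "(\<lambda>i. q i + y * pdir j i) \<in> std_Q k" using r(2)[of y] qQ by (cases "y = 0") auto
            then show "G v (\<lambda>i. q i + 0 * pdir j i) \<le> G v (\<lambda>i. q i + y * pdir j i)"
              using hat_range[OF K TX] Geq z by simp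
          qed
        qed
      qed
      have td: "total_derivative k T q j = (\<Sum>v\<in>?V. pd j (G v) q *\<^sub>R v)"
      proof -
        have D: "has_total_derivative k T (\<lambda>j. \<Sum>v\<in>?V. pd j (G v) q *\<^sub>R v) q"
          by (rule has_total_derivative_hat[OF K T G qQ]) (use elim in blast)
        then have "has_total_derivative k T (total_derivative k T q) q"
          unfolding total_derivative_def by (rule someI[where P = "\<lambda>D. has_total_derivative k T D q"])
        from total_derivative_unique[OF this D q j] show ?thesis .
      qed
      have sub: "vx X S \<subseteq> ?V" "\<And>v. v \<in> ?V - vx X S \<Longrightarrow> pd j (G v) q = 0" using out by (auto simp: vx_def[OF K])
      have td': "total_derivative k T q j = (\<Sum>v\<in>vx X S. pd j (G v) q *\<^sub>R v)"
        unfolding td by (rule sum.mono_neutral_right[OF fin sub(1)]) (simp add: sub(2))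
      have sum0': "(\<Sum>v\<in>vx X S. pd j (G v) q) = 0"
        using sum.mono_neutral_right[OF fin sub(1), of "\<lambda>v. pd j (G v) q"] sub(2) sum0 by simp
      show "total_derivative k T q j \<in> tangent (carrier_simplex X (T q)) \<and>
        (\<forall>v\<in>?V. lin X (carrier_simplex X (T q)) v (total_derivative k T q j) = pd j (G v) q)"
        unfolding S_def[symmetric] td'
        using tangent_combination[OF K S(1) sum0'] lin_combination[OF K S(1) sum0'] out by auto
    qed
  qed
qed

section \<open>Pullbacks of Whitney forms and Stokes' theorem for singular simplices\<close>

text \<open>The function \<open>f\<close> will be a pullback, for which measurability is not known
  in advance. Over the completion every subset of a null set is measurable, so agreement almost
  everywhere with a measurable function suffices.\<close>

lemma integral_completion_cong_ae:
  fixes f g :: "'b \<Rightarrow> real"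
  assumes g: "g \<in> borel_measurable M" and eq: "AE x in M. f x = g x"
  shows "integral\<^sup>L (completion M) f = integral\<^sup>L M g"
proof -
  have ne: "Measurable.pred (completion M) (\<lambda>x. f x \<noteq> g x)" by (rule sets_completion_AE) (use eq in simp)
  then have e: "Measurable.pred (completion M) (\<lambda>x. f x = g x)" using pred_intros_logic(2)[OF ne] by simp
  have gc: "g \<in> borel_measurable (completion M)" using g by (rule measurable_completion)
  have "f \<in> borel_measurable (completion M)"
  proof (rule measurableI)
    fix A :: "real set" assume A: "A \<in> sets borel"
    have "Measurable.pred (completion M) (\<lambda>x. f x \<in> A \<and> f x \<noteq> g x)"
      by (rule sets_completion_AE) (use eq in \<open>auto elim: eventually_mono\<close>)
    moreover have "Measurable.pred (completion M) (\<lambda>x. g x \<in> A \<and> f x = g x)"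
    proof -
      have "Measurable.pred (completion M) (\<lambda>x. g x \<in> A)" using measurable_compose[OF gc pred_sets2[OF A measurable_ident_sets[OF refl]]] by (simp add: o_def)
      then show ?thesis using e by measurable
    qed
    ultimately have "Measurable.pred (completion M) (\<lambda>x. (f x \<in> A \<and> f x \<noteq> g x) \<or> (g x \<in> A \<and> f x = g x))"
      by measurable
    moreover have "(f x \<in> A \<and> f x \<noteq> g x) \<or> (g x \<in> A \<and> f x = g x) \<longleftrightarrow> f x \<in> A" for x by auto
    ultimately have "Measurable.pred (completion M) (\<lambda>x. f x \<in> A)" by simp
    then show "f -` A \<inter> space (completion M) \<in> sets (completion M)" by (simp add: pred_def vimage_def Int_def conj_commute)
  qed simp
  then have "integral\<^sup>L (completion M) f = integral\<^sup>L (completion M) g"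
    using gc eq by (intro integral_cong_AE) (auto intro: AE_completion)
  then show ?thesis using integral_completion[OF g] by simp
qed

text \<open>Degree 0 is included: \<open>lebn 0\<close> is counting measure on one point, so
  evaluation at a point is an integral as well.\<close>

lemma simplex_integral_eq:
  assumes \<phi>: "am k \<phi>" and eq: "AE q in lebn k. q \<in> qint k \<longrightarrow> pullback X k T u q = \<phi> q"
  shows "simplex_integral X k T u = (\<integral>q. indicator (std_Q k) q * \<phi> q \<partial>lebn k)"
proof (cases "k = 0")
  case True
  have M: "lebn 0 = count_space {\<lambda>_. undefined}" by (simp add: PiM_empty)
  have q0: "(\<lambda>_. undefined) \<in> qint 0" by (auto simp: qint_def extensional_def)
  have "pullback X 0 T u (\<lambda>_. undefined) = \<phi> (\<lambda>_. undefined)"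
    using eq q0 unfolding True M by (simp add: AE_count_space)
  moreover have "Q_vertex 0 0 = (\<lambda>_. undefined)" by (simp add: Q_vertex_def restrict_def)
  ultimately have "simplex_integral X k T u = \<phi> (\<lambda>_. undefined)"
    by (simp add: simplex_integral_def True point_value_def pullback_def)
  also have "\<dots> = (\<integral>q. indicator (std_Q k) q * \<phi> q \<partial>lebn k)"
  proof -
    have "(\<lambda>_. undefined) \<in> std_Q 0" using q0 qint_subset[of 0] by blast
    then show ?thesis unfolding True M lebesgue_integral_count_space_finite[OF finite.insertI[OF finite.emptyI]] by simp
  qed
  finally show ?thesis .
next
  case False
  have "AE q in lebn k. indicator (std_Q k) q *\<^sub>R pullback X k T u q = indicator (std_Q k) q * \<phi> q"
    using eq qint_ae by eventually_elim (auto simp: indicator_def)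
  from integral_completion_cong_ae[OF borel_measurable_integrable[OF integrable_am[OF \<phi>]] this]
  show ?thesis using False by (simp add: simplex_integral_def set_lebesgue_integral_def)
qed

definition whitney_jac :: "nat \<Rightarrow> ('a \<Rightarrow> (nat \<Rightarrow> real) \<Rightarrow> real) \<Rightarrow> 'a list \<Rightarrow> (nat \<Rightarrow> real) \<Rightarrow> real" where
  "whitney_jac k G \<sigma> q = fact k * (\<Sum>i\<le>k. (-1) ^ i * (G (\<sigma> ! i) q * jac k (map G (omit i \<sigma>)) q))"

definition whitney_wint :: "nat \<Rightarrow> ('a \<Rightarrow> (nat \<Rightarrow> real) \<Rightarrow> real) \<Rightarrow> 'a list \<Rightarrow> real" where
  "whitney_wint k G \<sigma> = fact k * (\<Sum>i\<le>k. (-1) ^ i * wint k (G (\<sigma> ! i)) (map G (omit i \<sigma>)))"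

text \<open>The exterior derivative of the Whitney form of \<sigma>, in closed form;
  \<open>ext_deriv_whitney\<close> justifies this.\<close>

definition dwhitney :: "'a::euclidean_space set set \<Rightarrow> nat \<Rightarrow> 'a list \<Rightarrow> 'a form" where
  "dwhitney X k \<sigma> = normalize_form X (Suc k) (\<lambda>S x ws. fact (Suc k) * wedge (map (\<lambda>v. differential (hat X v) S x) \<sigma>) ws)"

lemma am_whitney_jac:
  assumes "\<And>v. bl k (G v)" "length \<sigma> = Suc k"
  shows "am k (whitney_jac k G \<sigma>)"
proof -
  have "am k (\<lambda>q. fact k * (\<Sum>i\<le>k. (-1) ^ i * (G (\<sigma> ! i) q * jac k (map G (omit i \<sigma>)) q)))"
    by (intro am_mult am_const am_sum finite_atMost bl_am assms am_jac) (use assms in auto)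
  then show ?thesis unfolding whitney_jac_def[abs_def] .
qed

lemma integral_whitney_jac:
  assumes "\<And>v. bl k (G v)" "length \<sigma> = Suc k"
  shows "(\<integral>q. indicator (std_Q k) q * whitney_jac k G \<sigma> q \<partial>lebn k) = whitney_wint k G \<sigma>"
proof -
  have i: "integrable (lebn k) (\<lambda>q. indicator (std_Q k) q * (G (\<sigma> ! i) q * jac k (map G (omit i \<sigma>)) q))" if "i \<le> k" for i
    by (intro integrable_am am_mult bl_am assms am_jac) (use assms that in auto)
  have "(\<integral>q. indicator (std_Q k) q * whitney_jac k G \<sigma> q \<partial>lebn k) =
      (\<integral>q. fact k * (\<Sum>i\<le>k. (-1) ^ i * (indicator (std_Q k) q * (G (\<sigma> ! i) q * jac k (map G (omit i \<sigma>)) q))) \<partial>lebn k)"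
  proof (intro Bochner_Integration.integral_cong refl)
    show "indicator (std_Q k) q * whitney_jac k G \<sigma> q =
      fact k * (\<Sum>i\<le>k. (-1) ^ i * (indicator (std_Q k) q * (G (\<sigma> ! i) q * jac k (map G (omit i \<sigma>)) q)))" for q
      unfolding whitney_jac_def by (cases "q \<in> std_Q k") simp_all
  qed
  also have "\<dots> = whitney_wint k G \<sigma>"
    unfolding whitney_wint_def wint_def integral_mult_right_zero
    by (subst Bochner_Integration.integral_sum) (use i in auto)
  finally show ?thesis .
qed

text \<open>Both formulas hold off the single null set of \<open>total_derivative_ae\<close>. There
  the chain rule d\<lambda>_v(DT e_j) = \<partial>_j(\<lambda>_v \<circ> T) holds with d\<lambda>_v
  taken on the carrier of \<open>T q\<close>, and wedge products of differentials become
  Jacobians.\<close>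

lemma pullback_ae_forms:
  assumes K: "simplicial_complex X" and T: "lipschitz_simplex k (\<Union>X) T" and G: "hat_functions X k T G"
  shows "AE q in lebn k. q \<in> qint k \<longrightarrow>
    (\<forall>\<sigma>. length \<sigma> = Suc k \<and> set \<sigma> \<subseteq> vertices X \<longrightarrow> pullback X k T (whitney_form X k \<sigma>) q = whitney_jac k G \<sigma> q) \<and>
    (\<forall>l \<sigma>. k = Suc l \<and> length \<sigma> = k \<and> set \<sigma> \<subseteq> vertices X \<longrightarrow> pullback X k T (dwhitney X l \<sigma>) q = fact k * jac k (map G \<sigma>) q)"
  using total_derivative_ae[OF K T G]
proof eventually_elim
  case (elim q)
  show ?case
  proof
    assume q: "q \<in> qint k"
    define S where "S = carrier_simplex X (T q)"
    define D where "D = map (total_derivative k T q) [1..<Suc k]"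
    have qQ: "q \<in> std_Q k" using q qint_subset by blast
    have "T q \<in> \<Union>X" using T qQ by (auto simp: lipschitz_simplex_def)
    then have S: "S \<in> X" "T q \<in> S" unfolding S_def using carrier_simplex[OF K] by auto
    have td: "total_derivative k T q j \<in> tangent S" "v \<in> vertices X \<Longrightarrow> lin X S v (total_derivative k T q j) = pd j (G v) q"
      if "j \<in> {1..k}" for j v using elim q that by (auto simp: S_def)
    have Dn: "D ! j = total_derivative k T q ([1..<Suc k] ! j)" "[1..<Suc k] ! j \<in> {1..k}" if "j < k" for j
      using that by (auto simp: D_def nth_upt)
    have D: "length D = k" "set D \<subseteq> tangent S" using td(1) by (auto simp: D_def)
    have w: "wedge (map (\<lambda>v. differential (hat X v) S (T q)) \<tau>) D = jac k (map G \<tau>) q" if \<tau>: "length \<tau> = k" "set \<tau> \<subseteq> vertices X" for \<tau>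
      unfolding jac_def
    proof (rule wedge_cong)
      fix i j assume "i < length (map (\<lambda>v. differential (hat X v) S (T q)) \<tau>)" "j < length (map (\<lambda>v. differential (hat X v) S (T q)) \<tau>)"
      then have ij: "i < k" "j < k" using \<tau> by auto
      then have v: "\<tau> ! i \<in> vertices X" using \<tau> by (metis nth_mem subsetD)
      show "(map (\<lambda>v. differential (hat X v) S (T q)) \<tau> ! i) (D ! j) = (map (\<lambda>h j. pd j h q) (map G \<tau>) ! i) ([1..<Suc k] ! j)"
        using ij \<tau> differential_hat[OF K S td(1)[OF Dn(2)[OF ij(2)]]] td(2)[OF Dn(2)[OF ij(2)] v] by (simp add: Dn(1)[OF ij(2)])
    qed (simp add: \<tau>)
    have Gq: "G v q = hat X v (T q)" for v using G qQ by (simp add: hat_functions_def)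
    have "pullback X k T (whitney_form X k \<sigma>) q = whitney_jac k G \<sigma> q" if \<sigma>: "length \<sigma> = Suc k" "set \<sigma> \<subseteq> vertices X" for \<sigma>
    proof -
      have om: "wedge (map (\<lambda>v. differential (hat X v) S (T q)) (omit i \<sigma>)) D = jac k (map G (omit i \<sigma>)) q" if "i \<le> k" for i
        by (rule w) (use \<sigma> that set_take_subset[of i \<sigma>] set_drop_subset[of "Suc i" \<sigma>] in \<open>auto simp: omit_def\<close>)
      have "pullback X k T (whitney_form X k \<sigma>) q = fact k * (\<Sum>i\<le>k. (-1) ^ i * hat X (\<sigma> ! i) (T q) *
          wedge (map (\<lambda>v. differential (hat X v) S (T q)) (omit i \<sigma>)) D)"
        unfolding pullback_def S_def[symmetric] D_def[symmetric] whitney_form_def normalize_form_def using S D by simp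
      also have "\<dots> = whitney_jac k G \<sigma> q"
      proof -
        have "(\<Sum>i\<le>k. (-1) ^ i * hat X (\<sigma> ! i) (T q) * wedge (map (\<lambda>v. differential (hat X v) S (T q)) (omit i \<sigma>)) D) =
          (\<Sum>i\<le>k. (-1) ^ i * (G (\<sigma> ! i) q * jac k (map G (omit i \<sigma>)) q))"
          by (rule sum.cong[OF refl]) (simp add: om Gq mult.assoc)
        then show ?thesis unfolding whitney_jac_def by (rule arg_cong)
      qed
      finally show ?thesis .
    qed
    moreover have "pullback X k T (dwhitney X l \<sigma>) q = fact k * jac k (map G \<sigma>) q"
      if "k = Suc l" "length \<sigma> = k" "set \<sigma> \<subseteq> vertices X" for l \<sigma>
    proof -
      have "pullback X k T (dwhitney X l \<sigma>) q = fact k * wedge (map (\<lambda>v. differential (hat X v) S (T q)) \<sigma>) D"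
        unfolding pullback_def S_def[symmetric] D_def[symmetric] dwhitney_def normalize_form_def using S D that(1) by simp
      then show ?thesis by (simp add: w[OF that(2,3)])
    qed
    ultimately show "(\<forall>\<sigma>. length \<sigma> = Suc k \<and> set \<sigma> \<subseteq> vertices X \<longrightarrow> pullback X k T (whitney_form X k \<sigma>) q = whitney_jac k G \<sigma> q) \<and>
      (\<forall>l \<sigma>. k = Suc l \<and> length \<sigma> = k \<and> set \<sigma> \<subseteq> vertices X \<longrightarrow> pullback X k T (dwhitney X l \<sigma>) q = fact k * jac k (map G \<sigma>) q)"
      by blast
  qed
qed

text \<open>Finite combinations are treated at once, since \<open>simplex_integral\<close> is not
  additive on arbitrary forms: integrability of the pullbacks is known only through this explicit
  shape.\<close>

lemma simplex_integral_whitney: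
  assumes K: "simplicial_complex X" and T: "lipschitz_simplex k (\<Union>X) T" and G: "hat_functions X k T G"
    and A: "finite A" "\<And>\<sigma>. \<sigma> \<in> A \<Longrightarrow> length \<sigma> = Suc k \<and> set \<sigma> \<subseteq> vertices X"
  shows "simplex_integral X k T (\<lambda>S x ws. \<Sum>\<sigma>\<in>A. c \<sigma> * whitney_form X k \<sigma> S x ws) = (\<Sum>\<sigma>\<in>A. c \<sigma> * whitney_wint k G \<sigma>)"
proof -
  have bl: "bl k (G v)" for v using G by (simp add: hat_functions_def)
  have am: "am k (whitney_jac k G \<sigma>)" if "\<sigma> \<in> A" for \<sigma> by (rule am_whitney_jac[OF bl]) (use A(2)[OF that] in simp)
  have "simplex_integral X k T (\<lambda>S x ws. \<Sum>\<sigma>\<in>A. c \<sigma> * whitney_form X k \<sigma> S x ws) =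
    (\<integral>q. indicator (std_Q k) q * (\<Sum>\<sigma>\<in>A. c \<sigma> * whitney_jac k G \<sigma> q) \<partial>lebn k)"
  proof (rule simplex_integral_eq)
    show "am k (\<lambda>q. \<Sum>\<sigma>\<in>A. c \<sigma> * whitney_jac k G \<sigma> q)" by (intro am_sum A am_mult am_const am)
    show "AE q in lebn k. q \<in> qint k \<longrightarrow> pullback X k T (\<lambda>S x ws. \<Sum>\<sigma>\<in>A. c \<sigma> * whitney_form X k \<sigma> S x ws) q = (\<Sum>\<sigma>\<in>A. c \<sigma> * whitney_jac k G \<sigma> q)"
      using pullback_ae_forms[OF K T G]
    proof eventually_elim
      case (elim q)
      show ?case
      proof
        assume q: "q \<in> qint k"
        have "pullback X k T (whitney_form X k \<sigma>) q = whitney_jac k G \<sigma> q" if "\<sigma> \<in> A" for \<sigma> using elim q A(2)[OF that] by blast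
        then show "pullback X k T (\<lambda>S x ws. \<Sum>\<sigma>\<in>A. c \<sigma> * whitney_form X k \<sigma> S x ws) q = (\<Sum>\<sigma>\<in>A. c \<sigma> * whitney_jac k G \<sigma> q)"
          unfolding pullback_def by (intro sum.cong refl) simp
      qed
    qed
  qed
  also have "\<dots> = (\<integral>q. (\<Sum>\<sigma>\<in>A. c \<sigma> * (indicator (std_Q k) q * whitney_jac k G \<sigma> q)) \<partial>lebn k)"
    by (intro Bochner_Integration.integral_cong refl) (simp add: sum_distrib_left mult_ac)
  also have "\<dots> = (\<Sum>\<sigma>\<in>A. c \<sigma> * (\<integral>q. indicator (std_Q k) q * whitney_jac k G \<sigma> q \<partial>lebn k))"
    by (subst Bochner_Integration.integral_sum) (use integrable_am[OF am] in auto)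
  also have "\<dots> = (\<Sum>\<sigma>\<in>A. c \<sigma> * whitney_wint k G \<sigma>)"
  proof (rule sum.cong[OF refl])
    fix \<sigma> assume "\<sigma> \<in> A"
    then have "length \<sigma> = Suc k" using A(2) by blast
    then show "c \<sigma> * (\<integral>q. indicator (std_Q k) q * whitney_jac k G \<sigma> q \<partial>lebn k) = c \<sigma> * whitney_wint k G \<sigma>"
      by (simp only: integral_whitney_jac[of k G \<sigma>, OF bl])
  qed
  finally show ?thesis .
qed

lemma simplex_integral_dwhitney:
  assumes K: "simplicial_complex X" and T: "lipschitz_simplex (Suc k) (\<Union>X) T" and G: "hat_functions X (Suc k) T G"
    and A: "finite A" "\<And>\<sigma>. \<sigma> \<in> A \<Longrightarrow> length \<sigma> = Suc k \<and> set \<sigma> \<subseteq> vertices X"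
  shows "simplex_integral X (Suc k) T (\<lambda>S x ws. \<Sum>\<sigma>\<in>A. c \<sigma> * dwhitney X k \<sigma> S x ws) = (\<Sum>\<sigma>\<in>A. c \<sigma> * (fact (Suc k) * wint (Suc k) (\<lambda>_. 1) (map G \<sigma>)))"
proof -
  let ?k = "Suc k"
  have bl: "bl ?k (G v)" for v using G by (simp add: hat_functions_def)
  have am: "am ?k (jac ?k (map G \<sigma>))" if "\<sigma> \<in> A" for \<sigma> by (rule am_jac) (use A(2)[OF that] bl in auto)
  have "simplex_integral X ?k T (\<lambda>S x ws. \<Sum>\<sigma>\<in>A. c \<sigma> * dwhitney X k \<sigma> S x ws) =
    (\<integral>q. indicator (std_Q ?k) q * (\<Sum>\<sigma>\<in>A. c \<sigma> * (fact ?k * jac ?k (map G \<sigma>) q)) \<partial>lebn ?k)"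
  proof (rule simplex_integral_eq)
    show "am ?k (\<lambda>q. \<Sum>\<sigma>\<in>A. c \<sigma> * (fact ?k * jac ?k (map G \<sigma>) q))" by (intro am_sum A am_mult am_const am)
    show "AE q in lebn ?k. q \<in> qint ?k \<longrightarrow> pullback X ?k T (\<lambda>S x ws. \<Sum>\<sigma>\<in>A. c \<sigma> * dwhitney X k \<sigma> S x ws) q = (\<Sum>\<sigma>\<in>A. c \<sigma> * (fact ?k * jac ?k (map G \<sigma>) q))"
      using pullback_ae_forms[OF K T G]
    proof eventually_elim
      case (elim q)
      show ?case
      proof
        assume q: "q \<in> qint ?k"
        have "pullback X ?k T (dwhitney X k \<sigma>) q = fact ?k * jac ?k (map G \<sigma>) q" if "\<sigma> \<in> A" for \<sigma> using elim q A(2)[OF that] by blast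
        then show "pullback X ?k T (\<lambda>S x ws. \<Sum>\<sigma>\<in>A. c \<sigma> * dwhitney X k \<sigma> S x ws) q = (\<Sum>\<sigma>\<in>A. c \<sigma> * (fact ?k * jac ?k (map G \<sigma>) q))"
          unfolding pullback_def by (intro sum.cong refl) simp
      qed
    qed
  qed
  also have "\<dots> = (\<integral>q. (\<Sum>\<sigma>\<in>A. (c \<sigma> * fact ?k) * (indicator (std_Q ?k) q * (1 * jac ?k (map G \<sigma>) q))) \<partial>lebn ?k)"
    by (intro Bochner_Integration.integral_cong refl) (simp add: sum_distrib_left mult_ac)
  also have "\<dots> = (\<Sum>\<sigma>\<in>A. (c \<sigma> * fact ?k) * wint ?k (\<lambda>_. 1) (map G \<sigma>))"
    unfolding wint_def by (subst Bochner_Integration.integral_sum) (use integrable_am[OF am] in auto)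
  finally show ?thesis by (simp only: mult.assoc)
qed

lemma wedge_laplace_any_row:
  assumes l: "l \<le> n" and len: "length \<alpha>s = Suc n" "length ws = Suc n"
  shows "wedge \<alpha>s ws = (\<Sum>j\<le>n. (-1) ^ (l + j) * (\<alpha>s ! l) (ws ! j) * wedge (omit l \<alpha>s) (omit j ws))"
proof -
  let ?A = "mat (Suc n) (Suc n) (\<lambda>(i, j). (\<alpha>s ! i) (ws ! j))"
  have "wedge \<alpha>s ws = (\<Sum>j<Suc n. ?A $$ (l, j) * cofactor ?A l j)"
    unfolding wedge_det len by (rule laplace_expansion_row) (use l in auto)
  also have "\<dots> = (\<Sum>j\<le>n. (-1) ^ (l + j) * (\<alpha>s ! l) (ws ! j) * wedge (omit l \<alpha>s) (omit j ws))"
  proof (intro sum.cong)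
    fix j assume "j \<in> {..n}"
    then have j: "j \<le> n" by simp
    have "mat_delete ?A l j = mat (length (omit l \<alpha>s)) (length (omit l \<alpha>s)) (\<lambda>(i, m). (omit l \<alpha>s ! i) (omit j ws ! m))"
      by (rule eq_matI) (use j l len in \<open>auto simp: mat_delete_def nth_omit\<close>)
    moreover have "?A $$ (l, j) = (\<alpha>s ! l) (ws ! j)" using j l by simp
    ultimately show "?A $$ (l, j) * cofactor ?A l j = (-1) ^ (l + j) * (\<alpha>s ! l) (ws ! j) * wedge (omit l \<alpha>s) (omit j ws)"
      by (simp only: cofactor_def wedge_det) simp
  qed auto
  finally show ?thesis .
qed

lemma wedge_move_to_front:
  assumes l: "l \<le> n" and len: "length \<alpha>s = Suc n" "length ws = Suc n"
  shows "wedge ((\<alpha>s ! l) # omit l \<alpha>s) ws = (-1) ^ l * wedge \<alpha>s ws"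
proof -
  have "(-1) ^ l * wedge \<alpha>s ws = (\<Sum>j\<le>n. ((-1) ^ l * (-1) ^ l) * ((-1) ^ j * (\<alpha>s ! l) (ws ! j) * wedge (omit l \<alpha>s) (omit j ws)))"
    unfolding wedge_laplace_any_row[OF assms] by (simp add: sum_distrib_left power_add mult_ac)
  also have "\<dots> = (\<Sum>j\<le>n. (-1) ^ j * (\<alpha>s ! l) (ws ! j) * wedge (omit l \<alpha>s) (omit j ws))"
    by (simp add: power_mult_distrib[symmetric])
  also have "\<dots> = wedge ((\<alpha>s ! l) # omit l \<alpha>s) ws"
    by (subst wedge_laplace_row) (use l len in simp_all)
  finally show ?thesis ..
qed

lemma jac_move_to_front:
  assumes "l \<le> n" "length \<sigma> = Suc n"
  shows "jac (Suc n) (G (\<sigma> ! l) # map G (omit l \<sigma>)) q = (-1) ^ l * jac (Suc n) (map G \<sigma>) q"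
  unfolding jac_def
  using wedge_move_to_front[OF assms(1), of "map (\<lambda>h j. pd j h q) (map G \<sigma>)" "[1..<Suc (Suc n)]"] assms
  by (simp add: map_omit[symmetric] o_def)

text \<open>The affine map through the vertices other than \<open>q\<^sub>i\<close> has the origin
  as base point for i > 0 and the first unit vector for i = 0; the two branches of
  \<open>face\<close> correspond to this.\<close>

lemma face_map_eq:
  assumes i: "i \<le> Suc k" and x: "x \<in> std_Q k"
  shows "face_map (Suc k) i x = face k i x"
proof -
  let ?Q = "map (Q_vertex (Suc k)) [0..<Suc (Suc k)]"
  have len: "length (omit i ?Q) = Suc k" using i by simp
  have nth: "omit i ?Q ! l = Q_vertex (Suc k) (if l < i then l else Suc l)" if "l \<le> k" for l
    using that i by (auto simp: nth_omit nth_append nth_upt simp del: upt_Suc map_append)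
  have "face_map (Suc k) i x j = face k i x j" for j
  proof (cases "j \<in> {1..Suc k}")
    case True
    have "face_map (Suc k) i x j = (omit i ?Q ! 0) j + (\<Sum>l=1..k. x l * ((omit i ?Q ! l) j - (omit i ?Q ! 0) j))"
      unfolding face_map_def affine_simplex_R_def len using x True by simp
    also have "\<dots> = Q_vertex (Suc k) (if 0 < i then 0 else 1) j +
        (\<Sum>l=1..k. x l * (Q_vertex (Suc k) (if l < i then l else Suc l) j - Q_vertex (Suc k) (if 0 < i then 0 else 1) j))"
      using nth[of 0] by (intro arg_cong2[of _ _ _ _ "(+)"] sum.cong refl) (simp_all add: nth One_nat_def)
    also have "\<dots> = face k i x j"
    proof (cases "i = 0")
      case True
      have "(\<Sum>l=1..k. x l * ((if j = Suc l then 1 else 0) - (if j = 1 then 1 else 0))) = (if j = 1 then - (\<Sum>l=1..k. x l) else x (j - 1))"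
      proof (cases "j = 1")
        case False
        then have "(\<Sum>l=1..k. x l * ((if j = Suc l then 1 else 0) - (if j = 1 then 1 else 0))) = (\<Sum>l=1..k. if l = j - 1 then x (j - 1) else 0)"
          using \<open>j \<in> {1..Suc k}\<close> by (intro sum.cong refl) auto
        then show ?thesis using False \<open>j \<in> {1..Suc k}\<close> by auto
      qed (auto simp: sum_negf[symmetric] intro!: sum.cong)
      then show ?thesis using True \<open>j \<in> {1..Suc k}\<close> by (auto simp: Q_vertex_def face_def ins_def)
    next
      case False
      have "(\<Sum>l=1..k. x l * (if j = shift i l then 1 else 0)) = ins i 0 x j"
      proof (cases "j = i")
        case True
        have "i \<noteq> shift i l" for l by (simp add: shift_def)
        then show ?thesis by (simp add: True ins_def)
      next
        case ji: False
        obtain l where l: "l \<in> {1..k}" "j = shift i l"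
        proof -
          have "j \<in> {1..Suc k} - {i}" using ji \<open>j \<in> {1..Suc k}\<close> by simp
          also have "{1..Suc k} - {i} = shift i ` {1..k}" using False i by (intro bij_betw_imp_surj_on[OF shift_bij, symmetric]) auto
          finally show ?thesis using that by blast
        qed
        have "(\<Sum>l'=1..k. x l' * (if j = shift i l' then 1 else 0)) = (\<Sum>l'=1..k. if l' = l then x l else 0)"
          by (intro sum.cong refl) (auto simp: l(2) shift_def split: if_splits)
        then show ?thesis using l by simp
      qed
      moreover have "Q_vertex (Suc k) 0 j = 0" using \<open>j \<in> {1..Suc k}\<close> by (auto simp: Q_vertex_def)
      ultimately show ?thesis using False \<open>j \<in> {1..Suc k}\<close> by (simp add: Q_vertex_def face_def shift_def)
    qed
    finally show ?thesis .
  next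
    case False
    have "face k i x j = undefined" using face_in_std_Q[OF i x] False by (auto simp: std_Q_def extensional_def)
    moreover have "face_map (Suc k) i x j = undefined"
      unfolding face_map_def affine_simplex_R_def len using x False by auto
    ultimately show ?thesis by simp
  qed
  then show ?thesis ..
qed

lemma lipschitz_simplex_face:
  assumes T: "lipschitz_simplex (Suc k) M T" and i: "i \<le> Suc k"
  shows "lipschitz_simplex k M (\<lambda>x\<in>std_Q k. T (face_map (Suc k) i x))"
proof -
  obtain C0 where C0: "\<And>x y. x \<in> std_Q (Suc k) \<Longrightarrow> y \<in> std_Q (Suc k) \<Longrightarrow> dist (T x) (T y) \<le> C0 * edist (Suc k) x y"
    using T by (auto simp: lipschitz_simplex_def)
  have e0: "0 \<le> edist k x y" for k x y by (simp add: edist_def L2_set_nonneg)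
  have "dist (T (face k i x)) (T (face k i y)) \<le> \<bar>C0\<bar> * (2 * (real k * edist k x y))" if "x \<in> std_Q k" "y \<in> std_Q k" for x y
  proof -
    have "dist (T (face k i x)) (T (face k i y)) \<le> C0 * edist (Suc k) (face k i x) (face k i y)"
      by (rule C0) (use face_in_std_Q[OF i] that in auto)
    also have "\<dots> \<le> \<bar>C0\<bar> * edist (Suc k) (face k i x) (face k i y)" by (rule mult_right_mono[OF abs_ge_self e0])
    also have "\<dots> \<le> \<bar>C0\<bar> * (2 * (real k * edist k x y))"
      by (intro mult_left_mono order_trans[OF edist_le] order_trans[OF face_diff[OF i]] sum_le_edist) auto
    finally show ?thesis .
  qed
  then have "\<exists>C. \<forall>x\<in>std_Q k. \<forall>y\<in>std_Q k. dist (T (face k i x)) (T (face k i y)) \<le> C * edist k x y"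
    by (intro exI[of _ "\<bar>C0\<bar> * (2 * real k)"]) (simp add: mult.assoc)
  moreover have "T (face k i x) \<in> M" if "x \<in> std_Q k" for x
    using T face_in_std_Q[OF i that] by (auto simp: lipschitz_simplex_def)
  ultimately show ?thesis using face_map_eq[OF i] by (simp add: lipschitz_simplex_def image_subset_iff)
qed

text \<open>Each summand of a Whitney form has the shape f dg_1 \<and> ... \<and> dg_k. Stokes for
  summand \<open>l\<close> produces the wedge product with row \<open>l\<close> moved to the front,
  and moving it back contributes a sign cancelling the one in the Whitney form. The k + 1 equal
  terms turn k! into (k + 1)!.\<close>

theorem stokes_simplex:
  assumes K: "simplicial_complex X" and T: "lipschitz_simplex (Suc k) (\<Union>X) T"
    and A: "finite A" "\<And>\<sigma>. \<sigma> \<in> A \<Longrightarrow> length \<sigma> = Suc k \<and> set \<sigma> \<subseteq> vertices X"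
  shows "simplex_integral X (Suc k) T (\<lambda>S x ws. \<Sum>\<sigma>\<in>A. c \<sigma> * dwhitney X k \<sigma> S x ws) =
    (\<Sum>i\<le>Suc k. (-1) ^ i * simplex_integral X k (\<lambda>x\<in>std_Q k. T (face_map (Suc k) i x)) (\<lambda>S x ws. \<Sum>\<sigma>\<in>A. c \<sigma> * whitney_form X k \<sigma> S x ws))"
proof -
  obtain G where G: "hat_functions X (Suc k) T G" using hat_functions_exist[OF K T] by blast
  have bl: "bl (Suc k) (G v)" for v using G by (simp add: hat_functions_def)
  \<comment> \<open>Restrictions of the same extensions \<open>G\<close> serve the faces, so that
    the two sides of \<open>stokes_bl\<close> match literally.\<close>
  define H where "H i v y = G v (face k i y)" for i v y
  have H: "hat_functions X k (\<lambda>x\<in>std_Q k. T (face_map (Suc k) i x)) (H i)" if i: "i \<le> Suc k" for i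
    unfolding hat_functions_def
  proof (intro allI conjI ballI)
    show "bl k (H i v)" for v unfolding H_def[abs_def] by (rule bl_face[OF bl i])
    fix v q assume q: "q \<in> std_Q k"
    show "H i v q = hat X v ((\<lambda>x\<in>std_Q k. T (face_map (Suc k) i x)) q)"
      using G face_in_std_Q[OF i q] q by (simp add: H_def face_map_eq[OF i q] hat_functions_def)
  qed
  have W: "(\<Sum>i\<le>Suc k. (-1) ^ i * whitney_wint k (H i) \<sigma>) = fact (Suc k) * wint (Suc k) (\<lambda>_. 1) (map G \<sigma>)" if "\<sigma> \<in> A" for \<sigma>
  proof -
    have len: "length \<sigma> = Suc k" using A(2)[OF that] by simp
    have st: "(\<Sum>i\<le>Suc k. (-1) ^ i * wint k (H i (\<sigma> ! l)) (map (H i) (omit l \<sigma>))) = (-1) ^ l * wint (Suc k) (\<lambda>_. 1) (map G \<sigma>)" if l: "l \<le> k" for l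
    proof -
      have "stokes k (G (\<sigma> ! l)) (map G (omit l \<sigma>))"
        by (rule stokes_bl[OF bl]) (use len l bl in auto)
      then have "(\<Sum>i\<le>Suc k. (-1) ^ i * wint k (H i (\<sigma> ! l)) (map (H i) (omit l \<sigma>))) = wint (Suc k) (\<lambda>_. 1) (G (\<sigma> ! l) # map G (omit l \<sigma>))"
        unfolding stokes_def by (simp add: H_def[abs_def] o_def del: sum.atMost_Suc)
      also have "\<dots> = (-1) ^ l * wint (Suc k) (\<lambda>_. 1) (map G \<sigma>)"
        unfolding wint_def jac_move_to_front[OF l len] integral_mult_right_zero[symmetric]
        by (intro Bochner_Integration.integral_cong refl) simp
      finally show ?thesis .
    qed
    have "(\<Sum>i\<le>Suc k. (-1) ^ i * whitney_wint k (H i) \<sigma>) =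
      fact k * (\<Sum>l\<le>k. (-1) ^ l * (\<Sum>i\<le>Suc k. (-1) ^ i * wint k (H i (\<sigma> ! l)) (map (H i) (omit l \<sigma>))))"
    proof -
      have "(\<Sum>i\<le>Suc k. (-1) ^ i * whitney_wint k (H i) \<sigma>) =
        (\<Sum>i\<le>Suc k. \<Sum>l\<le>k. fact k * ((-1) ^ l * ((-1) ^ i * wint k (H i (\<sigma> ! l)) (map (H i) (omit l \<sigma>)))))"
        unfolding whitney_wint_def by (simp add: sum_distrib_left mult_ac del: sum.atMost_Suc)
      also have "\<dots> = (\<Sum>l\<le>k. \<Sum>i\<le>Suc k. fact k * ((-1) ^ l * ((-1) ^ i * wint k (H i (\<sigma> ! l)) (map (H i) (omit l \<sigma>)))))"
        by (rule sum.swap)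
      finally show ?thesis by (simp add: sum_distrib_left del: sum.atMost_Suc)
    qed
    also have "\<dots> = fact k * (\<Sum>l\<le>k. (-1) ^ l * ((-1) ^ l * wint (Suc k) (\<lambda>_. 1) (map G \<sigma>)))"
      by (intro arg_cong2[of _ _ _ _ "(*)"] sum.cong refl) (simp add: st del: sum.atMost_Suc)
    also have "\<dots> = fact k * (\<Sum>l\<le>k. wint (Suc k) (\<lambda>_. 1) (map G \<sigma>))"
      by (simp add: mult.assoc[symmetric] power_mult_distrib[symmetric])
    finally show ?thesis by (simp add: algebra_simps)
  qed
  have "(\<Sum>i\<le>Suc k. (-1) ^ i * simplex_integral X k (\<lambda>x\<in>std_Q k. T (face_map (Suc k) i x)) (\<lambda>S x ws. \<Sum>\<sigma>\<in>A. c \<sigma> * whitney_form X k \<sigma> S x ws)) =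
    (\<Sum>i\<le>Suc k. (-1) ^ i * (\<Sum>\<sigma>\<in>A. c \<sigma> * whitney_wint k (H i) \<sigma>))"
  proof (rule sum.cong[OF refl])
    fix i assume "i \<in> {..Suc k}"
    then have i: "i \<le> Suc k" by simp
    have "simplex_integral X k (\<lambda>x\<in>std_Q k. T (face_map (Suc k) i x)) (\<lambda>S x ws. \<Sum>\<sigma>\<in>A. c \<sigma> * whitney_form X k \<sigma> S x ws) =
      (\<Sum>\<sigma>\<in>A. c \<sigma> * whitney_wint k (H i) \<sigma>)"
      by (rule simplex_integral_whitney[OF K lipschitz_simplex_face[OF T i] H[OF i] A(1)]) (rule A(2))
    then show "(-1) ^ i * simplex_integral X k (\<lambda>x\<in>std_Q k. T (face_map (Suc k) i x)) (\<lambda>S x ws. \<Sum>\<sigma>\<in>A. c \<sigma> * whitney_form X k \<sigma> S x ws) =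
      (-1) ^ i * (\<Sum>\<sigma>\<in>A. c \<sigma> * whitney_wint k (H i) \<sigma>)" by (rule arg_cong)
  qed
  also have "\<dots> = (\<Sum>\<sigma>\<in>A. c \<sigma> * (\<Sum>i\<le>Suc k. (-1) ^ i * whitney_wint k (H i) \<sigma>))"
    unfolding sum_distrib_left by (subst sum.swap) (simp add: mult_ac del: sum.atMost_Suc)
  also have "\<dots> = simplex_integral X (Suc k) T (\<lambda>S x ws. \<Sum>\<sigma>\<in>A. c \<sigma> * dwhitney X k \<sigma> S x ws)"
  proof -
    have "simplex_integral X (Suc k) T (\<lambda>S x ws. \<Sum>\<sigma>\<in>A. c \<sigma> * dwhitney X k \<sigma> S x ws) =
      (\<Sum>\<sigma>\<in>A. c \<sigma> * (fact (Suc k) * wint (Suc k) (\<lambda>_. 1) (map G \<sigma>)))"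
      by (rule simplex_integral_dwhitney[OF K T G A(1)]) (rule A(2))
    moreover have "(\<Sum>\<sigma>\<in>A. c \<sigma> * (\<Sum>i\<le>Suc k. (-1) ^ i * whitney_wint k (H i) \<sigma>)) =
      (\<Sum>\<sigma>\<in>A. c \<sigma> * (fact (Suc k) * wint (Suc k) (\<lambda>_. 1) (map G \<sigma>)))"
      by (rule sum.cong[OF refl]) (simp only: W)
    ultimately show ?thesis by (simp only:)
  qed
  finally show ?thesis ..
qed

section \<open>The space of Whitney forms\<close>

lemma sorted_wrt_distinct: "sorted_wrt (\<lambda>v w. (v, w) \<in> r \<and> v \<noteq> w) xs \<Longrightarrow> distinct xs"
  by (induction xs) auto

lemma sorted_wrt_set_unique:
  assumes r: "antisym r"
  shows "sorted_wrt (\<lambda>v w. (v, w) \<in> r \<and> v \<noteq> w) xs \<Longrightarrow> sorted_wrt (\<lambda>v w. (v, w) \<in> r \<and> v \<noteq> w) ys \<Longrightarrow> set xs = set ys \<Longrightarrow> xs = ys"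
proof (induction xs arbitrary: ys)
  case Nil
  then show ?case by simp
next
  case (Cons x xs)
  then obtain y zs where ys: "ys = y # zs" by (cases ys) auto
  have xs: "\<And>v. v \<in> set xs \<Longrightarrow> (x, v) \<in> r \<and> x \<noteq> v" "\<And>v. v \<in> set zs \<Longrightarrow> (y, v) \<in> r \<and> y \<noteq> v"
    using Cons.prems(1,2) ys by auto
  have eq: "insert x (set xs) = insert y (set zs)" using Cons.prems(3) ys by simp
  have xy: "x = y"
  proof (rule ccontr)
    assume ne: "x \<noteq> y"
    then have "x \<in> insert y (set zs)" "y \<in> insert x (set xs)" by (simp_all only: eq[symmetric] insertI1) (simp only: eq insertI1)
    then have "(y, x) \<in> r" "(x, y) \<in> r" using xs ne by simp_all
    then show False using antisymD[OF r] ne by simp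
  qed
  moreover have "set xs = set zs"
  proof -
    have "x \<notin> set xs" "x \<notin> set zs" using xs xy by blast+
    then show ?thesis using eq unfolding xy by (simp add: insert_ident)
  qed
  ultimately show ?case using Cons.IH[of zs] Cons.prems(1,2) ys by simp
qed

lemma linear_order_least:
  assumes r: "linear_order_on V r" and A: "finite A" "A \<noteq> {}" "A \<subseteq> V"
  shows "\<exists>m\<in>A. \<forall>v\<in>A. (m, v) \<in> r"
  using A
proof (induction A rule: finite_ne_induct)
  have o: "refl_on V r" "trans r" "total_on V r"
    using r unfolding linear_order_on_def partial_order_on_def preorder_on_def by blast+
  {
    case (singleton x)
    then show ?case using o(1) by (simp add: refl_on_def)
  next
    case (insert x A)
    then obtain m where m: "m \<in> A" "\<And>v. v \<in> A \<Longrightarrow> (m, v) \<in> r" by blast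
    have V: "x \<in> V" "m \<in> V" using insert m by blast+
    have xx: "(x, x) \<in> r" using o(1) V by (simp add: refl_on_def)
    have "x \<noteq> m" using insert m by blast
    then consider "(x, m) \<in> r" | "(m, x) \<in> r" using o(3) V unfolding total_on_def by blast
    then show ?case
    proof cases
      case 1
      then have "(x, v) \<in> r" if "v \<in> A" for v using m(2)[OF that] o(2) by (meson transD)
      then show ?thesis using xx by blast
    next
      case 2
      then show ?thesis using m by blast
    qed
  }
qed

lemma sorted_list_exists:
  assumes r: "linear_order_on V r" and A: "finite A" "A \<subseteq> V"
  shows "\<exists>xs. set xs = A \<and> sorted_wrt (\<lambda>v w. (v, w) \<in> r \<and> v \<noteq> w) xs"
  using A
proof (induction A rule: finite_psubset_induct)
  case (psubset A)
  show ?case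
  proof (cases "A = {}")
    case False
    obtain m where m: "m \<in> A" "\<And>v. v \<in> A \<Longrightarrow> (m, v) \<in> r" using linear_order_least[OF r psubset.hyps False psubset.prems] by blast
    have "A - {m} \<subset> A" "A - {m} \<subseteq> V" using m psubset.prems by blast+
    then obtain xs where xs: "set xs = A - {m}" "sorted_wrt (\<lambda>v w. (v, w) \<in> r \<and> v \<noteq> w) xs" using psubset.IH by blast
    have "set (m # xs) = A" using xs m by auto
    moreover have "sorted_wrt (\<lambda>v w. (v, w) \<in> r \<and> v \<noteq> w) (m # xs)" using xs m by auto
    ultimately show ?thesis by blast
  qed auto
qed

lemma simplicesD:
  assumes "\<sigma> \<in> simplices X r k"
  shows "length \<sigma> = Suc k" "set \<sigma> \<subseteq> vertices X" "distinct \<sigma>" "convex hull (set \<sigma>) \<in> X" "\<not> affine_dependent (set \<sigma>)"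
  using assms unfolding simplices_def by (auto intro: sorted_wrt_distinct)

lemma finite_simplices: "simplicial_complex X \<Longrightarrow> finite (simplices X r k)"
  by (rule finite_subset[OF _ finite_lists_length_eq[OF finite_vertices, of X "Suc k"]]) (auto simp: simplices_def)

lemma simplices_eqI:
  assumes "linear_order_on (vertices X) r" "\<sigma> \<in> simplices X r k" "\<tau> \<in> simplices X r k" "set \<sigma> \<subseteq> set \<tau>"
  shows "\<sigma> = \<tau>"
proof -
  have "card (set \<sigma>) = card (set \<tau>)" using simplicesD(1,3)[OF assms(2)] simplicesD(1,3)[OF assms(3)] by (simp add: distinct_card)
  then have "set \<sigma> = set \<tau>" using assms(4) by (simp add: card_subset_eq)
  moreover have "antisym r" using assms(1) by (simp add: linear_order_on_def partial_order_on_def)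
  ultimately show ?thesis using assms(2,3) sorted_wrt_set_unique by (auto simp: simplices_def)
qed

lemma set_omit: "set (omit i xs) \<subseteq> set xs"
  using set_take_subset[of i xs] set_drop_subset[of "Suc i" xs] by (auto simp: omit_def)

lemma convex_hull_in_complex:
  assumes K: "simplicial_complex X" and C: "\<not> affine_dependent C" "convex hull C \<in> X" and B: "B \<subseteq> C"
  shows "convex hull B \<in> X"
  by (rule face_in_complex[OF K C(2)]) (use face_of_convex_hull_affine_independent[OF C(1)] B in blast)

lemma simplices_omit:
  assumes K: "simplicial_complex X" and \<sigma>: "\<sigma> \<in> simplices X r (Suc k)" and i: "i \<le> Suc k"
  shows "omit i \<sigma> \<in> simplices X r k"
proof -
  note D = simplicesD[OF \<sigma>]
  let ?P = "\<lambda>v w. (v, w) \<in> r \<and> v \<noteq> w"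
  have "\<sigma> = take i \<sigma> @ \<sigma> ! i # drop (Suc i) \<sigma>" using i D(1) by (simp add: id_take_nth_drop)
  moreover have "sorted_wrt ?P \<sigma>" using \<sigma> by (simp add: simplices_def)
  ultimately have "sorted_wrt ?P (take i \<sigma> @ \<sigma> ! i # drop (Suc i) \<sigma>)" by simp
  then have "sorted_wrt ?P (omit i \<sigma>)" unfolding omit_def sorted_wrt_append by simp
  moreover have "convex hull (set (omit i \<sigma>)) \<in> X" by (rule convex_hull_in_complex[OF K D(5,4) set_omit])
  moreover have "\<not> affine_dependent (set (omit i \<sigma>))" by (rule affine_independent_subset[OF D(5) set_omit])
  ultimately show ?thesis using D(1,2) set_omit[of i \<sigma>] i by (auto simp: simplices_def)
qed

lemma simplex_of_vertices:
  assumes K: "simplicial_complex X" and r: "linear_order_on (vertices X) r" and S: "S \<in> X" and A: "A \<subseteq> vx X S" "card A = Suc k"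
  shows "\<exists>\<sigma>\<in>simplices X r k. set \<sigma> = A"
proof -
  note v = vx[OF K S]
  have AV: "A \<subseteq> vertices X" "finite A" using A(1) finite_subset[OF A(1) v(2)] by (simp_all add: vx_def[OF K])
  obtain xs where xs: "set xs = A" "sorted_wrt (\<lambda>v w. (v, w) \<in> r \<and> v \<noteq> w) xs" using sorted_list_exists[OF r AV(2,1)] by blast
  have "length xs = Suc k" using distinct_card[OF sorted_wrt_distinct[OF xs(2)]] xs(1) A(2) by simp
  moreover have "convex hull A \<in> X" by (rule convex_hull_in_complex[OF K v(1) _ A(1)]) (use v(3) S in simp)
  moreover have "\<not> affine_dependent A" by (rule affine_independent_subset[OF v(1) A(1)])
  ultimately show ?thesis using xs AV by (auto simp: simplices_def)
qed

section \<open>Whitney forms as determinants, exterior derivatives and closure of the space\<close>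

text \<open>Adjoining a column of point values turns the alternating sum in a Whitney form into one determinant.\<close>

definition aug :: "('v \<Rightarrow> real) \<Rightarrow> ('v \<Rightarrow> 'b \<Rightarrow> real) \<Rightarrow> 'v \<Rightarrow> 'b option \<Rightarrow> real" where
  "aug a A v = case_option (a v) (A v)"

lemma aug_simps [simp]: "aug a A v None = a v" "aug a A v (Some w) = A v w"
  by (simp_all add: aug_def)

lemma wedge_aug_tail:
  assumes "length \<sigma> = length ws"
  shows "wedge (map (aug a A) \<sigma>) (map Some ws) = wedge (map A \<sigma>) ws"
  by (rule wedge_cong) (use assms in simp_all)

lemma wedge_aug:
  assumes "length \<sigma> = Suc (length ws)"
  shows "wedge (map (aug a A) \<sigma>) (None # map Some ws) = (\<Sum>i\<le>length ws. (-1) ^ i * a (\<sigma> ! i) * wedge (map A (omit i \<sigma>)) ws)"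
proof -
  have "wedge (map (aug a A) \<sigma>) (None # map Some ws) =
    (\<Sum>i\<le>length ws. (-1) ^ i * (map (aug a A) \<sigma> ! i) None * wedge (omit i (map (aug a A) \<sigma>)) (map Some ws))"
    using assms by (subst wedge_laplace_col) simp_all
  also have "\<dots> = (\<Sum>i\<le>length ws. (-1) ^ i * a (\<sigma> ! i) * wedge (map A (omit i \<sigma>)) ws)"
  proof (rule sum.cong[OF refl])
    fix i assume "i \<in> {..length ws}"
    then have i: "i < length \<sigma>" using assms by simp
    have "wedge (omit i (map (aug a A) \<sigma>)) (map Some ws) = wedge (map A (omit i \<sigma>)) ws"
      unfolding map_omit[symmetric] by (rule wedge_aug_tail) (use i assms in simp)
    then show "(-1) ^ i * (map (aug a A) \<sigma> ! i) None * wedge (omit i (map (aug a A) \<sigma>)) (map Some ws) = (-1) ^ i * a (\<sigma> ! i) * wedge (map A (omit i \<sigma>)) ws"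
      using i by simp
  qed
  finally show ?thesis .
qed

lemma wedge_differential_hat:
  assumes K: "simplicial_complex X" and S: "S \<in> X" "x \<in> S" "set ws \<subseteq> tangent S" and len: "length \<sigma> = length ws"
  shows "wedge (map (\<lambda>v. differential (hat X v) S x) \<sigma>) ws = wedge (map (lin X S) \<sigma>) ws"
proof (rule wedge_cong)
  fix i j assume "i < length (map (\<lambda>v. differential (hat X v) S x) \<sigma>)" "j < length (map (\<lambda>v. differential (hat X v) S x) \<sigma>)"
  then have ij: "i < length \<sigma>" "j < length ws" using len by simp_all
  then have "ws ! j \<in> tangent S" using S(3) nth_mem by blast
  then show "(map (\<lambda>v. differential (hat X v) S x) \<sigma> ! i) (ws ! j) = (map (lin X S) \<sigma> ! i) (ws ! j)"
    using ij differential_hat[OF K S(1,2)] by simp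
qed simp

lemma whitney_form_value:
  assumes K: "simplicial_complex X" and S: "S \<in> X" "x \<in> S" "length ws = k" "set ws \<subseteq> tangent S" and len: "length \<sigma> = Suc k"
  shows "whitney_form X k \<sigma> S x ws = fact k * (\<Sum>i\<le>k. (-1) ^ i * hat X (\<sigma> ! i) x * wedge (map (lin X S) (omit i \<sigma>)) ws)"
proof -
  have "whitney_form X k \<sigma> S x ws = fact k * (\<Sum>i\<le>k. (-1) ^ i * hat X (\<sigma> ! i) x * wedge (map (\<lambda>v. differential (hat X v) S x) (omit i \<sigma>)) ws)"
    unfolding whitney_form_def normalize_form_def using S by simp
  also have "(\<Sum>i\<le>k. (-1) ^ i * hat X (\<sigma> ! i) x * wedge (map (\<lambda>v. differential (hat X v) S x) (omit i \<sigma>)) ws) =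
    (\<Sum>i\<le>k. (-1) ^ i * hat X (\<sigma> ! i) x * wedge (map (lin X S) (omit i \<sigma>)) ws)"
    by (intro sum.cong refl arg_cong2[of _ _ _ _ "(*)"] wedge_differential_hat[OF K S(1,2,4)]) (use S(3) len in simp)
  finally show ?thesis .
qed

text \<open>Sign rules and vanishing of Whitney forms for arbitrary lists of vertices become
  properties of the rows of a determinant.\<close>

lemma whitney_form_wedge:
  assumes K: "simplicial_complex X" and S: "S \<in> X" "x \<in> S" "length ws = k" "set ws \<subseteq> tangent S" and len: "length \<sigma> = Suc k"
  shows "whitney_form X k \<sigma> S x ws = fact k * wedge (map (aug (\<lambda>v. hat X v x) (lin X S)) \<sigma>) (None # map Some ws)"
proof -
  have "wedge (map (aug (\<lambda>v. hat X v x) (lin X S)) \<sigma>) (None # map Some ws) =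
    (\<Sum>i\<le>k. (-1) ^ i * hat X (\<sigma> ! i) x * wedge (map (lin X S) (omit i \<sigma>)) ws)"
    using wedge_aug[of \<sigma> ws "\<lambda>v. hat X v x" "lin X S"] S(3) len by simp
  then show ?thesis by (simp only: whitney_form_value[OF assms])
qed

lemma whitney_form_outside:
  "\<not> (S \<in> X \<and> x \<in> S \<and> length ws = k \<and> set ws \<subseteq> tangent S) \<Longrightarrow> whitney_form X k \<sigma> S x ws = 0"
  unfolding whitney_form_def normalize_form_def by (rule if_not_P)

lemma dwhitney_outside:
  "\<not> (S \<in> X \<and> x \<in> S \<and> length ws = Suc k \<and> set ws \<subseteq> tangent S) \<Longrightarrow> dwhitney X k \<sigma> S x ws = 0"
  unfolding dwhitney_def normalize_form_def by (rule if_not_P)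

lemma dwhitney_value:
  assumes K: "simplicial_complex X" and S: "S \<in> X" "x \<in> S" "length ws = Suc k" "set ws \<subseteq> tangent S" and len: "length \<sigma> = Suc k"
  shows "dwhitney X k \<sigma> S x ws = fact (Suc k) * wedge (map (lin X S) \<sigma>) ws"
proof -
  have "dwhitney X k \<sigma> S x ws = fact (Suc k) * wedge (map (\<lambda>v. differential (hat X v) S x) \<sigma>) ws"
    unfolding dwhitney_def normalize_form_def using S by simp
  then show ?thesis using wedge_differential_hat[OF K S(1,2,4), of \<sigma>] S(3) len by simp
qed

text \<open>On a simplex the factors d\<lambda>_v are constant and the coefficients \<lambda>_v
  affine. The alternating sum over the omitted direction is then the expansion of a determinant
  along a first row d\<lambda>_{v_j}; returning that row to position \<open>j\<close> cancels the
  sign, so all k + 1 terms coincide.\<close>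

lemma ext_deriv_whitney:
  assumes K: "simplicial_complex X" and len: "\<And>\<sigma>. \<sigma> \<in> A \<Longrightarrow> length \<sigma> = Suc k"
  shows "ext_deriv X k (\<lambda>S x ws. \<Sum>\<sigma>\<in>A. c \<sigma> * whitney_form X k \<sigma> S x ws) = (\<lambda>S x ws. \<Sum>\<sigma>\<in>A. c \<sigma> * dwhitney X k \<sigma> S x ws)"
proof (intro ext)
  fix S x and ws :: "'a list"
  let ?u = "\<lambda>S x ws. \<Sum>\<sigma>\<in>A. c \<sigma> * whitney_form X k \<sigma> S x ws"
  show "ext_deriv X k ?u S x ws = (\<Sum>\<sigma>\<in>A. c \<sigma> * dwhitney X k \<sigma> S x ws)"
  proof (cases "S \<in> X \<and> x \<in> S \<and> length ws = Suc k \<and> set ws \<subseteq> tangent S")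
    case False
    have "ext_deriv X k ?u S x ws = 0" unfolding ext_deriv_def normalize_form_def by (rule if_not_P[OF False])
    then show ?thesis by (simp add: dwhitney_outside[OF False])
  next
    case True
    then have S: "S \<in> X" "x \<in> S" "length ws = Suc k" "set ws \<subseteq> tangent S" by blast+
    define P where "P \<sigma> j i = wedge (map (lin X S) (omit j \<sigma>)) (omit i ws)" for \<sigma> j i
    have lin: "lin X S v (y + z) = lin X S v y + lin X S v z" "lin X S v (a *\<^sub>R y) = a * lin X S v y" for v y z a
      using lin_cst(1)[OF K S(1), of v] by (simp_all add: linear_add linear_scale)
    have d: "differential (\<lambda>y. ?u S y (omit i ws)) S x (ws ! i) =
      (\<Sum>\<sigma>\<in>A. c \<sigma> * (fact k * (\<Sum>j\<le>k. (-1) ^ j * lin X S (\<sigma> ! j) (ws ! i) * P \<sigma> j i)))" if i: "i \<le> k" for i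
    \<comment> \<open>With the directions \<open>omit i ws\<close> fixed, the form is an affine
      function of the point on \<open>S\<close>; \<open>l\<close> and \<open>c\<close> are its
      linear and constant parts.\<close>
    proof (rule differential_affine[where l = "\<lambda>w. \<Sum>\<sigma>\<in>A. c \<sigma> * (fact k * (\<Sum>j\<le>k. (-1) ^ j * lin X S (\<sigma> ! j) w * P \<sigma> j i))"
          and c = "\<Sum>\<sigma>\<in>A. c \<sigma> * (fact k * (\<Sum>j\<le>k. (-1) ^ j * cst X S (\<sigma> ! j) * P \<sigma> j i))"])
      show "convex S" "x \<in> S" using complex_convex[OF K S(1)] S(2) by blast+
      show "linear (\<lambda>w. \<Sum>\<sigma>\<in>A. c \<sigma> * (fact k * (\<Sum>j\<le>k. (-1) ^ j * lin X S (\<sigma> ! j) w * P \<sigma> j i)))"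
        by (rule linearI) (simp_all add: lin sum.distrib sum_distrib_left algebra_simps)
      show "ws ! i \<in> tangent S" using S(3,4) i nth_mem[of i ws] by auto
      fix y assume y: "y \<in> S"
      have om: "length (omit i ws) = k" "set (omit i ws) \<subseteq> tangent S" using S(3,4) i set_omit[of i ws] by auto
      have "?u S y (omit i ws) = (\<Sum>\<sigma>\<in>A. c \<sigma> * (fact k * (\<Sum>j\<le>k. (-1) ^ j * cst X S (\<sigma> ! j) * P \<sigma> j i)) +
         c \<sigma> * (fact k * (\<Sum>j\<le>k. (-1) ^ j * lin X S (\<sigma> ! j) y * P \<sigma> j i)))"
      proof (rule sum.cong[OF refl])
        fix \<sigma> assume \<sigma>: "\<sigma> \<in> A"
        have "whitney_form X k \<sigma> S y (omit i ws) = fact k * (\<Sum>j\<le>k. (-1) ^ j * hat X (\<sigma> ! j) y * P \<sigma> j i)"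
          unfolding P_def by (rule whitney_form_value[OF K S(1) y om len[OF \<sigma>]])
        also have "\<dots> = fact k * ((\<Sum>j\<le>k. (-1) ^ j * cst X S (\<sigma> ! j) * P \<sigma> j i) + (\<Sum>j\<le>k. (-1) ^ j * lin X S (\<sigma> ! j) y * P \<sigma> j i))"
          unfolding hat_bary[OF K S(1) y] bary_def[OF K] sum.distrib[symmetric] by (simp add: algebra_simps)
        finally show "c \<sigma> * whitney_form X k \<sigma> S y (omit i ws) = c \<sigma> * (fact k * (\<Sum>j\<le>k. (-1) ^ j * cst X S (\<sigma> ! j) * P \<sigma> j i)) +
           c \<sigma> * (fact k * (\<Sum>j\<le>k. (-1) ^ j * lin X S (\<sigma> ! j) y * P \<sigma> j i))" by (simp add: distrib_left)
      qed
      then show "?u S y (omit i ws) = (\<Sum>\<sigma>\<in>A. c \<sigma> * (fact k * (\<Sum>j\<le>k. (-1) ^ j * cst X S (\<sigma> ! j) * P \<sigma> j i))) +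
         (\<Sum>\<sigma>\<in>A. c \<sigma> * (fact k * (\<Sum>j\<le>k. (-1) ^ j * lin X S (\<sigma> ! j) y * P \<sigma> j i)))" by (simp add: sum.distrib)
    qed
    have row: "(\<Sum>i\<le>k. (-1) ^ i * lin X S (\<sigma> ! j) (ws ! i) * P \<sigma> j i) = (-1) ^ j * wedge (map (lin X S) \<sigma>) ws" if \<sigma>: "\<sigma> \<in> A" and j: "j \<le> k" for \<sigma> j
    proof -
      have "wedge (lin X S (\<sigma> ! j) # map (lin X S) (omit j \<sigma>)) ws = (\<Sum>i\<le>k. (-1) ^ i * lin X S (\<sigma> ! j) (ws ! i) * P \<sigma> j i)"
        unfolding P_def using wedge_laplace_row[of ws "map (lin X S) (omit j \<sigma>)" "lin X S (\<sigma> ! j)"] S(3) len[OF \<sigma>] j by simp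
      moreover have "wedge (lin X S (\<sigma> ! j) # map (lin X S) (omit j \<sigma>)) ws = (-1) ^ j * wedge (map (lin X S) \<sigma>) ws"
        using wedge_move_to_front[OF j, of "map (lin X S) \<sigma>" ws] S(3) len[OF \<sigma>] j by (simp add: map_omit)
      ultimately show ?thesis by simp
    qed
    have "ext_deriv X k ?u S x ws = (\<Sum>i\<le>k. (-1) ^ i * differential (\<lambda>y. ?u S y (omit i ws)) S x (ws ! i))"
      unfolding ext_deriv_def normalize_form_def by (rule if_P[OF True])
    also have "\<dots> = (\<Sum>i\<le>k. \<Sum>\<sigma>\<in>A. c \<sigma> * (fact k * (\<Sum>j\<le>k. (-1) ^ j * ((-1) ^ i * lin X S (\<sigma> ! j) (ws ! i) * P \<sigma> j i))))"
    proof (rule sum.cong[OF refl])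
      fix i assume "i \<in> {..k}"
      then show "(-1) ^ i * differential (\<lambda>y. ?u S y (omit i ws)) S x (ws ! i) =
        (\<Sum>\<sigma>\<in>A. c \<sigma> * (fact k * (\<Sum>j\<le>k. (-1) ^ j * ((-1) ^ i * lin X S (\<sigma> ! j) (ws ! i) * P \<sigma> j i))))"
        by (simp only: d atMost_iff) (simp only: sum_distrib_left mult_ac)
    qed
    also have "\<dots> = (\<Sum>\<sigma>\<in>A. c \<sigma> * (fact k * (\<Sum>j\<le>k. (-1) ^ j * (\<Sum>i\<le>k. (-1) ^ i * lin X S (\<sigma> ! j) (ws ! i) * P \<sigma> j i))))"
    proof (subst sum.swap, rule sum.cong[OF refl])
      fix \<sigma> assume "\<sigma> \<in> A"
      have "(\<Sum>i\<le>k. \<Sum>j\<le>k. (-1) ^ j * ((-1) ^ i * lin X S (\<sigma> ! j) (ws ! i) * P \<sigma> j i)) =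
        (\<Sum>j\<le>k. (-1) ^ j * (\<Sum>i\<le>k. (-1) ^ i * lin X S (\<sigma> ! j) (ws ! i) * P \<sigma> j i))"
        unfolding sum_distrib_left by (rule sum.swap)
      then show "(\<Sum>i\<le>k. c \<sigma> * (fact k * (\<Sum>j\<le>k. (-1) ^ j * ((-1) ^ i * lin X S (\<sigma> ! j) (ws ! i) * P \<sigma> j i)))) =
        c \<sigma> * (fact k * (\<Sum>j\<le>k. (-1) ^ j * (\<Sum>i\<le>k. (-1) ^ i * lin X S (\<sigma> ! j) (ws ! i) * P \<sigma> j i)))"
        by (simp only: sum_distrib_left[symmetric])
    qed
    also have "\<dots> = (\<Sum>\<sigma>\<in>A. c \<sigma> * dwhitney X k \<sigma> S x ws)"
    proof (rule sum.cong[OF refl])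
      fix \<sigma> assume \<sigma>: "\<sigma> \<in> A"
      have "(\<Sum>j\<le>k. (-1) ^ j * (\<Sum>i\<le>k. (-1) ^ i * lin X S (\<sigma> ! j) (ws ! i) * P \<sigma> j i)) = (\<Sum>j\<le>k. wedge (map (lin X S) \<sigma>) ws)"
        by (rule sum.cong[OF refl]) (simp add: row[OF \<sigma>] mult.assoc[symmetric] power_mult_distrib[symmetric])
      then show "c \<sigma> * (fact k * (\<Sum>j\<le>k. (-1) ^ j * (\<Sum>i\<le>k. (-1) ^ i * lin X S (\<sigma> ! j) (ws ! i) * P \<sigma> j i))) = c \<sigma> * dwhitney X k \<sigma> S x ws"
        by (simp add: dwhitney_value[OF K S len[OF \<sigma>]] algebra_simps)
    qed
    finally show ?thesis .
  qed
qed

definition wcomb :: "'a::euclidean_space set set \<Rightarrow> 'a rel \<Rightarrow> nat \<Rightarrow> ('a list \<Rightarrow> real) \<Rightarrow> 'a form" where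
  "wcomb X r k c = (\<lambda>S x ws. \<Sum>\<sigma>\<in>simplices X r k. c \<sigma> * whitney_form X k \<sigma> S x ws)"

lemma whitney_space_wcomb: "whitney_space X r k = range (wcomb X r k)"
  unfolding whitney_space_def wcomb_def[abs_def] by blast

lemma wcomb_sum:
  "(\<lambda>S x ws. \<Sum>v\<in>V. b v * wcomb X r k (c v) S x ws) = wcomb X r k (\<lambda>\<sigma>. \<Sum>v\<in>V. b v * c v \<sigma>)"
proof (intro ext)
  fix S x ws
  have "(\<Sum>v\<in>V. b v * wcomb X r k (c v) S x ws) = (\<Sum>v\<in>V. \<Sum>\<sigma>\<in>simplices X r k. b v * c v \<sigma> * whitney_form X k \<sigma> S x ws)"
    by (simp add: wcomb_def sum_distrib_left mult.assoc)
  also have "\<dots> = wcomb X r k (\<lambda>\<sigma>. \<Sum>v\<in>V. b v * c v \<sigma>) S x ws"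
    unfolding wcomb_def sum_distrib_right by (rule sum.swap)
  finally show "(\<Sum>v\<in>V. b v * wcomb X r k (c v) S x ws) = wcomb X r k (\<lambda>\<sigma>. \<Sum>v\<in>V. b v * c v \<sigma>) S x ws" .
qed

lemma wcomb_single:
  assumes "simplicial_complex X" "\<tau> \<in> simplices X r k"
  shows "wcomb X r k (\<lambda>\<sigma>. if \<sigma> = \<tau> then b else 0) S x ws = b * whitney_form X k \<tau> S x ws"
proof -
  have "wcomb X r k (\<lambda>\<sigma>. if \<sigma> = \<tau> then b else 0) S x ws = (\<Sum>\<sigma>\<in>simplices X r k. if \<sigma> = \<tau> then b * whitney_form X k \<sigma> S x ws else 0)"
    unfolding wcomb_def by (rule sum.cong) simp_all
  then show ?thesis using assms(2) finite_simplices[OF assms(1), of r k] by simp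
qed

text \<open>Reordering the list permutes the rows of the determinant; the factor is the sign of the
  permutation.\<close>

lemma whitney_form_permute:
  assumes K: "simplicial_complex X" and len: "length \<rho> = Suc k" and d: "distinct \<rho>" "distinct \<tau>" "set \<rho> = set \<tau>"
  shows "\<exists>b. \<forall>S x ws. whitney_form X k \<rho> S x ws = b * whitney_form X k \<tau> S x ws"
proof -
  have "mset \<rho> = mset \<tau>" using d by (simp add: set_eq_iff_mset_eq_distinct[symmetric])
  then obtain p where p: "p permutes {..<length \<tau>}" "permute_list p \<tau> = \<rho>" by (rule mset_eq_permutation)
  have len': "length \<tau> = Suc k" using len length_permute_list[of p \<tau>] unfolding p(2) by simp
  have "whitney_form X k \<rho> S x ws = of_int (sign p) * whitney_form X k \<tau> S x ws" for S x ws
  proof (cases "S \<in> X \<and> x \<in> S \<and> length ws = k \<and> set ws \<subseteq> tangent S")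
    case False
    then show ?thesis by (simp only: whitney_form_outside[OF False] mult_zero_right)
  next
    case True
    then have S: "S \<in> X" "x \<in> S" "length ws = k" "set ws \<subseteq> tangent S" by blast+
    let ?F = "aug (\<lambda>v. hat X v x) (lin X S)"
    have "map ?F \<rho> = map (\<lambda>i. map ?F \<tau> ! p i) [0..<length (map ?F \<tau>)]"
    proof (rule nth_equalityI)
      show "length (map ?F \<rho>) = length (map (\<lambda>i. map ?F \<tau> ! p i) [0..<length (map ?F \<tau>)])" using len len' by simp
      fix i assume "i < length (map ?F \<rho>)"
      then have i: "i < length \<tau>" using len len' by simp
      then have "p i < length \<tau>" using p(1) permutes_in_image[OF p(1), of i] by simp
      then show "map ?F \<rho> ! i = map (\<lambda>i. map ?F \<tau> ! p i) [0..<length (map ?F \<tau>)] ! i"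
        using i unfolding p(2)[symmetric] permute_list_def by simp
    qed
    then have "wedge (map ?F \<rho>) (None # map Some ws) = of_int (sign p) * wedge (map ?F \<tau>) (None # map Some ws)"
      using wedge_permute[of p "map ?F \<tau>"] p(1) by (simp add: lessThan_atLeast0)
    then show ?thesis by (simp add: whitney_form_wedge[OF K S len] whitney_form_wedge[OF K S len'])
  qed
  then show ?thesis by blast
qed

text \<open>A repeated vertex gives two equal rows. A vertex outside \<open>S\<close> gives a zero
  row, because its hat function and the differential vanish on \<open>S\<close>.\<close>

lemma whitney_form_zero:
  assumes K: "simplicial_complex X" and len: "length \<rho> = Suc k" and V: "set \<rho> \<subseteq> vertices X"
    and z: "\<not> distinct \<rho> \<or> (\<forall>S\<in>X. \<not> set \<rho> \<subseteq> S)"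
  shows "whitney_form X k \<rho> S x ws = 0"
proof (cases "S \<in> X \<and> x \<in> S \<and> length ws = k \<and> set ws \<subseteq> tangent S")
  case False
  then show ?thesis by (rule whitney_form_outside)
next
  case True
  then have S: "S \<in> X" "x \<in> S" "length ws = k" "set ws \<subseteq> tangent S" by blast+
  let ?F = "aug (\<lambda>v. hat X v x) (lin X S)"
  have "wedge (map ?F \<rho>) (None # map Some ws) = 0"
  proof (cases "distinct \<rho>")
    case False
    then obtain i j where "i < length \<rho>" "j < length \<rho>" "i \<noteq> j" "\<rho> ! i = \<rho> ! j" by (auto simp: distinct_conv_nth)
    then show ?thesis by (intro wedge_repeated[of i _ j]) simp_all
  next
    case True
    then obtain v where "v \<in> set \<rho>" "v \<notin> S" using z S(1) by blast
    then obtain l where l: "l < length \<rho>" "\<rho> ! l \<notin> S" by (metis in_set_conv_nth)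
    have z: "?F (\<rho> ! l) w = 0" for w
      by (cases w) (simp_all add: hat_outside[OF K S(1,2) l(2)] lin_outside[OF K S(1) l(2)])
    show ?thesis
      by (subst wedge_laplace_any_row[of l k]) (use l(1) len S(3) z in simp_all)
  qed
  then show ?thesis by (simp add: whitney_form_wedge[OF K S len])
qed

text \<open>Lists obtained by putting a vertex in front of a simplex are usually unsorted and may
  span no simplex. They either give the zero form or reduce, up to a factor, to the sorted list with
  the same vertices.\<close>

lemma whitney_form_in_space:
  assumes K: "simplicial_complex X" and r: "linear_order_on (vertices X) r" and len: "length \<rho> = Suc k" and V: "set \<rho> \<subseteq> vertices X"
  shows "\<exists>c. whitney_form X k \<rho> = wcomb X r k c"
proof (cases "distinct \<rho> \<and> (\<exists>S\<in>X. set \<rho> \<subseteq> S)")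
  case False
  then have "whitney_form X k \<rho> S x ws = wcomb X r k (\<lambda>_. 0) S x ws" for S x ws
    using whitney_form_zero[OF K len V] by (auto simp: wcomb_def)
  then show ?thesis by blast
next
  case True
  then obtain S where S: "S \<in> X" "set \<rho> \<subseteq> vx X S" and d: "distinct \<rho>" using V by (auto simp: vx_def[OF K])
  have "card (set \<rho>) = Suc k" using d len by (simp add: distinct_card)
  then obtain \<tau> where \<tau>: "\<tau> \<in> simplices X r k" "set \<tau> = set \<rho>" using simplex_of_vertices[OF K r S] by blast
  obtain b where b: "\<And>S x ws. whitney_form X k \<rho> S x ws = b * whitney_form X k \<tau> S x ws"
    using whitney_form_permute[OF K len d simplicesD(3)[OF \<tau>(1)] \<tau>(2)[symmetric]] by blast
  have "whitney_form X k \<rho> = wcomb X r k (\<lambda>\<sigma>. if \<sigma> = \<tau> then b else 0)"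
    by (intro ext) (simp only: wcomb_single[OF K \<tau>(1)] b)
  then show ?thesis by blast
qed

text \<open>Multiplication by 1 = \<Sum> \<lambda>_v: summed over all vertices, the first rows of
  the determinants add up to (1, 0, ..., 0), as the hat functions sum to 1 and their differentials
  to 0 on tangent vectors. This expresses the derivative through Whitney forms of the next
  degree.\<close>

lemma dwhitney_sum:
  assumes K: "simplicial_complex X" and len: "length \<sigma> = Suc k"
  shows "dwhitney X k \<sigma> S x ws = (\<Sum>v\<in>vertices X. whitney_form X (Suc k) (v # \<sigma>) S x ws)"
proof (cases "S \<in> X \<and> x \<in> S \<and> length ws = Suc k \<and> set ws \<subseteq> tangent S")
  case False
  then show ?thesis by (simp add: dwhitney_outside[OF False] whitney_form_outside[OF False])
next
  case True
  then have S: "S \<in> X" "x \<in> S" "length ws = Suc k" "set ws \<subseteq> tangent S" by blast+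
  let ?F = "aug (\<lambda>v. hat X v x) (lin X S)" and ?w = "None # map Some ws"
  have row: "(\<Sum>v\<in>vertices X. ?F v (?w ! j)) = (if j = 0 then 1 else 0)" if "j \<le> Suc k" for j
  proof (cases j)
    case 0
    then show ?thesis using hat_sum(1)[OF K, of x] S by auto
  next
    case (Suc i)
    then have "ws ! i \<in> tangent S" using that S(3,4) nth_mem[of i ws] by auto
    then show ?thesis using lin_sum_zero[OF K S(1,2)] Suc that S(3) by simp
  qed
  have "(\<Sum>v\<in>vertices X. whitney_form X (Suc k) (v # \<sigma>) S x ws) =
    (\<Sum>v\<in>vertices X. fact (Suc k) * (\<Sum>j\<le>Suc k. (-1) ^ j * ?F v (?w ! j) * wedge (map ?F \<sigma>) (omit j ?w)))"
  proof (rule sum.cong[OF refl])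
    fix v
    have "wedge (map ?F (v # \<sigma>)) ?w = (\<Sum>j\<le>Suc k. (-1) ^ j * ?F v (?w ! j) * wedge (map ?F \<sigma>) (omit j ?w))"
      using wedge_laplace_row[of ?w "map ?F \<sigma>" "?F v"] S(3) len by simp
    then show "whitney_form X (Suc k) (v # \<sigma>) S x ws = fact (Suc k) * (\<Sum>j\<le>Suc k. (-1) ^ j * ?F v (?w ! j) * wedge (map ?F \<sigma>) (omit j ?w))"
      using whitney_form_wedge[OF K S, of "v # \<sigma>"] len by (simp only: list.size)
  qed
  also have "\<dots> = fact (Suc k) * (\<Sum>j\<le>Suc k. (-1) ^ j * (\<Sum>v\<in>vertices X. ?F v (?w ! j)) * wedge (map ?F \<sigma>) (omit j ?w))"
    unfolding sum_distrib_left[symmetric] by (subst sum.swap) (simp only: sum_distrib_left sum_distrib_right mult_ac)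
  also have "\<dots> = fact (Suc k) * (\<Sum>j\<le>Suc k. if j = 0 then wedge (map ?F \<sigma>) (map Some ws) else 0)"
    by (intro arg_cong[of _ _ "(*) (fact (Suc k))"] sum.cong refl) (simp add: row omit_def)
  also have "\<dots> = dwhitney X k \<sigma> S x ws"
    using wedge_aug_tail[of \<sigma> ws "\<lambda>v. hat X v x" "lin X S"] len S(3) by (simp add: dwhitney_value[OF K S len])
  finally show ?thesis ..
qed

lemma ext_deriv_in_space:
  assumes K: "simplicial_complex X" and r: "linear_order_on (vertices X) r" and u: "u \<in> whitney_space X r k"
  shows "ext_deriv X k u \<in> whitney_space X r (Suc k)"
proof -
  obtain c where c: "u = wcomb X r k c" using u by (auto simp: whitney_space_wcomb)
  have "\<forall>\<rho>. length \<rho> = Suc (Suc k) \<and> set \<rho> \<subseteq> vertices X \<longrightarrow> (\<exists>b. whitney_form X (Suc k) \<rho> = wcomb X r (Suc k) b)"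
    using whitney_form_in_space[OF K r] by blast
  then obtain B where B: "\<And>\<rho>. length \<rho> = Suc (Suc k) \<Longrightarrow> set \<rho> \<subseteq> vertices X \<Longrightarrow> whitney_form X (Suc k) \<rho> = wcomb X r (Suc k) (B \<rho>)" by metis
  have "dwhitney X k \<sigma> S x ws = wcomb X r (Suc k) (\<lambda>\<tau>. \<Sum>v\<in>vertices X. 1 * B (v # \<sigma>) \<tau>) S x ws" if \<sigma>: "\<sigma> \<in> simplices X r k" for \<sigma> S x ws
  proof -
    have "dwhitney X k \<sigma> S x ws = (\<Sum>v\<in>vertices X. 1 * wcomb X r (Suc k) (B (v # \<sigma>)) S x ws)"
      unfolding dwhitney_sum[OF K simplicesD(1)[OF \<sigma>]]
      by (rule sum.cong[OF refl]) (use simplicesD(1,2)[OF \<sigma>] in \<open>simp add: B\<close>)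
    then show ?thesis by (simp only: fun_cong[OF fun_cong[OF fun_cong[OF wcomb_sum]]])
  qed
  then have "ext_deriv X k u = (\<lambda>S x ws. \<Sum>\<sigma>\<in>simplices X r k. c \<sigma> * wcomb X r (Suc k) (\<lambda>\<tau>. \<Sum>v\<in>vertices X. 1 * B (v # \<sigma>) \<tau>) S x ws)"
    unfolding c wcomb_def[of X r k] using ext_deriv_whitney[OF K, of "simplices X r k" k c, OF simplicesD(1)] by simp
  then show ?thesis unfolding wcomb_sum whitney_space_wcomb by blast
qed

section \<open>Integration of Whitney forms over chains and the homotopy identity\<close>

text \<open>Barycentric coordinates on the standard simplex; index 0 belongs to the origin. They put
  all vertices on an equal footing, unlike the coordinates of \<open>std_Q\<close>.\<close>

definition bcoord :: "nat \<Rightarrow> (nat \<Rightarrow> real) \<Rightarrow> nat \<Rightarrow> real" where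
  "bcoord k q i = (if i = 0 then 1 - (\<Sum>j=1..k. q j) else q i)"

lemma sum_split_first: "(\<Sum>i\<le>k::nat. f i) = f 0 + (\<Sum>i=1..k. f i)"
proof -
  have "{..k} = insert 0 {1..k}" by auto
  then show ?thesis by simp
qed

lemma sum_bcoord: "(\<Sum>i\<le>k. bcoord k q i) = 1"
  by (simp add: sum_split_first bcoord_def)

lemma bcoord_nonneg: "q \<in> std_Q k \<Longrightarrow> i \<le> k \<Longrightarrow> 0 \<le> bcoord k q i"
  by (auto simp: bcoord_def std_Q_def)

lemma affine_simplex_bcoord:
  assumes "length \<tau> = Suc k" "q \<in> std_Q k"
  shows "affine_simplex \<tau> q = (\<Sum>i\<le>k. bcoord k q i *\<^sub>R \<tau> ! i)"
proof -
  have "affine_simplex \<tau> q = \<tau> ! 0 + (\<Sum>i=1..k. q i *\<^sub>R (\<tau> ! i - \<tau> ! 0))"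
    using assms by (simp add: affine_simplex_def)
  also have "\<dots> = (1 - (\<Sum>j=1..k. q j)) *\<^sub>R \<tau> ! 0 + (\<Sum>i=1..k. q i *\<^sub>R \<tau> ! i)"
    by (simp add: scaleR_diff_right sum_subtractf scaleR_sum_left[symmetric] scaleR_diff_left)
  also have "(\<Sum>i=1..k. q i *\<^sub>R \<tau> ! i) = (\<Sum>i=1..k. bcoord k q i *\<^sub>R \<tau> ! i)"
    by (rule sum.cong) (auto simp: bcoord_def)
  finally show ?thesis by (simp add: sum_split_first) (simp add: bcoord_def)
qed

lemma lipschitz_affine_simplex:
  assumes \<tau>: "\<tau> \<in> simplices X r k"
  shows "lipschitz_simplex k (\<Union>X) (affine_simplex \<tau>)"
proof -
  note D = simplicesD[OF \<tau>]
  let ?M = "\<Sum>i=1..k. norm (\<tau> ! i - \<tau> ! 0)"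
  have "affine_simplex \<tau> q \<in> convex hull (set \<tau>)" if q: "q \<in> std_Q k" for q
    unfolding affine_simplex_bcoord[OF D(1) q]
    by (rule convex_sum) (use bcoord_nonneg[OF q] D(1) in \<open>auto simp: sum_bcoord intro: hull_inc\<close>)
  then have "affine_simplex \<tau> ` std_Q k \<subseteq> \<Union>X" using D(4) by blast
  moreover have "affine_simplex \<tau> \<in> extensional (std_Q k)" using D(1) by (simp add: affine_simplex_def)
  moreover have "dist (affine_simplex \<tau> x) (affine_simplex \<tau> y) \<le> (?M * real k) * edist k x y"
    if "x \<in> std_Q k" "y \<in> std_Q k" for x y
  proof -
    have "affine_simplex \<tau> x - affine_simplex \<tau> y = (\<Sum>i=1..k. (x i - y i) *\<^sub>R (\<tau> ! i - \<tau> ! 0))"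
      using that D(1) by (simp add: affine_simplex_def sum_subtractf[symmetric] scaleR_diff_left)
    then have "dist (affine_simplex \<tau> x) (affine_simplex \<tau> y) \<le> (\<Sum>i=1..k. \<bar>x i - y i\<bar> * norm (\<tau> ! i - \<tau> ! 0))"
      unfolding dist_norm by (simp add: sum_norm_le)
    also have "\<dots> \<le> (\<Sum>i=1..k. \<bar>x i - y i\<bar> * ?M)"
      by (intro sum_mono mult_left_mono member_le_sum) auto
    also have "\<dots> = ?M * (\<Sum>i\<in>{1..k}. \<bar>x i - y i\<bar>)" by (simp add: sum_distrib_right mult.commute)
    also have "\<dots> \<le> ?M * (real k * edist k x y)"
      by (intro mult_left_mono sum_le_edist sum_nonneg norm_ge_zero)
    finally show ?thesis by (simp add: mult.assoc)
  qed
  ultimately show ?thesis unfolding lipschitz_simplex_def by blast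
qed

lemma hat_affine_simplex:
  assumes K: "simplicial_complex X" and \<tau>: "\<tau> \<in> simplices X r k" and q: "q \<in> std_Q k"
  shows "hat X v (affine_simplex \<tau> q) = (\<Sum>i\<le>k. bcoord k q i * (if \<tau> ! i = v then 1 else 0))"
proof -
  note D = simplicesD[OF \<tau>]
  let ?S = "convex hull (set \<tau>)"
  have m: "affine_simplex \<tau> q \<in> ?S"
    unfolding affine_simplex_bcoord[OF D(1) q]
    by (rule convex_sum) (use bcoord_nonneg[OF q] D(1) in \<open>auto simp: sum_bcoord intro: hull_inc\<close>)
  have "hat X v (affine_simplex \<tau> q) = cst X ?S v + lin X ?S v (\<Sum>i\<le>k. bcoord k q i *\<^sub>R \<tau> ! i)"
    using hat_bary[OF K D(4) m, of v] unfolding bary_def[OF K] affine_simplex_bcoord[OF D(1) q] .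
  also have "\<dots> = (\<Sum>i\<le>k. bcoord k q i * cst X ?S v) + (\<Sum>i\<le>k. bcoord k q i * lin X ?S v (\<tau> ! i))"
    using lin_cst(1)[OF K D(4), of v] by (simp add: sum_distrib_right[symmetric] sum_bcoord linear_sum linear_scale)
  also have "\<dots> = (\<Sum>i\<le>k. bcoord k q i * (cst X ?S v + lin X ?S v (\<tau> ! i)))"
    by (simp add: sum.distrib[symmetric] distrib_left)
  also have "\<dots> = (\<Sum>i\<le>k. bcoord k q i * (if \<tau> ! i = v then 1 else 0))"
  proof (rule sum.cong[OF refl])
    fix i assume "i \<in> {..k}"
    then have "\<tau> ! i \<in> set \<tau>" using D(1) by simp
    then have "\<tau> ! i \<in> vx X ?S" using D(2) by (auto simp: vx_def[OF K] hull_inc)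
    then show "bcoord k q i * (cst X ?S v + lin X ?S v (\<tau> ! i)) = bcoord k q i * (if \<tau> ! i = v then 1 else 0)"
      by (simp only: lin_cst(2)[OF K D(4)])
  qed
  finally show ?thesis .
qed

lemma bcoord_line:
  assumes "i \<le> k" "j \<in> {1..k}"
  shows "bcoord k (\<lambda>l. q l + t * pdir j l) i = bcoord k q i + t * (if i = 0 then - 1 else if i = j then 1 else 0)"
proof -
  have "(\<Sum>l=1..k. t * pdir j l) = (\<Sum>l=1..k. if l = j then t else 0)" by (rule sum.cong) auto
  then have "(\<Sum>l=1..k. q l + t * pdir j l) = (\<Sum>l=1..k. q l) + t" using assms(2) by (simp add: sum.distrib)
  then show ?thesis by (auto simp: bcoord_def)
qed

lemma pd_hat_affine_simplex:
  assumes K: "simplicial_complex X" and \<tau>: "\<tau> \<in> simplices X r k" and G: "hat_functions X k (affine_simplex \<tau>) G"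
    and q: "q \<in> qint k" and j: "j \<in> {1..k}"
  shows "pd j (G v) q = (\<Sum>i\<le>k. (if i = 0 then - 1 else if i = j then 1 else 0) * (if \<tau> ! i = v then 1 else 0))"
proof (rule pd_eqI, rule has_dird_linear_local)
  let ?c = "\<Sum>i\<le>k. (if i = 0 then - 1 else if i = j then 1 else 0) * (if \<tau> ! i = v then 1 else 0) :: real"
  have val: "G v y = (\<Sum>i\<le>k. bcoord k y i * (if \<tau> ! i = v then 1 else 0))" if "y \<in> qint k" for y
  proof -
    have y: "y \<in> std_Q k" using that qint_subset by blast
    then have "G v y = hat X v (affine_simplex \<tau> y)" using G by (simp add: hat_functions_def)
    then show ?thesis by (simp only: hat_affine_simplex[OF K \<tau> y])
  qed
  show "\<forall>\<^sub>F t in at 0. G v (\<lambda>i. q i + t * pdir j i) = G v q + t * ?c"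
    using qint_line[OF q j]
  proof eventually_elim
    case (elim t)
    have "G v (\<lambda>i. q i + t * pdir j i) = (\<Sum>i\<le>k. bcoord k (\<lambda>i. q i + t * pdir j i) i * (if \<tau> ! i = v then 1 else 0))"
      by (rule val[OF elim])
    also have "\<dots> = (\<Sum>i\<le>k. bcoord k q i * (if \<tau> ! i = v then 1 else 0) + t * ((if i = 0 then - 1 else if i = j then 1 else 0) * (if \<tau> ! i = v then 1 else 0)))"
      by (rule sum.cong[OF refl]) (simp only: atMost_iff bcoord_line[OF _ j] distrib_right mult.assoc)
    also have "\<dots> = G v q + t * ?c" by (simp only: sum.distrib sum_distrib_left val[OF q])
    finally show ?case .
  qed
qed

text \<open>The first row may be replaced by the sum of all rows, which is (1, 0, ..., 0); the minor
  that remains is the identity matrix.\<close>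

lemma wedge_barycentric:
  assumes \<beta>: "(\<Sum>i\<le>k. \<beta> i) = (1 :: real)" and f: "\<And>i. i \<le> k \<Longrightarrow> f i None = \<beta> i"
    "\<And>i j. i \<le> k \<Longrightarrow> j \<in> {1..k} \<Longrightarrow> f i (Some j) = (if i = 0 then - 1 else if i = j then 1 else 0)"
  shows "wedge (map f [0..<Suc k]) (None # map Some [1..<Suc k]) = 1"
proof -
  \<comment> \<open>The sum of all rows: the barycentric coordinates sum to 1, their partial
    derivatives to 0.\<close>
  define u :: "nat option \<Rightarrow> real" where "u = case_option 1 (\<lambda>_. 0)"
  let ?fs = "map f [1..<Suc k]" and ?ws = "None # map Some [1..<Suc k]"
  have ws: "length ?ws = Suc (length ?fs)" "length ?fs = k" by simp_all
  have wj: "?ws ! j = (if j = 0 then None else Some j)" if "j \<le> k" for j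
    using that by (cases j) (simp_all add: nth_upt)
  have f0: "f 0 (?ws ! j) = u (?ws ! j) - (\<Sum>l=1..k. f l (?ws ! j))" if j: "j \<le> k" for j
  proof (cases "j = 0")
    case True
    have "(\<Sum>l=1..k. f l None) = (\<Sum>l=1..k. \<beta> l)" by (rule sum.cong) (simp_all add: f(1))
    then show ?thesis using True \<beta> by (simp add: u_def f(1) sum_split_first)
  next
    case False
    then have j': "j \<in> {1..k}" using j by simp
    have "(\<Sum>l=1..k. f l (Some j)) = (\<Sum>l=1..k. if l = j then 1 else 0)" by (rule sum.cong) (use f(2)[OF _ j'] in auto)
    then show ?thesis using False j' by (simp add: wj[OF j] f(2)[OF _ j'] u_def)
  qed
  have "[0..<Suc k] = 0 # [1..<Suc k]" by (simp add: upt_conv_Cons One_nat_def)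
  then have "wedge (map f [0..<Suc k]) ?ws = (\<Sum>j\<le>k. (-1) ^ j * f 0 (?ws ! j) * wedge ?fs (omit j ?ws))"
    using wedge_laplace_row[OF ws(1), of "f 0"] by simp
  also have "\<dots> = (\<Sum>j\<le>k. (-1) ^ j * u (?ws ! j) * wedge ?fs (omit j ?ws) - (\<Sum>l=1..k. (-1) ^ j * f l (?ws ! j) * wedge ?fs (omit j ?ws)))"
    by (rule sum.cong[OF refl]) (simp only: f0 atMost_iff left_diff_distrib right_diff_distrib sum_distrib_left sum_distrib_right)
  also have "\<dots> = (\<Sum>j\<le>k. (-1) ^ j * u (?ws ! j) * wedge ?fs (omit j ?ws)) - (\<Sum>l=1..k. \<Sum>j\<le>k. (-1) ^ j * f l (?ws ! j) * wedge ?fs (omit j ?ws))"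
    unfolding sum_subtractf by (subst (2) sum.swap) (rule refl)
  also have "(\<Sum>l=1..k. \<Sum>j\<le>k. (-1) ^ j * f l (?ws ! j) * wedge ?fs (omit j ?ws)) = 0"
  proof (rule sum.neutral, rule ballI)
    fix l assume l: "l \<in> {1..k}"
    have "wedge (f l # ?fs) ?ws = 0"
      by (rule wedge_repeated[of 0 _ l]) (use l in \<open>auto simp: nth_Cons' nth_upt\<close>)
    then show "(\<Sum>j\<le>k. (-1) ^ j * f l (?ws ! j) * wedge ?fs (omit j ?ws)) = 0"
      using wedge_laplace_row[OF ws(1), of "f l"] by (simp only: ws(2))
  qed
  also have "(\<Sum>j\<le>k. (-1) ^ j * u (?ws ! j) * wedge ?fs (omit j ?ws)) = (\<Sum>j\<le>k. if j = 0 then wedge ?fs (map Some [1..<Suc k]) else 0)"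
    by (rule sum.cong[OF refl]) (simp add: wj u_def omit_def)
  also have "\<dots> = wedge ?fs (map Some [1..<Suc k])" by simp
  also have "\<dots> = 1"
  proof -
    have "mat k k (\<lambda>(i, j). (?fs ! i) (map Some [1..<Suc k] ! j)) = 1\<^sub>m k"
      by (rule eq_matI) (simp_all add: nth_upt f(2))
    then show ?thesis unfolding wedge_det ws(2) by simp
  qed
  finally show ?thesis by simp
qed

text \<open>On \<sigma> itself the integrand is the constant k!, balanced by the volume 1/k! of the
  standard simplex. If \<tau> differs from \<sigma>, some vertex of \<sigma> is missing from \<tau>,
  and its row in the determinant is zero.\<close>

lemma whitney_wint_affine_simplex:
  assumes K: "simplicial_complex X" and r: "linear_order_on (vertices X) r"
    and \<sigma>: "\<sigma> \<in> simplices X r k" and \<tau>: "\<tau> \<in> simplices X r k" and G: "hat_functions X k (affine_simplex \<tau>) G"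
  shows "whitney_wint k G \<sigma> = (if \<sigma> = \<tau> then 1 else 0)"
proof -
  note D = simplicesD[OF \<tau>] and E = simplicesD[OF \<sigma>]
  have bl: "bl k (G v)" for v using G by (simp add: hat_functions_def)
  let ?ws = "None # map Some [1..<Suc k]"
  have val: "whitney_jac k G \<sigma> q = (if \<sigma> = \<tau> then fact k else 0)" if q: "q \<in> qint k" for q
  proof -
    let ?F = "aug (\<lambda>v. G v q) (\<lambda>v j. pd j (G v) q)"
    have qQ: "q \<in> std_Q k" using q qint_subset by blast
    have Gq: "G v q = (\<Sum>i\<le>k. bcoord k q i * (if \<tau> ! i = v then 1 else 0))" for v
      using G qQ hat_affine_simplex[OF K \<tau> qQ] by (simp add: hat_functions_def)
    note pdq = pd_hat_affine_simplex[OF K \<tau> G q]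
    have W: "whitney_jac k G \<sigma> q = fact k * wedge (map ?F \<sigma>) ?ws"
      using wedge_aug[of \<sigma> "[1..<Suc k]" "\<lambda>v. G v q" "\<lambda>v j. pd j (G v) q"] E(1)
      by (simp add: whitney_jac_def jac_def o_def mult.assoc)
    show ?thesis
    proof (cases "\<sigma> = \<tau>")
      case True
      have one: "(\<Sum>i\<le>k. g i * (if \<tau> ! i = \<tau> ! l then 1 else 0)) = g l" if l: "l \<le> k" for g :: "nat \<Rightarrow> real" and l
      proof -
        have "(\<Sum>i\<le>k. g i * (if \<tau> ! i = \<tau> ! l then 1 else 0)) = (\<Sum>i\<le>k. if i = l then g l else 0)"
          by (rule sum.cong[OF refl]) (use l D(1,3) in \<open>simp add: nth_eq_iff_index_eq\<close>)
        then show ?thesis using l by simp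
      qed
      have "wedge (map (\<lambda>i. ?F (\<tau> ! i)) [0..<Suc k]) ?ws = 1"
      proof (rule wedge_barycentric[OF sum_bcoord])
        show "?F (\<tau> ! i) None = bcoord k q i" if "i \<le> k" for i using one[OF that] by (simp add: Gq)
        show "?F (\<tau> ! i) (Some j) = (if i = 0 then - 1 else if i = j then 1 else 0)" if "i \<le> k" "j \<in> {1..k}" for i j
          unfolding aug_simps pdq[OF that(2)] by (rule one[OF that(1)])
      qed
      moreover have "map (\<lambda>i. ?F (\<tau> ! i)) [0..<Suc k] = map ?F \<tau>"
        by (rule nth_equalityI) (use D(1) in \<open>simp_all add: nth_upt\<close>)
      ultimately show ?thesis using W True by simp
    next
      case False
      then have "\<not> set \<sigma> \<subseteq> set \<tau>" using simplices_eqI[OF r \<sigma> \<tau>] by blast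
      then obtain v where "v \<in> set \<sigma>" "v \<notin> set \<tau>" by blast
      then obtain l where l: "l < length \<sigma>" "\<sigma> ! l \<notin> set \<tau>" by (metis in_set_conv_nth)
      have ne: "\<tau> ! i \<noteq> \<sigma> ! l" if "i \<le> k" for i
      proof -
        have "\<tau> ! i \<in> set \<tau>" using D(1) that by simp
        then show ?thesis using l(2) by metis
      qed
      have z: "?F (\<sigma> ! l) (?ws ! j) = 0" if "j \<le> k" for j
      proof (cases j)
        case 0
        then show ?thesis by (simp add: Gq ne)
      next
        case (Suc i)
        then have "j \<in> {1..k}" using that by simp
        then show ?thesis using Suc that by (simp add: nth_upt pdq ne)
      qed
      have "wedge (map ?F \<sigma>) ?ws = 0"
        by (subst wedge_laplace_any_row[of l k]) (use l(1) E(1) z in simp_all)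
      then show ?thesis using W False by simp
    qed
  qed
  have "whitney_wint k G \<sigma> = (\<integral>q. indicator (std_Q k) q * whitney_jac k G \<sigma> q \<partial>lebn k)"
    by (rule integral_whitney_jac[symmetric, OF bl E(1)])
  also have "\<dots> = (\<integral>q. indicator (std_Q k) q * (if \<sigma> = \<tau> then fact k else 0) \<partial>lebn k)"
  proof (rule integral_cong_AE)
    show "(\<lambda>q. indicator (std_Q k) q * whitney_jac k G \<sigma> q) \<in> borel_measurable (lebn k)"
      by (rule borel_measurable_integrable[OF integrable_am[OF am_whitney_jac[OF bl E(1)]]])
    show "(\<lambda>q. indicator (std_Q k) q * (if \<sigma> = \<tau> then fact k else 0 :: real)) \<in> borel_measurable (lebn k)"
      by (rule borel_measurable_integrable[OF integrable_am[OF am_const]])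
    show "AE q in lebn k. indicator (std_Q k) q * whitney_jac k G \<sigma> q = indicator (std_Q k) q * (if \<sigma> = \<tau> then fact k else 0)"
      using qint_ae
    proof eventually_elim
      case (elim q)
      then show ?case by (cases "q \<in> std_Q k") (simp_all add: val)
    qed
  qed
  also have "\<dots> = (\<integral>q. indicator (std_Q k) q \<partial>lebn k) * (if \<sigma> = \<tau> then fact k else 0)"
    by (rule integral_mult_left_zero)
  also have "(\<integral>q. indicator (std_Q k) q \<partial>lebn k) = (1 / fact k :: real)"
  proof -
    have "std_Q k \<inter> space (lebn k) = std_Q k" using sets.sets_into_space[OF std_Q_sets] by blast
    then show ?thesis using emeasure_std_Q[of k] by (simp add: measure_def)
  qed
  finally show ?thesis by simp
qed

lemma integral_wcomb_affine_simplex: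
  assumes K: "simplicial_complex X" and r: "linear_order_on (vertices X) r" and \<tau>: "\<tau> \<in> simplices X r k"
  shows "simplex_integral X k (affine_simplex \<tau>) (wcomb X r k c) = c \<tau>"
proof -
  obtain G where G: "hat_functions X k (affine_simplex \<tau>) G" using hat_functions_exist[OF K lipschitz_affine_simplex[OF \<tau>]] by blast
  have "simplex_integral X k (affine_simplex \<tau>) (wcomb X r k c) = (\<Sum>\<sigma>\<in>simplices X r k. c \<sigma> * whitney_wint k G \<sigma>)"
    unfolding wcomb_def by (rule simplex_integral_whitney[OF K lipschitz_affine_simplex[OF \<tau>] G finite_simplices[OF K]]) (use simplicesD(1,2) in blast)
  also have "\<dots> = (\<Sum>\<sigma>\<in>simplices X r k. if \<sigma> = \<tau> then c \<tau> else 0)"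
    by (rule sum.cong[OF refl]) (simp add: whitney_wint_affine_simplex[OF K r _ \<tau> G])
  also have "\<dots> = c \<tau>" using \<tau> finite_simplices[OF K, of r k] by simp
  finally show ?thesis .
qed

lemma wcomb_cong: "(\<And>\<sigma>. \<sigma> \<in> simplices X r k \<Longrightarrow> c \<sigma> = c' \<sigma>) \<Longrightarrow> wcomb X r k c = wcomb X r k c'"
  unfolding wcomb_def by (intro ext sum.cong refl) simp

lemma whitney_space_interpolate:
  assumes "simplicial_complex X" "linear_order_on (vertices X) r" "u \<in> whitney_space X r k"
  shows "wcomb X r k (\<lambda>\<sigma>. simplex_integral X k (affine_simplex \<sigma>) u) = u"
proof -
  obtain c where c: "u = wcomb X r k c" using assms(3) by (auto simp: whitney_space_wcomb)
  show ?thesis unfolding c by (rule wcomb_cong) (rule integral_wcomb_affine_simplex[OF assms(1,2)])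
qed

text \<open>By duality the defining conditions prescribe the coefficients, so exactly one Whitney
  form satisfies them and the description in \<open>cone_potential\<close> denotes it.\<close>

lemma cone_potential_wcomb:
  assumes K: "simplicial_complex X" and r: "linear_order_on (vertices X) r"
  shows "cone_potential X r Co (Suc k) u = wcomb X r k (\<lambda>\<sigma>. chain_integral X (Suc k) (Co k (Poly_Mapping.single \<sigma> 1)) u)"
  unfolding cone_potential_def diff_Suc_1
proof (rule the_equality)
  let ?c = "\<lambda>\<sigma>. chain_integral X (Suc k) (Co k (Poly_Mapping.single \<sigma> 1)) u"
  show "wcomb X r k ?c \<in> whitney_space X r k \<and> (\<forall>\<sigma>\<in>simplices X r k. simplex_integral X k (affine_simplex \<sigma>) (wcomb X r k ?c) = ?c \<sigma>)"
    using integral_wcomb_affine_simplex[OF K r] by (auto simp: whitney_space_wcomb)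
  fix w assume w: "w \<in> whitney_space X r k \<and> (\<forall>\<sigma>\<in>simplices X r k. simplex_integral X k (affine_simplex \<sigma>) w = ?c \<sigma>)"
  then have "w = wcomb X r k (\<lambda>\<sigma>. simplex_integral X k (affine_simplex \<sigma>) w)" using whitney_space_interpolate[OF K r] by metis
  also have "\<dots> = wcomb X r k ?c" by (rule wcomb_cong) (use w in blast)
  finally show "w = wcomb X r k ?c" .
qed

lemma stokes_whitney_space:
  assumes K: "simplicial_complex X" and T: "lipschitz_simplex (Suc k) (\<Union>X) T" and u: "u \<in> whitney_space X r k"
  shows "simplex_integral X (Suc k) T (ext_deriv X k u) = (\<Sum>i\<le>Suc k. (-1) ^ i * simplex_integral X k (\<lambda>x\<in>std_Q k. T (face_map (Suc k) i x)) u)"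
proof -
  obtain c where c: "u = wcomb X r k c" using u by (auto simp: whitney_space_wcomb)
  have "ext_deriv X k u = (\<lambda>S x ws. \<Sum>\<sigma>\<in>simplices X r k. c \<sigma> * dwhitney X k \<sigma> S x ws)"
    unfolding c wcomb_def by (rule ext_deriv_whitney[OF K simplicesD(1)])
  then show ?thesis unfolding c wcomb_def
    using stokes_simplex[OF K T finite_simplices[OF K], of r k c] simplicesD(1,2) by metis
qed

section \<open>Chains, cones and the homotopy identity\<close>

lemma linear_extension_superset:
  assumes "finite B" "Poly_Mapping.keys c \<subseteq> B"
  shows "linear_extension f c = (\<Sum>x\<in>B. Poly_Mapping.lookup c x *\<^sub>R f x)"
  unfolding linear_extension_def
  by (rule sum.mono_neutral_left[OF assms]) (simp add: in_keys_iff)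

lemma linear_linear_extension: "linear (linear_extension f)"
proof (rule linearI)
  fix p q :: "'a \<Rightarrow>\<^sub>0 real" and b :: real
  let ?B = "Poly_Mapping.keys p \<union> Poly_Mapping.keys q"
  have "linear_extension f (p + q) = (\<Sum>x\<in>?B. Poly_Mapping.lookup (p + q) x *\<^sub>R f x)"
    by (rule linear_extension_superset) (simp_all add: Poly_Mapping.keys_add)
  also have "\<dots> = (\<Sum>x\<in>?B. Poly_Mapping.lookup p x *\<^sub>R f x) + (\<Sum>x\<in>?B. Poly_Mapping.lookup q x *\<^sub>R f x)"
    by (simp add: lookup_add scaleR_add_left sum.distrib)
  also have "\<dots> = linear_extension f p + linear_extension f q"
    using linear_extension_superset[of ?B p f] linear_extension_superset[of ?B q f] by simp
  finally show "linear_extension f (p + q) = linear_extension f p + linear_extension f q" .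
  have "linear_extension f (b *\<^sub>R p) = (\<Sum>x\<in>Poly_Mapping.keys p. Poly_Mapping.lookup (b *\<^sub>R p) x *\<^sub>R f x)"
    by (rule linear_extension_superset) (auto simp: in_keys_iff lookup_scaleR)
  then show "linear_extension f (b *\<^sub>R p) = b *\<^sub>R linear_extension f p"
    by (simp add: linear_extension_def lookup_scaleR scaleR_sum_right)
qed

lemma linear_extension_single: "linear_extension f (Poly_Mapping.single x 1) = f x"
  by (simp add: linear_extension_def)

lemma stokes_chain:
  assumes K: "simplicial_complex X" and c: "c \<in> lipschitz_chains (Suc k) (\<Union>X)" and u: "u \<in> whitney_space X r k"
  shows "chain_integral X (Suc k) c (ext_deriv X k u) = chain_integral X k (singular_boundary (Suc k) c) u"
proof -
  let ?F = "\<lambda>T. simplex_integral X k T u"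
  let ?b = "\<lambda>T. \<Sum>i\<le>Suc k. (-1) ^ i *\<^sub>R Poly_Mapping.single (\<lambda>x\<in>std_Q k. T (face_map (Suc k) i x)) (1 :: real)"
  have "chain_integral X k (singular_boundary (Suc k) c) u = linear_extension ?F (\<Sum>T\<in>Poly_Mapping.keys c. Poly_Mapping.lookup c T *\<^sub>R ?b T)"
    unfolding chain_integral_def singular_boundary_def diff_Suc_1 linear_extension_def[of ?b] ..
  also have "\<dots> = (\<Sum>T\<in>Poly_Mapping.keys c. Poly_Mapping.lookup c T *\<^sub>R (\<Sum>i\<le>Suc k. (-1) ^ i *\<^sub>R ?F (\<lambda>x\<in>std_Q k. T (face_map (Suc k) i x))))"
    by (simp only: linear_sum[OF linear_linear_extension] linear_scale[OF linear_linear_extension] linear_extension_single)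
  also have "\<dots> = (\<Sum>T\<in>Poly_Mapping.keys c. Poly_Mapping.lookup c T *\<^sub>R simplex_integral X (Suc k) T (ext_deriv X k u))"
  proof (rule sum.cong[OF refl])
    fix T assume "T \<in> Poly_Mapping.keys c"
    then have "lipschitz_simplex (Suc k) (\<Union>X) T" using c by (simp add: lipschitz_chains_def)
    then show "Poly_Mapping.lookup c T *\<^sub>R (\<Sum>i\<le>Suc k. (-1) ^ i *\<^sub>R ?F (\<lambda>x\<in>std_Q k. T (face_map (Suc k) i x))) =
      Poly_Mapping.lookup c T *\<^sub>R simplex_integral X (Suc k) T (ext_deriv X k u)"
      by (simp only: stokes_whitney_space[OF K _ u] real_scaleR_def)
  qed
  finally show ?thesis unfolding chain_integral_def linear_extension_def by simp
qed

text \<open>Linearity is given on the subspace of chains only, so the induction carries along that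
  all partial sums are chains.\<close>

lemma linear_between_chains_sum:
  assumes f: "linear_between (chains X r k) W f" and x: "\<And>i. i \<in> A \<Longrightarrow> x i \<in> chains X r k" and A: "finite A"
  shows "f (\<Sum>i\<in>A. b i *\<^sub>R x i) = (\<Sum>i\<in>A. b i *\<^sub>R f (x i))"
proof -
  have zero: "0 \<in> chains X r k" by (simp add: chains_def)
  have add: "p + q \<in> chains X r k" if "p \<in> chains X r k" "q \<in> chains X r k" for p q
    using that Poly_Mapping.keys_add[of p q] by (auto simp: chains_def)
  have scale: "s *\<^sub>R p \<in> chains X r k" if "p \<in> chains X r k" for s p
  proof -
    have "Poly_Mapping.keys (s *\<^sub>R p) \<subseteq> Poly_Mapping.keys p" by (auto simp: in_keys_iff lookup_scaleR)
    then show ?thesis using that by (auto simp: chains_def)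
  qed
  have f0: "f 0 = 0"
  proof -
    have "f (0 *\<^sub>R 0) = 0 *\<^sub>R f 0" using f zero unfolding linear_between_def by blast
    then show ?thesis by simp
  qed
  have "(\<Sum>i\<in>B. b i *\<^sub>R x i) \<in> chains X r k \<and> f (\<Sum>i\<in>B. b i *\<^sub>R x i) = (\<Sum>i\<in>B. b i *\<^sub>R f (x i))" if "finite B" "B \<subseteq> A" for B
    using that
  proof (induction B rule: finite_induct)
    case empty
    then show ?case by (simp add: zero f0)
  next
    case (insert i B)
    then have i: "x i \<in> chains X r k" using x by blast
    have IH: "(\<Sum>i\<in>B. b i *\<^sub>R x i) \<in> chains X r k" "f (\<Sum>i\<in>B. b i *\<^sub>R x i) = (\<Sum>i\<in>B. b i *\<^sub>R f (x i))" using insert by blast+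
    have "f (b i *\<^sub>R x i + (\<Sum>i\<in>B. b i *\<^sub>R x i)) = f (b i *\<^sub>R x i) + f (\<Sum>i\<in>B. b i *\<^sub>R x i)"
      using f scale[OF i] IH(1) unfolding linear_between_def by blast
    moreover have "f (b i *\<^sub>R x i) = b i *\<^sub>R f (x i)" using f i unfolding linear_between_def by blast
    ultimately show ?case using insert.hyps IH add[OF scale[OF i] IH(1)] by simp
  qed
  then show ?thesis using A by blast
qed

text \<open>In barycentric coordinates every face map inserts a zero at position \<open>i\<close>,
  so the slanted face is no longer special.\<close>

lemma bcoord_face:
  assumes i: "i \<le> Suc k"
  shows "bcoord (Suc k) (face k i x) i = 0" "l \<le> k \<Longrightarrow> bcoord (Suc k) (face k i x) (shift i l) = bcoord k x l"
proof -
  have s: "(\<Sum>j=1..Suc k. face k i x j) = (if i = 0 then 1 else \<Sum>j=1..k. x j)"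
    using sum_shift[of 1 k "face k i x"] sum_shift[of i k "face k i x"] i by (cases "i = 0") (simp_all add: face_def)
  show "bcoord (Suc k) (face k i x) i = 0"
    unfolding bcoord_def s by (simp add: face_def)
  assume "l \<le> k"
  show "bcoord (Suc k) (face k i x) (shift i l) = bcoord k x l"
  proof (cases "i = 0")
    case True
    then have "bcoord (Suc k) (face k i x) (shift i l) = ins 1 (1 - (\<Sum>l=1..k. x l)) x (Suc l)" by (simp add: bcoord_def shift_def face_def)
    also have "\<dots> = bcoord k x l" by (cases l) (simp_all add: ins_def bcoord_def One_nat_def)
    finally show ?thesis .
  next
    case False
    have "shift i l = 0 \<longleftrightarrow> l = 0" using False by (auto simp: shift_def)
    then show ?thesis using False unfolding bcoord_def s by (simp add: face_def)
  qed
qed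

lemma affine_simplex_face:
  assumes len: "length \<sigma> = Suc (Suc k)" and i: "i \<le> Suc k"
  shows "(\<lambda>x\<in>std_Q k. affine_simplex \<sigma> (face_map (Suc k) i x)) = affine_simplex (omit i \<sigma>)"
proof
  fix x
  have lo: "length (omit i \<sigma>) = Suc k" using len i by simp
  show "(\<lambda>x\<in>std_Q k. affine_simplex \<sigma> (face_map (Suc k) i x)) x = affine_simplex (omit i \<sigma>) x"
  proof (cases "x \<in> std_Q k")
    case False
    then show ?thesis using lo by (simp add: affine_simplex_def)
  next
    case True
    let ?y = "face k i x"
    have m: "bij_betw (shift i) {..k} ({..Suc k} - {i})"
      by (rule bij_betwI[where g = "\<lambda>j. if j < i then j else j - 1"]) (use i in \<open>auto simp: shift_def split: if_splits\<close>)
    have "affine_simplex \<sigma> ?y = (\<Sum>j\<le>Suc k. bcoord (Suc k) ?y j *\<^sub>R \<sigma> ! j)"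
      by (rule affine_simplex_bcoord[OF len face_in_std_Q[OF i True]])
    also have "\<dots> = (\<Sum>j\<in>{..Suc k} - {i}. bcoord (Suc k) ?y j *\<^sub>R \<sigma> ! j)"
      using i bcoord_face(1)[OF i] by (subst sum.remove[of _ i]) simp_all
    also have "\<dots> = (\<Sum>l\<le>k. bcoord (Suc k) ?y (shift i l) *\<^sub>R \<sigma> ! shift i l)"
      by (rule sum.reindex_bij_betw[OF m, symmetric])
    also have "\<dots> = (\<Sum>l\<le>k. bcoord k x l *\<^sub>R omit i \<sigma> ! l)"
      by (rule sum.cong[OF refl]) (use len i in \<open>simp add: nth_omit bcoord_face(2)[OF i] shift_def[symmetric]\<close>)
    also have "\<dots> = affine_simplex (omit i \<sigma>) x" by (rule affine_simplex_bcoord[OF lo True, symmetric])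
    finally show ?thesis using True by (simp add: face_map_eq[OF i True])
  qed
qed

lemma simplices_0:
  shows "\<sigma> \<in> simplices X r 0 \<longleftrightarrow> (\<exists>v\<in>vertices X. \<sigma> = [v])"
proof
  assume "\<sigma> \<in> simplices X r 0"
  then have "length \<sigma> = 1" "set \<sigma> \<subseteq> vertices X" by (auto simp: simplices_def One_nat_def)
  then show "\<exists>v\<in>vertices X. \<sigma> = [v]" by (cases \<sigma>) (auto simp: One_nat_def)
next
  assume "\<exists>v\<in>vertices X. \<sigma> = [v]"
  then show "\<sigma> \<in> simplices X r 0" by (auto simp: simplices_def vertices_def)
qed

text \<open>Constants are Whitney forms because \<Sum> \<lambda>_v = 1. Hence the identity in degree
  0 can also be compared coefficient by coefficient.\<close>

lemma constant_form_wcomb: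
  assumes K: "simplicial_complex X"
  shows "constant_form X b = wcomb X r 0 (\<lambda>_. b)"
proof (intro ext)
  fix S x and ws :: "'a list"
  show "constant_form X b S x ws = wcomb X r 0 (\<lambda>_. b) S x ws"
  proof (cases "S \<in> X \<and> x \<in> S \<and> length ws = 0 \<and> set ws \<subseteq> tangent S")
    case False
    have "constant_form X b S x ws = 0" unfolding constant_form_def normalize_form_def by (rule if_not_P[OF False])
    then show ?thesis by (simp only: wcomb_def whitney_form_outside[OF False]) simp
  next
    case True
    then have S: "S \<in> X" "x \<in> S" "length ws = 0" "set ws \<subseteq> tangent S" by blast+
    have one: "wedge [] ws = 1" for ws :: "'a list" unfolding wedge_det by (simp add: det_dim_zero)
    have v: "whitney_form X 0 [v] S x ws = hat X v x" for v
      using whitney_form_value[OF K S, of "[v]"] by (simp add: omit_def one)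
    have "simplices X r 0 = (\<lambda>v. [v]) ` vertices X" using simplices_0[of _ X r] by blast
    then have "wcomb X r 0 (\<lambda>_. b) S x ws = (\<Sum>v\<in>vertices X. b * whitney_form X 0 [v] S x ws)"
      unfolding wcomb_def by (simp add: sum.reindex inj_on_def)
    also have "\<dots> = b * (\<Sum>v\<in>vertices X. hat X v x)" by (simp add: v sum_distrib_left)
    also have "\<dots> = b" using hat_sum(1)[OF K, of x] S by auto
    finally show ?thesis using S by (simp add: constant_form_def normalize_form_def)
  qed
qed

lemma integral_point: "simplex_integral X 0 (affine_simplex [v]) u = point_value X u v"
proof -
  have "Q_vertex 0 0 \<in> std_Q 0" by (simp add: Q_vertex_def std_Q_def restrict_def)
  then have "affine_simplex [v] (Q_vertex 0 0) = v" by (simp add: affine_simplex_def)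
  then show ?thesis by (simp add: simplex_integral_def)
qed

text \<open>Stokes on \<sigma> leaves integrals of the potential over the faces of \<sigma>, which
  are prescribed as integrals over cones; linearity of \<open>Co k\<close> collects them into the
  cone over the boundary.\<close>

lemma integral_ext_deriv_cone_potential:
  assumes K: "simplicial_complex X" and r: "linear_order_on (vertices X) r" and Co: "singular_cone_operator X r a Co"
    and \<sigma>: "\<sigma> \<in> simplices X r (Suc k)"
  shows "simplex_integral X (Suc k) (affine_simplex \<sigma>) (ext_deriv X k (cone_potential X r Co (Suc k) u)) =
    chain_integral X (Suc k) (Co k (boundary (Suc k) (Poly_Mapping.single \<sigma> 1))) u"
proof -
  let ?w = "cone_potential X r Co (Suc k) u" and ?s = "\<lambda>i. Poly_Mapping.single (omit i \<sigma>) (1 :: real)"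
  note w = cone_potential_wcomb[OF K r, of Co k u]
  have om: "omit i \<sigma> \<in> simplices X r k" if "i \<le> Suc k" for i by (rule simplices_omit[OF K \<sigma> that])
  have "simplex_integral X (Suc k) (affine_simplex \<sigma>) (ext_deriv X k ?w) =
    (\<Sum>i\<le>Suc k. (-1) ^ i * simplex_integral X k (\<lambda>x\<in>std_Q k. affine_simplex \<sigma> (face_map (Suc k) i x)) ?w)"
    by (rule stokes_whitney_space[OF K lipschitz_affine_simplex[OF \<sigma>], of _ r]) (use w in \<open>auto simp: whitney_space_wcomb\<close>)
  also have "\<dots> = (\<Sum>i\<le>Suc k. (-1) ^ i *\<^sub>R chain_integral X (Suc k) (Co k (?s i)) u)"
  proof (rule sum.cong[OF refl])
    fix i assume "i \<in> {..Suc k}"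
    then have i: "i \<le> Suc k" by simp
    show "(-1) ^ i * simplex_integral X k (\<lambda>x\<in>std_Q k. affine_simplex \<sigma> (face_map (Suc k) i x)) ?w = (-1) ^ i *\<^sub>R chain_integral X (Suc k) (Co k (?s i)) u"
      unfolding affine_simplex_face[OF simplicesD(1)[OF \<sigma>] i] w integral_wcomb_affine_simplex[OF K r om[OF i]] by simp
  qed
  also have "\<dots> = chain_integral X (Suc k) (\<Sum>i\<le>Suc k. (-1) ^ i *\<^sub>R Co k (?s i)) u"
    unfolding chain_integral_def by (simp only: linear_sum[OF linear_linear_extension] linear_scale[OF linear_linear_extension])
  also have "(\<Sum>i\<le>Suc k. (-1) ^ i *\<^sub>R Co k (?s i)) = Co k (\<Sum>i\<le>Suc k. (-1) ^ i *\<^sub>R ?s i)"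
  proof (rule linear_between_chains_sum[symmetric])
    show "linear_between (chains X r k) (lipschitz_chains (Suc k) (\<Union>X)) (Co k)"
      using Co by (simp add: singular_cone_operator_def)
    show "?s i \<in> chains X r k" if "i \<in> {..Suc k}" for i using om that by (simp add: chains_def)
  qed simp
  also have "(\<Sum>i\<le>Suc k. (-1) ^ i *\<^sub>R ?s i) = boundary (Suc k) (Poly_Mapping.single \<sigma> 1)"
    by (simp only: boundary_def linear_extension_single)
  finally show ?thesis .
qed

lemma cone_lipschitz:
  assumes "singular_cone_operator X r a Co" "\<sigma> \<in> simplices X r k"
  shows "Co k (Poly_Mapping.single \<sigma> 1) \<in> lipschitz_chains (Suc k) (\<Union>X)"
proof -
  have "Poly_Mapping.single \<sigma> 1 \<in> chains X r k" using assms(2) by (simp add: chains_def)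
  then show ?thesis using assms(1) unfolding singular_cone_operator_def linear_between_def by blast
qed

theorem proposition3p7:
  fixes X :: "'a::euclidean_space set set"
    and r :: "'a rel"
    and a :: 'a
    and Co :: "nat \<Rightarrow> ('a list \<Rightarrow>\<^sub>0 real) \<Rightarrow> 'a singular_chain"
  assumes "simplicial_complex X"
    and "linear_order_on (vertices X) r"
    and "a \<in> \<Union>X"
    and "singular_cone_operator X r a Co"
  shows "(\<forall>k\<ge>1. \<forall>u\<in>whitney_space X r k.
            ext_deriv X (k - 1) (cone_potential X r Co k u) +
            cone_potential X r Co (k + 1) (ext_deriv X k u) = u) \<and>
         (\<forall>u\<in>whitney_space X r 0.
            cone_potential X r Co 1 (ext_deriv X 0 u) = u - constant_form X (point_value X u a))"
proof (intro conjI allI impI ballI)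
  note K = assms(1) and r = assms(2) and Co = assms(4)
  {
    fix k u assume "1 \<le> k" and u: "u \<in> whitney_space X r k"
    then obtain m where k: "k = Suc m" by (cases k) (simp_all add: One_nat_def)
    have km: "k - 1 = m" "k + 1 = Suc k" by (simp_all add: k One_nat_def)
    let ?w = "cone_potential X r Co k u" and ?z = "cone_potential X r Co (Suc k) (ext_deriv X k u)"
    let ?I = "\<lambda>u \<sigma>. simplex_integral X k (affine_simplex \<sigma>) u"
    \<comment> \<open>The derivative of the potential is again a Whitney form, so it is recovered
      from its integrals over simplices.\<close>
    have dw: "ext_deriv X m ?w = wcomb X r k (?I (ext_deriv X m ?w))"
    proof -
      have "?w \<in> whitney_space X r m" unfolding k cone_potential_wcomb[OF K r] whitney_space_wcomb by blast
      then have "ext_deriv X m ?w \<in> whitney_space X r k" unfolding k by (rule ext_deriv_in_space[OF K r])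
      then show ?thesis by (rule whitney_space_interpolate[OF K r, symmetric])
    qed
    have z: "?z = wcomb X r k (\<lambda>\<sigma>. chain_integral X (Suc k) (Co k (Poly_Mapping.single \<sigma> 1)) (ext_deriv X k u))"
      by (rule cone_potential_wcomb[OF K r])
    have val: "?I (ext_deriv X m ?w) \<sigma> + chain_integral X (Suc k) (Co k (Poly_Mapping.single \<sigma> 1)) (ext_deriv X k u) = ?I u \<sigma>"
      if \<sigma>: "\<sigma> \<in> simplices X r k" for \<sigma>
    proof -
      have d: "?I (ext_deriv X m ?w) \<sigma> = chain_integral X k (Co m (boundary k (Poly_Mapping.single \<sigma> 1))) u"
        using integral_ext_deriv_cone_potential[OF K r Co, of \<sigma> m u] \<sigma> unfolding k by blast
      have s: "chain_integral X (Suc k) (Co k (Poly_Mapping.single \<sigma> 1)) (ext_deriv X k u) =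
        chain_integral X k (singular_boundary (Suc k) (Co k (Poly_Mapping.single \<sigma> 1))) u"
        by (rule stokes_chain[OF K cone_lipschitz[OF Co \<sigma>] u])
      have "Co (k - 1) (boundary k (Poly_Mapping.single \<sigma> 1)) + singular_boundary (k + 1) (Co k (Poly_Mapping.single \<sigma> 1)) = Poly_Mapping.single (affine_simplex \<sigma>) 1"
        using Co \<sigma> \<open>1 \<le> k\<close> unfolding singular_cone_operator_def by blast
      then have "Co m (boundary k (Poly_Mapping.single \<sigma> 1)) + singular_boundary (Suc k) (Co k (Poly_Mapping.single \<sigma> 1)) = Poly_Mapping.single (affine_simplex \<sigma>) 1"
        by (simp only: km)
      then have "chain_integral X k (Co m (boundary k (Poly_Mapping.single \<sigma> 1))) u +
          chain_integral X k (singular_boundary (Suc k) (Co k (Poly_Mapping.single \<sigma> 1))) u = ?I u \<sigma>"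
        unfolding chain_integral_def linear_add[OF linear_linear_extension, symmetric] by (simp only: linear_extension_single)
      then show ?thesis by (simp only: d s)
    qed
    have "ext_deriv X m ?w + ?z = wcomb X r k (\<lambda>\<sigma>. ?I (ext_deriv X m ?w) \<sigma> + chain_integral X (Suc k) (Co k (Poly_Mapping.single \<sigma> 1)) (ext_deriv X k u))"
      unfolding z by (subst dw) (intro ext, simp add: wcomb_def sum.distrib distrib_right)
    also have "\<dots> = wcomb X r k (?I u)" by (rule wcomb_cong[OF val])
    also have "\<dots> = u" by (rule whitney_space_interpolate[OF K r u])
    finally show "ext_deriv X (k - 1) ?w + cone_potential X r Co (k + 1) (ext_deriv X k u) = u" by (simp only: km)
  next
    fix u assume u: "u \<in> whitney_space X r 0"
    let ?b = "point_value X u a" and ?I = "\<lambda>\<sigma>. simplex_integral X 0 (affine_simplex \<sigma>) u"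
    \<comment> \<open>Integrals over points are values, so the degree 0 cone identity gives u(v) -
      u(a) at each vertex; the subtracted number is the coefficient of the constant form at every
      vertex.\<close>
    have val: "chain_integral X (Suc 0) (Co 0 (Poly_Mapping.single \<sigma> 1)) (ext_deriv X 0 u) = ?I \<sigma> - ?b" if \<sigma>: "\<sigma> \<in> simplices X r 0" for \<sigma>
    proof -
      obtain v where v: "v \<in> vertices X" "\<sigma> = [v]" using \<sigma> by (auto simp: simplices_0)
      have "singular_boundary (Suc 0) (Co 0 (Poly_Mapping.single \<sigma> 1)) = Poly_Mapping.single (affine_simplex \<sigma>) 1 - Poly_Mapping.single (affine_simplex [a]) 1"
        using Co v unfolding singular_cone_operator_def One_nat_def by blast
      then have "chain_integral X 0 (singular_boundary (Suc 0) (Co 0 (Poly_Mapping.single \<sigma> 1))) u = ?I \<sigma> - ?b"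
        unfolding chain_integral_def by (simp only: linear_diff[OF linear_linear_extension] linear_extension_single integral_point)
      then show ?thesis by (simp only: stokes_chain[OF K cone_lipschitz[OF Co \<sigma>] u])
    qed
    have "cone_potential X r Co 1 (ext_deriv X 0 u) = wcomb X r 0 (\<lambda>\<sigma>. ?I \<sigma> - ?b)"
      unfolding One_nat_def cone_potential_wcomb[OF K r] by (rule wcomb_cong[OF val])
    also have "\<dots> = wcomb X r 0 ?I - wcomb X r 0 (\<lambda>_. ?b)"
      by (intro ext) (simp add: wcomb_def sum_subtractf left_diff_distrib)
    also have "\<dots> = u - constant_form X ?b"
      unfolding whitney_space_interpolate[OF K r u] constant_form_wcomb[OF K, of _ r] ..
    finally show "cone_potential X r Co 1 (ext_deriv X 0 u) = u - constant_form X ?b" .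
  }
qed

end
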